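(* The identity $L^1(m_{L^1}) = L\log L$ holds as vector sublattices of $L^0$ and with equivalent lattice norms. In particular, $L^1(m_{L^1})$ and $L\log L$ are isomorphic Banach function spaces over $(-1,1)$. Moreover, the integration operator $I_{m_{L^1}}\colon L^1(m_{L^1})\to L^1$ satisfies $I_{m_{L^1}} = T_{\log}$.
   Context: $\mu$ is Lebesgue measure on the Borel $\sigma$-algebra $\mathcal B$ of $(-1,1)$. $L^0$ is the space of $\mathbb C$-valued measurable functions on $(-1,1)$, with functions equal a.e. identified; it is a complex vector lattice for the a.e. pointwise order. $L^p=L^p(\mu)$ for $1\le p\le\infty$. A Banach function space over $(-1,1)$ is an order ideal $X$ of $L^0$ containing all $\mathcal B$-simple functions and equipped with a lattice norm for which it is complete. The finite Hilbert transform of $f\in L^1$ is $T(f)(t):=\lim_{\varepsilon\to0^+}\frac1\pi\left(\int_{-1}^{t-\varepsilon}+\int_{t+\varepsilon}^1\right)\frac{f(x)}{x-t}\,dx$, which exists for a.e. $t\in(-1,1)$ and is measurable. $T$ maps $L^2$ boundedly into $L^2$. For $f\in L^0$, $f^*$ is the decreasing rearrangement (the right-continuous inverse of the distribution function $\lambda\mapsto\mu(\{|f|>\lambda\})$). $L\log L$ is the space of all $f\in L^0$ with $\|f\|_{L\log L}:=\int_0^2 f^*(t)\log(2e/t)\,dt<\infty$, equipped with this norm (equivalently, $\int_{-1}^1|f|\log^+|f|\,dx<\infty$). It is known that $T$ maps $L\log L$ boundedly into $L^1$; $T_{\log}\colon L\log L\to L^1$ denotes the resulting operator. $m_{L^1}\colon\mathcal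 B\to L^1$ is the set function $m_{L^1}(A):=T(\chi_A)$, which is $\sigma$-additive (a vector measure). For $g\in L^\infty=(L^1)^*$, $\langle m_{L^1},g\rangle(A):=\langle m_{L^1}(A),g\rangle=\int_{-1}^1 m_{L^1}(A)\,g\,d\mu$ is a complex measure, with variation measure $|\langle m_{L^1},g\rangle|$. A $\mathcal B$-measurable $f\colon(-1,1)\to\mathbb C$ is $m_{L^1}$-integrable if it is $\langle m_{L^1},g\rangle$-integrable for every $g\in L^\infty$ and, for every $A\in\mathcal B$, there is an element $\int_A f\,dm_{L^1}\in L^1$ (necessarily unique) with $\langle\int_A f\,dm_{L^1},g\rangle=\int_A f\,d\langle m_{L^1},g\rangle$ for all $g\in L^\infty$. $L^1(m_{L^1})$ is the space of all $m_{L^1}$-integrable functions, with functions equal $\mu$-a.e. identified ($m_{L^1}$ and $\mu$ have the same null sets), equipped with the norm $\|f\|_{L^1(m_{L^1})}:=\sup\{\int_{-1}^1|f|\,d|\langle m_{L^1},g\rangle|: g\in L^\infty,\ \|g\|_\infty\le1\}$; it is a Banach function space over $(-1,1)$. The integration operator is $I_{m_{L^1}}(f):=\int_{(-1,1)}f\,dm_{L^1}$. *)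

theory Defs
  imports "HOL-Probability.Essential_Supremum"
begin

text \<open>
  Elements of \<open>L\<^sup>0\<close> are represented by Borel functions on the open interval, and all notions below
  depend on a function only up to equality almost everywhere. Values outside the interval are
  irrelevant, because \<open>mu\<close> lives on the interval. Spaces of classes are represented by
  the set of all representatives of their elements, so that equality of spaces is equality of
  sets. Norms take values in \<open>ennreal\<close>, so that an infinite value is not confused with 0.
\<close>

definition mu :: "real measure" where
  "mu = restrict_space lborel {-1<..<1}"

definition L0 :: "(real \<Rightarrow> complex) set" where
  "L0 = borel_measurable mu"

definition L1 :: "(real \<Rightarrow> complex) set" where
  "L1 = {f. integrable mu f}"

definition norm_Linf :: "(real \<Rightarrow> complex) \<Rightarrow> ennreal" where
  "norm_Linf g = esssup mu (\<lambda>x. ennreal (cmod (g x)))"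

definition Linf :: "(real \<Rightarrow> complex) set" where
  "Linf = {g \<in> L0. norm_Linf g < \<infinity>}"


subsection \<open>Banach function spaces over the interval\<close>

text \<open>
  A complex vector sublattice is the complexification of a real one, hence closed under
  conjugation as well as under the modulus.
\<close>

definition vector_sublattice :: "(real \<Rightarrow> complex) set \<Rightarrow> bool" where
  "vector_sublattice X \<longleftrightarrow>
     X \<subseteq> L0 \<and>
     (\<forall>f\<in>X. \<forall>g\<in>L0. (AE x in mu. g x = f x) \<longrightarrow> g \<in> X) \<and>
     (\<lambda>x. 0) \<in> X \<and>
     (\<forall>f\<in>X. \<forall>g\<in>X. (\<lambda>x. f x + g x) \<in> X) \<and>
     (\<forall>c. \<forall>f\<in>X. (\<lambda>x. c * f x) \<in> X) \<and>
     (\<forall>f\<in>X. (\<lambda>x. cnj (f x)) \<in> X) \<and>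
     (\<forall>f\<in>X. (\<lambda>x. complex_of_real (cmod (f x))) \<in> X)"

definition order_ideal :: "(real \<Rightarrow> complex) set \<Rightarrow> bool" where
  "order_ideal X \<longleftrightarrow>
     X \<subseteq> L0 \<and>
     (\<lambda>x. 0) \<in> X \<and>
     (\<forall>f\<in>X. \<forall>g\<in>X. (\<lambda>x. f x + g x) \<in> X) \<and>
     (\<forall>c. \<forall>f\<in>X. (\<lambda>x. c * f x) \<in> X) \<and>
     (\<forall>f\<in>X. \<forall>g\<in>L0. (AE x in mu. cmod (g x) \<le> cmod (f x)) \<longrightarrow> g \<in> X)"

definition lattice_norm_on ::
    "(real \<Rightarrow> complex) set \<Rightarrow> ((real \<Rightarrow> complex) \<Rightarrow> ennreal) \<Rightarrow> bool" where
  "lattice_norm_on X N \<longleftrightarrow>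
     (\<forall>f\<in>X. N f < \<infinity>) \<and>
     (\<forall>f\<in>X. N f = 0 \<longleftrightarrow> (AE x in mu. f x = 0)) \<and>
     (\<forall>c. \<forall>f\<in>X. N (\<lambda>x. c * f x) = ennreal (cmod c) * N f) \<and>
     (\<forall>f\<in>X. \<forall>g\<in>X. N (\<lambda>x. f x + g x) \<le> N f + N g) \<and>
     (\<forall>f\<in>X. \<forall>g\<in>X. (AE x in mu. cmod (f x) \<le> cmod (g x)) \<longrightarrow> N f \<le> N g)"

definition norm_complete_on ::
    "(real \<Rightarrow> complex) set \<Rightarrow> ((real \<Rightarrow> complex) \<Rightarrow> ennreal) \<Rightarrow> bool" where
  "norm_complete_on X N \<longleftrightarrow>
     (\<forall>u::nat \<Rightarrow> real \<Rightarrow> complex.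
        (\<forall>n. u n \<in> X) \<and>
        (\<forall>e>0. \<exists>K. \<forall>m\<ge>K. \<forall>n\<ge>K. N (\<lambda>x. u m x - u n x) < e) \<longrightarrow>
        (\<exists>f\<in>X. (\<lambda>n. N (\<lambda>x. u n x - f x)) \<longlonglongrightarrow> 0))"

definition banach_function_space ::
    "(real \<Rightarrow> complex) set \<Rightarrow> ((real \<Rightarrow> complex) \<Rightarrow> ennreal) \<Rightarrow> bool" where
  "banach_function_space X N \<longleftrightarrow>
     order_ideal X \<and>
     {f. simple_function mu f} \<subseteq> X \<and>
     lattice_norm_on X N \<and>
     norm_complete_on X N"

definition equivalent_norms_on ::
    "(real \<Rightarrow> complex) set \<Rightarrow> ((real \<Rightarrow> complex) \<Rightarrow> ennreal) \<Rightarrow>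
     ((real \<Rightarrow> complex) \<Rightarrow> ennreal) \<Rightarrow> bool" where
  "equivalent_norms_on X N N' \<longleftrightarrow>
     (\<exists>c C::real. 0 < c \<and> 0 < C \<and>
        (\<forall>f\<in>X. ennreal c * N f \<le> N' f \<and> N' f \<le> ennreal C * N f))"

text \<open>
  A linear lattice isomorphism onto, bounded above and below. Boundedness makes \<open>J\<close> respect
  equality almost everywhere.
\<close>

definition isomorphic_bfs ::
    "(real \<Rightarrow> complex) set \<Rightarrow> ((real \<Rightarrow> complex) \<Rightarrow> ennreal) \<Rightarrow>
     (real \<Rightarrow> complex) set \<Rightarrow> ((real \<Rightarrow> complex) \<Rightarrow> ennreal) \<Rightarrow> bool" where
  "isomorphic_bfs X N Y N' \<longleftrightarrow>
     (\<exists>J. (\<forall>f\<in>X. J f \<in> Y) \<and>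
        (\<forall>f\<in>X. \<forall>g\<in>X. AE x in mu. J (\<lambda>y. f y + g y) x = J f x + J g x) \<and>
        (\<forall>c. \<forall>f\<in>X. AE x in mu. J (\<lambda>y. c * f y) x = c * J f x) \<and>
        (\<forall>f\<in>X. AE x in mu.
           J (\<lambda>y. complex_of_real (cmod (f y))) x = complex_of_real (cmod (J f x))) \<and>
        (\<forall>h\<in>Y. \<exists>f\<in>X. AE x in mu. J f x = h x) \<and>
        (\<exists>c C::real. 0 < c \<and> 0 < C \<and>
           (\<forall>f\<in>X. ennreal c * N f \<le> N' (J f) \<and> N' (J f) \<le> ennreal C * N f)))"


subsection \<open>The finite Hilbert transform\<close>

definition truncated_hilbert :: "(real \<Rightarrow> complex) \<Rightarrow> real \<Rightarrow> real \<Rightarrow> complex" where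
  "truncated_hilbert f t \<epsilon> =
     complex_of_real (1 / pi) *
       ((LINT x:{-1<..<t - \<epsilon>}|lborel. f x / complex_of_real (x - t)) +
        (LINT x:{t + \<epsilon><..<1}|lborel. f x / complex_of_real (x - t)))"

text \<open>
  The null set of points where the limit does not exist is assigned the value 0.
\<close>

definition finite_hilbert :: "(real \<Rightarrow> complex) \<Rightarrow> real \<Rightarrow> complex" where
  "finite_hilbert f t =
     (if \<exists>l. (truncated_hilbert f t \<longlongrightarrow> l) (at_right 0)
      then Lim (at_right 0) (truncated_hilbert f t) else 0)"


subsection \<open>The space L log L\<close>

definition decreasing_rearrangement :: "(real \<Rightarrow> complex) \<Rightarrow> real \<Rightarrow> ennreal" where
  "decreasing_rearrangement f t =
     Inf {ennreal s | s. 0 \<le> s \<and> emeasure mu {x \<in> space mu. s < cmod (f x)} \<le> ennreal t}"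

definition norm_LlogL :: "(real \<Rightarrow> complex) \<Rightarrow> ennreal" where
  "norm_LlogL f =
     (\<integral>\<^sup>+t\<in>{0<..2}. decreasing_rearrangement f t * ennreal (ln (2 * exp 1 / t)) \<partial>lborel)"

definition LlogL :: "(real \<Rightarrow> complex) set" where
  "LlogL = {f \<in> L0. norm_LlogL f < \<infinity>}"

definition T_log :: "(real \<Rightarrow> complex) \<Rightarrow> real \<Rightarrow> complex" where
  "T_log = restrict finite_hilbert LlogL"


subsection \<open>Complex measures\<close>

definition variation :: "'a measure \<Rightarrow> ('a set \<Rightarrow> complex) \<Rightarrow> 'a set \<Rightarrow> ennreal" where
  "variation M \<nu> A =
     (SUP P \<in> {P. finite P \<and> P \<subseteq> sets M \<and> partition_on A P}. \<Sum>B\<in>P. ennreal (cmod (\<nu> B)))"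

definition variation_measure :: "'a measure \<Rightarrow> ('a set \<Rightarrow> complex) \<Rightarrow> 'a measure" where
  "variation_measure M \<nu> = measure_of (space M) (sets M) (variation M \<nu>)"

text \<open>
  The positive part of the Jordan decomposition of a finite signed measure \<open>\<sigma>\<close>. The negative part
  is the positive part of \<open>-\<sigma>\<close>.
\<close>

definition positive_part :: "'a measure \<Rightarrow> ('a set \<Rightarrow> real) \<Rightarrow> 'a measure" where
  "positive_part M \<sigma> =
     measure_of (space M) (sets M) (\<lambda>A. SUP B \<in> {B \<in> sets M. B \<subseteq> A}. ennreal (\<sigma> B))"

definition complex_measure_integrable ::
    "'a measure \<Rightarrow> ('a set \<Rightarrow> complex) \<Rightarrow> ('a \<Rightarrow> complex) \<Rightarrow> bool" where
  "complex_measure_integrable M \<nu> f \<longleftrightarrow> integrable (variation_measure M \<nu>) f"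

definition complex_measure_integral ::
    "'a measure \<Rightarrow> ('a set \<Rightarrow> complex) \<Rightarrow> 'a set \<Rightarrow> ('a \<Rightarrow> complex) \<Rightarrow> complex" where
  "complex_measure_integral M \<nu> A f =
     ((LINT x:A|positive_part M (\<lambda>B. Re (\<nu> B)). f x) -
      (LINT x:A|positive_part M (\<lambda>B. - Re (\<nu> B)). f x)) +
     \<i> * ((LINT x:A|positive_part M (\<lambda>B. Im (\<nu> B)). f x) -
          (LINT x:A|positive_part M (\<lambda>B. - Im (\<nu> B)). f x))"


subsection \<open>The vector measure and its integrable functions\<close>

definition m_L1 :: "real set \<Rightarrow> real \<Rightarrow> complex" where
  "m_L1 A = finite_hilbert (indicator A)"

definition dual_pairing :: "(real \<Rightarrow> complex) \<Rightarrow> (real \<Rightarrow> complex) \<Rightarrow> complex" where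
  "dual_pairing h g = (LINT x|mu. h x * g x)"

definition m_L1_scalar :: "(real \<Rightarrow> complex) \<Rightarrow> real set \<Rightarrow> complex" where
  "m_L1_scalar g A = dual_pairing (m_L1 A) g"

definition is_m_L1_integral ::
    "(real \<Rightarrow> complex) \<Rightarrow> real set \<Rightarrow> (real \<Rightarrow> complex) \<Rightarrow> bool" where
  "is_m_L1_integral f A h \<longleftrightarrow>
     h \<in> L1 \<and>
     (\<forall>g\<in>Linf. dual_pairing h g = complex_measure_integral mu (m_L1_scalar g) A f)"

definition L1_m :: "(real \<Rightarrow> complex) set" where
  "L1_m = {f \<in> L0.
     (\<forall>g\<in>Linf. complex_measure_integrable mu (m_L1_scalar g) f) \<and>
     (\<forall>A\<in>sets mu. \<exists>h. is_m_L1_integral f A h)}"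

definition norm_L1_m :: "(real \<Rightarrow> complex) \<Rightarrow> ennreal" where
  "norm_L1_m f =
     (SUP g \<in> {g \<in> Linf. norm_Linf g \<le> 1}.
        \<integral>\<^sup>+x. ennreal (cmod (f x)) \<partial>variation_measure mu (m_L1_scalar g))"

text \<open>
  The integral is unique only up to equality almost everywhere, so a representative is chosen.
\<close>

definition m_L1_integral :: "real set \<Rightarrow> (real \<Rightarrow> complex) \<Rightarrow> real \<Rightarrow> complex" where
  "m_L1_integral A f = (SOME h. is_m_L1_integral f A h)"

definition I_m_L1 :: "(real \<Rightarrow> complex) \<Rightarrow> real \<Rightarrow> complex" where
  "I_m_L1 f = m_L1_integral (space mu) f"

end

theory Submission
  imports Defs "HOL-Complex_Analysis.Complex_Analysis" "HOL-Real_Asymp.Real_Asymp" "HOL-Probability.Probability"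
begin

text \<open>
  If \<open>f \<in> L log L\<close>, the bounded functions \<open>g\<close> have exponentially integrable transforms, so
  \<open>|f| |T g|\<close> is integrable and the Parseval formula \<open>\<integral> T f g = - \<integral> f T g\<close> holds. Hence
  \<open>\<langle>m, g\<rangle>\<close> has density \<open>- T g\<close>, its variation has density \<open>|T g|\<close>, and \<open>f\<close> is integrable with integral
  \<open>T f\<close>, with norm at most a constant times the norm of \<open>L log L\<close>.

  Conversely, let \<open>f\<close> be integrable for \<open>m\<close>. Taking \<open>A = {Re (c f) > 0}\<close> with \<open>c \<in> {1, -1, \<i>, -\<i>}\<close>, the
  integral over \<open>A\<close> provides \<open>h \<in> L\<^sup>1\<close> that is dual to \<open>u = max 0 (Re (c f))\<close>. Testing with Poisson kernels
  shows that the conjugate Poisson integral \<open>Q\<close> of \<open>u\<close> is bounded in \<open>L\<^sup>1\<close> with respect to harmonic measure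
  up to the boundary. With \<open>P\<close> the Poisson integral of \<open>u\<close> and \<open>X = 1 + P - \<i> Q\<close>, the mean value property
  of \<open>X log X\<close> bounds \<open>\<integral> (1 + P) ln (1 + P)\<close>, and Fatou's lemma gives \<open>u \<in> L log L\<close> (Zygmund's theorem).
  The transforms of the indicators of \<open>(-1,1)\<close> and \<open>(0,1)\<close> are never small at the same point, which
  controls the norm of \<open>f\<close> in \<open>L\<^sup>1\<close>.
\<close>

subsection \<open>Poisson kernels and boundary limits\<close>

text \<open>Test functions are supported in the interval, while Poisson kernels are not. Cutting the
  kernel off leaves the remainder \<open>outer\<close>, whose average over harmonic measure grows
  logarithmically at the endpoints. This is the growth of \<open>L1fun\<close>, up to a factor \<pi>
  the transform of the constant 1, against which \<open>f\<close> is integrable by hypothesis; so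
  the remainder is harmless.

  The line is treated through the half-plane because each quantitative fact is then one application
  of Poisson's formula at \<i>: to the square of the Cauchy integral (existence of transforms), to
  its exponential (exponential integrability), to X log X (entropy). Harmonic measure is finite, so
  bounded functions are integrable, and its density is bounded below on the interval. The formula is
  applied at positive height, where everything is bounded and holomorphic across the axis; limits
  are taken last.

  The entropy bound is not homogeneous. Equivalence of the norms therefore needs it with explicit
  constants on the unit ball of \<open>norm_L1_m\<close>, followed by scaling.\<close>

definition pois :: "real \<Rightarrow> real \<Rightarrow> real" where
  "pois y s = y / (pi * (s\<^sup>2 + y\<^sup>2))"

text \<open>With \<open>pois\<close> this forms the Cauchy kernel:
  \<open>cpois y s + \<i> * pois y s\<close> is 1 / (\<pi> (s - \<i> y)). As \<open>y\<close> tends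
  to 0, \<open>cpois\<close> becomes the kernel of the Hilbert transform and \<open>pois\<close>
  concentrates at 0.\<close>

definition cpois :: "real \<Rightarrow> real \<Rightarrow> real" where
  "cpois y s = s / (pi * (s\<^sup>2 + y\<^sup>2))"

lemma pois_measurable[measurable]: "pois y \<in> borel_measurable borel"
  unfolding pois_def by measurable

lemma cpois_measurable[measurable]: "cpois y \<in> borel_measurable borel"
  unfolding cpois_def by measurable

lemma sum_sq_pos: "y > 0 \<Longrightarrow> (s::real)\<^sup>2 + y\<^sup>2 > 0"
  by (simp add: add_nonneg_pos)

lemma pois_pos: "y > 0 \<Longrightarrow> pois y s > 0"
  unfolding pois_def by (simp add: sum_sq_pos)

lemma pois_nonneg: "y > 0 \<Longrightarrow> pois y s \<ge> 0"
  using pois_pos[of y s] by simp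

lemma pois_minus: "pois y (- s) = pois y s"
  by (simp add: pois_def)

lemma cpois_minus: "cpois y (- s) = - cpois y s"
  by (simp add: cpois_def)

lemma has_bochner_integral_pois_1: "has_bochner_integral lborel (pois 1) 1"
proof -
  have "has_bochner_integral lborel (\<lambda>x::real. inverse (1 + x\<^sup>2)) pi"
    using integrable_inverse_1_plus_square LBINT_inverse_1_plus_square
    by (simp add: has_bochner_integral_iff set_integrable_def interval_lebesgue_integral_def set_lebesgue_integral_def)
  from has_bochner_integral_divide_zero[OF this, of pi] show ?thesis
    unfolding pois_def
    by (simp add: divide_simps mult.commute add.commute)
qed

lemma pois_scale: "y > 0 \<Longrightarrow> pois y s = pois 1 (s / y) / y"
  by (simp add: pois_def power_divide divide_simps sum_sq_pos) (simp add: power2_eq_square algebra_simps)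

lemma has_bochner_integral_pois:
  assumes "y > 0"
  shows "has_bochner_integral lborel (\<lambda>s. pois y (s - t)) 1"
proof -
  have "has_bochner_integral lborel (\<lambda>s. pois 1 (- t / y + (1/y) * s)) (1 /\<^sub>R \<bar>1/y\<bar>)"
    by (rule lborel_has_bochner_integral_real_affine_iff[THEN iffD1, OF _ has_bochner_integral_pois_1])
       (use assms in simp)
  then have "has_bochner_integral lborel (\<lambda>s. pois 1 (- t / y + (1/y) * s) / y) (1 /\<^sub>R \<bar>1/y\<bar> / y)"
    by (rule has_bochner_integral_divide_zero)
  moreover have "pois 1 (- t / y + (1/y) * s) / y = pois y (s - t)" for s
    using assms by (subst pois_scale[of y]) (simp_all add: diff_divide_distrib)
  ultimately show ?thesis using assms by simp
qed

lemma integrable_pois: "y > 0 \<Longrightarrow> integrable lborel (\<lambda>s. pois y (s - t))"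
  and integral_pois: "y > 0 \<Longrightarrow> (\<integral>s. pois y (s - t) \<partial>lborel) = 1"
  using has_bochner_integral_pois[of y t] by (auto simp: has_bochner_integral_iff)

section \<open>Poisson's formula in the upper half-plane, by contour integration\<close>

lemma holomorphic_half_plane_integral_eq_0:
  fixes G :: "complex \<Rightarrow> complex"
  assumes hol: "G holomorphic_on {z. Im z > - d}" and d: "d > 0"
    and B: "\<And>z. Im z \<ge> 0 \<Longrightarrow> cmod z \<ge> 2 \<Longrightarrow> cmod (G z) \<le> B / (cmod z)\<^sup>2"
    and int: "integrable lborel (\<lambda>x. G (of_real x))"
  shows "(\<integral>x. G (of_real x) \<partial>lborel) = 0"
proof -
  have B0: "B \<ge> 0" using order_trans[OF norm_ge_zero B[of 2]] by simp
  let ?I = "\<lambda>n::nat. \<integral>x\<in>{- real n..real n}. G (of_real x) \<partial>lborel"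
  have lim1: "?I \<longlonglongrightarrow> (\<integral>x. G (of_real x) \<partial>lborel)"
    unfolding set_lebesgue_integral_def
  proof (rule integral_dominated_convergence[where w="\<lambda>x. norm (G (of_real x))"])
    show "AE x in lborel. (\<lambda>n. indicat_real {- real n..real n} x *\<^sub>R G (complex_of_real x))
          \<longlonglongrightarrow> G (complex_of_real x)"
    proof (rule AE_I2)
      fix x :: real
      have "eventually (\<lambda>n. real n \<ge> \<bar>x\<bar>) sequentially"
        using eventually_ge_at_top[of "nat \<lceil>\<bar>x\<bar>\<rceil>"] by eventually_elim linarith
      then have "eventually (\<lambda>n. indicat_real {- real n..real n} x *\<^sub>R G (complex_of_real x) = G (of_real x)) sequentially"
        by eventually_elim (auto simp: indicator_def)
      then show "(\<lambda>n. indicat_real {- real n..real n} x *\<^sub>R G (complex_of_real x)) \<longlonglongrightarrow> G (complex_of_real x)"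
        by (rule tendsto_eventually)
    qed
  qed (use int in \<open>auto split: split_indicator\<close>)
  \<comment> \<open>Close the segment by the upper half-circle: its length \<pi> n times the bound B
    / n^2 tends to 0. The condition \<open>n \<ge> 2\<close> reflects that the decay is assumed for
    \<open>cmod z \<ge> 2\<close> only.\<close>
  have bd: "cmod (?I n) \<le> B * pi / real n" if n: "n \<ge> 2" for n
  proof -
    let ?R = "real n"
    let ?S = "{z. Im z > - d}"
    let ?L = "linepath (- of_real ?R) (of_real ?R)" and ?C = "part_circlepath 0 ?R 0 pi"
    have R: "?R \<ge> 2" using n by simp
    have conv: "convex ?S" by (rule convex_halfspace_Im_gt)
    have ends: "pathstart ?C = of_real ?R" "pathfinish ?C = - of_real ?R"
      by (auto simp: exp_Euler)
    have arc: "cmod z = ?R \<and> Im z \<ge> 0" if zz: "z \<in> path_image ?C" for z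
    proof -
      obtain x where x: "x \<in> {0..pi}" "z = ?R * cis x"
        using zz pi_ge_zero by (auto simp: path_image_part_circlepath' closed_segment_eq_real_ivl cis_conv_exp)
      then show ?thesis using R by (auto simp: norm_mult sin_ge_zero)
    qed
    have lin: "path_image ?L \<subseteq> ?S"
      using d closed_segment_subset[OF _ _ conv, of "- of_real ?R" "of_real ?R"] by simp
    have arcS: "path_image ?C \<subseteq> ?S" using arc d by fastforce
    have cont: "continuous_on ?S G" using hol by (rule holomorphic_on_imp_continuous_on)
    have i1: "G contour_integrable_on ?L"
      by (rule contour_integrable_continuous_linepath) (use continuous_on_subset[OF cont lin] in simp)
    have i2: "G contour_integrable_on ?C"
      by (rule contour_integrable_continuous_part_circlepath) (rule continuous_on_subset[OF cont arcS])
    have "(G has_contour_integral 0) (?L +++ ?C)"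
      by (rule Cauchy_theorem_convex_simple[OF hol conv])
         (use ends lin arcS in \<open>auto intro!: valid_path_join simp: path_image_join\<close>)
    then have sum0: "contour_integral ?L G + contour_integral ?C G = 0"
      using i1 i2 contour_integral_unique by fastforce
    have "cmod (G z) \<le> B / ?R\<^sup>2" if "z \<in> path_image ?C" for z
      using B[of z] arc[OF that] R by simp
    then have "norm (contour_integral ?C G) \<le> B / ?R\<^sup>2 * ?R * \<bar>pi - 0\<bar>"
      by (intro contour_integral_bound_part_circlepath[OF i2]) (use R B0 in auto)
    also have "\<dots> = B * pi / ?R" using R by (simp add: field_simps power2_eq_square)
    finally have cb: "norm (contour_integral ?L G) \<le> B * pi / ?R"
      using sum0 by (metis add_eq_0_iff norm_minus_cancel)
    have "contour_integral ?L G = integral {Re (- of_real ?R)..Re (of_real ?R)} (\<lambda>x. G (of_real x))"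
      by (rule contour_integral_linepath_Reals_eq) (use R in auto)
    moreover have "set_integrable lborel {-?R..?R} (\<lambda>x. G (of_real x))"
      unfolding set_integrable_def by (rule integrable_mult_indicator) (use int in auto)
    ultimately have "contour_integral ?L G = ?I n"
      using set_borel_integral_eq_integral(2) by fastforce
    then show ?thesis using cb by simp
  qed
  have "?I \<longlonglongrightarrow> 0"
  proof (rule Lim_null_comparison)
    show "\<forall>\<^sub>F n in sequentially. cmod (?I n) \<le> B * pi / real n"
      using eventually_ge_at_top[of 2] by eventually_elim (rule bd)
    show "(\<lambda>n. B * pi / real n) \<longlonglongrightarrow> 0" by real_asymp
  qed
  with lim1 show ?thesis by (rule LIMSEQ_unique)
qed

text \<open>The residue at \<i> is removed rather than computed. After subtracting
  \<open>G \<i>\<close>, the quotient by z^2 + 1 is holomorphic past the axis and decays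
  quadratically, so its integral over the axis vanishes; divided by \<pi> this is the difference of
  the Poisson integrals of \<open>G\<close> and of the constant \<open>G \<i>\<close>.\<close>

lemma poisson_formula_i:
  fixes G :: "complex \<Rightarrow> complex"
  assumes hol: "G holomorphic_on {z. Im z > - d}" and d: "d > 0"
    and B: "\<And>z. Im z \<ge> 0 \<Longrightarrow> cmod (G z) \<le> B"
  shows "(\<integral>s. of_real (pois 1 s) * G (of_real s) \<partial>lborel) = G \<i>"
proof -
  \<comment> \<open>\<open>e \<le> 1\<close> keeps -\<i>, the other zero of z^2 + 1, out of the
    domain.\<close>
  define e where "e = min d 1"
  have e: "e > 0" "e \<le> d" "e \<le> 1" using d by (auto simp: e_def)
  let ?S = "{z. Im z > - e}"
  have oS: "open ?S" by (rule open_halfspace_Im_gt)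
  have holS: "G holomorphic_on ?S" by (rule holomorphic_on_subset[OF hol]) (use e in auto)
  define H where "H z = (if z = \<i> then deriv G \<i> else (G z - G \<i>) / (z - \<i>)) / (z + \<i>)" for z
  have nz: "z + \<i> \<noteq> 0" if "z \<in> ?S" for z
    using that e by (auto simp: complex_eq_iff)
  have holH: "H holomorphic_on ?S"
    unfolding H_def by (intro holomorphic_intros pole_lemma_open holS oS) (use nz in auto)
  have B0: "B \<ge> 0" using order_trans[OF norm_ge_zero B[of 0]] by simp
  have Heq: "H z = (G z - G \<i>) / (z\<^sup>2 + 1)" if "z \<noteq> \<i>" for z
    using that by (simp add: H_def field_simps power2_eq_square)
  have Hbd: "cmod (H z) \<le> (4 * B) / (cmod z)\<^sup>2" if z: "Im z \<ge> 0" "cmod z \<ge> 2" for z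
  proof -
    have zi: "z \<noteq> \<i>" using z by auto
    have "cmod (G z - G \<i>) \<le> 2 * B" using norm_triangle_ineq4[of "G z" "G \<i>"] B[of z] B[of \<i>] z by simp
    moreover have "cmod (z\<^sup>2 + 1) \<ge> (cmod z)\<^sup>2 / 2"
    proof -
      have "cmod (z\<^sup>2 + 1) \<ge> (cmod z)\<^sup>2 - 1"
        using norm_diff_ineq[of "z\<^sup>2" 1] by (simp add: norm_power)
      moreover have "(cmod z)\<^sup>2 \<ge> 2\<^sup>2" by (rule power_mono) (use z in auto)
      ultimately show ?thesis by simp
    qed
    moreover have "(cmod z)\<^sup>2 > 0" using z by (auto intro!: zero_less_power)
    ultimately have "cmod (G z - G \<i>) / cmod (z\<^sup>2 + 1) \<le> (2 * B) / ((cmod z)\<^sup>2 / 2)"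
      using B0 by (intro frac_le) auto
    then show ?thesis by (simp add: Heq[OF zi] norm_divide)
  qed
  have contG: "continuous_on UNIV (\<lambda>x::real. G (of_real x))"
    by (rule continuous_on_compose2[OF holomorphic_on_imp_continuous_on[OF hol]])
       (use d in \<open>auto intro!: continuous_intros\<close>)
  then have [measurable]: "(\<lambda>x::real. G (of_real x)) \<in> borel_measurable borel"
    by (rule borel_measurable_continuous_onI)
  have i0: "integrable lborel (pois 1)"
    using has_bochner_integral_pois_1 by (rule integrable.intros)
  have iG: "integrable lborel (\<lambda>s. of_real (pois 1 s) * G (of_real s))"
  proof (rule Bochner_Integration.integrable_bound[OF integrable_mult_right[OF i0, of B]])
    show "AE x in lborel. norm (of_real (pois 1 x) * G (of_real x)) \<le> norm (B * pois 1 x)"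
    proof (rule AE_I2)
      fix x :: real
      have "norm (of_real (pois 1 x) * G (of_real x)) = pois 1 x * cmod (G (of_real x))" "norm (B * pois 1 x) = pois 1 x * B"
        using B0 pois_nonneg[of 1 x] by (simp_all add: norm_mult)
      then show "norm (of_real (pois 1 x) * G (of_real x)) \<le> norm (B * pois 1 x)"
        using mult_left_mono[OF B[of "of_real x"] pois_nonneg[of 1 x]] by simp
    qed
  qed simp
  have ic: "integrable lborel (\<lambda>s. of_real (pois 1 s) * G \<i>)"
    using i0 by (intro integrable_mult_left) (simp)
  have Hre: "H (of_real x) = of_real pi * (of_real (pois 1 x) * G (of_real x) - of_real (pois 1 x) * G \<i>)" for x
  proof -
    define c :: complex where "c = (of_real x)\<^sup>2 + 1"
    have c0: "c = of_real (x\<^sup>2 + 1)" by (simp add: c_def)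
    have "x\<^sup>2 + 1 > 0" by (simp add: add_nonneg_pos)
    then have "c \<noteq> 0" unfolding c0 using of_real_eq_0_iff by (metis less_irrefl)
    moreover have "of_real (pois 1 x) = 1 / (of_real pi * c)" by (simp add: pois_def c0)
    moreover have "of_real x \<noteq> \<i>" by (simp add: complex_eq_iff)
    ultimately show ?thesis
      by (subst Heq) (simp_all add: right_diff_distrib diff_divide_distrib flip: c_def)
  qed
  have iH: "integrable lborel (\<lambda>x. H (of_real x))"
    unfolding Hre by (intro integrable_mult_right Bochner_Integration.integrable_diff iG ic)
  have "0 = (\<integral>x. H (of_real x) \<partial>lborel)"
    by (rule holomorphic_half_plane_integral_eq_0[OF holH e(1) _ iH, symmetric]) (use Hbd in auto)
  also have "\<dots> = of_real pi * ((\<integral>s. of_real (pois 1 s) * G (of_real s) \<partial>lborel) - (\<integral>s. of_real (pois 1 s) * G \<i> \<partial>lborel))"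
    unfolding Hre by (simp add: Bochner_Integration.integral_diff[OF iG ic])
  also have "(\<integral>s. of_real (pois 1 s) * G \<i> \<partial>lborel) = G \<i>"
    using integral_pois[of 1 0] by simp
  finally show ?thesis by simp
qed

lemma poisson_formula:
  fixes G :: "complex \<Rightarrow> complex"
  assumes hol: "G holomorphic_on {z. Im z > - d}" and d: "d > 0"
    and B: "\<And>z. Im z \<ge> 0 \<Longrightarrow> cmod (G z) \<le> B" and y: "y > 0"
  shows "(\<integral>s. of_real (pois y (s - t)) * G (of_real s) \<partial>lborel) = G (Complex t y)"
proof -
  let ?K = "\<lambda>z. G (of_real t + of_real y * z)"
  have "(\<integral>s. of_real (pois 1 s) * ?K (of_real s) \<partial>lborel) = ?K \<i>"
  proof (rule poisson_formula_i)
    show "?K holomorphic_on {z. Im z > - (d / y)}"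
      using y by (intro holomorphic_on_compose_gen[OF _ hol, unfolded o_def] holomorphic_intros) (auto simp: field_simps)
    show "cmod (?K z) \<le> B" if "Im z \<ge> 0" for z by (rule B) (use that y in simp)
  qed (use y d in auto)
  also have "?K \<i> = G (Complex t y)" by (simp add: complex_eq_iff flip: Complex_eq) (metis complex_eq complex.sel mult.commute)
  finally have 1: "(\<integral>s. of_real (pois 1 s) * G (of_real (t + y * s)) \<partial>lborel) = G (Complex t y)" by simp
  have "(\<integral>s. of_real (pois y (s - t)) * G (of_real s) \<partial>lborel) =
     \<bar>y\<bar> *\<^sub>R (\<integral>s. of_real (pois y (t + y * s - t)) * G (of_real (t + y * s)) \<partial>lborel)"
    by (rule lborel_integral_real_affine) (use y in simp)
  also have "\<dots> = (\<integral>s. y *\<^sub>R (of_real (pois y (y * s)) * G (of_real (t + y * s))) \<partial>lborel)"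
    using y by simp
  also have "\<dots> = (\<integral>s. of_real (pois 1 s) * G (of_real (t + y * s)) \<partial>lborel)"
    by (rule Bochner_Integration.integral_cong[OF refl]) (use y in \<open>simp add: pois_scale[of y] scaleR_conv_of_real field_simps\<close>)
  finally show ?thesis using 1 by simp
qed


section \<open>Lebesgue points\<close>

definition lebesgue_point :: "(real \<Rightarrow> real) \<Rightarrow> real \<Rightarrow> bool" where
  "lebesgue_point u t \<longleftrightarrow>
     (\<forall>e>0. eventually (\<lambda>r. (\<integral>\<^sup>+x\<in>{t - r..t + r}. ennreal \<bar>u x - u t\<bar> \<partial>lborel) \<le> ennreal (e * r)) (at_right 0))"

text \<open>Weak type (1,1) of the maximal function, by Vitali's covering lemma. The factor 10 is
  the length of a ball of radius 5 r divided by r. A measurable superset \<open>E\<close> stands in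
  for the exceptional set itself.\<close>

lemma maximal_weak_type:
  fixes v :: "real \<Rightarrow> ennreal"
  assumes v[measurable]: "v \<in> borel_measurable borel" and l: "l > 0"
  obtains E where "E \<in> sets lborel"
    "{t. \<exists>r>0. (\<integral>\<^sup>+x\<in>{t - r..t + r}. v x \<partial>lborel) > ennreal (l * r)} \<subseteq> E"
    "emeasure lborel E \<le> ennreal (10 / l) * (\<integral>\<^sup>+x. v x \<partial>lborel)"
proof (cases "(\<integral>\<^sup>+x. v x \<partial>lborel) = \<infinity>")
  case True
  show ?thesis by (rule that[of UNIV]) (use True l in \<open>auto simp: ennreal_mult_top\<close>)
next
  case False
  then obtain I where I: "I \<ge> 0" "(\<integral>\<^sup>+x. v x \<partial>lborel) = ennreal I"
    by (cases "\<integral>\<^sup>+x. v x \<partial>lborel") auto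
  let ?S = "{t. \<exists>r>0. (\<integral>\<^sup>+x\<in>{t - r..t + r}. v x \<partial>lborel) > ennreal (l * r)}"
  let ?K = "{(t, r). r > 0 \<and> (\<integral>\<^sup>+x\<in>{t - r..t + r}. v x \<partial>lborel) > ennreal (l * r)}"
  let ?D = "density lborel v"
  have cb: "cball t r = {t - r..t + r}" for t r :: real by (auto simp: dist_real_def)
  have big: "ennreal (l * r) \<le> emeasure ?D (cball t r)" if "(t, r) \<in> ?K" for t r
    using that by (auto simp: emeasure_density cb)
  \<comment> \<open>Vitali's lemma needs bounded radii; the finite integral of \<open>v\<close>
    bounds them.\<close>
  have rb: "0 < snd i \<and> snd i \<le> I / l" if "i \<in> ?K" for i
  proof -
    obtain t r where i: "i = (t, r)" "r > 0" "(\<integral>\<^sup>+x\<in>{t - r..t + r}. v x \<partial>lborel) > ennreal (l * r)"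
      using \<open>i \<in> ?K\<close> by auto
    have "ennreal (l * r) \<le> (\<integral>\<^sup>+x. v x \<partial>lborel)"
      using i(3) by (auto intro!: order_trans[OF less_imp_le nn_integral_mono] split: split_indicator)
    then have "l * r \<le> I" using I by (simp add: ennreal_le_iff)
    then show ?thesis using i l by (simp add: field_simps)
  qed
  have cov: "?S \<subseteq> (\<Union>i\<in>?K. cball (fst i) (snd i))" by force
  obtain C where C: "countable C" "C \<subseteq> ?K"
     "pairwise (\<lambda>i j. disjnt (cball (fst i) (snd i)) (cball (fst j) (snd j))) C"
     "?S \<subseteq> (\<Union>i\<in>C. cball (fst i) (5 * snd i))"
    using Vitali_covering_lemma_cballs[OF cov rb] by blast
  let ?E = "\<Union>i\<in>C. cball (fst i) (5 * snd i)"
  have Em[measurable]: "?E \<in> sets lborel" using C(1) by (intro sets.countable_UN'') auto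
  \<comment> \<open>The countable sum over \<open>C\<close> is written as an integral for the
    counting measure, so that countable subadditivity becomes an exchange of two integrals.\<close>
  have ind: "indicator ?E x \<le> (\<integral>\<^sup>+i. indicator (cball (fst i) (5 * snd i)) x \<partial>count_space C)" for x :: real
  proof (cases "x \<in> ?E")
    case True
    then obtain i where i: "i \<in> C" "x \<in> cball (fst i) (5 * snd i)" by auto
    have "indicator {i} j \<le> (indicator (cball (fst j) (5 * snd j)) x :: ennreal)" if "j \<in> C" for j
      using i by (auto split: split_indicator)
    then have "(\<integral>\<^sup>+j. indicator {i} j \<partial>count_space C) \<le> (\<integral>\<^sup>+i. indicator (cball (fst i) (5 * snd i)) x \<partial>count_space C)"
      by (intro nn_integral_mono) auto
    moreover have "(\<integral>\<^sup>+j. indicator {i} j \<partial>count_space C) = 1"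
      using i by (subst nn_integral_indicator) auto
    ultimately show ?thesis using True by simp
  qed simp
  have "emeasure lborel ?E = (\<integral>\<^sup>+x. indicator ?E x \<partial>lborel)"
    by (rule nn_integral_indicator[OF Em, symmetric])
  also have "\<dots> \<le> (\<integral>\<^sup>+x. (\<integral>\<^sup>+i. indicator (cball (fst i) (5 * snd i)) x \<partial>count_space C) \<partial>lborel)"
    by (intro nn_integral_mono ind)
  also have "\<dots> = (\<integral>\<^sup>+i. (\<integral>\<^sup>+x. indicator (cball (fst i) (5 * snd i)) x \<partial>lborel) \<partial>count_space C)"
    using C(1) by (subst nn_integral_count_space_nn_integral) (auto intro!: borel_measurable_indicator)
  also have "\<dots> \<le> (\<integral>\<^sup>+i. ennreal (10 / l) * emeasure ?D (cball (fst i) (snd i)) \<partial>count_space C)"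
  proof (rule nn_integral_mono)
    fix i assume "i \<in> space (count_space C)"
    then have iK: "i \<in> ?K" using C by auto
    then have pos: "snd i > 0" by auto
    have "(\<integral>\<^sup>+x. indicator (cball (fst i) (5 * snd i)) x \<partial>lborel) = ennreal (10 * snd i)"
      unfolding cb using pos by simp
    also have "\<dots> = ennreal (10 / l) * ennreal (l * snd i)"
      using pos l by (simp add: ennreal_mult[symmetric])
    also have "\<dots> \<le> ennreal (10 / l) * emeasure ?D (cball (fst i) (snd i))"
      using big[of "fst i" "snd i"] iK by (intro mult_left_mono) auto
    finally show "(\<integral>\<^sup>+x. indicator (cball (fst i) (5 * snd i)) x \<partial>lborel) \<le> \<dots>" .
  qed
  also have "\<dots> = ennreal (10 / l) * (\<integral>\<^sup>+i. emeasure ?D (cball (fst i) (snd i)) \<partial>count_space C)"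
    by (rule nn_integral_cmult) simp
  also have "(\<integral>\<^sup>+i. emeasure ?D (cball (fst i) (snd i)) \<partial>count_space C) = emeasure ?D (\<Union>i\<in>C. cball (fst i) (snd i))"
    by (rule emeasure_UN_countable[symmetric])
       (use C in \<open>auto simp: disjoint_family_on_def pairwise_def disjnt_def\<close>)
  also have "\<dots> \<le> emeasure ?D (space ?D)" by (rule emeasure_space)
  also have "\<dots> = (\<integral>\<^sup>+x. v x \<partial>lborel)" by (subst emeasure_density) auto
  finally have "emeasure lborel ?E \<le> ennreal (10 / l) * (\<integral>\<^sup>+x. v x \<partial>lborel)"
    by (simp add: mult_left_mono)
  with C(4) Em show ?thesis by (intro that[of ?E])
qed

lemma nn_integral_abs_triangle_interval:
  fixes u v :: "real \<Rightarrow> real"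
  assumes [measurable]: "u \<in> borel_measurable borel" "v \<in> borel_measurable borel" and r: "r > 0"
  shows "(\<integral>\<^sup>+x\<in>{t - r..t + r}. ennreal \<bar>u x - u t\<bar> \<partial>lborel) \<le>
    (\<integral>\<^sup>+x\<in>{t - r..t + r}. ennreal \<bar>u x - v x\<bar> \<partial>lborel) + (\<integral>\<^sup>+x\<in>{t - r..t + r}. ennreal \<bar>v x - v t\<bar> \<partial>lborel)
    + ennreal (2 * r * \<bar>u t - v t\<bar>)"
proof -
  let ?J = "{t - r..t + r}"
  have "(\<integral>\<^sup>+x\<in>?J. ennreal \<bar>u x - u t\<bar> \<partial>lborel) \<le>
     (\<integral>\<^sup>+x. (ennreal \<bar>u x - v x\<bar> * indicator ?J x + ennreal \<bar>v x - v t\<bar> * indicator ?J x) + ennreal \<bar>u t - v t\<bar> * indicator ?J x \<partial>lborel)"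
    by (intro nn_integral_mono) (auto split: split_indicator simp flip: ennreal_plus intro!: ennreal_leI)
  also have "\<dots> = (\<integral>\<^sup>+x\<in>?J. ennreal \<bar>u x - v x\<bar> \<partial>lborel) + (\<integral>\<^sup>+x\<in>?J. ennreal \<bar>v x - v t\<bar> \<partial>lborel) +
      (\<integral>\<^sup>+x. ennreal \<bar>u t - v t\<bar> * indicator ?J x \<partial>lborel)"
    by (simp add: nn_integral_add)
  also have "(\<integral>\<^sup>+x. ennreal \<bar>u t - v t\<bar> * indicator ?J x \<partial>lborel) = ennreal (2 * r * \<bar>u t - v t\<bar>)"
    using r by (subst nn_integral_cmult_indicator) (auto simp: ennreal_mult[symmetric] mult.commute)
  finally show ?thesis .
qed

text \<open>The oscillation of \<open>u\<close> at \<open>t\<close> is at most that of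
  \<open>v\<close>, plus the averages of \<bar>u - v\<bar> near \<open>t\<close>, plus \<bar>u t - v
  t\<bar>. The last two are large only on sets of small measure, by the weak type bound and by
  Markov's inequality.\<close>

lemma AE_lebesgue_point_approx:
  fixes u :: "real \<Rightarrow> real"
  assumes u[measurable]: "u \<in> borel_measurable borel"
    and approx: "\<And>e. e > 0 \<Longrightarrow> \<exists>v\<in>borel_measurable borel. (AE t in lborel. lebesgue_point v t) \<and>
      (\<integral>\<^sup>+x. ennreal \<bar>u x - v x\<bar> \<partial>lborel) \<le> ennreal e"
  shows "AE t in lborel. lebesgue_point u t"
proof -
  \<comment> \<open>4 = 1 + 1 + 2: one \<open>l * r\<close> each from \<open>u - v\<close> and from
    the oscillation of \<open>v\<close>, and \<open>2 * r * l\<close> from the constant \<bar>u t -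
    v t\<bar> on an interval of length 2 r.\<close>
  define good where "good l t \<longleftrightarrow> eventually (\<lambda>r. (\<integral>\<^sup>+x\<in>{t - r..t + r}. ennreal \<bar>u x - u t\<bar> \<partial>lborel) \<le> ennreal (4 * l * r)) (at_right 0)" for l t
  have ex: "\<exists>E\<in>sets lborel. {t. \<not> good l t} \<subseteq> E \<and> emeasure lborel E \<le> ennreal e" if l: "l > 0" and e: "e > 0" for l e
  proof -
    \<comment> \<open>11 = 10 + 1: the weak type bound contributes the factor 10 / l, Markov's
      inequality the factor 1 / l.\<close>
    have "e * l / 11 > 0" using l e by simp
    from approx[OF this] obtain v where v[measurable]: "v \<in> borel_measurable borel"
      and vl: "AE t in lborel. lebesgue_point v t" and ve: "(\<integral>\<^sup>+x. ennreal \<bar>u x - v x\<bar> \<partial>lborel) \<le> ennreal (e * l / 11)" by blast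
    obtain E1 where E1: "E1 \<in> sets lborel"
      "{t. \<exists>r>0. (\<integral>\<^sup>+x\<in>{t - r..t + r}. ennreal \<bar>u x - v x\<bar> \<partial>lborel) > ennreal (l * r)} \<subseteq> E1"
      "emeasure lborel E1 \<le> ennreal (10 / l) * (\<integral>\<^sup>+x. ennreal \<bar>u x - v x\<bar> \<partial>lborel)"
      by (rule maximal_weak_type[of "\<lambda>x. ennreal \<bar>u x - v x\<bar>" l]) (use l in auto)
    let ?E2 = "{t \<in> space lborel. 1 \<le> ennreal (1 / l) * ennreal \<bar>u t - v t\<bar>}"
    have m2[measurable]: "?E2 \<in> sets lborel" by measurable
    have "emeasure lborel ?E2 \<le> ennreal (1 / l) * (\<integral>\<^sup>+x. ennreal \<bar>u x - v x\<bar> * indicator UNIV x \<partial>lborel)"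
      using nn_integral_Markov_inequality[of "\<lambda>x. ennreal \<bar>u x - v x\<bar>" UNIV lborel "ennreal (1/l)"] by simp
    then have E2: "emeasure lborel ?E2 \<le> ennreal (1 / l) * (\<integral>\<^sup>+x. ennreal \<bar>u x - v x\<bar> \<partial>lborel)" by simp
    obtain E3 where E3: "\<And>t. t \<in> space lborel - E3 \<Longrightarrow> lebesgue_point v t" "E3 \<in> null_sets lborel"
      using AE_E3[OF vl] by blast
    let ?E = "E1 \<union> ?E2 \<union> E3"
    have Em: "?E \<in> sets lborel" using E1(1) E3(2) m2 by (intro sets.Un) auto
    have "emeasure lborel ?E \<le> emeasure lborel E1 + emeasure lborel ?E2 + emeasure lborel E3"
      using E1(1) E3(2) m2 by (intro order_trans[OF emeasure_subadditive] add_mono emeasure_subadditive) auto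
    also have "emeasure lborel E3 = 0" using E3(2) by auto
    also have "emeasure lborel E1 + emeasure lborel ?E2 + 0 \<le>
       ennreal (10 / l) * ennreal (e * l / 11) + ennreal (1 / l) * ennreal (e * l / 11)"
      using order_trans[OF E1(3) mult_left_mono[OF ve]] order_trans[OF E2 mult_left_mono[OF ve]] by (simp add: add_mono)
    also have "\<dots> = ennreal e" using l e by (simp add: ennreal_mult[symmetric] ennreal_plus[symmetric] del: ennreal_plus)
    finally have meas: "emeasure lborel ?E \<le> ennreal e" .
    have "good l t" if t: "t \<notin> ?E" for t
    proof -
      have 1: "(\<integral>\<^sup>+x\<in>{t - r..t + r}. ennreal \<bar>u x - v x\<bar> \<partial>lborel) \<le> ennreal (l * r)" if "r > 0" for r
      proof (rule ccontr)
        assume "\<not> ?thesis"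
        then have "t \<in> E1" using that by (intro subsetD[OF E1(2)]) (auto simp: not_le)
        then show False using t by simp
      qed
      have "\<not> (1 \<le> ennreal (1 / l) * ennreal \<bar>u t - v t\<bar>)" using t by simp
      then have 2: "\<bar>u t - v t\<bar> < l" using l
        by (auto simp: ennreal_mult[symmetric] simp flip: ennreal_1 simp add: field_simps)
      have "lebesgue_point v t" using t E3(1) by simp
      then have "eventually (\<lambda>r. (\<integral>\<^sup>+x\<in>{t - r..t + r}. ennreal \<bar>v x - v t\<bar> \<partial>lborel) \<le> ennreal (l * r)) (at_right 0)"
        using l by (simp add: lebesgue_point_def)
      moreover have "eventually (\<lambda>r::real. r > 0) (at_right 0)" by (simp add: eventually_at_right_less)
      ultimately show ?thesis unfolding good_def
      proof eventually_elim
        case (elim r)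
        have "(\<integral>\<^sup>+x\<in>{t - r..t + r}. ennreal \<bar>u x - u t\<bar> \<partial>lborel) \<le> ennreal (l * r) + ennreal (l * r) + ennreal (2 * r * l)"
        proof (rule order_trans[OF nn_integral_abs_triangle_interval[OF u v elim(2)]])
          have "2 * r * \<bar>u t - v t\<bar> \<le> 2 * r * l" using elim(2) 2 by (intro mult_left_mono) auto
          then show "(\<integral>\<^sup>+x\<in>{t - r..t + r}. ennreal \<bar>u x - v x\<bar> \<partial>lborel) + (\<integral>\<^sup>+x\<in>{t - r..t + r}. ennreal \<bar>v x - v t\<bar> \<partial>lborel)
            + ennreal (2 * r * \<bar>u t - v t\<bar>) \<le> ennreal (l * r) + ennreal (l * r) + ennreal (2 * r * l)"
            using 1[OF elim(2)] elim(1) by (intro add_mono ennreal_leI)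
        qed
        also have "\<dots> = ennreal (4 * l * r)" using elim l by (simp flip: ennreal_plus)
        finally show ?case .
      qed
    qed
    then show ?thesis using Em meas by blast
  qed
  have AEg: "AE t in lborel. good l t" if l: "l > 0" for l
  proof -
    have "\<exists>E. \<forall>n::nat. E n \<in> sets lborel \<and> {t. \<not> good l t} \<subseteq> E n \<and> emeasure lborel (E n) \<le> ennreal (1 / (real n + 1))"
    proof (intro choice allI)
      fix n :: nat
      have "1 / (real n + 1) > 0" by simp
      from ex[OF l this] show "\<exists>E. E \<in> sets lborel \<and> {t. \<not> good l t} \<subseteq> E \<and> emeasure lborel E \<le> ennreal (1 / (real n + 1))"
        by blast
    qed
    then obtain E where E: "\<And>n. E n \<in> sets lborel" "\<And>n. {t. \<not> good l t} \<subseteq> E n"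
      "\<And>n::nat. emeasure lborel (E n) \<le> ennreal (1 / (real n + 1))" by blast
    have le: "emeasure lborel (\<Inter>n. E n) \<le> ennreal (1 / (real n + 1))" for n
      using E(1) by (intro order_trans[OF emeasure_mono E(3)]) auto
    have "(\<lambda>n. ennreal (1 / (real n + 1))) \<longlonglongrightarrow> ennreal 0"
      by (rule tendsto_ennrealI) real_asymp
    from tendsto_lowerbound[OF this] le have "emeasure lborel (\<Inter>n. E n) \<le> 0" by auto
    then have "(\<Inter>n. E n) \<in> null_sets lborel" using E(1) by auto
    then show ?thesis by (rule AE_I') (use E(2) in blast)
  qed
  have "AE t in lborel. \<forall>n::nat. good (1 / (real n + 1)) t"
    unfolding AE_all_countable by (intro allI AEg) simp
  then show ?thesis
  proof eventually_elim
    case (elim t)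
    show ?case unfolding lebesgue_point_def
    proof (intro allI impI)
      fix e :: real assume e: "e > 0"
      obtain n where n: "4 / e < real n" using reals_Archimedean2 by blast
      then have n': "4 * (1 / (real n + 1)) \<le> e" using e by (simp add: field_simps)
      have "eventually (\<lambda>r::real. r > 0) (at_right 0)" by (simp add: eventually_at_right_less)
      with elim[rule_format, of n, unfolded good_def]
      show "\<forall>\<^sub>F r in at_right 0. (\<integral>\<^sup>+x\<in>{t - r..t + r}. ennreal \<bar>u x - u t\<bar> \<partial>lborel) \<le> ennreal (e * r)"
      proof eventually_elim
        case (elim r)
        then show ?case using n' by (elim order_trans) (intro ennreal_leI mult_right_mono, auto)
      qed
    qed
  qed
qed

lemma lebesgue_point_locally_eq:
  assumes v: "lebesgue_point v t" and d: "d > 0" and eq: "\<And>x. \<bar>x - t\<bar> < d \<Longrightarrow> u x = v x"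
  shows "lebesgue_point u t"
  unfolding lebesgue_point_def
proof (intro allI impI)
  fix e :: real assume "e > 0"
  then have "eventually (\<lambda>r. (\<integral>\<^sup>+x\<in>{t - r..t + r}. ennreal \<bar>v x - v t\<bar> \<partial>lborel) \<le> ennreal (e * r)) (at_right 0)"
    using v by (simp add: lebesgue_point_def)
  moreover have "eventually (\<lambda>r. r < d) (at_right 0)" using d by (intro eventually_at_rightI[of 0 d]) auto
  ultimately show "eventually (\<lambda>r. (\<integral>\<^sup>+x\<in>{t - r..t + r}. ennreal \<bar>u x - u t\<bar> \<partial>lborel) \<le> ennreal (e * r)) (at_right 0)"
  proof eventually_elim
    case (elim r)
    have "(\<integral>\<^sup>+x\<in>{t - r..t + r}. ennreal \<bar>u x - u t\<bar> \<partial>lborel) = (\<integral>\<^sup>+x\<in>{t - r..t + r}. ennreal \<bar>v x - v t\<bar> \<partial>lborel)"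
      by (intro nn_integral_cong) (use elim d eq in \<open>auto split: split_indicator\<close>)
    with elim show ?case by simp
  qed
qed

lemma lebesgue_point_const: "lebesgue_point (\<lambda>x. c) t"
  by (simp add: lebesgue_point_def)

lemma lebesgue_point_lincomb:
  assumes [measurable]: "u \<in> borel_measurable borel" "v \<in> borel_measurable borel"
    and u: "lebesgue_point u t" and v: "lebesgue_point v t"
  shows "lebesgue_point (\<lambda>x. a * u x + b * v x) t"
  unfolding lebesgue_point_def
proof (intro allI impI)
  fix e :: real assume e: "e > 0"
  let ?c = "\<bar>a\<bar> + \<bar>b\<bar> + 1"
  have c: "?c > 0" by simp
  have "eventually (\<lambda>r. (\<integral>\<^sup>+x\<in>{t - r..t + r}. ennreal \<bar>u x - u t\<bar> \<partial>lborel) \<le> ennreal (e / ?c * r)) (at_right 0)"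
       "eventually (\<lambda>r. (\<integral>\<^sup>+x\<in>{t - r..t + r}. ennreal \<bar>v x - v t\<bar> \<partial>lborel) \<le> ennreal (e / ?c * r)) (at_right 0)"
    by (rule u[unfolded lebesgue_point_def, rule_format] v[unfolded lebesgue_point_def, rule_format],
        use c e in \<open>simp only: divide_pos_pos\<close>)+
  moreover have "eventually (\<lambda>r::real. r > 0) (at_right 0)" by (simp add: eventually_at_right_less)
  ultimately show "\<forall>\<^sub>F r in at_right 0. (\<integral>\<^sup>+x\<in>{t - r..t + r}. ennreal \<bar>(a * u x + b * v x) - (a * u t + b * v t)\<bar> \<partial>lborel) \<le> ennreal (e * r)"
  proof eventually_elim
    case (elim r)
    have "(\<integral>\<^sup>+x\<in>{t - r..t + r}. ennreal \<bar>(a * u x + b * v x) - (a * u t + b * v t)\<bar> \<partial>lborel) \<le>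
      (\<integral>\<^sup>+x. ennreal \<bar>a\<bar> * (ennreal \<bar>u x - u t\<bar> * indicator {t - r..t + r} x) + ennreal \<bar>b\<bar> * (ennreal \<bar>v x - v t\<bar> * indicator {t - r..t + r} x) \<partial>lborel)"
    proof (intro nn_integral_mono)
      fix x :: real
      have "\<bar>(a * u x + b * v x) - (a * u t + b * v t)\<bar> = \<bar>a * (u x - u t) + b * (v x - v t)\<bar>" by (simp add: algebra_simps)
      also have "\<dots> \<le> \<bar>a\<bar> * \<bar>u x - u t\<bar> + \<bar>b\<bar> * \<bar>v x - v t\<bar>" by (metis abs_mult abs_triangle_ineq)
      finally show "ennreal \<bar>(a * u x + b * v x) - (a * u t + b * v t)\<bar> * indicator {t - r..t + r} x \<le>
         ennreal \<bar>a\<bar> * (ennreal \<bar>u x - u t\<bar> * indicator {t - r..t + r} x) + ennreal \<bar>b\<bar> * (ennreal \<bar>v x - v t\<bar> * indicator {t - r..t + r} x)"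
        by (auto split: split_indicator simp: ennreal_mult[symmetric] simp flip: ennreal_plus intro!: ennreal_leI)
    qed
    also have "\<dots> = ennreal \<bar>a\<bar> * (\<integral>\<^sup>+x\<in>{t - r..t + r}. ennreal \<bar>u x - u t\<bar> \<partial>lborel) + ennreal \<bar>b\<bar> * (\<integral>\<^sup>+x\<in>{t - r..t + r}. ennreal \<bar>v x - v t\<bar> \<partial>lborel)"
      by (simp add: nn_integral_add nn_integral_cmult)
    also have "\<dots> \<le> ennreal \<bar>a\<bar> * ennreal (e / ?c * r) + ennreal \<bar>b\<bar> * ennreal (e / ?c * r)"
      by (intro add_mono mult_left_mono) (use elim in auto)
    also have "\<dots> = ennreal ((\<bar>a\<bar> + \<bar>b\<bar>) * (e / ?c * r))"
      using elim e c by (simp add: ennreal_mult[symmetric] ennreal_plus[symmetric] distrib_right add_divide_distrib del: ennreal_plus)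
    also have "\<dots> \<le> ennreal (e * r)"
    proof (rule ennreal_leI)
      have "(\<bar>a\<bar> + \<bar>b\<bar>) * (e / ?c * r) = (\<bar>a\<bar> + \<bar>b\<bar>) / ?c * (e * r)" by simp
      also have "\<dots> \<le> 1 * (e * r)" by (intro mult_right_mono) (use elim e in auto)
      finally show "(\<bar>a\<bar> + \<bar>b\<bar>) * (e / ?c * r) \<le> e * r" by simp
    qed
    finally show ?case .
  qed
qed

text \<open>Dominated convergence turns pointwise approximation into the L^1 approximation that
  \<open>AE_lebesgue_point_approx\<close> asks for.\<close>

lemma AE_lebesgue_point_limit:
  fixes u :: "real \<Rightarrow> real" and s :: "nat \<Rightarrow> real \<Rightarrow> real"
  assumes u[measurable]: "u \<in> borel_measurable borel" and s[measurable]: "\<And>i. s i \<in> borel_measurable borel"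
    and sl: "\<And>i. AE t in lborel. lebesgue_point (s i) t"
    and w: "integrable lborel w" "\<And>i x. \<bar>s i x\<bar> \<le> w x" and lim: "\<And>x. (\<lambda>i. s i x) \<longlonglongrightarrow> u x"
  shows "AE t in lborel. lebesgue_point u t"
proof (rule AE_lebesgue_point_approx[OF u])
  fix e :: real assume e: "e > 0"
  have [measurable]: "w \<in> borel_measurable borel" using w(1) by auto
  have "(\<lambda>i. \<integral>\<^sup>+x. ennreal (norm (u x - s i x)) \<partial>lborel) \<longlonglongrightarrow> 0"
    by (rule nn_integral_dominated_convergence_norm[where w=w])
       (use w lim in \<open>auto simp: real_integrable_def less_top\<close>)
  then have "eventually (\<lambda>i. (\<integral>\<^sup>+x. ennreal (norm (u x - s i x)) \<partial>lborel) < ennreal e) sequentially"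
    using e by (simp add: order_tendsto_iff)
  then obtain i where "(\<integral>\<^sup>+x. ennreal (norm (u x - s i x)) \<partial>lborel) < ennreal e"
    using eventually_happens'[OF sequentially_bot] by blast
  then show "\<exists>v\<in>borel_measurable borel. (AE t in lborel. lebesgue_point v t) \<and> (\<integral>\<^sup>+x. ennreal \<bar>u x - v x\<bar> \<partial>lborel) \<le> ennreal e"
    using sl s by (intro bexI[of _ "s i"]) auto
qed

text \<open>Dynkin induction from the half-lines, whose indicators are locally constant off finitely
  many points once cut to the window. The window \<open>{- real n..real n}\<close> provides a common
  integrable bound, which the step for countable disjoint unions needs.\<close>

lemma AE_lebesgue_point_indicator_bounded:
  fixes A :: "real set" and n :: nat
  assumes A: "A \<in> sets borel"
  shows "AE t in lborel. lebesgue_point (indicat_real (A \<inter> {- real n..real n})) t"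
proof -
  let ?J = "{- real n..real n}"
  have iJ: "integrable lborel (indicat_real ?J)" by (rule integrable_real_indicator) auto
  have G: "Int_stable (range (atMost :: real \<Rightarrow> real set))" "range (atMost :: real \<Rightarrow> real set) \<subseteq> Pow UNIV"
    unfolding Int_stable_def by (safe, metis Int_atMost rangeI, simp)
  have "A \<in> sigma_sets UNIV (range atMost)"
    using A by (simp add: borel_eq_atMost)
  with G show ?thesis
  proof (induction rule: sigma_sets_induct_disjoint)
    case (basic B)
    then obtain a where B: "B = {..a}" by auto
    have "AE t in lborel. t \<noteq> a \<and> t \<noteq> real n \<and> t \<noteq> - real n"
      using AE_lborel_singleton[of a] AE_lborel_singleton[of "real n"] AE_lborel_singleton[of "- real n"] by eventually_elim auto
    then show ?case
    proof eventually_elim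
      case (elim t)
      define d where "d = min \<bar>t - a\<bar> (min \<bar>t - real n\<bar> \<bar>t + real n\<bar>)"
      have "d > 0" using elim by (auto simp: d_def)
      then show ?case
        by (rule lebesgue_point_locally_eq[OF lebesgue_point_const[of "indicat_real (B \<inter> ?J) t"]])
           (auto simp: B d_def indicator_def)
    qed
  next
    case empty show ?case by (simp add: lebesgue_point_def)
  next
    case (compl B)
    then have [measurable]: "B \<in> sets borel" by (simp add: borel_eq_atMost)
    have J: "AE t in lborel. t \<noteq> real n \<and> t \<noteq> - real n"
      using AE_lborel_singleton[of "real n"] AE_lborel_singleton[of "- real n"] by eventually_elim auto
    have eq: "indicat_real ((UNIV - B) \<inter> ?J) = (\<lambda>x. 1 * indicat_real ?J x + (-1) * indicat_real (B \<inter> ?J) x)"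
      by (auto simp: indicator_def)
    show ?case using J compl(2)
    proof eventually_elim
      case (elim t)
      define d where "d = min \<bar>t - real n\<bar> \<bar>t + real n\<bar>"
      have "d > 0" using elim by (auto simp: d_def)
      then have "lebesgue_point (indicat_real ?J) t"
        by (rule lebesgue_point_locally_eq[OF lebesgue_point_const[of "indicat_real ?J t"]])
           (auto simp: d_def indicator_def)
      then show ?case unfolding eq by (intro lebesgue_point_lincomb) (use elim in auto)
    qed
  next
    case (union B)
    then have Bm[measurable]: "B i \<in> sets borel" for i by (auto simp: borel_eq_atMost)
    define s where "s m x = (\<Sum>i<m. indicat_real (B i \<inter> ?J) x)" for m x
    have sm[measurable]: "s m \<in> borel_measurable borel" for m unfolding s_def by measurable
    have sl: "AE t in lborel. lebesgue_point (s m) t" for m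
    proof (induction m)
      case 0 show ?case by (simp add: s_def lebesgue_point_def)
    next
      case (Suc m)
      have eq: "s (Suc m) = (\<lambda>x. 1 * s m x + 1 * indicat_real (B m \<inter> ?J) x)" by (rule ext) (simp add: s_def)
      show ?case using Suc union(3)[of m]
        by eventually_elim (unfold eq, intro lebesgue_point_lincomb, auto)
    qed
    have seq: "s m x = indicat_real ((\<Union>i<m. B i) \<inter> ?J) x" for m x
    proof -
      have "s m x = indicat_real (\<Union>i<m. B i \<inter> ?J) x" unfolding s_def
        by (rule indicator_UN_disjoint[symmetric]) (use union(1) in \<open>auto simp: disjoint_family_on_def\<close>)
      moreover have "(\<Union>i<m. B i \<inter> ?J) = (\<Union>i<m. B i) \<inter> ?J" by blast
      ultimately show ?thesis by (simp only:)
    qed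
    show ?case
    proof (rule AE_lebesgue_point_limit[OF _ sm sl iJ])
      show "\<bar>s i x\<bar> \<le> indicat_real ?J x" for i x by (auto simp: seq indicator_def)
      show "(\<lambda>i. s i x) \<longlonglongrightarrow> indicat_real (\<Union> (range B) \<inter> ?J) x" for x
      proof (cases "x \<in> \<Union> (range B)")
        case True
        then obtain k where k: "x \<in> B k" by auto
        show ?thesis
          by (rule tendsto_eventually) (use k in \<open>auto intro!: eventually_mono[OF eventually_gt_at_top[of k]] simp: seq indicator_def\<close>)
      qed (auto simp: seq indicator_def)
    qed auto
  qed
qed

lemma AE_lebesgue_point_integrable:
  assumes u: "integrable lborel (u :: real \<Rightarrow> real)"
  shows "AE t in lborel. lebesgue_point u t"
  using u
proof (induction rule: integrable_induct)
  case (base A c)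
  then have [measurable]: "A \<in> sets borel" by simp
  show ?case
  proof (rule AE_lebesgue_point_limit[where s="\<lambda>n x. c * indicat_real (A \<inter> {- real n..real n}) x + 0 * 0" and w="\<lambda>x. \<bar>c\<bar> * indicat_real A x"])
    show "AE t in lborel. lebesgue_point (\<lambda>x. c * indicat_real (A \<inter> {- real n..real n}) x + 0 * 0) t" for n
      using AE_lebesgue_point_indicator_bounded[OF \<open>A \<in> sets borel\<close>, of n]
      by eventually_elim (intro lebesgue_point_lincomb[of _ "\<lambda>x. 0"] lebesgue_point_const, auto)
    show "integrable lborel (\<lambda>x. \<bar>c\<bar> * indicat_real A x)" using base by auto
    show "\<bar>c * indicat_real (A \<inter> {- real i..real i}) x + 0 * 0\<bar> \<le> \<bar>c\<bar> * indicat_real A x" for i x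
      by (auto simp: indicator_def)
    fix x :: real
    have "eventually (\<lambda>n. real n \<ge> \<bar>x\<bar>) sequentially"
      using eventually_ge_at_top[of "nat \<lceil>\<bar>x\<bar>\<rceil>"] by eventually_elim linarith
    then have "eventually (\<lambda>n. c * indicat_real (A \<inter> {- real n..real n}) x + 0 * 0 = indicat_real A x *\<^sub>R c) sequentially"
      by eventually_elim (auto simp: indicator_def)
    then show "(\<lambda>n. c * indicat_real (A \<inter> {- real n..real n}) x + 0 * 0) \<longlonglongrightarrow> indicat_real A x *\<^sub>R c"
      by (rule tendsto_eventually)
  qed auto
next
  case (add f g)
  then have [measurable]: "f \<in> borel_measurable borel" "g \<in> borel_measurable borel" by auto
  show ?case using add(3,4)
    by eventually_elim (use lebesgue_point_lincomb[of f g _ 1 1] in auto)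
next
  case (lim f s)
  show ?case
    by (rule AE_lebesgue_point_limit[where s=s and w="\<lambda>x. 2 * norm (f x)"]) (use lim in auto)
qed

text \<open>Being a Lebesgue point is local, and on a bounded interval the weight
  \<open>pois 1\<close> is bounded below. The boundary functions to which this is applied are
  integrable for this weight, but in general not for Lebesgue measure.\<close>

theorem AE_lebesgue_point_pois:
  assumes u: "integrable lborel (\<lambda>x. pois 1 x * u x)" and um[measurable]: "u \<in> borel_measurable borel"
  shows "AE t in lborel. lebesgue_point u t"
proof -
  have "AE t in lborel. lebesgue_point (\<lambda>x. indicat_real {- real n..real n} x * u x) t" for n :: nat
  proof (rule AE_lebesgue_point_integrable, rule Bochner_Integration.integrable_bound)
    show "integrable lborel (\<lambda>x. pi * ((real n)\<^sup>2 + 1) * (pois 1 x * u x))" by (intro integrable_mult_right u)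
    show "AE x in lborel. norm (indicat_real {- real n..real n} x * u x) \<le> norm (pi * ((real n)\<^sup>2 + 1) * (pois 1 x * u x))"
    proof (rule AE_I2)
      fix x :: real
      show "norm (indicat_real {- real n..real n} x * u x) \<le> norm (pi * ((real n)\<^sup>2 + 1) * (pois 1 x * u x))"
      proof (cases "x \<in> {- real n..real n}")
        case True
        then have "x\<^sup>2 \<le> (real n)\<^sup>2" by (intro power2_le_iff_abs_le[THEN iffD2]) auto
        then have "1 \<le> pi * ((real n)\<^sup>2 + 1) * pois 1 x"
          by (simp add: pois_def le_divide_eq_1_pos add_nonneg_pos)
        then have "1 * \<bar>u x\<bar> \<le> (pi * ((real n)\<^sup>2 + 1) * pois 1 x) * \<bar>u x\<bar>" by (intro mult_right_mono) auto
        then show ?thesis using True pois_nonneg[of 1 x] by (simp add: abs_mult mult_ac)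
      qed auto
    qed
  qed measurable
  then have "AE t in lborel. \<forall>n. lebesgue_point (\<lambda>x. indicat_real {- real n..real n} x * u x) t"
    by (simp add: AE_all_countable)
  then show ?thesis
  proof eventually_elim
    case (elim t)
    obtain n where n: "real n > \<bar>t\<bar>" using reals_Archimedean2 by blast
    show ?case
      by (rule lebesgue_point_locally_eq[OF elim[rule_format, of n], where d="real n - \<bar>t\<bar>"])
         (use n in \<open>auto simp: indicator_def\<close>)
  qed
qed

text \<open>At a Lebesgue point only averages over centred intervals are controlled. This bound by a
  geometric mixture of indicators of such intervals transfers the control to Poisson
  integrals.\<close>

lemma pois_le_dyadic:
  assumes y: "y > 0"
  shows "ennreal (pois y s) \<le> (\<Sum>j. ennreal (4 * (1/4)^j / y) * indicator {- (2^j * y)..2^j * y} s)"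
proof -
  \<comment> \<open>\<open>j\<close> is the first dyadic scale that contains \<open>s\<close>.
    Failure at the previous scale i = j - 1 gives s^2 \<ge> 4^i y^2, and the shift from i to j
    accounts for the factor 4.\<close>
  define j where "j = (LEAST j. \<bar>s\<bar> \<le> 2^j * y)"
  obtain k where "\<bar>s\<bar> / y < 2 ^ k" using real_arch_pow[of 2 "\<bar>s\<bar> / y"] by auto
  then have "\<bar>s\<bar> \<le> 2 ^ k * y" using y by (simp add: field_simps)
  then have j: "\<bar>s\<bar> \<le> 2^j * y" unfolding j_def by (rule LeastI)
  have "pois y s \<le> 4 * (1/4)^j / y"
  proof (cases j)
    case 0
    have "pi * (s\<^sup>2 + y\<^sup>2) \<ge> 1 * y\<^sup>2" by (intro mult_mono) (use pi_gt3 in auto)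
    then have "pois y s \<le> y / y\<^sup>2" unfolding pois_def using y by (intro divide_left_mono) (auto simp: sum_sq_pos)
    also have "\<dots> = 1 / y" using y by (simp add: power2_eq_square)
    also have "\<dots> \<le> 4 * (1/4)^j / y" using 0 y by (simp add: divide_right_mono)
    finally show ?thesis .
  next
    case (Suc i)
    have "\<not> \<bar>s\<bar> \<le> 2^i * y" using not_less_Least[of i "\<lambda>j. \<bar>s\<bar> \<le> 2^j * y"] Suc by (simp add: j_def)
    then have "(2^i * y)\<^sup>2 \<le> \<bar>s\<bar>\<^sup>2" using y by (intro power_mono) auto
    then have s: "4^i * y\<^sup>2 \<le> s\<^sup>2" by (simp add: power_mult_distrib power_mult[symmetric] mult.commute[of i] power_mult)
    have "pi * (s\<^sup>2 + y\<^sup>2) \<ge> 1 * (4^i * y\<^sup>2)" by (intro mult_mono) (use pi_gt3 s y in \<open>auto intro: add_increasing2\<close>)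
    then have "pois y s \<le> y / (4^i * y\<^sup>2)" unfolding pois_def using y by (intro divide_left_mono) (auto simp: sum_sq_pos)
    also have "\<dots> = 4 * (1/4)^j / y" using y Suc by (simp add: power2_eq_square power_divide)
    finally show ?thesis .
  qed
  then have "ennreal (pois y s) \<le> ennreal (4 * (1/4)^j / y) * indicator {- (2^j * y)..2^j * y} s"
    using j by (auto simp: indicator_def intro!: ennreal_leI)
  also have "\<dots> \<le> (\<Sum>k. ennreal (4 * (1/4)^k / y) * indicator {- (2^k * y)..2^k * y} s)"
  proof -
    have "f j \<le> suminf f" for f :: "nat \<Rightarrow> ennreal"
      using sum_le_suminf[of f "{j}"] by simp
    then show ?thesis .
  qed
  finally show ?thesis .
qed

text \<open>Away from \<open>t\<close> the kernel tends to 0 like \<open>y\<close>, uniformly with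
  respect to \<open>pois 1\<close>. The constant comes from 1 + x^2 \<le> 2 (x - t)^2 + 1 + 2 t^2,
  where the last two terms are absorbed by (x - t)^2 \<ge> d^2.\<close>

lemma pois_far:
  assumes y: "y > 0" and d: "d > 0" and x: "\<bar>x - t\<bar> \<ge> d"
  shows "pois y (x - t) \<le> y * (2 + (1 + 2 * t\<^sup>2) / d\<^sup>2) * pois 1 x"
proof -
  have d2: "d\<^sup>2 \<le> (x - t)\<^sup>2" using x d by (metis abs_le_square_iff abs_of_pos)
  have "0 \<le> (x - 2 * t)\<^sup>2" by simp
  then have "1 + x\<^sup>2 \<le> 2 * (x - t)\<^sup>2 + (1 + 2 * t\<^sup>2)" by (simp add: power2_eq_square algebra_simps)
  also have "(1 + 2 * t\<^sup>2) \<le> (1 + 2 * t\<^sup>2) / d\<^sup>2 * (x - t)\<^sup>2"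
  proof -
    have "1 \<le> (x - t)\<^sup>2 / d\<^sup>2" using d d2 by (simp add: le_divide_eq_1_pos)
    from mult_left_mono[OF this, of "1 + 2 * t\<^sup>2"] show ?thesis by (simp add: add_nonneg_nonneg)
  qed
  finally have "1 + x\<^sup>2 \<le> (2 + (1 + 2 * t\<^sup>2) / d\<^sup>2) * (x - t)\<^sup>2" by (simp add: algebra_simps)
  also have "\<dots> \<le> (2 + (1 + 2 * t\<^sup>2) / d\<^sup>2) * ((x - t)\<^sup>2 + y\<^sup>2)"
    by (intro mult_left_mono) (auto intro!: add_nonneg_nonneg divide_nonneg_nonneg)
  finally have *: "1 + x\<^sup>2 \<le> (2 + (1 + 2 * t\<^sup>2) / d\<^sup>2) * ((x - t)\<^sup>2 + y\<^sup>2)" .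
  have p: "(x - t)\<^sup>2 + y\<^sup>2 > 0" "1 + x\<^sup>2 > 0" using y by (auto simp: sum_sq_pos add_pos_nonneg)
  have "1 / ((x - t)\<^sup>2 + y\<^sup>2) \<le> (2 + (1 + 2 * t\<^sup>2) / d\<^sup>2) / (1 + x\<^sup>2)"
    using * p by (simp add: pos_divide_le_eq pos_le_divide_eq mult.commute)
  then have "y / pi * (1 / ((x - t)\<^sup>2 + y\<^sup>2)) \<le> y / pi * ((2 + (1 + 2 * t\<^sup>2) / d\<^sup>2) / (1 + x\<^sup>2))"
    using y by (intro mult_left_mono) auto
  then show ?thesis by (simp add: pois_def field_simps)
qed

lemma ennreal_tendsto_0I:
  assumes "\<And>e::real. e > 0 \<Longrightarrow> eventually (\<lambda>x. f x \<le> ennreal e) F"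
  shows "(f \<longlongrightarrow> 0) F"
proof (rule order_tendstoI)
  fix a :: ennreal assume "0 < a"
  then obtain e where e: "0 < ennreal e" "ennreal e < a"
    by (metis dense ennreal_cases less_top_ennreal ennreal_less_top top.not_eq_extremum less_trans)
  then have "e > 0" by simp
  from assms[OF this] show "eventually (\<lambda>x. f x < a) F"
    by eventually_elim (use e in auto)
qed auto

text \<open>Split at distance \<open>d\<close> from \<open>t\<close>. Near \<open>t\<close> the
  dyadic bound reduces the integral to averages over intervals, each small by hypothesis, with
  summable weights; far from \<open>t\<close> the kernel is O(y) relative to
  \<open>pois 1\<close>.\<close>

theorem poisson_kernel_tendsto_0:
  fixes \<phi> :: "real \<Rightarrow> ennreal"
  assumes [measurable]: "\<phi> \<in> borel_measurable borel"
    and fin: "(\<integral>\<^sup>+x. \<phi> x * ennreal (pois 1 x) \<partial>lborel) < \<infinity>"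
    and leb: "\<And>e. e > 0 \<Longrightarrow> eventually (\<lambda>r. (\<integral>\<^sup>+x\<in>{t - r..t + r}. \<phi> x \<partial>lborel) \<le> ennreal (e * r)) (at_right 0)"
  shows "((\<lambda>y. \<integral>\<^sup>+x. \<phi> x * ennreal (pois y (x - t)) \<partial>lborel) \<longlongrightarrow> 0) (at_right 0)"
proof (rule ennreal_tendsto_0I)
  fix e0 :: real assume e0: "e0 > 0"
  \<comment> \<open>The near part contributes \<open>8 * e\<close> and the far part
    \<open>e\<close>, so a sixteenth leaves room for both.\<close>
  define e where "e = e0 / 16"
  have e: "e > 0" using e0 by (simp add: e_def)
  obtain b where b: "b > 0" "\<And>r. 0 < r \<Longrightarrow> r < b \<Longrightarrow> (\<integral>\<^sup>+x\<in>{t - r..t + r}. \<phi> x \<partial>lborel) \<le> ennreal (e * r)"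
    using leb[OF e] by (auto simp: eventually_at_right_field)
  define d where "d = b / 2"
  have d: "d > 0" "\<And>r. 0 < r \<Longrightarrow> r \<le> d \<Longrightarrow> (\<integral>\<^sup>+x\<in>{t - r..t + r}. \<phi> x \<partial>lborel) \<le> ennreal (e * r)"
    using b by (auto simp: d_def)
  obtain I where I: "I \<ge> 0" "(\<integral>\<^sup>+x. \<phi> x * ennreal (pois 1 x) \<partial>lborel) = ennreal I"
    using fin by (cases "\<integral>\<^sup>+x. \<phi> x * ennreal (pois 1 x) \<partial>lborel") auto
  define C where "C = 2 + (1 + 2 * t\<^sup>2) / d\<^sup>2"
  have C: "C \<ge> 0" by (auto simp: C_def intro!: add_nonneg_nonneg divide_nonneg_nonneg)
  have near: "(\<integral>\<^sup>+x\<in>{t - d..t + d}. \<phi> x * ennreal (pois y (x - t)) \<partial>lborel) \<le> ennreal (8 * e)" if y: "y > 0" for y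
  proof -
    have "(\<integral>\<^sup>+x\<in>{t - d..t + d}. \<phi> x * ennreal (pois y (x - t)) \<partial>lborel) \<le>
      (\<integral>\<^sup>+x. (\<Sum>j. ennreal (4 * (1/4)^j / y) * (\<phi> x * indicator {t - min d (2^j * y)..t + min d (2^j * y)} x)) \<partial>lborel)"
    proof (rule nn_integral_mono)
      fix x :: real
      show "\<phi> x * ennreal (pois y (x - t)) * indicator {t - d..t + d} x \<le>
        (\<Sum>j. ennreal (4 * (1/4)^j / y) * (\<phi> x * indicator {t - min d (2^j * y)..t + min d (2^j * y)} x))"
      proof (cases "x \<in> {t - d..t + d}")
        case True
        \<comment> \<open>Capping the radius at \<open>d\<close> keeps every interval within the
          range where the averages are known to be small; for \<open>x\<close> within distance
          \<open>d\<close> of \<open>t\<close> the cap changes nothing.\<close>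
        have ind: "indicator {- (2^j * y)..2^j * y} (x - t) = (indicator {t - min d (2^j * y)..t + min d (2^j * y)} x :: ennreal)" for j
          using True by (auto simp: indicator_def)
        have "\<phi> x * ennreal (pois y (x - t)) \<le> \<phi> x * (\<Sum>j. ennreal (4 * (1/4)^j / y) * indicator {- (2^j * y)..2^j * y} (x - t))"
          by (intro mult_left_mono pois_le_dyadic y) auto
        also have "\<dots> = (\<Sum>j. \<phi> x * (ennreal (4 * (1/4)^j / y) * indicator {t - min d (2^j * y)..t + min d (2^j * y)} x))"
          by (simp only: ind ennreal_suminf_cmult)
        also have "\<dots> = (\<Sum>j. ennreal (4 * (1/4)^j / y) * (\<phi> x * indicator {t - min d (2^j * y)..t + min d (2^j * y)} x))"
          by (intro suminf_cong) (simp only: mult.left_commute)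
        finally show ?thesis using True by (simp only: indicator_simps mult_1_right)
      qed simp
    qed
    also have "\<dots> = (\<Sum>j. ennreal (4 * (1/4)^j / y) * (\<integral>\<^sup>+x\<in>{t - min d (2^j * y)..t + min d (2^j * y)}. \<phi> x \<partial>lborel))"
      by (simp add: nn_integral_suminf nn_integral_cmult)
    also have "\<dots> \<le> (\<Sum>j. ennreal (4 * e * (1/2)^j))"
    proof (intro suminf_le)
      fix j :: nat
      have "(\<integral>\<^sup>+x\<in>{t - min d (2^j * y)..t + min d (2^j * y)}. \<phi> x \<partial>lborel) \<le> ennreal (e * min d (2^j * y))"
        using d y by (intro d(2)) auto
      also have "\<dots> \<le> ennreal (e * (2^j * y))" using e by (intro ennreal_leI mult_left_mono) auto
      finally have "ennreal (4 * (1/4)^j / y) * (\<integral>\<^sup>+x\<in>{t - min d (2^j * y)..t + min d (2^j * y)}. \<phi> x \<partial>lborel) \<le>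
         ennreal (4 * (1/4)^j / y) * ennreal (e * (2^j * y))" by (intro mult_left_mono) auto
      also have "\<dots> = ennreal (4 * e * (1/2)^j)"
        using y e by (subst ennreal_mult[symmetric]) (auto simp: field_simps power_divide power_mult_distrib[symmetric])
      finally show "ennreal (4 * (1/4)^j / y) * (\<integral>\<^sup>+x\<in>{t - min d (2^j * y)..t + min d (2^j * y)}. \<phi> x \<partial>lborel) \<le> ennreal (4 * e * (1/2)^j)" .
    qed auto
    also have "\<dots> = ennreal (8 * e)"
    proof -
      have "(\<lambda>j. 4 * e * (1/2::real)^j) sums (4 * e * (1 / (1 - 1/2)))"
        by (intro sums_mult geometric_sums) auto
      then show ?thesis using e by (subst suminf_ennreal_eq) auto
    qed
    finally show ?thesis .
  qed
  have far: "(\<integral>\<^sup>+x\<in>- {t - d..t + d}. \<phi> x * ennreal (pois y (x - t)) \<partial>lborel) \<le> ennreal (y * C * I)" if y: "y > 0" for y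
  proof -
    have "(\<integral>\<^sup>+x\<in>- {t - d..t + d}. \<phi> x * ennreal (pois y (x - t)) \<partial>lborel) \<le> (\<integral>\<^sup>+x. ennreal (y * C) * (\<phi> x * ennreal (pois 1 x)) \<partial>lborel)"
    proof (rule nn_integral_mono)
      fix x :: real
      show "\<phi> x * ennreal (pois y (x - t)) * indicator (- {t - d..t + d}) x \<le> ennreal (y * C) * (\<phi> x * ennreal (pois 1 x))"
      proof (cases "x \<in> - {t - d..t + d}")
        case True
        have "\<phi> x * ennreal (pois y (x - t)) \<le> \<phi> x * ennreal (y * C * pois 1 x)"
          unfolding C_def by (intro mult_left_mono ennreal_leI pois_far y d) (use True in auto)
        also have "\<dots> = ennreal (y * C) * (\<phi> x * ennreal (pois 1 x))"
          using y C pois_nonneg[of 1 x] by (simp add: ennreal_mult mult_ac)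
        finally show ?thesis using True by simp
      qed simp
    qed
    also have "\<dots> = ennreal (y * C) * ennreal I" by (simp add: nn_integral_cmult I)
    finally show ?thesis using y C I by (simp add: ennreal_mult)
  qed
  have "((\<lambda>y. y * C * I) \<longlongrightarrow> 0 * C * I) (at_right 0)" by (intro tendsto_intros)
  then have "eventually (\<lambda>y. y * C * I < e) (at_right 0)" using e by (simp add: order_tendsto_iff)
  moreover have "eventually (\<lambda>y::real. y > 0) (at_right 0)" by (simp add: eventually_at_right_less)
  ultimately show "eventually (\<lambda>y. (\<integral>\<^sup>+x. \<phi> x * ennreal (pois y (x - t)) \<partial>lborel) \<le> ennreal e0) (at_right 0)"
  proof eventually_elim
    case (elim y)
    have "(\<integral>\<^sup>+x. \<phi> x * ennreal (pois y (x - t)) \<partial>lborel) =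
      (\<integral>\<^sup>+x. \<phi> x * ennreal (pois y (x - t)) * indicator {t - d..t + d} x + \<phi> x * ennreal (pois y (x - t)) * indicator (- {t - d..t + d}) x \<partial>lborel)"
      by (intro nn_integral_cong) (auto simp: indicator_def)
    also have "\<dots> = (\<integral>\<^sup>+x\<in>{t - d..t + d}. \<phi> x * ennreal (pois y (x - t)) \<partial>lborel) + (\<integral>\<^sup>+x\<in>- {t - d..t + d}. \<phi> x * ennreal (pois y (x - t)) \<partial>lborel)"
      by (rule nn_integral_add) auto
    also have "\<dots> \<le> ennreal (8 * e) + ennreal e"
      using near[of y] far[of y] elim by (intro add_mono) (auto intro: order_trans simp: ennreal_leI)
    also have "\<dots> \<le> ennreal e0" using e by (simp add: e_def flip: ennreal_plus)
    finally show ?case .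
  qed
qed

subsection \<open>The norm of L log L\<close>

lemma space_mu: "space mu = {-1<..<1}"
  by (simp add: mu_def space_restrict_space)

lemma sets_mu_iff: "A \<in> sets mu \<longleftrightarrow> A \<in> sets borel \<and> A \<subseteq> {-1<..<1}"
  by (auto simp: mu_def sets_restrict_space_iff)

lemma emeasure_mu: "A \<in> sets mu \<Longrightarrow> emeasure mu A = emeasure lborel A"
  by (simp add: mu_def emeasure_restrict_space sets_mu_iff[unfolded mu_def])

lemma emeasure_space_mu: "emeasure mu {-1<..<1} = 2"
  by (subst emeasure_mu) (auto simp: sets_mu_iff)

interpretation mu: finite_measure mu
  by standard (simp add: space_mu emeasure_space_mu)

lemma measurable_mu_iff:
  "f \<in> borel_measurable mu \<longleftrightarrow> (\<lambda>x. indicator {-1<..<1} x *\<^sub>R f x) \<in> borel_measurable borel"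
  for f :: "real \<Rightarrow> 'a::real_normed_vector"
  unfolding mu_def by (subst borel_measurable_restrict_space_iff) auto

lemma borel_measurable_muI: "f \<in> borel_measurable borel \<Longrightarrow> f \<in> borel_measurable mu"
  unfolding mu_def by (rule measurable_restrict_space1) simp

lemma nn_integral_mu: "(\<integral>\<^sup>+x. f x \<partial>mu) = (\<integral>\<^sup>+x\<in>{-1<..<1}. f x \<partial>lborel)"
  unfolding mu_def by (subst nn_integral_restrict_space) auto

lemma AE_mu_iff: "(AE x in mu. P x) \<longleftrightarrow> (AE x in lborel. -1 < x \<and> x < 1 \<longrightarrow> P x)"
  unfolding mu_def by (subst AE_restrict_space_iff) auto

text \<open>
  \<open>Phi a\<close> is the integral of \<open>log (2e/t)\<close> over \<open>0 < t \<le> a\<close>, so that the norm of \<open>L log L\<close> becomes the integral of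
  \<open>Phi\<close> along the distribution function \<open>lam f\<close>.
\<close>
definition lam :: "(real \<Rightarrow> complex) \<Rightarrow> real \<Rightarrow> real" where
  "lam f s = measure mu {x \<in> space mu. s < cmod (f x)}"

definition Phi :: "real \<Rightarrow> real" where
  "Phi a = a * ln (2 * exp 1 / a) + a"

lemma emeasure_lam: "emeasure mu {x \<in> space mu. s < cmod (f x)} = ennreal (lam f s)"
  unfolding lam_def by (rule mu.emeasure_eq_measure)

lemma lam_nonneg[simp]: "lam f s \<ge> 0"
  by (simp add: lam_def)

lemma lam_le_2: "lam f s \<le> 2"
proof -
  have "lam f s \<le> measure mu (space mu)"
    unfolding lam_def by (rule mu.bounded_measure)
  also have "\<dots> = 2" by (simp add: measure_def space_mu emeasure_space_mu)
  finally show ?thesis .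
qed

lemma sets_above_level: "f \<in> L0 \<Longrightarrow> {x \<in> space mu. s < cmod (f x)} \<in> sets mu"
  unfolding L0_def by measurable

lemma lam_antimono: "f \<in> L0 \<Longrightarrow> s \<le> s' \<Longrightarrow> lam f s' \<le> lam f s"
  unfolding lam_def by (rule mu.finite_measure_mono) (auto simp: sets_above_level)

lemma lam_mono_AE:
  assumes f[measurable]: "f \<in> borel_measurable mu" and g[measurable]: "g \<in> borel_measurable mu"
    and le: "AE x in mu. cmod (f x) \<le> cmod (g x)"
  shows "lam f s \<le> lam g s"
  unfolding lam_def
proof (rule mu.finite_measure_mono_AE)
  show "AE x in mu. x \<in> {x \<in> space mu. s < cmod (f x)} \<longrightarrow> x \<in> {x \<in> space mu. s < cmod (g x)}"
    using le by eventually_elim auto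
qed measurable

lemma lam_measurable:
  assumes "f \<in> L0" shows "lam f \<in> borel_measurable borel"
proof -
  have "mono (\<lambda>s. - lam f s)" using lam_antimono[OF assms] by (auto simp: mono_def)
  then have "(\<lambda>s. - (- lam f s)) \<in> borel_measurable borel"
    by (intro borel_measurable_uminus borel_measurable_mono)
  then show ?thesis by simp
qed

lemma lam_tendsto_0:
  assumes f: "f \<in> L0" shows "(\<lambda>n. lam f (real n)) \<longlonglongrightarrow> 0"
proof -
  have [measurable]: "f \<in> borel_measurable mu" using f by (simp add: L0_def)
  have "(\<lambda>n. measure mu {x \<in> space mu. real n < cmod (f x)}) \<longlonglongrightarrow> measure mu (\<Inter>n. {x \<in> space mu. real n < cmod (f x)})"
    by (intro mu.finite_Lim_measure_decseq) (auto simp: decseq_def sets_above_level[OF f])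
  also have "(\<Inter>n. {x \<in> space mu. real n < cmod (f x)}) = {}"
    by auto (meson less_asym reals_Archimedean2)
  finally show ?thesis by (simp add: lam_def)
qed

lemma nn_integral_ln:
  assumes a: "0 \<le> a" "a \<le> 2"
  shows "(\<integral>\<^sup>+t\<in>{0<..<a}. ennreal (ln (2 * exp 1 / t)) \<partial>lborel) = ennreal (Phi a)"
proof (cases "a = 0")
  case True then show ?thesis by (simp add: Phi_def)
next
  case False
  then have a0: "0 < a" using a by simp
  have F: "((\<lambda>t. t * ln (2 * exp 1 / t) + t) has_real_derivative ln (2 * exp 1 / t)) (at t)" if "0 < t" for t
    using that by (auto intro!: derivative_eq_intros simp: field_simps)
  have pos: "0 \<le> ln (2 * exp 1 / t)" if "0 < t" "t < a" for t
  proof -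
    have "1 \<le> exp (1::real)" by simp
    then have "1 * t \<le> exp 1 * 2" using that a by (intro mult_mono) auto
    then show ?thesis using that by (intro ln_ge_zero) (simp add: field_simps)
  qed
  have c: "isCont (\<lambda>t. ln (2 * exp 1 / t)) t" if "0 < t" for t :: real
    using that by (intro continuous_intros) auto
  have l0: "((\<lambda>t. t * ln (2 * exp 1 / t) + t) \<longlongrightarrow> 0) (at_right (0::real))" by real_asymp
  have la: "((\<lambda>t. t * ln (2 * exp 1 / t) + t) \<longlongrightarrow> Phi a) (at_left a)"
    unfolding Phi_def using a0 by (intro tendsto_intros) auto
  have l0': "(((\<lambda>t. t * ln (2 * exp 1 / t) + t) \<circ> real_of_ereal) \<longlongrightarrow> 0) (at_right (ereal 0))"
    using l0 by (simp only: ereal_tendsto_simps)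
  have la': "(((\<lambda>t. t * ln (2 * exp 1 / t) + t) \<circ> real_of_ereal) \<longlongrightarrow> Phi a) (at_left (ereal a))"
    using la by (simp only: ereal_tendsto_simps)
  have pos': "AE t in lborel. ereal 0 < ereal t \<longrightarrow> ereal t < ereal a \<longrightarrow> 0 \<le> ln (2 * exp 1 / t)"
    by (intro AE_I2 impI pos) auto
  have si: "set_integrable lborel (einterval (ereal 0) (ereal a)) (\<lambda>t. ln (2 * exp 1 / t))"
    by (rule interval_integral_FTC_nonneg(1)[where F="\<lambda>t. t * ln (2 * exp 1 / t) + t" and A=0 and B="Phi a", OF _ _ _ pos' l0' la'])
       (use a0 F c in auto)
  have sv: "(LBINT t=ereal 0..ereal a. ln (2 * exp 1 / t)) = Phi a - 0"
    by (rule interval_integral_FTC_nonneg(2)[where F="\<lambda>t. t * ln (2 * exp 1 / t) + t" and A=0 and B="Phi a", OF _ _ _ pos' l0' la'])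
       (use a0 F c in auto)
  have "(\<integral>\<^sup>+t\<in>{0<..<a}. ennreal (ln (2 * exp 1 / t)) \<partial>lborel) = (\<integral>\<^sup>+t. ennreal (indicat_real {0<..<a} t *\<^sub>R ln (2 * exp 1 / t)) \<partial>lborel)"
    by (intro nn_integral_cong) (auto simp: indicator_def)
  also have "\<dots> = ennreal (\<integral>t. indicat_real {0<..<a} t *\<^sub>R ln (2 * exp 1 / t) \<partial>lborel)"
    using si pos by (intro nn_integral_eq_integral) (auto simp: set_integrable_def indicator_def)
  also have "(\<integral>t. indicat_real {0<..<a} t *\<^sub>R ln (2 * exp 1 / t) \<partial>lborel) = Phi a"
    using sv a0 by (simp add: interval_lebesgue_integral_def set_lebesgue_integral_def)
  finally show ?thesis .
qed

lemma ln_2e_nonneg: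
  fixes a :: real
  assumes a: "0 < a" "a \<le> 2"
  shows "ln (2 * exp 1 / a) \<ge> 1"
proof -
  from a have "exp 1 \<le> 2 * exp 1 / a" by (simp add: field_simps)
  then have "ln (exp 1) \<le> ln (2 * exp 1 / a)" using a by (intro ln_mono) auto
  then show ?thesis by simp
qed

lemma Phi_ge: "0 \<le> a \<Longrightarrow> a \<le> 2 \<Longrightarrow> 2 * a \<le> Phi a"
  using mult_left_mono[OF ln_2e_nonneg, of a a] by (cases "a = 0") (auto simp: Phi_def)

lemma Phi_nonneg: "0 \<le> a \<Longrightarrow> a \<le> 2 \<Longrightarrow> 0 \<le> Phi a"
  using Phi_ge[of a] by simp

lemma Phi_mono:
  assumes "0 \<le> a" "a \<le> b" "b \<le> 2"
  shows "Phi a \<le> Phi b"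
proof -
  have "ennreal (Phi a) \<le> ennreal (Phi b)"
    using assms by (simp flip: nn_integral_ln) (intro nn_integral_mono, auto simp: indicator_def)
  then show ?thesis using assms Phi_nonneg by (simp add: ennreal_le_iff)
qed

text \<open>\<open>Phi\<close> is concave with derivative log (2e/b) at \<open>b\<close>; the
  right-hand side is its tangent there.\<close>

lemma Phi_tangent:
  assumes a: "0 \<le> a" and b: "0 < b"
  shows "Phi a \<le> a * ln (2 * exp 1 / b) + b"
proof (cases "a = 0")
  case False
  then have a0: "0 < a" using a by simp
  have "a * ln (b / a) \<le> a * (b / a - 1)"
    using a0 b ln_le_minus_one[of "b / a"] by (intro mult_left_mono) auto
  also have "\<dots> = b - a" using a0 by (simp add: field_simps)
  finally have "a * (ln b - ln a) \<le> b - a" using a0 b by (simp add: ln_div)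
  then show ?thesis using a0 b by (simp add: Phi_def ln_div algebra_simps)
qed (use b in \<open>simp add: Phi_def\<close>)

lemma Phi_measurable[measurable]: "Phi \<in> borel_measurable borel"
  unfolding Phi_def by measurable

text \<open>As \<open>lam f\<close> is decreasing, the levels \<open>s > 0\<close> with
  \<open>t < lam f s\<close> form an initial interval, and the rearrangement is its length. Written
  as an integral in \<open>s\<close>, the infimum disappears and Tonelli's theorem applies.\<close>

lemma decreasing_rearrangement_eq:
  assumes f: "f \<in> L0" and t: "0 < t"
  shows "decreasing_rearrangement f t = (\<integral>\<^sup>+s\<in>{0<..}. indicator {s. t < lam f s} s \<partial>lborel)"
proof -
  let ?D = "{s. 0 < s \<and> t < lam f s}"
  have [measurable]: "lam f \<in> borel_measurable borel" by (rule lam_measurable[OF f])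
  have Dm[measurable]: "?D \<in> sets lborel" by measurable
  have "(\<integral>\<^sup>+s\<in>{0<..}. indicator {s. t < lam f s} s \<partial>lborel) = (\<integral>\<^sup>+s. indicator ?D s \<partial>lborel)"
    by (intro nn_integral_cong) (auto simp: indicator_def)
  also have "\<dots> = emeasure lborel ?D" by (rule nn_integral_indicator[OF Dm])
  also have "\<dots> = decreasing_rearrangement f t"
  proof (rule antisym)
    show "emeasure lborel ?D \<le> decreasing_rearrangement f t"
      unfolding decreasing_rearrangement_def
    proof (rule Inf_greatest, clarify)
      fix s :: real assume s: "0 \<le> s" "emeasure mu {x \<in> space mu. s < cmod (f x)} \<le> ennreal t"
      then have ls: "lam f s \<le> t" using t by (simp add: emeasure_lam)
      have "?D \<subseteq> {0..s}"
        using lam_antimono[OF f, of s] ls by (auto simp: not_le intro: ccontr) (meson less_le_trans linorder_le_cases not_le order_trans)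
      then have "emeasure lborel ?D \<le> emeasure lborel {0..s}" by (rule emeasure_mono) simp
      then show "emeasure lborel ?D \<le> ennreal s" using s by simp
    qed
    show "decreasing_rearrangement f t \<le> emeasure lborel ?D"
    proof (rule dense_le)
      fix y assume y: "y < decreasing_rearrangement f t"
      then obtain s where s: "0 \<le> s" "y = ennreal s" by (cases y) auto
      have "{0<..<s} \<subseteq> ?D"
      proof
        fix s' assume s': "s' \<in> {0<..<s}"
        have "\<not> lam f s' \<le> t"
        proof
          assume "lam f s' \<le> t"
          then have "decreasing_rearrangement f t \<le> ennreal s'"
            unfolding decreasing_rearrangement_def using s' t
            by (intro Inf_lower) (auto simp: emeasure_lam intro!: exI[of _ s'])
          also have "\<dots> \<le> ennreal s" using s' by (intro ennreal_leI) simp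
          finally show False using y s by simp
        qed
        then show "s' \<in> ?D" using s' by simp
      qed
      then have "emeasure lborel {0<..<s} \<le> emeasure lborel ?D" by (rule emeasure_mono) simp
      then show "y \<le> emeasure lborel ?D" using s by simp
    qed
  qed
  finally show ?thesis ..
qed

theorem norm_LlogL_eq:
  assumes f: "f \<in> L0"
  shows "norm_LlogL f = (\<integral>\<^sup>+s\<in>{0<..}. ennreal (Phi (lam f s)) \<partial>lborel)"
proof -
  have [measurable]: "lam f \<in> borel_measurable borel" by (rule lam_measurable[OF f])
  let ?w = "\<lambda>t. ennreal (ln (2 * exp 1 / t))"
  have "norm_LlogL f = (\<integral>\<^sup>+t. (\<integral>\<^sup>+s. indicator {0<..2} t * (?w t * (indicator {0<..} s * (if t < lam f s then 1 else 0))) \<partial>lborel) \<partial>lborel)"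
    unfolding norm_LlogL_def
  proof (intro nn_integral_cong)
    fix t :: real
    show "decreasing_rearrangement f t * ?w t * indicator {0<..2} t = (\<integral>\<^sup>+s. indicator {0<..2} t * (?w t * (indicator {0<..} s * (if t < lam f s then 1 else 0))) \<partial>lborel)"
    proof (cases "t \<in> {0<..2}")
      case True
      have "(\<integral>\<^sup>+s. indicator {0<..2} t * (?w t * (indicator {0<..} s * (if t < lam f s then 1 else 0))) \<partial>lborel) = ?w t * (\<integral>\<^sup>+s. indicator {0<..} s * (if t < lam f s then 1 else 0) \<partial>lborel)"
        using True by (simp add: nn_integral_cmult)
      also have "(\<integral>\<^sup>+s. indicator {0<..} s * (if t < lam f s then 1 else 0) \<partial>lborel) = decreasing_rearrangement f t"
        using True by (subst decreasing_rearrangement_eq[OF f]) (auto intro!: nn_integral_cong simp: indicator_def)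
      finally show ?thesis using True by (simp add: mult.commute)
    qed simp
  qed
  also have "\<dots> = (\<integral>\<^sup>+s. (\<integral>\<^sup>+t. indicator {0<..2} t * (?w t * (indicator {0<..} s * (if t < lam f s then 1 else 0))) \<partial>lborel) \<partial>lborel)"
    by (rule lborel_pair.Fubini') measurable
  also have "\<dots> = (\<integral>\<^sup>+s\<in>{0<..}. ennreal (Phi (lam f s)) \<partial>lborel)"
  proof (intro nn_integral_cong)
    fix s :: real
    have "(\<integral>\<^sup>+t. indicator {0<..2} t * (?w t * (indicator {0<..} s * (if t < lam f s then 1 else 0))) \<partial>lborel) = (\<integral>\<^sup>+t. indicator {0<..} s * (?w t * indicator {0<..<lam f s} t) \<partial>lborel)"
      using lam_le_2[of f s] by (intro nn_integral_cong) (auto simp: indicator_def)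
    also have "\<dots> = indicator {0<..} s * ennreal (Phi (lam f s))"
      using lam_le_2[of f s] by (subst nn_integral_cmult) (auto simp: nn_integral_ln)
    finally show "(\<integral>\<^sup>+t. indicator {0<..2} t * (?w t * (indicator {0<..} s * (if t < lam f s then 1 else 0))) \<partial>lborel) = ennreal (Phi (lam f s)) * indicator {0<..} s"
      by (simp add: mult.commute)
  qed
  finally show ?thesis .
qed

text \<open>Tonelli's theorem with a weight \<psi> on the levels and a weight \<open>h\<close> on
  the points. It is used with \<psi> = 1 and \<open>h\<close> a transform for the pairing bound, and
  with \<psi> logarithmic and \<open>h\<close> = 1 for the entropy.\<close>

lemma layer_cake:
  assumes f: "f \<in> L0" and h[measurable]: "h \<in> borel_measurable mu" and p[measurable]: "\<psi> \<in> borel_measurable borel"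
  shows "(\<integral>\<^sup>+s\<in>{0<..}. \<psi> s * (\<integral>\<^sup>+x. h x * indicator {x. s < cmod (f x)} x \<partial>mu) \<partial>lborel) =
    (\<integral>\<^sup>+x. h x * (\<integral>\<^sup>+s\<in>{0<..<cmod (f x)}. \<psi> s \<partial>lborel) \<partial>mu)"
proof -
  interpret P: pair_sigma_finite lborel mu ..
  have [measurable]: "f \<in> borel_measurable mu" using f by (simp add: L0_def)
  have "(\<integral>\<^sup>+s\<in>{0<..}. \<psi> s * (\<integral>\<^sup>+x. h x * indicator {x. s < cmod (f x)} x \<partial>mu) \<partial>lborel) =
    (\<integral>\<^sup>+s. (\<integral>\<^sup>+x. indicator {0<..} s * (\<psi> s * (h x * (if s < cmod (f x) then 1 else 0))) \<partial>mu) \<partial>lborel)"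
  proof (intro nn_integral_cong)
    fix s :: real
    have "(\<integral>\<^sup>+x. indicator {0<..} s * (\<psi> s * (h x * (if s < cmod (f x) then 1 else 0))) \<partial>mu) = indicator {0<..} s * (\<psi> s * (\<integral>\<^sup>+x. h x * (if s < cmod (f x) then 1 else 0) \<partial>mu))"
      by (subst nn_integral_cmult, measurable)+
    moreover have "(\<integral>\<^sup>+x. h x * (if s < cmod (f x) then 1 else 0) \<partial>mu) = (\<integral>\<^sup>+x. h x * indicator {x. s < cmod (f x)} x \<partial>mu)"
      by (intro nn_integral_cong) (auto simp: indicator_def)
    ultimately show "\<psi> s * (\<integral>\<^sup>+x. h x * indicator {x. s < cmod (f x)} x \<partial>mu) * indicator {0<..} s = (\<integral>\<^sup>+x. indicator {0<..} s * (\<psi> s * (h x * (if s < cmod (f x) then 1 else 0))) \<partial>mu)"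
      by (simp add: mult.commute)
  qed
  also have "\<dots> = (\<integral>\<^sup>+x. (\<integral>\<^sup>+s. indicator {0<..} s * (\<psi> s * (h x * (if s < cmod (f x) then 1 else 0))) \<partial>lborel) \<partial>mu)"
    by (rule P.Fubini'[symmetric]) measurable
  also have "\<dots> = (\<integral>\<^sup>+x. h x * (\<integral>\<^sup>+s\<in>{0<..<cmod (f x)}. \<psi> s \<partial>lborel) \<partial>mu)"
  proof (intro nn_integral_cong)
    fix x :: real
    have "(\<integral>\<^sup>+s. indicator {0<..} s * (\<psi> s * (h x * (if s < cmod (f x) then 1 else 0))) \<partial>lborel) = (\<integral>\<^sup>+s. h x * (\<psi> s * indicator {0<..<cmod (f x)} s) \<partial>lborel)"
      by (intro nn_integral_cong) (auto simp: indicator_def mult.commute)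
    then show "(\<integral>\<^sup>+s. indicator {0<..} s * (\<psi> s * (h x * (if s < cmod (f x) then 1 else 0))) \<partial>lborel) = h x * (\<integral>\<^sup>+s\<in>{0<..<cmod (f x)}. \<psi> s \<partial>lborel)"
      by (simp add: nn_integral_cmult)
  qed
  finally show ?thesis .
qed

lemma nn_integral_indicator_lam: "f \<in> L0 \<Longrightarrow> (\<integral>\<^sup>+x. indicator {x. s < cmod (f x)} x \<partial>mu) = ennreal (lam f s)"
proof -
  assume "f \<in> L0"
  then have [measurable]: "f \<in> borel_measurable mu" by (simp add: L0_def)
  have "(\<integral>\<^sup>+x. indicator {x. s < cmod (f x)} x \<partial>mu) = (\<integral>\<^sup>+x. indicator {x \<in> space mu. s < cmod (f x)} x \<partial>mu)"
    by (intro nn_integral_cong) (auto simp: indicator_def)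
  also have "\<dots> = emeasure mu {x \<in> space mu. s < cmod (f x)}" by (rule nn_integral_indicator) measurable
  finally show ?thesis by (simp add: emeasure_lam)
qed

lemma layer_cake_above:
  assumes f: "f \<in> L0" and c: "c \<ge> 0"
  shows "(\<integral>\<^sup>+s\<in>{c<..}. ennreal (lam f s) \<partial>lborel) = (\<integral>\<^sup>+x. ennreal (cmod (f x) - c) \<partial>mu)"
proof -
  have "(\<integral>\<^sup>+s\<in>{c<..}. ennreal (lam f s) \<partial>lborel) = (\<integral>\<^sup>+s\<in>{0<..}. indicator {c<..} s * (\<integral>\<^sup>+x. 1 * indicator {x. s < cmod (f x)} x \<partial>mu) \<partial>lborel)"
    using c by (intro nn_integral_cong) (auto simp: indicator_def[of "{_<..}"] nn_integral_indicator_lam[OF f])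
  also have "\<dots> = (\<integral>\<^sup>+x. 1 * (\<integral>\<^sup>+s\<in>{0<..<cmod (f x)}. indicator {c<..} s \<partial>lborel) \<partial>mu)"
    by (rule layer_cake[OF f]) auto
  also have "\<dots> = (\<integral>\<^sup>+x. ennreal (cmod (f x) - c) \<partial>mu)"
  proof (intro nn_integral_cong)
    fix x :: real
    have "(\<integral>\<^sup>+s\<in>{0<..<cmod (f x)}. indicator {c<..} s \<partial>lborel) = (\<integral>\<^sup>+s. indicator {c<..<cmod (f x)} s \<partial>lborel)"
      using c by (intro nn_integral_cong) (auto simp: indicator_def)
    also have "\<dots> = ennreal (cmod (f x) - c)" by (cases "c \<le> cmod (f x)") (auto simp: ennreal_neg)
    finally show "1 * (\<integral>\<^sup>+s\<in>{0<..<cmod (f x)}. indicator {c<..} s \<partial>lborel) = ennreal (cmod (f x) - c)" by simp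
  qed
  finally show ?thesis .
qed

text \<open>
  The K-functional of \<open>(L\<^sup>1, L\<^sup>\<infinity>)\<close>, that is, the integral of the decreasing rearrangement from \<open>0\<close> to \<open>r\<close>.
  Unlike the rearrangement itself it is subadditive in \<open>f\<close>.
\<close>
definition Kf :: "(real \<Rightarrow> complex) \<Rightarrow> real \<Rightarrow> ennreal" where
  "Kf f r = (\<integral>\<^sup>+s\<in>{0<..}. ennreal (min (lam f s) r) \<partial>lborel)"

lemma Kf_le:
  assumes f: "f \<in> L0" and c: "c \<ge> 0" and r: "r \<ge> 0"
  shows "Kf f r \<le> ennreal (r * c) + (\<integral>\<^sup>+x. ennreal (cmod (f x) - c) \<partial>mu)"
proof -
  have [measurable]: "lam f \<in> borel_measurable borel" by (rule lam_measurable[OF f])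
  have "Kf f r \<le> (\<integral>\<^sup>+s. ennreal r * indicator {0..c} s + ennreal (lam f s) * indicator {c<..} s \<partial>lborel)"
    unfolding Kf_def by (intro nn_integral_mono) (auto simp: indicator_def intro!: ennreal_leI)
  also have "\<dots> = ennreal (r * c) + (\<integral>\<^sup>+s\<in>{c<..}. ennreal (lam f s) \<partial>lborel)"
    using c r by (subst nn_integral_add) (auto simp: nn_integral_cmult_indicator ennreal_mult)
  finally show ?thesis by (simp add: layer_cake_above[OF f c])
qed

text \<open>Splitting \<open>f\<close> at height \<open>c\<close> bounds \<open>Kf f r\<close> for
  every \<open>c\<close>. Equality holds at the quantile where \<open>lam f\<close> passes from
  above \<open>r\<close> to at most \<open>r\<close>, since there the minimum of
  \<open>lam f\<close> and \<open>r\<close> switches. Thus \<open>Kf\<close> is an infimum over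
  splittings, which makes it subadditive.\<close>

lemma Kf_attained:
  assumes f: "f \<in> L0" and r: "r > 0"
  obtains c where "c \<ge> 0" "Kf f r = ennreal (r * c) + (\<integral>\<^sup>+x. ennreal (cmod (f x) - c) \<partial>mu)"
proof -
  have [measurable]: "lam f \<in> borel_measurable borel" by (rule lam_measurable[OF f])
  let ?S = "{s. 0 \<le> s \<and> lam f s \<le> r}"
  define c where "c = Inf ?S"
  have "eventually (\<lambda>n. lam f (real n) < r) sequentially"
    using lam_tendsto_0[OF f] r by (simp add: order_tendsto_iff)
  then obtain n where "lam f (real n) < r" using eventually_happens'[OF sequentially_bot] by blast
  then have ne: "?S \<noteq> {}" by (auto intro!: exI[of _ "real n"])
  have bb: "bdd_below ?S" by (rule bdd_belowI[of _ 0]) auto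
  have c: "c \<ge> 0" unfolding c_def by (rule cInf_greatest[OF ne]) auto
  have below: "lam f s > r" if "0 < s" "s < c" for s
    using that cInf_lower[OF _ bb, of s] by (auto simp: c_def not_le[symmetric])
  have above: "lam f s \<le> r" if "s > c" for s
  proof -
    from that have "Inf ?S < s" by (simp only: c_def)
    from cInf_lessD[OF ne this] show ?thesis
    proof (rule bexE)
      fix s' assume "s' \<in> ?S" "s' < s"
      then show ?thesis using lam_antimono[OF f, of s' s] by simp
    qed
  qed
  have "Kf f r = (\<integral>\<^sup>+s. ennreal r * indicator {0<..<c} s + ennreal (lam f s) * indicator {c<..} s \<partial>lborel)"
    unfolding Kf_def
  proof (rule nn_integral_cong_AE)
    show "AE s in lborel. ennreal (min (lam f s) r) * indicator {0<..} s = ennreal r * indicator {0<..<c} s + ennreal (lam f s) * indicator {c<..} s"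
      using AE_lborel_singleton[of c]
    proof eventually_elim
      case (elim s)
      consider "s \<le> 0" | "0 < s" "s < c" | "c < s" using elim by linarith
      then show ?case using c below[of s] above[of s]
        by cases (auto simp: indicator_def min_def)
    qed
  qed
  also have "\<dots> = ennreal (r * c) + (\<integral>\<^sup>+s\<in>{c<..}. ennreal (lam f s) \<partial>lborel)"
    using c r by (subst nn_integral_add) (auto simp: nn_integral_cmult_indicator ennreal_mult)
  also have "\<dots> = ennreal (r * c) + (\<integral>\<^sup>+x. ennreal (cmod (f x) - c) \<partial>mu)" by (simp add: layer_cake_above[OF f c])
  finally show ?thesis using that c by blast
qed

lemma ennreal_add_le: "ennreal (a + b) \<le> ennreal a + ennreal b"
proof -
  have "ennreal (a + b) \<le> ennreal (max 0 a + max 0 b)" by (intro ennreal_leI) auto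
  also have "\<dots> = ennreal a + ennreal b" by (subst ennreal_plus) (auto simp: ennreal_max_0')
  finally show ?thesis .
qed

lemma L0_add: "f \<in> L0 \<Longrightarrow> g \<in> L0 \<Longrightarrow> (\<lambda>x. f x + g x) \<in> L0"
  and L0_mult: "f \<in> L0 \<Longrightarrow> (\<lambda>x. c * f x) \<in> L0"
  and L0_diff: "f \<in> L0 \<Longrightarrow> g \<in> L0 \<Longrightarrow> (\<lambda>x. f x - g x) \<in> L0"
  unfolding L0_def by (auto intro!: borel_measurable_add borel_measurable_times borel_measurable_diff)

lemma Kf_add:
  assumes f: "f \<in> L0" and g: "g \<in> L0" and r: "r > 0"
  shows "Kf (\<lambda>x. f x + g x) r \<le> Kf f r + Kf g r"
proof -
  have [measurable]: "f \<in> borel_measurable mu" "g \<in> borel_measurable mu" using f g by (auto simp: L0_def)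
  obtain c where c: "c \<ge> 0" "Kf f r = ennreal (r * c) + (\<integral>\<^sup>+x. ennreal (cmod (f x) - c) \<partial>mu)"
    using Kf_attained[OF f r] .
  obtain d where d: "d \<ge> 0" "Kf g r = ennreal (r * d) + (\<integral>\<^sup>+x. ennreal (cmod (g x) - d) \<partial>mu)"
    using Kf_attained[OF g r] .
  \<comment> \<open>The heights are added: the excess of a sum over \<open>c + d\<close> is at most
    the sum of the excesses over \<open>c\<close> and \<open>d\<close>.\<close>
  have "Kf (\<lambda>x. f x + g x) r \<le> ennreal (r * (c + d)) + (\<integral>\<^sup>+x. ennreal (cmod (f x + g x) - (c + d)) \<partial>mu)"
    by (rule Kf_le[OF L0_add[OF f g]]) (use c d r in auto)
  also have "(\<integral>\<^sup>+x. ennreal (cmod (f x + g x) - (c + d)) \<partial>mu) \<le> (\<integral>\<^sup>+x. ennreal (cmod (f x) - c) + ennreal (cmod (g x) - d) \<partial>mu)"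
  proof (intro nn_integral_mono)
    fix x :: real
    have "ennreal (cmod (f x + g x) - (c + d)) \<le> ennreal ((cmod (f x) - c) + (cmod (g x) - d))"
      using norm_triangle_ineq[of "f x" "g x"] by (intro ennreal_leI) simp
    also have "\<dots> \<le> ennreal (cmod (f x) - c) + ennreal (cmod (g x) - d)" by (rule ennreal_add_le)
    finally show "ennreal (cmod (f x + g x) - (c + d)) \<le> ennreal (cmod (f x) - c) + ennreal (cmod (g x) - d)" .
  qed
  also have "\<dots> = (\<integral>\<^sup>+x. ennreal (cmod (f x) - c) \<partial>mu) + (\<integral>\<^sup>+x. ennreal (cmod (g x) - d) \<partial>mu)"
    by (rule nn_integral_add) auto
  also have "ennreal (r * (c + d)) = ennreal (r * c) + ennreal (r * d)"
    using c d r by (simp add: distrib_left)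
  finally show ?thesis unfolding c d by (simp add: add_ac add_mono)
qed

text \<open>A concave function as a mixture of truncations: the weight 1 / r is minus the second
  derivative of \<open>Phi\<close>, and the linear term has slope 1, the derivative at 2. Inserted
  into the norm, truncations of \<open>lam f\<close> become values of \<open>Kf\<close>, and the
  triangle inequality follows from that of \<open>Kf\<close>.\<close>

lemma Phi_min:
  assumes a: "0 \<le> a" "a \<le> 2"
  shows "ennreal (Phi a) = ennreal a + (\<integral>\<^sup>+r\<in>{0<..<2}. ennreal (min a r) * ennreal (1 / r) \<partial>lborel)"
proof (cases "a = 0")
  case True
  have "(\<integral>\<^sup>+r\<in>{0<..<2}. ennreal (min a r) * ennreal (1 / r) \<partial>lborel) = (\<integral>\<^sup>+r. 0 \<partial>(lborel :: real measure))"
    by (intro nn_integral_cong) (auto simp: True indicator_def min_def ennreal_neg)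
  then show ?thesis using True by (simp add: Phi_def)
next
  case False
  then have a0: "0 < a" using a by simp
  have "(\<integral>\<^sup>+r\<in>{0<..<2}. ennreal (min a r) * ennreal (1 / r) \<partial>lborel) =
    (\<integral>\<^sup>+r. indicator {0<..<a} r + ennreal (a / r) * indicator {a..2} r \<partial>lborel)"
  proof (rule nn_integral_cong_AE)
    show "AE r in lborel. ennreal (min a r) * ennreal (1 / r) * indicator {0<..<2} r = indicator {0<..<a} r + ennreal (a / r) * indicator {a..2} r"
      using AE_lborel_singleton[of 2]
    proof eventually_elim
      case (elim r)
      consider "r \<le> 0" | "0 < r" "r < a" | "a \<le> r" "r < 2" | "2 < r" using elim by linarith
      then show ?case using a0 a by cases (auto simp: indicator_def min_def ennreal_mult[symmetric])
    qed
  qed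
  also have "\<dots> = ennreal a + (\<integral>\<^sup>+r\<in>{a..2}. ennreal (a / r) \<partial>lborel)"
    using a by (subst nn_integral_add) auto
  also have "(\<integral>\<^sup>+r\<in>{a..2}. ennreal (a / r) \<partial>lborel) = ennreal (a * ln 2 - a * ln a)"
    by (rule nn_integral_FTC_Icc) (use a a0 in \<open>auto intro!: derivative_eq_intros simp: field_simps\<close>)
  finally have "ennreal a + (\<integral>\<^sup>+r\<in>{0<..<2}. ennreal (min a r) * ennreal (1 / r) \<partial>lborel) = ennreal a + (ennreal a + ennreal (a * ln 2 - a * ln a))" by simp
  moreover have "a * ln 2 - a * ln a \<ge> 0" using a a0 by (simp add: mult_left_mono ln_mono flip: right_diff_distrib)
  moreover have "Phi a = a + (a + (a * ln 2 - a * ln a))" using a0 by (simp add: Phi_def ln_div ln_mult algebra_simps)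
  ultimately show ?thesis using a by (simp flip: ennreal_plus)
qed

lemma norm_LlogL_Kf:
  assumes f: "f \<in> L0"
  shows "norm_LlogL f = (\<integral>\<^sup>+x. ennreal (cmod (f x)) \<partial>mu) + (\<integral>\<^sup>+r\<in>{0<..<2}. Kf f r * ennreal (1 / r) \<partial>lborel)"
proof -
  have [measurable]: "lam f \<in> borel_measurable borel" by (rule lam_measurable[OF f])
  have "norm_LlogL f = (\<integral>\<^sup>+s. ennreal (lam f s) * indicator {0<..} s + (\<integral>\<^sup>+r. indicator {0<..} s * (indicator {0<..<2} r * (ennreal (min (lam f s) r) * ennreal (1 / r))) \<partial>lborel) \<partial>lborel)"
    unfolding norm_LlogL_eq[OF f]
  proof (intro nn_integral_cong)
    fix s :: real
    show "ennreal (Phi (lam f s)) * indicator {0<..} s = ennreal (lam f s) * indicator {0<..} s + (\<integral>\<^sup>+r. indicator {0<..} s * (indicator {0<..<2} r * (ennreal (min (lam f s) r) * ennreal (1 / r))) \<partial>lborel)"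
      using lam_le_2[of f s] by (subst nn_integral_cmult) (auto simp: Phi_min indicator_def[of "{0<..}"] mult.commute)
  qed
  also have "\<dots> = (\<integral>\<^sup>+s\<in>{0<..}. ennreal (lam f s) \<partial>lborel) + (\<integral>\<^sup>+s. (\<integral>\<^sup>+r. indicator {0<..} s * (indicator {0<..<2} r * (ennreal (min (lam f s) r) * ennreal (1 / r))) \<partial>lborel) \<partial>lborel)"
    by (rule nn_integral_add) measurable
  also have "(\<integral>\<^sup>+s. (\<integral>\<^sup>+r. indicator {0<..} s * (indicator {0<..<2} r * (ennreal (min (lam f s) r) * ennreal (1 / r))) \<partial>lborel) \<partial>lborel) = (\<integral>\<^sup>+r. (\<integral>\<^sup>+s. indicator {0<..} s * (indicator {0<..<2} r * (ennreal (min (lam f s) r) * ennreal (1 / r))) \<partial>lborel) \<partial>lborel)"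
    by (rule lborel_pair.Fubini') measurable
  also have "\<dots> = (\<integral>\<^sup>+r\<in>{0<..<2}. Kf f r * ennreal (1 / r) \<partial>lborel)"
  proof (intro nn_integral_cong)
    fix r :: real
    have "(\<integral>\<^sup>+s. indicator {0<..} s * (indicator {0<..<2} r * (ennreal (min (lam f s) r) * ennreal (1 / r))) \<partial>lborel) =
      (\<integral>\<^sup>+s. (indicator {0<..<2} r * ennreal (1 / r)) * (ennreal (min (lam f s) r) * indicator {0<..} s) \<partial>lborel)"
      by (intro nn_integral_cong) (simp add: mult_ac)
    also have "\<dots> = (indicator {0<..<2} r * ennreal (1 / r)) * Kf f r"
      unfolding Kf_def by (rule nn_integral_cmult) measurable
    finally show "(\<integral>\<^sup>+s. indicator {0<..} s * (indicator {0<..<2} r * (ennreal (min (lam f s) r) * ennreal (1 / r))) \<partial>lborel) = Kf f r * ennreal (1 / r) * indicator {0<..<2} r"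
      by (simp add: mult_ac)
  qed
  finally show ?thesis using layer_cake_above[OF f order_refl] by simp
qed

lemma Kf_measurable: "f \<in> L0 \<Longrightarrow> Kf f \<in> borel_measurable borel"
proof -
  assume "f \<in> L0"
  then have [measurable]: "lam f \<in> borel_measurable borel" by (rule lam_measurable)
  show "Kf f \<in> borel_measurable borel" unfolding Kf_def by measurable
qed

theorem norm_LlogL_triangle:
  assumes f: "f \<in> L0" and g: "g \<in> L0"
  shows "norm_LlogL (\<lambda>x. f x + g x) \<le> norm_LlogL f + norm_LlogL g"
proof -
  have [measurable]: "f \<in> borel_measurable mu" "g \<in> borel_measurable mu" using f g by (auto simp: L0_def)
  have [measurable]: "Kf f \<in> borel_measurable borel" "Kf g \<in> borel_measurable borel" using f g Kf_measurable by auto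
  have "(\<integral>\<^sup>+x. ennreal (cmod (f x + g x)) \<partial>mu) \<le> (\<integral>\<^sup>+x. ennreal (cmod (f x)) + ennreal (cmod (g x)) \<partial>mu)"
    by (intro nn_integral_mono) (auto simp: norm_triangle_ineq simp flip: ennreal_plus intro!: ennreal_leI)
  also have "\<dots> = (\<integral>\<^sup>+x. ennreal (cmod (f x)) \<partial>mu) + (\<integral>\<^sup>+x. ennreal (cmod (g x)) \<partial>mu)"
    by (rule nn_integral_add) auto
  finally have 1: "(\<integral>\<^sup>+x. ennreal (cmod (f x + g x)) \<partial>mu) \<le> \<dots>" .
  have "(\<integral>\<^sup>+r\<in>{0<..<2}. Kf (\<lambda>x. f x + g x) r * ennreal (1 / r) \<partial>lborel) \<le>
    (\<integral>\<^sup>+r. Kf f r * ennreal (1 / r) * indicator {0<..<2} r + Kf g r * ennreal (1 / r) * indicator {0<..<2} r \<partial>lborel)"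
  proof (intro nn_integral_mono)
    fix r :: real
    show "Kf (\<lambda>x. f x + g x) r * ennreal (1 / r) * indicator {0<..<2} r \<le> Kf f r * ennreal (1 / r) * indicator {0<..<2} r + Kf g r * ennreal (1 / r) * indicator {0<..<2} r"
    proof (cases "r \<in> {0<..<2}")
      case True
      then have "Kf (\<lambda>x. f x + g x) r * ennreal (1 / r) \<le> (Kf f r + Kf g r) * ennreal (1 / r)"
        by (intro mult_right_mono Kf_add[OF f g]) auto
      then show ?thesis using True by (simp add: distrib_right)
    qed simp
  qed
  also have "\<dots> = (\<integral>\<^sup>+r\<in>{0<..<2}. Kf f r * ennreal (1 / r) \<partial>lborel) + (\<integral>\<^sup>+r\<in>{0<..<2}. Kf g r * ennreal (1 / r) \<partial>lborel)"
    by (rule nn_integral_add) measurable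
  finally have 2: "(\<integral>\<^sup>+r\<in>{0<..<2}. Kf (\<lambda>x. f x + g x) r * ennreal (1 / r) \<partial>lborel) \<le> \<dots>" .
  show ?thesis
    unfolding norm_LlogL_Kf[OF f] norm_LlogL_Kf[OF g] norm_LlogL_Kf[OF L0_add[OF f g]]
    using add_mono[OF 1 2] by (simp add: add_ac)
qed

lemma norm_LlogL_mono:
  assumes f: "f \<in> L0" and g: "g \<in> L0" and le: "AE x in mu. cmod (f x) \<le> cmod (g x)"
  shows "norm_LlogL f \<le> norm_LlogL g"
  unfolding norm_LlogL_eq[OF f] norm_LlogL_eq[OF g]
proof (intro nn_integral_mono mult_right_mono ennreal_leI Phi_mono)
  show "lam f s \<le> lam g s" for s by (rule lam_mono_AE) (use f g le in \<open>auto simp: L0_def\<close>)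
qed (auto simp: lam_le_2)

lemma norm_LlogL_ge_L1:
  assumes f: "f \<in> L0" shows "(\<integral>\<^sup>+x. ennreal (cmod (f x)) \<partial>mu) \<le> norm_LlogL f"
  unfolding norm_LlogL_Kf[OF f] by simp

lemma norm_LlogL_zero: "norm_LlogL (\<lambda>x. 0) = 0"
proof -
  have z: "(\<lambda>x. 0) \<in> L0" by (simp add: L0_def)
  have "ennreal (Phi (lam (\<lambda>x. 0) s)) * indicator {0<..} s = 0" for s
    by (cases "s > 0") (auto simp: lam_def Phi_def)
  then show ?thesis unfolding norm_LlogL_eq[OF z] by (simp only: nn_integral_const mult_zero_left)
qed

lemma norm_LlogL_cmult:
  assumes f: "f \<in> L0" shows "norm_LlogL (\<lambda>x. c * f x) = ennreal (cmod c) * norm_LlogL f"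
proof (cases "c = 0")
  case True then show ?thesis by (simp add: norm_LlogL_zero)
next
  case False
  have [measurable]: "lam f \<in> borel_measurable borel" "lam (\<lambda>x. c * f x) \<in> borel_measurable borel"
    using f L0_mult[OF f] by (auto intro: lam_measurable)
  have lc: "lam (\<lambda>x. c * f x) (cmod c * s) = lam f s" for s
    using False by (simp add: lam_def norm_mult)
  have "norm_LlogL (\<lambda>x. c * f x) = ennreal \<bar>cmod c\<bar> * (\<integral>\<^sup>+s. ennreal (Phi (lam (\<lambda>x. c * f x) (0 + cmod c * s))) * indicator {0<..} (0 + cmod c * s) \<partial>lborel)"
    unfolding norm_LlogL_eq[OF L0_mult[OF f]] by (rule nn_integral_real_affine) (use False in auto)
  also have "(\<integral>\<^sup>+s. ennreal (Phi (lam (\<lambda>x. c * f x) (0 + cmod c * s))) * indicator {0<..} (0 + cmod c * s) \<partial>lborel) = norm_LlogL f"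
    unfolding norm_LlogL_eq[OF f] using False by (intro nn_integral_cong) (auto simp: lc indicator_def zero_less_mult_iff)
  finally show ?thesis by simp
qed

text \<open>Fatou's lemma three times: in \<open>x\<close> for the distribution function, in
  \<open>t\<close> for \<open>Phi\<close>, in \<open>s\<close> for the norm. Each time the set
  involved is defined by a strict inequality, which persists for large \<open>n\<close>.\<close>

theorem norm_LlogL_Fatou:
  assumes f: "f \<in> L0" and u: "\<And>n. u n \<in> L0" and lim: "AE x in mu. (\<lambda>n. u n x) \<longlonglongrightarrow> f x"
  shows "norm_LlogL f \<le> liminf (\<lambda>n. norm_LlogL (u n))"
proof -
  have [measurable]: "f \<in> borel_measurable mu" "\<And>n. u n \<in> borel_measurable mu" using f u by (auto simp: L0_def)
  have [measurable]: "lam f \<in> borel_measurable borel" "\<And>n. lam (u n) \<in> borel_measurable borel" using f u by (auto intro: lam_measurable)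
  let ?w = "\<lambda>t. ennreal (ln (2 * exp 1 / t))"
  have lam_le: "ennreal (lam f s) \<le> liminf (\<lambda>n. ennreal (lam (u n) s))" for s
  proof -
    have "ennreal (lam f s) = (\<integral>\<^sup>+x. indicator {x. s < cmod (f x)} x \<partial>mu)" by (simp add: nn_integral_indicator_lam[OF f])
    also have "\<dots> \<le> (\<integral>\<^sup>+x. liminf (\<lambda>n. indicator {x. s < cmod (u n x)} x) \<partial>mu)"
    proof (rule nn_integral_mono_AE)
      show "AE x in mu. (indicator {x. s < cmod (f x)} x :: ennreal) \<le> liminf (\<lambda>n. indicator {x. s < cmod (u n x)} x)"
        using lim
      proof eventually_elim
        case (elim x)
        show ?case
        proof (cases "s < cmod (f x)")
          case True
          have "(\<lambda>n. cmod (u n x)) \<longlonglongrightarrow> cmod (f x)" using elim by (rule tendsto_norm)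
          then have "eventually (\<lambda>n. s < cmod (u n x)) sequentially" using True by (simp add: order_tendsto_iff)
          then have "eventually (\<lambda>n. (1::ennreal) \<le> indicator {x. s < cmod (u n x)} x) sequentially"
            by eventually_elim auto
          then have "(1::ennreal) \<le> liminf (\<lambda>n. indicator {x. s < cmod (u n x)} x)" by (rule Liminf_bounded)
          then show ?thesis using True by simp
        qed simp
      qed
    qed
    also have "\<dots> \<le> liminf (\<lambda>n. \<integral>\<^sup>+x. indicator {x. s < cmod (u n x)} x \<partial>mu)"
      by (rule nn_integral_liminf) measurable
    finally show ?thesis by (simp add: nn_integral_indicator_lam[OF u])
  qed
  have inner: "ennreal (Phi (lam f s)) \<le> liminf (\<lambda>n. ennreal (Phi (lam (u n) s)))" for s
  proof -
    have "ennreal (Phi (lam f s)) = (\<integral>\<^sup>+t\<in>{0<..<lam f s}. ?w t \<partial>lborel)"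
      by (simp add: nn_integral_ln lam_le_2)
    also have "\<dots> \<le> (\<integral>\<^sup>+t. liminf (\<lambda>n. ?w t * indicator {0<..<lam (u n) s} t) \<partial>lborel)"
    proof (intro nn_integral_mono)
      fix t :: real
      show "?w t * indicator {0<..<lam f s} t \<le> liminf (\<lambda>n. ?w t * indicator {0<..<lam (u n) s} t)"
      proof (cases "t \<in> {0<..<lam f s}")
        case True
        then have "ennreal t < liminf (\<lambda>n. ennreal (lam (u n) s))"
          by (intro less_le_trans[OF _ lam_le]) (auto simp: ennreal_less_iff)
        then have "eventually (\<lambda>n. ennreal t < ennreal (lam (u n) s)) sequentially" by (rule less_LiminfD)
        then have "eventually (\<lambda>n. ?w t \<le> ?w t * indicator {0<..<lam (u n) s} t) sequentially"
          by eventually_elim (use True in \<open>auto simp: ennreal_less_iff\<close>)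
        then have "?w t \<le> liminf (\<lambda>n. ?w t * indicator {0<..<lam (u n) s} t)" by (rule Liminf_bounded)
        then show ?thesis using True by simp
      qed simp
    qed
    also have "\<dots> \<le> liminf (\<lambda>n. \<integral>\<^sup>+t\<in>{0<..<lam (u n) s}. ?w t \<partial>lborel)"
      by (rule nn_integral_liminf) measurable
    finally show ?thesis by (simp add: nn_integral_ln lam_le_2)
  qed
  have "norm_LlogL f \<le> (\<integral>\<^sup>+s. liminf (\<lambda>n. ennreal (Phi (lam (u n) s)) * indicator {0<..} s) \<partial>lborel)"
    unfolding norm_LlogL_eq[OF f] by (intro nn_integral_mono) (use inner in \<open>auto simp: indicator_def\<close>)
  also have "\<dots> \<le> liminf (\<lambda>n. \<integral>\<^sup>+s\<in>{0<..}. ennreal (Phi (lam (u n) s)) \<partial>lborel)"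
    by (rule nn_integral_liminf) measurable
  finally show ?thesis by (simp add: norm_LlogL_eq[OF u])
qed

text \<open>Young's inequality at each level \<open>s\<close>, with a = \<open>lam f s\<close>:
  \<bar>k\<bar> \<le> log (2e/a) + a exp \<bar>k\<bar>. Integrated over the level set the first term
  gives a log (2e/a), and the second at most a K, so both are controlled by
  \<open>Phi a\<close>.\<close>

lemma exp_integrable_bound:
  assumes f: "f \<in> L0" and k[measurable]: "k \<in> borel_measurable mu" and K: "K \<ge> 0"
    and E: "(\<integral>\<^sup>+x. ennreal (exp \<bar>k x\<bar>) \<partial>mu) \<le> ennreal K"
  shows "(\<integral>\<^sup>+x. ennreal (cmod (f x) * \<bar>k x\<bar>) \<partial>mu) \<le> ennreal (1 + K) * norm_LlogL f"
proof -
  have [measurable]: "f \<in> borel_measurable mu" using f by (simp add: L0_def)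
  have [measurable]: "lam f \<in> borel_measurable borel" by (rule lam_measurable[OF f])
  have "(\<integral>\<^sup>+x. ennreal (cmod (f x) * \<bar>k x\<bar>) \<partial>mu) = (\<integral>\<^sup>+x. ennreal \<bar>k x\<bar> * (\<integral>\<^sup>+s\<in>{0<..<cmod (f x)}. 1 \<partial>lborel) \<partial>mu)"
    by (intro nn_integral_cong) (simp add: ennreal_mult mult.commute)
  also have "\<dots> = (\<integral>\<^sup>+s\<in>{0<..}. 1 * (\<integral>\<^sup>+x. ennreal \<bar>k x\<bar> * indicator {x. s < cmod (f x)} x \<partial>mu) \<partial>lborel)"
    by (rule layer_cake[OF f, symmetric]) auto
  also have "\<dots> \<le> (\<integral>\<^sup>+s. ennreal (1 + K) * (ennreal (Phi (lam f s)) * indicator {0<..} s) \<partial>lborel)"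
  proof (intro nn_integral_mono)
    fix s :: real
    let ?a = "lam f s" and ?A = "{x. s < cmod (f x)}"
    have main: "(\<integral>\<^sup>+x. ennreal \<bar>k x\<bar> * indicator ?A x \<partial>mu) \<le> ennreal (1 + K) * ennreal (Phi ?a)"
    proof (cases "?a = 0")
      case True
      then have "emeasure mu {x \<in> space mu. s < cmod (f x)} = 0" by (simp add: emeasure_lam)
      then have "AE x in mu. \<not> s < cmod (f x)" by (subst AE_iff_measurable[OF _ refl]) auto
      then have "(\<integral>\<^sup>+x. ennreal \<bar>k x\<bar> * indicator ?A x \<partial>mu) = (\<integral>\<^sup>+x. 0 \<partial>mu)"
        by (intro nn_integral_cong_AE) auto
      then show ?thesis by simp
    next
      case False
      then have a: "0 < ?a" "?a \<le> 2" using lam_le_2[of f s] lam_nonneg[of f s] by (simp_all only: less_le) auto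
      have w: "ln (2 * exp 1 / ?a) \<ge> 1" using ln_2e_nonneg a by blast
      have pt: "\<bar>k x\<bar> \<le> ln (2 * exp 1 / ?a) + ?a * exp \<bar>k x\<bar>" for x
      proof -
        have "ln (?a * exp \<bar>k x\<bar>) \<le> ?a * exp \<bar>k x\<bar> - 1" using a by (intro ln_le_minus_one) auto
        then have "ln ?a + \<bar>k x\<bar> \<le> ?a * exp \<bar>k x\<bar>" using a by (simp add: ln_mult)
        moreover have "- ln ?a \<le> ln (2 * exp 1 / ?a)" using a by (simp add: ln_div ln_mult)
        ultimately show ?thesis by linarith
      qed
      have "(\<integral>\<^sup>+x. ennreal \<bar>k x\<bar> * indicator ?A x \<partial>mu) \<le> (\<integral>\<^sup>+x. ennreal (ln (2 * exp 1 / ?a)) * indicator ?A x + ennreal ?a * ennreal (exp \<bar>k x\<bar>) \<partial>mu)"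
      proof (intro nn_integral_mono)
        fix x :: real
        have "ennreal \<bar>k x\<bar> \<le> ennreal (ln (2 * exp 1 / ?a) + ?a * exp \<bar>k x\<bar>)" by (rule ennreal_leI[OF pt])
        also have "\<dots> = ennreal (ln (2 * exp 1 / ?a)) + ennreal ?a * ennreal (exp \<bar>k x\<bar>)"
          using order_trans[OF zero_le_one w] a by (subst ennreal_plus) (auto simp: ennreal_mult)
        finally show "ennreal \<bar>k x\<bar> * indicator ?A x \<le> ennreal (ln (2 * exp 1 / ?a)) * indicator ?A x + ennreal ?a * ennreal (exp \<bar>k x\<bar>)"
          by (auto simp: indicator_def)
      qed
      also have "\<dots> = ennreal (ln (2 * exp 1 / ?a)) * ennreal ?a + ennreal ?a * (\<integral>\<^sup>+x. ennreal (exp \<bar>k x\<bar>) \<partial>mu)"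
        by (subst nn_integral_add) (auto simp: nn_integral_cmult nn_integral_indicator_lam[OF f])
      also have "\<dots> \<le> ennreal (ln (2 * exp 1 / ?a)) * ennreal ?a + ennreal ?a * ennreal K"
        by (intro add_mono mult_left_mono E) auto
      also have "\<dots> = ennreal (ln (2 * exp 1 / ?a) * ?a + ?a * K)" using a K order_trans[OF zero_le_one w]
        by (subst ennreal_plus) (auto simp: ennreal_mult)
      also have "\<dots> \<le> ennreal ((1 + K) * Phi ?a)"
      proof (rule ennreal_leI)
        have "0 \<le> K * (?a * ln (2 * exp 1 / ?a))"
          by (rule mult_nonneg_nonneg[OF K mult_nonneg_nonneg[OF less_imp_le[OF a(1)] order_trans[OF zero_le_one w]]])
        then show "ln (2 * exp 1 / ?a) * ?a + ?a * K \<le> (1 + K) * Phi ?a" using a by (simp add: Phi_def algebra_simps)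
      qed
      also have "\<dots> = ennreal (1 + K) * ennreal (Phi ?a)" using K a Phi_nonneg[of ?a] by (intro ennreal_mult) auto
      finally show ?thesis .
    qed
    then show "1 * (\<integral>\<^sup>+x. ennreal \<bar>k x\<bar> * indicator ?A x \<partial>mu) * indicator {0<..} s \<le> ennreal (1 + K) * (ennreal (Phi ?a) * indicator {0<..} s)"
      by (auto simp: indicator_def[of "{0<..}"])
  qed
  also have "\<dots> = ennreal (1 + K) * norm_LlogL f"
    unfolding norm_LlogL_eq[OF f] by (rule nn_integral_cmult) measurable
  finally show ?thesis .
qed

text \<open>Take the tangent of \<open>Phi\<close> at b = 1 / (1 + s)^2. These \<open>b\<close> have
  integral 1 over s \<ge> 0, which is the additive constant, while log (2e/b) is at most 2 (1 + log
  (1 + s)), and 1 + log (1 + s) has the primitive (1 + s) log (1 + s).\<close>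

lemma norm_LlogL_le_entropy:
  assumes f: "f \<in> L0"
  shows "norm_LlogL f \<le> 2 * (\<integral>\<^sup>+x. ennreal ((1 + cmod (f x)) * ln (1 + cmod (f x))) \<partial>mu) + 1"
proof -
  have [measurable]: "f \<in> borel_measurable mu" using f by (simp add: L0_def)
  have [measurable]: "lam f \<in> borel_measurable borel" by (rule lam_measurable[OF f])
  have "norm_LlogL f \<le> (\<integral>\<^sup>+s. 2 * (ennreal (1 + ln (1 + s)) * ennreal (lam f s) * indicator {0<..} s) + ennreal (1 / (1 + s)\<^sup>2) * indicator {0..} s \<partial>lborel)"
    unfolding norm_LlogL_eq[OF f]
  proof (intro nn_integral_mono)
    fix s :: real
    show "ennreal (Phi (lam f s)) * indicator {0<..} s \<le> 2 * (ennreal (1 + ln (1 + s)) * ennreal (lam f s) * indicator {0<..} s) + ennreal (1 / (1 + s)\<^sup>2) * indicator {0..} s"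
    proof (cases "s > 0")
      case True
      let ?b = "1 / (1 + s)\<^sup>2"
      have "Phi (lam f s) \<le> lam f s * ln (2 * exp 1 / ?b) + ?b" using True by (intro Phi_tangent) auto
      also have "ln (2 * exp 1 / ?b) = ln 2 + 1 + 2 * ln (1 + s)" using True by (simp add: ln_mult ln_realpow)
      also have "lam f s * (ln 2 + 1 + 2 * ln (1 + s)) + ?b \<le> lam f s * (2 * (1 + ln (1 + s))) + ?b"
        using ln_le_minus_one[of 2] by (intro add_mono mult_left_mono) auto
      finally have "ennreal (Phi (lam f s)) \<le> ennreal (2 * ((1 + ln (1 + s)) * lam f s) + ?b)"
        by (intro ennreal_leI) (simp add: algebra_simps)
      also have "\<dots> = 2 * (ennreal (1 + ln (1 + s)) * ennreal (lam f s)) + ennreal ?b"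
        using True by (subst ennreal_plus) (auto simp: ennreal_mult)
      finally show ?thesis using True by simp
    qed simp
  qed
  also have "\<dots> = 2 * (\<integral>\<^sup>+s\<in>{0<..}. ennreal (1 + ln (1 + s)) * ennreal (lam f s) \<partial>lborel) + (\<integral>\<^sup>+s\<in>{0..}. ennreal (1 / (1 + s)\<^sup>2) \<partial>lborel)"
    by (subst nn_integral_add) (auto simp: nn_integral_cmult)
  also have "(\<integral>\<^sup>+s\<in>{0..}. ennreal (1 / (1 + s)\<^sup>2) \<partial>lborel) = ennreal (0 - (- 1 / (1 + 0)))"
  proof (rule nn_integral_FTC_atLeast)
    show "((\<lambda>s::real. - 1 / (1 + s)) \<longlongrightarrow> 0) at_top" by real_asymp
  qed (auto intro!: derivative_eq_intros simp: field_simps power2_eq_square)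
  also have "ennreal (0 - (- 1 / (1 + 0))) = 1" by simp
  also have "(\<integral>\<^sup>+s\<in>{0<..}. ennreal (1 + ln (1 + s)) * ennreal (lam f s) \<partial>lborel) = (\<integral>\<^sup>+s\<in>{0<..}. ennreal (1 + ln (1 + s)) * (\<integral>\<^sup>+x. 1 * indicator {x. s < cmod (f x)} x \<partial>mu) \<partial>lborel)"
    by (simp add: nn_integral_indicator_lam[OF f])
  also have "\<dots> = (\<integral>\<^sup>+x. 1 * (\<integral>\<^sup>+s\<in>{0<..<cmod (f x)}. ennreal (1 + ln (1 + s)) \<partial>lborel) \<partial>mu)"
    by (rule layer_cake[OF f]) auto
  also have "\<dots> = (\<integral>\<^sup>+x. ennreal ((1 + cmod (f x)) * ln (1 + cmod (f x))) \<partial>mu)"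
  proof (intro nn_integral_cong)
    fix x :: real
    have "(\<integral>\<^sup>+s\<in>{0<..<cmod (f x)}. ennreal (1 + ln (1 + s)) \<partial>lborel) = (\<integral>\<^sup>+s\<in>{0..cmod (f x)}. ennreal (1 + ln (1 + s)) \<partial>lborel)"
    proof (rule nn_integral_cong_AE)
      show "AE s in lborel. ennreal (1 + ln (1 + s)) * indicator {0<..<cmod (f x)} s = ennreal (1 + ln (1 + s)) * indicator {0..cmod (f x)} s"
        using AE_lborel_singleton[of 0] AE_lborel_singleton[of "cmod (f x)"] by eventually_elim (auto simp: indicator_def)
    qed
    also have "\<dots> = ennreal ((1 + cmod (f x)) * ln (1 + cmod (f x)) - (1 + 0) * ln (1 + 0))"
      by (rule nn_integral_FTC_Icc) (auto intro!: derivative_eq_intros simp: field_simps)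
    finally show "1 * (\<integral>\<^sup>+s\<in>{0<..<cmod (f x)}. ennreal (1 + ln (1 + s)) \<partial>lborel) = ennreal ((1 + cmod (f x)) * ln (1 + cmod (f x)))" by simp
  qed
  finally show ?thesis .
qed

text \<open>Dominated convergence along the levels: every level set of the tail has measure at most
  \<open>lam f (real n)\<close>, which tends to 0. This makes bounded functions dense, so that
  transforms can be extended from them.\<close>

lemma norm_LlogL_tail:
  assumes f: "f \<in> LlogL"
  shows "(\<lambda>n. norm_LlogL (\<lambda>x. if cmod (f x) \<le> real n then 0 else f x)) \<longlonglongrightarrow> 0"
proof -
  have f0: "f \<in> L0" and fin: "norm_LlogL f < \<infinity>" using f by (auto simp: LlogL_def)
  have [measurable]: "f \<in> borel_measurable mu" using f0 by (simp add: L0_def)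
  let ?u = "\<lambda>n x. if cmod (f x) \<le> real n then 0 else f x"
  have u0: "?u n \<in> L0" for n unfolding L0_def by measurable
  have [measurable]: "lam f \<in> borel_measurable borel" "\<And>n. lam (?u n) \<in> borel_measurable borel" using f0 u0 by (auto intro: lam_measurable)
  have lf: "lam (?u n) s \<le> lam f s" for n s
    by (rule lam_mono_AE) (use u0[of n] in \<open>auto simp: L0_def\<close>)
  have ln': "lam (?u n) s \<le> lam f (real n)" if "s > 0" for n s
    unfolding lam_def using that by (intro mu.finite_measure_mono) (auto simp: sets_above_level[OF f0])
  have "(\<lambda>n. \<integral>\<^sup>+s\<in>{0<..}. ennreal (Phi (lam (?u n) s)) \<partial>lborel) \<longlonglongrightarrow> (\<integral>\<^sup>+s. 0 \<partial>(lborel :: real measure))"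
  proof (rule nn_integral_dominated_convergence[where w="\<lambda>s. ennreal (Phi (lam f s)) * indicator {0<..} s"])
    show "(\<integral>\<^sup>+s\<in>{0<..}. ennreal (Phi (lam f s)) \<partial>lborel) < \<infinity>" using fin by (simp add: norm_LlogL_eq[OF f0])
    show "AE s in lborel. ennreal (Phi (lam (?u n) s)) * indicator {0<..} s \<le> ennreal (Phi (lam f s)) * indicator {0<..} s" for n
      by (intro AE_I2 mult_right_mono ennreal_leI Phi_mono) (auto simp: lf lam_le_2)
    show "AE s in lborel. (\<lambda>n. ennreal (Phi (lam (?u n) s)) * indicator {0<..} s) \<longlonglongrightarrow> 0"
    proof (rule AE_I2)
      fix s :: real
      show "(\<lambda>n. ennreal (Phi (lam (?u n) s)) * indicator {0<..} s) \<longlonglongrightarrow> 0"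
      proof (cases "s > 0")
        case True
        have "(\<lambda>n. Phi (lam (?u n) s)) \<longlonglongrightarrow> 0"
        proof (rule LIMSEQ_I)
          fix e :: real assume e: "e > 0"
          \<comment> \<open>The tangent at \<open>b\<close> serves as continuity of
            \<open>Phi\<close> at 0: its constant term is e / 2, and its slope is multiplied by
            something that tends to 0.\<close>
          define b where "b = e / 2"
          have b: "b > 0" using e by (simp add: b_def)
          have "(\<lambda>n. lam f (real n) * \<bar>ln (2 * exp 1 / b)\<bar>) \<longlonglongrightarrow> 0 * \<bar>ln (2 * exp 1 / b)\<bar>"
            by (intro tendsto_intros lam_tendsto_0[OF f0])
          then have "eventually (\<lambda>n. lam f (real n) * \<bar>ln (2 * exp 1 / b)\<bar> < b) sequentially"
            using b by (simp add: order_tendsto_iff)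
          then obtain N where N: "\<And>n. n \<ge> N \<Longrightarrow> lam f (real n) * \<bar>ln (2 * exp 1 / b)\<bar> < b"
            by (auto simp: eventually_sequentially)
          have "norm (Phi (lam (?u n) s) - 0) < e" if n: "n \<ge> N" for n
          proof -
            have "Phi (lam (?u n) s) \<le> lam (?u n) s * ln (2 * exp 1 / b) + b" using b by (intro Phi_tangent) auto
            also have "lam (?u n) s * ln (2 * exp 1 / b) \<le> lam f (real n) * \<bar>ln (2 * exp 1 / b)\<bar>"
              using ln'[OF True, of n] by (intro order_trans[OF mult_left_mono[OF abs_ge_self] mult_right_mono]) auto
            also have "\<dots> < b" using N[OF n] .
            finally have "Phi (lam (?u n) s) < e" by (simp add: b_def)
            then show ?thesis using Phi_nonneg[of "lam (?u n) s"] lam_le_2[of "?u n" s] by simp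
          qed
          then show "\<exists>no. \<forall>n\<ge>no. norm (Phi (lam (?u n) s) - 0) < e" by blast
        qed
        then have "(\<lambda>n. ennreal (Phi (lam (?u n) s))) \<longlonglongrightarrow> ennreal 0" by (rule tendsto_ennrealI)
        then show ?thesis using True by simp
      qed simp
    qed
  qed measurable
  then show ?thesis by (simp add: norm_LlogL_eq[OF u0])
qed

lemma bounded_in_LlogL:
  assumes f: "f \<in> L0" and M: "AE x in mu. cmod (f x) \<le> M"
  shows "f \<in> LlogL"
proof -
  have "norm_LlogL f \<le> norm_LlogL (\<lambda>x. complex_of_real M)"
    by (rule norm_LlogL_mono[OF f]) (use M in \<open>auto simp: L0_def\<close>)
  also have "\<dots> \<le> (\<integral>\<^sup>+s. ennreal (Phi 2) * indicator {0..\<bar>M\<bar>} s \<partial>lborel)"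
  proof (subst norm_LlogL_eq)
    show "(\<integral>\<^sup>+s\<in>{0<..}. ennreal (Phi (lam (\<lambda>x. complex_of_real M) s)) \<partial>lborel) \<le> (\<integral>\<^sup>+s. ennreal (Phi 2) * indicator {0..\<bar>M\<bar>} s \<partial>lborel)"
    proof (intro nn_integral_mono)
      fix s :: real
      have "ennreal (Phi (lam (\<lambda>x. complex_of_real M) s)) \<le> ennreal (Phi 2)"
        by (intro ennreal_leI Phi_mono) (auto simp: lam_le_2)
      moreover have "s > \<bar>M\<bar> \<Longrightarrow> Phi (lam (\<lambda>x. complex_of_real M) s) = 0" by (simp add: lam_def Phi_def)
      ultimately show "ennreal (Phi (lam (\<lambda>x. complex_of_real M) s)) * indicator {0<..} s \<le> ennreal (Phi 2) * indicator {0..\<bar>M\<bar>} s"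
        by (auto simp: indicator_def not_le)
    qed
  qed (simp add: L0_def)
  also have "\<dots> = ennreal (Phi 2) * ennreal \<bar>M\<bar>" by (subst nn_integral_cmult_indicator) auto
  also have "\<dots> < \<infinity>" by (simp add: ennreal_mult_less_top)
  finally show ?thesis using f by (simp add: LlogL_def)
qed

section \<open>\<open>LlogL\<close> as a Banach function space\<close>

lemma LlogL_ideal:
  assumes "f \<in> LlogL" "g \<in> L0" "AE x in mu. cmod (g x) \<le> cmod (f x)"
  shows "g \<in> LlogL"
  using assms norm_LlogL_mono[of g f] by (auto simp: LlogL_def)

lemma LlogL_add: "f \<in> LlogL \<Longrightarrow> g \<in> LlogL \<Longrightarrow> (\<lambda>x. f x + g x) \<in> LlogL"
  using norm_LlogL_triangle[of f g] by (auto simp: LlogL_def L0_add intro: le_less_trans)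

lemma LlogL_cmult: "f \<in> LlogL \<Longrightarrow> (\<lambda>x. c * f x) \<in> LlogL"
  by (auto simp: LlogL_def L0_mult norm_LlogL_cmult ennreal_mult_less_top)

lemma order_ideal_LlogL: "order_ideal LlogL"
  unfolding order_ideal_def
  using LlogL_add LlogL_cmult LlogL_ideal bounded_in_LlogL[of "\<lambda>x. 0" 0]
  by (auto simp: L0_def LlogL_def)

lemma order_ideal_imp_vector_sublattice:
  assumes "order_ideal X" shows "vector_sublattice X"
  unfolding vector_sublattice_def
proof (intro conjI ballI allI impI)
  have X: "X \<subseteq> L0" and id: "\<And>f g. f \<in> X \<Longrightarrow> g \<in> L0 \<Longrightarrow> (AE x in mu. cmod (g x) \<le> cmod (f x)) \<Longrightarrow> g \<in> X"
    using assms by (auto simp: order_ideal_def)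
  show "X \<subseteq> L0" by (rule X)
  show "g \<in> X" if "f \<in> X" "g \<in> L0" "AE x in mu. g x = f x" for f g
    using that by (intro id[of f g]) auto
  show "(\<lambda>x. cnj (f x)) \<in> X" "(\<lambda>x. complex_of_real (cmod (f x))) \<in> X" if "f \<in> X" for f
  proof -
    have [measurable]: "f \<in> borel_measurable mu" using X that by (auto simp: L0_def)
    have "(\<lambda>x. cnj (f x)) \<in> borel_measurable mu"
      by (rule borel_measurable_continuous_on[of cnj, OF _ \<open>f \<in> borel_measurable mu\<close>]) (intro continuous_intros)
    then show "(\<lambda>x. cnj (f x)) \<in> X" by (intro id[OF that]) (auto simp: L0_def)
    show "(\<lambda>x. complex_of_real (cmod (f x))) \<in> X" by (intro id[OF that]) (auto simp: L0_def)
  qed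
qed (use assms in \<open>auto simp: order_ideal_def\<close>)

lemma lattice_norm_LlogL: "lattice_norm_on LlogL norm_LlogL"
  unfolding lattice_norm_on_def
proof (intro conjI ballI allI impI)
  fix f assume f: "f \<in> LlogL"
  then have f0: "f \<in> L0" by (simp add: LlogL_def)
  have [measurable]: "f \<in> borel_measurable mu" using f0 by (simp add: L0_def)
  show "norm_LlogL f < \<infinity>" using f by (simp add: LlogL_def)
  show "norm_LlogL f = 0 \<longleftrightarrow> (AE x in mu. f x = 0)"
  proof
    assume "norm_LlogL f = 0"
    then have "(\<integral>\<^sup>+x. ennreal (cmod (f x)) \<partial>mu) = 0" using norm_LlogL_ge_L1[OF f0] by simp
    then show "AE x in mu. f x = 0" by (subst (asm) nn_integral_0_iff_AE) auto
  next
    assume "AE x in mu. f x = 0"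
    then have "norm_LlogL f \<le> norm_LlogL (\<lambda>x. 0)" by (intro norm_LlogL_mono[OF f0]) (auto simp: L0_def)
    then show "norm_LlogL f = 0" by (simp add: norm_LlogL_zero)
  qed
  show "norm_LlogL (\<lambda>x. c * f x) = ennreal (cmod c) * norm_LlogL f" for c by (rule norm_LlogL_cmult[OF f0])
  fix g assume "g \<in> LlogL"
  then have g0: "g \<in> L0" by (simp add: LlogL_def)
  show "norm_LlogL (\<lambda>x. f x + g x) \<le> norm_LlogL f + norm_LlogL g" by (rule norm_LlogL_triangle[OF f0 g0])
  show "norm_LlogL f \<le> norm_LlogL g" if "AE x in mu. cmod (f x) \<le> cmod (g x)" by (rule norm_LlogL_mono[OF f0 g0 that])
qed

lemma Cauchy_L1_limit:
  fixes u :: "nat \<Rightarrow> 'a \<Rightarrow> 'b::{banach, second_countable_topology}"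
  assumes int: "\<And>n. integrable M (u n)"
    and cau: "\<And>e. e > 0 \<Longrightarrow> \<exists>N. \<forall>i\<ge>N. \<forall>j\<ge>N. (LINT x|M. norm (u i x - u j x)) < e"
  obtains f r where "f \<in> borel_measurable M" "strict_mono r" "AE x in M. (\<lambda>i. u (r i) x) \<longlonglongrightarrow> f x"
proof -
  have [measurable]: "\<And>n. u n \<in> borel_measurable M" using int by auto
  obtain r where r: "strict_mono r" "AE x in M. Cauchy (\<lambda>i. u (r i) x)"
    using cauchy_L1_AE_cauchy_subseq[OF int cau] by blast
  let ?f = "\<lambda>x. lim (\<lambda>i. u (r i) x)"
  have "?f \<in> borel_measurable M" by (rule borel_measurable_lim_metric) measurable
  moreover have "AE x in M. (\<lambda>i. u (r i) x) \<longlonglongrightarrow> ?f x"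
    using r(2) by eventually_elim (simp add: Cauchy_convergent_iff convergent_LIMSEQ_iff)
  ultimately show ?thesis using that r by blast
qed

text \<open>The norm dominates that of L^1, so a subsequence of a Cauchy sequence converges a.e.;
  the Fatou property of the norm upgrades this to convergence in norm.\<close>

theorem complete_LlogL: "norm_complete_on LlogL norm_LlogL"
  unfolding norm_complete_on_def
proof (intro allI impI, elim conjE)
  fix u :: "nat \<Rightarrow> real \<Rightarrow> complex"
  assume u: "\<forall>n. u n \<in> LlogL"
    and cau: "\<forall>e>0. \<exists>K. \<forall>m\<ge>K. \<forall>n\<ge>K. norm_LlogL (\<lambda>x. u m x - u n x) < e"
  have u0: "u n \<in> L0" for n using u by (simp add: LlogL_def)
  have [measurable]: "u n \<in> borel_measurable mu" for n using u0 by (simp add: L0_def)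
  have int: "integrable mu (u n)" for n
    using norm_LlogL_ge_L1[OF u0] u by (intro integrableI_bounded) (auto simp: LlogL_def intro: le_less_trans)
  have cauL1: "\<exists>N. \<forall>i\<ge>N. \<forall>j\<ge>N. (LINT x|mu. norm (u i x - u j x)) < e" if e: "e > 0" for e
  proof -
    obtain K where K: "\<forall>m\<ge>K. \<forall>n\<ge>K. norm_LlogL (\<lambda>x. u m x - u n x) < ennreal e" using cau e by (metis ennreal_0 ennreal_less_iff order_refl)
    have "(LINT x|mu. norm (u i x - u j x)) < e" if "i \<ge> K" "j \<ge> K" for i j
    proof -
      have "ennreal (LINT x|mu. norm (u i x - u j x)) = (\<integral>\<^sup>+x. ennreal (norm (u i x - u j x)) \<partial>mu)"
        using int by (intro nn_integral_eq_integral[symmetric]) auto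
      also have "\<dots> \<le> norm_LlogL (\<lambda>x. u i x - u j x)" by (rule norm_LlogL_ge_L1[OF L0_diff[OF u0 u0]])
      also have "\<dots> < ennreal e" using K that by blast
      finally show ?thesis using e by (simp add: ennreal_less_iff)
    qed
    then show ?thesis by blast
  qed
  obtain f r where fr: "f \<in> borel_measurable mu" "strict_mono r" "AE x in mu. (\<lambda>i. u (r i) x) \<longlonglongrightarrow> f x"
    using Cauchy_L1_limit[where u=u, OF int cauL1] by blast
  have f0: "f \<in> L0" using fr by (simp add: L0_def)
  have ev: "\<exists>K. \<forall>m\<ge>K. norm_LlogL (\<lambda>x. u m x - f x) \<le> e" if e: "e > 0" for e
  proof -
    obtain K where K: "\<forall>m\<ge>K. \<forall>n\<ge>K. norm_LlogL (\<lambda>x. u m x - u n x) < e"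
      using cau e by blast
    have "norm_LlogL (\<lambda>x. u m x - f x) \<le> e" if m: "m \<ge> K" for m
    proof -
      have "norm_LlogL (\<lambda>x. u m x - f x) \<le> liminf (\<lambda>i. norm_LlogL (\<lambda>x. u m x - u (r i) x))"
      proof (rule norm_LlogL_Fatou)
        show "AE x in mu. (\<lambda>n. u m x - u (r n) x) \<longlonglongrightarrow> u m x - f x"
          using fr(3) by eventually_elim (intro tendsto_intros)
      qed (intro L0_diff u0 f0)+
      also have "\<dots> \<le> limsup (\<lambda>i. norm_LlogL (\<lambda>x. u m x - u (r i) x))" by (rule Liminf_le_Limsup) simp
      also have "\<dots> \<le> e"
      proof (rule Limsup_bounded)
        show "\<forall>\<^sub>F i in sequentially. norm_LlogL (\<lambda>x. u m x - u (r i) x) \<le> e"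
          using eventually_ge_at_top[of K]
        proof eventually_elim
          case (elim i)
          then have "r i \<ge> K" using seq_suble[OF fr(2), of i] by simp
          then show ?case using K m by (auto intro: less_imp_le)
        qed
      qed
      finally show ?thesis .
    qed
    then show ?thesis by blast
  qed
  obtain K where K: "\<forall>m\<ge>K. norm_LlogL (\<lambda>x. u m x - f x) \<le> 1" using ev[of 1] by auto
  have "(\<lambda>x. u K x - f x) \<in> LlogL"
    using K f0 u0 by (auto simp: LlogL_def L0_diff intro: le_less_trans[of _ 1])
  then have "(\<lambda>x. u K x + (-1) * (u K x - f x)) \<in> LlogL"
    using u by (intro LlogL_add LlogL_cmult) auto
  then have fL: "f \<in> LlogL" by simp
  moreover have "(\<lambda>n. norm_LlogL (\<lambda>x. u n x - f x)) \<longlonglongrightarrow> 0"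
  proof (rule order_tendstoI)
    fix a :: ennreal assume "0 < a"
    then obtain e where "0 < e" "e < a" using dense by blast
    with ev[of e] show "\<forall>\<^sub>F n in sequentially. norm_LlogL (\<lambda>x. u n x - f x) < a"
      by (auto simp: eventually_sequentially intro: le_less_trans)
  qed auto
  ultimately show "\<exists>f\<in>LlogL. (\<lambda>n. norm_LlogL (\<lambda>x. u n x - f x)) \<longlonglongrightarrow> 0" by blast
qed

lemma simple_subset_LlogL: "{f. simple_function mu f} \<subseteq> LlogL"
proof
  fix f :: "real \<Rightarrow> complex" assume "f \<in> {f. simple_function mu f}"
  then have s: "simple_function mu f" by simp
  then have fin: "finite (f ` space mu)" by (simp add: simple_function_def)
  have "AE x in mu. cmod (f x) \<le> Max (cmod ` f ` space mu)"
    using fin by (intro AE_I2 Max_ge) auto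
  then show "f \<in> LlogL"
    using borel_measurable_simple_function[OF s] by (intro bounded_in_LlogL) (auto simp: L0_def)
qed

lemma bfs_LlogL: "banach_function_space LlogL norm_LlogL"
  unfolding banach_function_space_def
  using order_ideal_LlogL simple_subset_LlogL lattice_norm_LlogL complete_LlogL by blast

subsection \<open>Conjugate Poisson integrals\<close>

lemma cpois_bound:
  assumes y: "y > 0" shows "\<bar>cpois y s\<bar> \<le> 1 / y"
proof -
  have "0 \<le> (\<bar>s\<bar> - y)\<^sup>2" by simp
  then have "2 * (\<bar>s\<bar> * y) \<le> s\<^sup>2 + y\<^sup>2" by (simp add: power2_eq_square algebra_simps)
  moreover have "1 * (s\<^sup>2 + y\<^sup>2) \<le> pi * (s\<^sup>2 + y\<^sup>2)" using pi_gt3 by (intro mult_right_mono) auto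
  moreover have "0 \<le> \<bar>s\<bar> * y" using y by simp
  moreover have "a \<le> P" if "2 * a \<le> S" "1 * S \<le> P" "0 \<le> a" for a S P :: real using that by linarith
  ultimately have "\<bar>s\<bar> * y \<le> pi * (s\<^sup>2 + y\<^sup>2)" by blast
  then have "\<bar>s\<bar> \<le> 1 / y * (pi * (s\<^sup>2 + y\<^sup>2))" using y by (simp add: pos_le_divide_eq)
  moreover have "\<bar>cpois y s\<bar> = \<bar>s\<bar> / (pi * (s\<^sup>2 + y\<^sup>2))"
    using sum_sq_pos[OF y, of s] by (simp add: cpois_def abs_mult)
  ultimately show ?thesis using sum_sq_pos[OF y, of s] by (simp only: pos_divide_le_eq mult_pos_pos pi_gt_zero)
qed

lemma pois_bound:
  assumes y: "y > 0" shows "pois y s \<le> 1 / y"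
proof -
  have "1 * y\<^sup>2 \<le> pi * (s\<^sup>2 + y\<^sup>2)" using pi_gt3 by (intro mult_mono) auto
  then have "y / (pi * (s\<^sup>2 + y\<^sup>2)) \<le> y / (1 * y\<^sup>2)"
    using y sum_sq_pos[OF y, of s] by (intro divide_left_mono) auto
  also have "\<dots> = 1 / y" using y by (simp add: power2_eq_square)
  finally show ?thesis by (simp add: pois_def)
qed

text \<open>Harnack comparison of harmonic measure at t + \<i> y with harmonic measure at \<i>. It
  makes the Poisson integral of a function that is integrable for \<open>pois 1\<close> available at
  every point of the half-plane.\<close>

lemma pois_le_pois_1:
  assumes y: "y > 0"
  shows "pois y (x - t) \<le> y * (2 + (1 + 2 * t\<^sup>2) / y\<^sup>2) * pois 1 x"
proof -
  have "0 \<le> (x - 2 * t)\<^sup>2" by simp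
  then have "1 + x\<^sup>2 \<le> 2 * (x - t)\<^sup>2 + (1 + 2 * t\<^sup>2)" by (simp add: power2_eq_square algebra_simps)
  also have "\<dots> \<le> (2 + (1 + 2 * t\<^sup>2) / y\<^sup>2) * ((x - t)\<^sup>2 + y\<^sup>2)"
  proof -
    define q where "q = (1 + 2 * t\<^sup>2) / y\<^sup>2"
    have "1 + 2 * t\<^sup>2 = q * y\<^sup>2" using y by (simp add: q_def)
    moreover have "0 \<le> 2 * y\<^sup>2 + q * (x - t)\<^sup>2"
      unfolding q_def by (intro add_nonneg_nonneg mult_nonneg_nonneg divide_nonneg_nonneg) auto
    then have "2 * (x - t)\<^sup>2 + q * y\<^sup>2 \<le> (2 + q) * ((x - t)\<^sup>2 + y\<^sup>2)"
      by (simp only: distrib_left distrib_right)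
    ultimately show ?thesis unfolding q_def by (simp only:)
  qed
  finally have *: "1 + x\<^sup>2 \<le> (2 + (1 + 2 * t\<^sup>2) / y\<^sup>2) * ((x - t)\<^sup>2 + y\<^sup>2)" .
  have p: "(x - t)\<^sup>2 + y\<^sup>2 > 0" "1 + x\<^sup>2 > 0" using y by (auto simp: sum_sq_pos add_pos_nonneg)
  have "1 / ((x - t)\<^sup>2 + y\<^sup>2) \<le> (2 + (1 + 2 * t\<^sup>2) / y\<^sup>2) / (1 + x\<^sup>2)"
    using * p by (simp add: pos_divide_le_eq pos_le_divide_eq mult.commute)
  then have "y / pi * (1 / ((x - t)\<^sup>2 + y\<^sup>2)) \<le> y / pi * ((2 + (1 + 2 * t\<^sup>2) / y\<^sup>2) / (1 + x\<^sup>2))"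
    using y by (intro mult_left_mono) auto
  then show ?thesis by (simp add: pois_def field_simps)
qed

lemma integral_norm_le:
  fixes f :: "'a \<Rightarrow> 'b::{banach, second_countable_topology}"
  assumes "integrable M f" "integrable M g" "\<And>x. norm (f x) \<le> g x"
  shows "norm (\<integral>x. f x \<partial>M) \<le> (\<integral>x. g x \<partial>M)"
  by (rule order_trans[OF integral_norm_bound integral_mono]) (use assms in auto)

text \<open>The argument \<open>x - t\<close> is chosen so that the boundary limit is the principal
  value with kernel 1 / (\<pi> (x - t)), with the sign of the finite Hilbert transform.\<close>

definition QI :: "(real \<Rightarrow> real) \<Rightarrow> real \<Rightarrow> real \<Rightarrow> real" where
  "QI u y t = (\<integral>x. u x * cpois y (x - t) \<partial>lborel)"

definition PI :: "(real \<Rightarrow> real) \<Rightarrow> real \<Rightarrow> real \<Rightarrow> real" where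
  "PI u y t = (\<integral>x. u x * pois y (x - t) \<partial>lborel)"

text \<open>The Cauchy integral, holomorphic in the upper half-plane. With the sign of
  \<open>QI\<close> its real part is the conjugate Poisson integral and its imaginary part the
  Poisson integral, so it is P - \<i> Q multiplied by \<i> with Q replaced by -Q; hence 1 - \<i>
  \<open>Fc\<close> has the real part 1 + P and the imaginary part -Q.\<close>

definition Fc :: "(real \<Rightarrow> real) \<Rightarrow> complex \<Rightarrow> complex" where
  "Fc u z = (\<integral>x. of_real (u x) * (1 / (of_real pi * (of_real x - z))) \<partial>lborel)"

lemma integrable_mult_cpois:
  assumes u: "integrable lborel u" and y: "y > 0"
  shows "integrable lborel (\<lambda>x. u x * cpois y (x - t))"
proof -
  have [measurable]: "u \<in> borel_measurable borel" using u by auto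
  show ?thesis
    by (rule Bochner_Integration.integrable_bound[OF integrable_mult_right[OF u, of "1/y"]])
       (use cpois_bound[OF y] y in \<open>auto simp: abs_mult intro!: AE_I2\<close>, metis abs_ge_zero mult.commute mult_right_mono divide_inverse mult_1)
qed

lemma integrable_mult_pois:
  assumes u: "integrable lborel u" and y: "y > 0"
  shows "integrable lborel (\<lambda>x. u x * pois y (x - t))"
proof -
  have [measurable]: "u \<in> borel_measurable borel" using u by auto
  show ?thesis
  proof (rule Bochner_Integration.integrable_bound[OF integrable_mult_right[OF u, of "1/y"]])
    show "AE x in lborel. norm (u x * pois y (x - t)) \<le> norm (1 / y * u x)"
    proof (rule AE_I2)
      fix x
      have "\<bar>u x\<bar> * pois y (x - t) \<le> \<bar>u x\<bar> * (1 / y)" by (intro mult_left_mono pois_bound y) auto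
      then show "norm (u x * pois y (x - t)) \<le> norm (1 / y * u x)" using y pois_nonneg[OF y] by (simp add: abs_mult)
    qed
  qed measurable
qed

lemma cauchy_kernel_eq:
  assumes y: "y > 0"
  shows "1 / (of_real pi * (of_real x - Complex t y)) = Complex (cpois y (x - t)) (pois y (x - t))"
proof -
  have p: "(x - t)\<^sup>2 + y\<^sup>2 > 0" using y by (rule sum_sq_pos)
  have "of_real pi * (of_real x - Complex t y) = Complex (pi * (x - t)) (- (pi * y))" by (simp add: complex_eq_iff)
  then have "1 / (of_real pi * (of_real x - Complex t y)) = 1 / Complex (pi * (x - t)) (- (pi * y))"
    by (simp only:)
  also have "\<dots> = Complex (cpois y (x - t)) (pois y (x - t))"
  proof -
    have e: "(pi * (x - t))\<^sup>2 + (- (pi * y))\<^sup>2 = pi * (pi * ((x - t)\<^sup>2 + y\<^sup>2))"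
      by (simp add: power2_eq_square algebra_simps)
    have "1 / Complex (pi * (x - t)) (- (pi * y)) = inverse (Complex (pi * (x - t)) (- (pi * y)))"
      by (simp only: inverse_eq_divide)
    also have "\<dots> = Complex (cpois y (x - t)) (pois y (x - t))"
      unfolding complex_inverse e by (simp add: cpois_def pois_def)
    finally show ?thesis .
  qed
  finally show ?thesis .
qed

lemma Fc_eq:
  assumes u: "integrable lborel u" and y: "y > 0"
  shows "Fc u (Complex t y) = Complex (QI u y t) (PI u y t)"
    and "integrable lborel (\<lambda>x. of_real (u x) * (1 / (of_real pi * (of_real x - Complex t y))) :: complex)"
proof -
  have eq: "of_real (u x) * (1 / (of_real pi * (of_real x - Complex t y))) = of_real (u x * cpois y (x - t)) + \<i> * of_real (u x * pois y (x - t))" for x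
    unfolding cauchy_kernel_eq[OF y] by (simp add: complex_eq_iff)
  show int: "integrable lborel (\<lambda>x. of_real (u x) * (1 / (of_real pi * (of_real x - Complex t y))) :: complex)"
    unfolding eq by (intro Bochner_Integration.integrable_add integrable_of_real integrable_mult_right integrable_mult_cpois integrable_mult_pois u y)
  show "Fc u (Complex t y) = Complex (QI u y t) (PI u y t)"
    unfolding Fc_def eq QI_def PI_def
    by (subst Bochner_Integration.integral_add)
       (auto intro!: integrable_of_real integrable_mult_right integrable_mult_cpois integrable_mult_pois u y simp: complex_eq_iff simp del: of_real_mult)
qed

lemma Fc_integrable:
  assumes u: "integrable lborel u" and z: "Im z > 0"
  shows "integrable lborel (\<lambda>x. of_real (u x) * (1 / (of_real pi * (of_real x - z))) :: complex)"
  using Fc_eq(2)[OF u z, of "Re z"] by simp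

lemma Im_le_dist_real: "Im z > 0 \<Longrightarrow> Im z \<le> cmod (of_real x - z)"
  using abs_Im_le_cmod[of "of_real x - z"] by simp

lemma Fc_bound:
  assumes u: "integrable lborel u" and z: "Im z > 0"
  shows "cmod (Fc u z) \<le> (\<integral>x. \<bar>u x\<bar> \<partial>lborel) / (pi * Im z)"
proof -
  have "cmod (Fc u z) \<le> (\<integral>x. \<bar>u x\<bar> * (1 / (pi * Im z)) \<partial>lborel)"
    unfolding Fc_def
  proof (rule integral_norm_le[OF Fc_integrable[OF u z]])
    show "integrable lborel (\<lambda>x. \<bar>u x\<bar> * (1 / (pi * Im z)))" using u by (intro integrable_mult_left integrable_abs)
    fix x :: real
    have "pi * Im z \<le> pi * cmod (of_real x - z)" using Im_le_dist_real[OF z] by simp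
    then have "1 / (pi * cmod (of_real x - z)) \<le> 1 / (pi * Im z)" using z by (intro divide_left_mono) (auto intro!: mult_pos_pos)
    then have "\<bar>u x\<bar> * (1 / (pi * cmod (of_real x - z))) \<le> \<bar>u x\<bar> * (1 / (pi * Im z))" by (intro mult_left_mono) auto
    then show "cmod (of_real (u x) * (1 / (of_real pi * (of_real x - z)))) \<le> \<bar>u x\<bar> * (1 / (pi * Im z))"
      by (simp add: norm_mult norm_divide)
  qed
  also have "\<dots> = (\<integral>x. \<bar>u x\<bar> \<partial>lborel) / (pi * Im z)" by simp
  finally show ?thesis .
qed

text \<open>Differentiation under the integral by an explicit remainder: the difference quotient
  minus the integral of the differentiated kernel is \<open>w - z\<close> times an integral that
  stays bounded near \<open>z\<close>.\<close>

lemma Fc_holomorphic: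
  assumes u: "integrable lborel u"
  shows "Fc u holomorphic_on {z. Im z > 0}"
proof (rule holomorphic_onI)
  fix z assume "z \<in> {z. Im z > 0}"
  then have z: "Im z > 0" by simp
  \<comment> \<open>The disc of radius \<open>b\<close> about \<open>z\<close> stays at height at
    least \<open>b\<close>, where all kernels are bounded.\<close>
  define b where "b = Im z / 2"
  have b: "b > 0" using z by (simp add: b_def)
  have um[measurable]: "u \<in> borel_measurable borel" using u by auto
  let ?k = "\<lambda>z x. 1 / (of_real pi * (of_real x - z)) :: complex"
  let ?K = "\<lambda>x. of_real (u x) * (of_real pi * (?k z x)\<^sup>2) :: complex"
  define C where "C = (\<integral>x. \<bar>u x\<bar> \<partial>lborel) / b ^ 3"
  have nz: "of_real x - w \<noteq> 0" if "Im w > 0" for w and x :: real using that by (auto simp: complex_eq_iff)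
  have kb: "cmod (?k w x) \<le> 1 / (pi * b)" if w: "Im w \<ge> b" for w x
  proof -
    have "pi * b \<le> pi * cmod (of_real x - w)" using Im_le_dist_real[of w x] w b by simp
    then have "1 / (pi * cmod (of_real x - w)) \<le> 1 / (pi * b)" using b w by (intro divide_left_mono) (auto intro!: mult_pos_pos simp: nz)
    then show ?thesis by (simp add: norm_divide norm_mult)
  qed
  have iK: "integrable lborel ?K"
  proof (rule Bochner_Integration.integrable_bound[OF integrable_mult_right[OF u, of "pi * (1 / (pi * b))\<^sup>2"]])
    show "AE x in lborel. norm (?K x) \<le> norm (pi * (1 / (pi * b))\<^sup>2 * u x)"
    proof (rule AE_I2)
      fix x
      have "(cmod (?k z x))\<^sup>2 \<le> (1 / (pi * b))\<^sup>2" by (intro power_mono kb) (use b in \<open>auto simp: b_def\<close>)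
      then have "pi * ((cmod (?k z x))\<^sup>2 * \<bar>u x\<bar>) \<le> pi * ((1 / (pi * b))\<^sup>2 * \<bar>u x\<bar>)" by (intro mult_left_mono mult_right_mono) auto
      then show "norm (?K x) \<le> norm (pi * (1 / (pi * b))\<^sup>2 * u x)" by (simp add: norm_mult norm_power abs_mult mult_ac)
    qed
  qed measurable
  have est: "cmod ((Fc u w - Fc u z) / (w - z) - (\<integral>x. ?K x \<partial>lborel)) \<le> C * cmod (w - z)" if w: "w \<noteq> z" "dist w z < b" for w
  proof -
    have "\<bar>Im w - Im z\<bar> < b" using w(2) abs_Im_le_cmod[of "w - z"] by (simp add: dist_norm)
    then have Iw: "Im w \<ge> b" "Im w > 0" using b by (auto simp: b_def abs_if split: if_splits)
    have Iz: "Im z \<ge> b" using b by (simp add: b_def)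
    let ?R = "\<lambda>x. of_real (u x) * ((w - z) * of_real (pi\<^sup>2) * ((?k z x)\<^sup>2 * ?k w x)) :: complex"
    have id: "(of_real (u x) * ?k w x - of_real (u x) * ?k z x) / (w - z) - ?K x = ?R x" for x
    proof -
      define A B where "A = of_real pi * (of_real x - z)" and "B = of_real pi * (of_real x - w)"
      have AB: "A \<noteq> 0" "B \<noteq> 0" using nz z Iw by (auto simp: A_def B_def)
      have d: "A - B = of_real pi * (w - z)" by (simp add: A_def B_def algebra_simps)
      have p0: "complex_of_real pi \<noteq> 0" by simp
      have wz: "w - z = (A - B) / of_real pi" using d by simp
      have "A - B \<noteq> 0" using d w by simp
      then have "(of_real (u x) * (1 / B) - of_real (u x) * (1 / A)) / ((A - B) / of_real pi) - of_real (u x) * (of_real pi * (1 / A)\<^sup>2)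
         = of_real (u x) * ((A - B) / of_real pi * of_real (pi\<^sup>2) * ((1 / A)\<^sup>2 * (1 / B)))"
        using AB p0 by (simp add: divide_simps power2_eq_square) (simp add: algebra_simps)
      then show ?thesis unfolding wz A_def[symmetric] B_def[symmetric] .
    qed
    have "(Fc u w - Fc u z) / (w - z) - (\<integral>x. ?K x \<partial>lborel) = (\<integral>x. (of_real (u x) * ?k w x - of_real (u x) * ?k z x) / (w - z) - ?K x \<partial>lborel)"
      using Fc_integrable[OF u Iw(2)] Fc_integrable[OF u z] iK unfolding Fc_def
      by (subst Bochner_Integration.integral_diff) (auto intro!: Bochner_Integration.integrable_diff integrable_divide simp: Bochner_Integration.integral_diff)
    also have "\<dots> = (\<integral>x. ?R x \<partial>lborel)" by (simp only: id)
    finally have eq: "(Fc u w - Fc u z) / (w - z) - (\<integral>x. ?K x \<partial>lborel) = (\<integral>x. ?R x \<partial>lborel)" .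
    have iR: "integrable lborel ?R"
      unfolding id[symmetric] using Fc_integrable[OF u Iw(2)] Fc_integrable[OF u z] iK
      by (intro Bochner_Integration.integrable_diff integrable_divide)
    have "cmod (\<integral>x. ?R x \<partial>lborel) \<le> (\<integral>x. \<bar>u x\<bar> * (cmod (w - z) / b ^ 3) \<partial>lborel)"
    proof (rule integral_norm_le[OF iR])
      show "integrable lborel (\<lambda>x. \<bar>u x\<bar> * (cmod (w - z) / b ^ 3))" using u by (intro integrable_mult_left integrable_abs)
      fix x
      have "(cmod (?k z x))\<^sup>2 * cmod (?k w x) \<le> (1 / (pi * b))\<^sup>2 * (1 / (pi * b))"
        by (intro mult_mono power_mono kb Iw Iz) auto
      then have "pi\<^sup>2 * ((cmod (?k z x))\<^sup>2 * cmod (?k w x)) \<le> pi\<^sup>2 * ((1 / (pi * b))\<^sup>2 * (1 / (pi * b)))"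
        by (intro mult_left_mono) auto
      also have "\<dots> = 1 / (pi * b ^ 3)" using b by (simp add: power2_eq_square power3_eq_cube)
      also have "\<dots> \<le> 1 / (1 * b ^ 3)" using b pi_gt3 by (intro divide_left_mono mult_right_mono) auto
      finally have "\<bar>u x\<bar> * (cmod (w - z) * (pi\<^sup>2 * ((cmod (?k z x))\<^sup>2 * cmod (?k w x)))) \<le> \<bar>u x\<bar> * (cmod (w - z) * (1 / (1 * b ^ 3)))"
        by (intro mult_left_mono) auto
      moreover have "cmod (complex_of_real (pi\<^sup>2)) = pi\<^sup>2" by (simp add: norm_power)
      then have "cmod (?R x) = \<bar>u x\<bar> * (cmod (w - z) * (pi\<^sup>2 * ((cmod (?k z x))\<^sup>2 * cmod (?k w x))))"
        by (simp only: norm_mult norm_power norm_of_real mult.assoc)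
      ultimately show "cmod (?R x) \<le> \<bar>u x\<bar> * (cmod (w - z) / b ^ 3)" by simp
    qed
    also have "\<dots> = C * cmod (w - z)" by (simp add: C_def)
    finally show ?thesis unfolding eq .
  qed
  have "((\<lambda>w. (Fc u w - Fc u z) / (w - z) - (\<integral>x. ?K x \<partial>lborel)) \<longlongrightarrow> 0) (at z)"
  proof (rule Lim_null_comparison)
    show "\<forall>\<^sub>F w in at z. cmod ((Fc u w - Fc u z) / (w - z) - (\<integral>x. ?K x \<partial>lborel)) \<le> C * cmod (w - z)"
      unfolding eventually_at using b est by (intro exI[of _ b]) auto
    have "((\<lambda>w. C * cmod (w - z)) \<longlongrightarrow> C * cmod (z - z)) (at z)" by (intro tendsto_intros)
    then show "((\<lambda>w. C * cmod (w - z)) \<longlongrightarrow> 0) (at z)" by simp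
  qed
  then have "((\<lambda>w. (Fc u w - Fc u z) / (w - z)) \<longlongrightarrow> (\<integral>x. ?K x \<partial>lborel)) (at z)"
    by (simp add: LIM_zero_iff)
  then have "(Fc u has_field_derivative (\<integral>x. ?K x \<partial>lborel)) (at z)"
    by (simp add: has_field_derivative_iff)
  then show "Fc u field_differentiable at z within {z. Im z > 0}"
    using field_differentiable_at_within field_differentiable_def by blast
qed

text \<open>Raised by \<open>y\<close>, the Cauchy integral is bounded on the closed half-plane and
  holomorphic beyond the axis, which is what Poisson's formula requires.\<close>

lemma Fc_shift:
  assumes u: "integrable lborel u" and y: "y > 0"
  shows "(\<lambda>z. Fc u (z + \<i> * of_real y)) holomorphic_on {z. Im z > - y}"
    and "\<And>z. Im z \<ge> 0 \<Longrightarrow> cmod (Fc u (z + \<i> * of_real y)) \<le> (\<integral>x. \<bar>u x\<bar> \<partial>lborel) / (pi * y)"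
proof -
  show "(\<lambda>z. Fc u (z + \<i> * of_real y)) holomorphic_on {z. Im z > - y}"
    by (rule holomorphic_on_compose_gen[OF _ Fc_holomorphic[OF u], unfolded o_def]) (auto intro!: holomorphic_intros)
  fix z :: complex assume z: "Im z \<ge> 0"
  have "cmod (Fc u (z + \<i> * of_real y)) \<le> (\<integral>x. \<bar>u x\<bar> \<partial>lborel) / (pi * Im (z + \<i> * of_real y))"
    by (rule Fc_bound[OF u]) (use z y in simp)
  also have "\<dots> \<le> (\<integral>x. \<bar>u x\<bar> \<partial>lborel) / (pi * y)"
    using z y by (intro divide_left_mono) (auto intro!: integral_nonneg_AE mult_pos_pos)
  finally show "cmod (Fc u (z + \<i> * of_real y)) \<le> (\<integral>x. \<bar>u x\<bar> \<partial>lborel) / (pi * y)" .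
qed

lemma of_real_shift: "of_real t + \<i> * of_real y = Complex t y"
  by (simp add: complex_eq_iff)

lemma QI_continuous:
  assumes u: "integrable lborel u" and y: "y > 0"
  shows "continuous_on UNIV (QI u y)" "continuous_on UNIV (PI u y)"
proof -
  have "continuous_on UNIV (\<lambda>t::real. Fc u (of_real t + \<i> * of_real y))"
    by (rule continuous_on_compose2[OF holomorphic_on_imp_continuous_on[OF Fc_shift(1)[OF u y]]])
       (use y in \<open>auto intro!: continuous_intros\<close>)
  then have c: "continuous_on UNIV (\<lambda>t. Complex (QI u y t) (PI u y t))"
    by (simp add: of_real_shift Fc_eq(1)[OF u y])
  show "continuous_on UNIV (QI u y)" using continuous_on_Re[OF c] by simp
  show "continuous_on UNIV (PI u y)" using continuous_on_Im[OF c] by simp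
qed

lemma QI_measurable: "integrable lborel u \<Longrightarrow> y > 0 \<Longrightarrow> QI u y \<in> borel_measurable borel"
  and PI_measurable: "integrable lborel u \<Longrightarrow> y > 0 \<Longrightarrow> PI u y \<in> borel_measurable borel"
  using QI_continuous by (auto intro: borel_measurable_continuous_onI)

lemma QI_bound: "integrable lborel u \<Longrightarrow> y > 0 \<Longrightarrow> \<bar>QI u y t\<bar> \<le> (\<integral>x. \<bar>u x\<bar> \<partial>lborel) / (pi * y)"
  and PI_bound: "integrable lborel u \<Longrightarrow> y > 0 \<Longrightarrow> \<bar>PI u y t\<bar> \<le> (\<integral>x. \<bar>u x\<bar> \<partial>lborel) / (pi * y)"
  using Fc_bound[of u "Complex t y"] abs_Re_le_cmod[of "Fc u (Complex t y)"] abs_Im_le_cmod[of "Fc u (Complex t y)"]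
  by (auto simp: Fc_eq(1))

lemma integrable_pois_bounded:
  assumes f: "f \<in> borel_measurable borel" and B: "\<And>x. \<bar>f x\<bar> \<le> B" and s: "s > 0"
  shows "integrable lborel (\<lambda>x. pois s (x - t) * f x)"
proof (rule Bochner_Integration.integrable_bound[OF integrable_mult_right[OF integrable_pois[OF s, of t], of B]])
  show "AE x in lborel. norm (pois s (x - t) * f x) \<le> norm (B * pois s (x - t))"
  proof (rule AE_I2)
    fix x
    have "pois s (x - t) * \<bar>f x\<bar> \<le> pois s (x - t) * B" by (intro mult_left_mono B pois_nonneg s)
    moreover have "B \<ge> 0" using order_trans[OF abs_ge_zero B] .
    ultimately show "norm (pois s (x - t) * f x) \<le> norm (B * pois s (x - t))"
      using pois_nonneg[OF s, of "x - t"] by (simp add: abs_mult mult.commute)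
  qed
qed (use f in measurable)

text \<open>Real part of Poisson's formula for the raised Cauchy integral. It shows that a limit of
  \<open>QI u y\<close> as \<open>y\<close> tends to 0 has \<open>QI u\<close> as its Poisson
  integral.\<close>

lemma QI_semigroup:
  assumes u: "integrable lborel u" and y: "y > 0" and s: "s > 0"
  shows "(\<integral>x. pois s (x - t) * QI u y x \<partial>lborel) = QI u (s + y) t"
proof -
  have m[measurable]: "QI u y \<in> borel_measurable borel" "PI u y \<in> borel_measurable borel"
    using QI_measurable PI_measurable u y by auto
  have i1: "integrable lborel (\<lambda>x. pois s (x - t) * QI u y x)" and i2: "integrable lborel (\<lambda>x. pois s (x - t) * PI u y x)"
    using integrable_pois_bounded[OF m(1) QI_bound[OF u y] s] integrable_pois_bounded[OF m(2) PI_bound[OF u y] s] by auto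
  have "(\<integral>x. of_real (pois s (x - t)) * Fc u (of_real x + \<i> * of_real y) \<partial>lborel) = Fc u (Complex t s + \<i> * of_real y)"
    by (rule poisson_formula[OF Fc_shift(1)[OF u y] y Fc_shift(2)[OF u y] s])
  also have "Complex t s + \<i> * of_real y = Complex t (s + y)" by (simp add: complex_eq_iff)
  also have "(\<lambda>x. of_real (pois s (x - t)) * Fc u (of_real x + \<i> * of_real y)) =
    (\<lambda>x. of_real (pois s (x - t) * QI u y x) + \<i> * of_real (pois s (x - t) * PI u y x))"
    by (auto simp: of_real_shift Fc_eq(1)[OF u y] complex_eq_iff)
  finally have "(\<integral>x. of_real (pois s (x - t) * QI u y x) + \<i> * of_real (pois s (x - t) * PI u y x) \<partial>lborel) = Complex (QI u (s + y) t) (PI u (s + y) t)"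
    using y s by (simp add: Fc_eq(1)[OF u])
  moreover have "(\<integral>x. of_real (pois s (x - t) * QI u y x) + \<i> * of_real (pois s (x - t) * PI u y x) \<partial>lborel) =
     of_real (\<integral>x. pois s (x - t) * QI u y x \<partial>lborel) + \<i> * of_real (\<integral>x. pois s (x - t) * PI u y x \<partial>lborel)"
    by (subst Bochner_Integration.integral_add) (use i1 i2 in \<open>auto intro!: integrable_of_real integrable_mult_right simp del: of_real_mult\<close>)
  ultimately show ?thesis by (simp add: complex_eq_iff)
qed

text \<open>Harmonic measure of the upper half-plane at \<open>\<i>\<close>, which turns the mean value property into expectations.\<close>
definition nu :: "real measure" where
  "nu = density lborel (\<lambda>x. ennreal (pois 1 x))"

lemma sets_nu[measurable_cong, simp]: "sets nu = sets borel"
  and space_nu[simp]: "space nu = UNIV"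
  by (auto simp: nu_def)

lemma measurable_nu_iff: "f \<in> borel_measurable nu \<longleftrightarrow> f \<in> borel_measurable borel"
  by (simp only: measurable_cong_sets[OF sets_nu refl])

lemma integrable_nu_iff:
  fixes f :: "real \<Rightarrow> real"
  assumes "f \<in> borel_measurable borel"
  shows "integrable nu f \<longleftrightarrow> integrable lborel (\<lambda>x. pois 1 x * f x)"
  unfolding nu_def using assms pois_nonneg[of 1] by (subst integrable_density) auto

lemma integral_nu:
  fixes f :: "real \<Rightarrow> real"
  assumes "f \<in> borel_measurable borel"
  shows "(\<integral>x. f x \<partial>nu) = (\<integral>x. pois 1 x * f x \<partial>lborel)"
  unfolding nu_def using assms pois_nonneg[of 1] by (subst integral_density) auto

lemma nn_integral_nu:
  assumes "f \<in> borel_measurable borel"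
  shows "(\<integral>\<^sup>+x. f x \<partial>nu) = (\<integral>\<^sup>+x. f x * ennreal (pois 1 x) \<partial>lborel)"
  unfolding nu_def using assms by (subst nn_integral_density) (auto simp: mult.commute)

lemma AE_nu_iff: "(AE x in nu. P x) \<longleftrightarrow> (AE x in lborel. P x)"
  unfolding nu_def using pois_pos[of 1] by (subst AE_density) auto

interpretation nu: prob_space nu
proof
  have "emeasure nu (space nu) = (\<integral>\<^sup>+x. ennreal (pois 1 x) \<partial>lborel)"
    unfolding nu_def by (subst emeasure_density) auto
  also have "\<dots> = ennreal (\<integral>x. pois 1 x \<partial>lborel)"
    using has_bochner_integral_pois_1 pois_nonneg[of 1]
    by (intro nn_integral_eq_integral) (auto simp: has_bochner_integral_iff)
  finally show "emeasure nu (space nu) = 1" using integral_pois[of 1 0] by simp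
qed

lemma integrable_nu_bounded:
  fixes f :: "real \<Rightarrow> real"
  assumes "f \<in> borel_measurable borel" "\<And>x. \<bar>f x\<bar> \<le> B"
  shows "integrable nu f"
  by (rule nu.integrable_const_bound[where B=B]) (use assms in \<open>auto simp: measurable_nu_iff\<close>)

lemma integrable_pois_mult:
  assumes h: "integrable nu h" and y: "y > 0"
  shows "integrable lborel (\<lambda>x. pois y (x - t) * h x)"
proof -
  have [measurable]: "h \<in> borel_measurable borel" using h by (auto dest: borel_measurable_integrable simp: measurable_nu_iff)
  let ?C = "y * (2 + (1 + 2 * t\<^sup>2) / y\<^sup>2)"
  have i: "integrable lborel (\<lambda>x. pois 1 x * h x)" using h by (simp add: integrable_nu_iff)
  show ?thesis
  proof (rule Bochner_Integration.integrable_bound[OF integrable_mult_right[OF i, of ?C]])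
    show "AE x in lborel. norm (pois y (x - t) * h x) \<le> norm (?C * (pois 1 x * h x))"
    proof (rule AE_I2)
      fix x
      have C: "?C \<ge> 0" using y by (intro mult_nonneg_nonneg add_nonneg_nonneg divide_nonneg_nonneg) auto
      have "pois y (x - t) * \<bar>h x\<bar> \<le> (?C * pois 1 x) * \<bar>h x\<bar>" by (intro mult_right_mono pois_le_pois_1 y) auto
      then show "norm (pois y (x - t) * h x) \<le> norm (?C * (pois 1 x * h x))"
        using C y pois_nonneg[OF y, of "x - t"] pois_nonneg[of 1 x] by (simp add: abs_mult mult.assoc)
    qed
  qed measurable
qed

lemma tendsto_ennreal_imp_tendsto_0:
  assumes g: "(g \<longlongrightarrow> 0) F" and le: "eventually (\<lambda>x. ennreal (f x) \<le> g x) F"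
    and f: "\<And>x. f x \<ge> 0"
  shows "(f \<longlongrightarrow> (0::real)) F"
proof (rule tendstoI)
  fix e :: real assume e: "e > 0"
  then have "eventually (\<lambda>x. g x < ennreal e) F" using g by (simp add: order_tendsto_iff)
  with le show "eventually (\<lambda>x. dist (f x) 0 < e) F"
    by eventually_elim (use f e in \<open>auto simp: dist_real_def ennreal_less_iff dest: le_less_trans\<close>)
qed

text \<open>The second claim, with the modulus inside the integral, also controls kernels that are
  merely dominated by the Poisson kernel; it is applied to the difference of truncated and conjugate
  Poisson kernels.\<close>

lemma poisson_integral_tendsto:
  assumes h: "integrable nu h" and leb: "lebesgue_point h t"
  shows "((\<lambda>y. \<integral>x. pois y (x - t) * h x \<partial>lborel) \<longlongrightarrow> h t) (at_right 0)"
    and "((\<lambda>y. \<integral>\<^sup>+x. ennreal \<bar>h x - h t\<bar> * ennreal (pois y (x - t)) \<partial>lborel) \<longlongrightarrow> 0) (at_right 0)"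
proof -
  have [measurable]: "h \<in> borel_measurable borel" using h by (auto dest: borel_measurable_integrable simp: measurable_nu_iff)
  have "integrable nu (\<lambda>x. h x - h t)" using h by simp
  then have "integrable lborel (\<lambda>x. pois 1 x * (h x - h t))" by (subst (asm) integrable_nu_iff) auto
  then have "(\<integral>\<^sup>+x. ennreal (norm (pois 1 x * (h x - h t))) \<partial>lborel) < \<infinity>" by (simp add: integrable_iff_bounded)
  then have fin: "(\<integral>\<^sup>+x. ennreal \<bar>h x - h t\<bar> * ennreal (pois 1 x) \<partial>lborel) < \<infinity>"
    using pois_nonneg[of 1] by (simp add: abs_mult ennreal_mult mult.commute)
  show lim: "((\<lambda>y. \<integral>\<^sup>+x. ennreal \<bar>h x - h t\<bar> * ennreal (pois y (x - t)) \<partial>lborel) \<longlongrightarrow> 0) (at_right 0)"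
    by (rule poisson_kernel_tendsto_0[OF _ fin]) (use leb in \<open>auto simp: lebesgue_point_def\<close>)
  show "((\<lambda>y. \<integral>x. pois y (x - t) * h x \<partial>lborel) \<longlongrightarrow> h t) (at_right 0)"
  proof (rule LIM_zero_cancel, rule tendsto_norm_zero_cancel, rule tendsto_ennreal_imp_tendsto_0[OF lim _ norm_ge_zero])
    have "eventually (\<lambda>y::real. y > 0) (at_right 0)" by (simp add: eventually_at_right_less)
    then show "eventually (\<lambda>y. ennreal (norm ((\<integral>x. pois y (x - t) * h x \<partial>lborel) - h t)) \<le> (\<integral>\<^sup>+x. ennreal \<bar>h x - h t\<bar> * ennreal (pois y (x - t)) \<partial>lborel)) (at_right 0)"
    proof eventually_elim
      case (elim y)
      have "(\<integral>x. pois y (x - t) * h x \<partial>lborel) - h t = (\<integral>x. pois y (x - t) * h x \<partial>lborel) - (\<integral>x. pois y (x - t) * h t \<partial>lborel)"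
        using integral_pois[OF elim, of t] by simp
      also have "\<dots> = (\<integral>x. pois y (x - t) * h x - pois y (x - t) * h t \<partial>lborel)"
        by (rule Bochner_Integration.integral_diff[symmetric]) (use integrable_pois_mult[OF h elim] integrable_pois[OF elim] in auto)
      finally have "ennreal (norm ((\<integral>x. pois y (x - t) * h x \<partial>lborel) - h t)) \<le> (\<integral>\<^sup>+x. ennreal (norm (pois y (x - t) * h x - pois y (x - t) * h t)) \<partial>lborel)"
        by (simp only:) (rule integral_norm_bound_ennreal, use integrable_pois_mult[OF h elim] integrable_pois[OF elim] in auto)
      also have "\<dots> = (\<integral>\<^sup>+x. ennreal \<bar>h x - h t\<bar> * ennreal (pois y (x - t)) \<partial>lborel)"
      proof (intro nn_integral_cong)
        fix x
        have "pois y (x - t) * h x - pois y (x - t) * h t = pois y (x - t) * (h x - h t)" by (simp add: right_diff_distrib)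
        then show "ennreal (norm (pois y (x - t) * h x - pois y (x - t) * h t)) = ennreal \<bar>h x - h t\<bar> * ennreal (pois y (x - t))"
          using pois_nonneg[OF elim, of "x - t"] by (simp only: real_norm_def abs_mult abs_of_nonneg) (simp add: ennreal_mult mult.commute)
      qed
      finally show ?case .
    qed
  qed
qed

subsection \<open>The Hilbert transform on the line\<close>

lemma L1_complete:
  fixes u :: "nat \<Rightarrow> 'a \<Rightarrow> real"
  assumes int: "\<And>n. integrable M (u n)"
    and cau: "\<And>e. e > 0 \<Longrightarrow> \<exists>N. \<forall>i\<ge>N. \<forall>j\<ge>N. (LINT x|M. norm (u i x - u j x)) < e"
  obtains f where "integrable M f" "(\<lambda>n. \<integral>x. \<bar>u n x - f x\<bar> \<partial>M) \<longlonglongrightarrow> 0"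
proof -
  have [measurable]: "\<And>n. u n \<in> borel_measurable M" using int by auto
  obtain f r where fr: "f \<in> borel_measurable M" "strict_mono r" "AE x in M. (\<lambda>i. u (r i) x) \<longlonglongrightarrow> f x"
    using Cauchy_L1_limit[where u=u, OF int cau] by blast
  note [measurable] = fr(1)
  have ev: "\<exists>N. \<forall>n\<ge>N. (\<integral>\<^sup>+x. ennreal \<bar>u n x - f x\<bar> \<partial>M) \<le> ennreal e" if e: "e > 0" for e
  proof -
    obtain N where N: "\<forall>i\<ge>N. \<forall>j\<ge>N. (LINT x|M. norm (u i x - u j x)) < e" using cau[OF e] by blast
    have "(\<integral>\<^sup>+x. ennreal \<bar>u n x - f x\<bar> \<partial>M) \<le> ennreal e" if n: "n \<ge> N" for n
    proof -
      have "(\<integral>\<^sup>+x. ennreal \<bar>u n x - f x\<bar> \<partial>M) = (\<integral>\<^sup>+x. liminf (\<lambda>i. ennreal \<bar>u n x - u (r i) x\<bar>) \<partial>M)"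
      proof (rule nn_integral_cong_AE)
        show "AE x in M. ennreal \<bar>u n x - f x\<bar> = liminf (\<lambda>i. ennreal \<bar>u n x - u (r i) x\<bar>)"
          using fr(3)
        proof eventually_elim
          case (elim x)
          have "(\<lambda>i. ennreal \<bar>u n x - u (r i) x\<bar>) \<longlonglongrightarrow> ennreal \<bar>u n x - f x\<bar>"
            by (intro tendsto_ennrealI tendsto_rabs tendsto_diff tendsto_const elim)
          then show ?case using lim_imp_Liminf[of sequentially] by (metis sequentially_bot)
        qed
      qed
      also have "\<dots> \<le> liminf (\<lambda>i. \<integral>\<^sup>+x. ennreal \<bar>u n x - u (r i) x\<bar> \<partial>M)" by (rule nn_integral_liminf) measurable
      also have "\<dots> \<le> limsup (\<lambda>i. \<integral>\<^sup>+x. ennreal \<bar>u n x - u (r i) x\<bar> \<partial>M)" by (rule Liminf_le_Limsup) simp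
      also have "\<dots> \<le> ennreal e"
      proof (rule Limsup_bounded)
        show "\<forall>\<^sub>F i in sequentially. (\<integral>\<^sup>+x. ennreal \<bar>u n x - u (r i) x\<bar> \<partial>M) \<le> ennreal e"
          using eventually_ge_at_top[of N]
        proof eventually_elim
          case (elim i)
          then have ri: "r i \<ge> N" using seq_suble[OF fr(2), of i] by simp
          have "(\<integral>\<^sup>+x. ennreal \<bar>u n x - u (r i) x\<bar> \<partial>M) = ennreal (LINT x|M. norm (u n x - u (r i) x))"
            using int by (subst nn_integral_eq_integral[symmetric]) auto
          also have "\<dots> \<le> ennreal e" using N n ri by (intro ennreal_leI less_imp_le) blast
          finally show ?case .
        qed
      qed
      finally show ?thesis .
    qed
    then show ?thesis by blast
  qed
  obtain N where N: "\<forall>n\<ge>N. (\<integral>\<^sup>+x. ennreal \<bar>u n x - f x\<bar> \<partial>M) \<le> ennreal 1" using ev[of 1] by auto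
  have "integrable M (\<lambda>x. u N x - f x)"
    using N by (intro integrableI_bounded) (auto intro: le_less_trans)
  then have "integrable M (\<lambda>x. u N x - (u N x - f x))" by (rule Bochner_Integration.integrable_diff[OF int])
  then have fi: "integrable M f" by (simp only: diff_diff_eq2 add_diff_cancel_left')
  moreover have "(\<lambda>n. \<integral>x. \<bar>u n x - f x\<bar> \<partial>M) \<longlonglongrightarrow> 0"
  proof (rule LIMSEQ_I)
    fix e :: real assume e: "e > 0"
    obtain N where N: "\<forall>n\<ge>N. (\<integral>\<^sup>+x. ennreal \<bar>u n x - f x\<bar> \<partial>M) \<le> ennreal (e / 2)" using ev[of "e/2"] e by auto
    have "norm ((\<integral>x. \<bar>u n x - f x\<bar> \<partial>M) - 0) < e" if n: "n \<ge> N" for n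
    proof -
      have "ennreal (\<integral>x. \<bar>u n x - f x\<bar> \<partial>M) \<le> ennreal (e / 2)"
        using N n int fi by (subst nn_integral_eq_integral[symmetric]) auto
      then have "(\<integral>x. \<bar>u n x - f x\<bar> \<partial>M) \<le> e / 2" using e by (simp add: ennreal_le_iff)
      moreover have "(\<integral>x. \<bar>u n x - f x\<bar> \<partial>M) \<ge> 0" by (rule integral_nonneg_AE) simp
      ultimately show ?thesis using e by simp
    qed
    then show "\<exists>no. \<forall>n\<ge>no. norm ((\<integral>x. \<bar>u n x - f x\<bar> \<partial>M) - 0) < e" by blast
  qed
  ultimately show ?thesis using that by blast
qed

definition yseq :: "nat \<Rightarrow> real" where "yseq n = 1 / (real n + 1)"

lemma yseq_pos: "yseq n > 0" and yseq_le_1: "yseq n \<le> 1"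
  by (auto simp: yseq_def)

lemma yseq_tendsto: "yseq \<longlonglongrightarrow> 0"
  unfolding yseq_def by real_asymp

lemma yseq_at_right: "filterlim yseq (at_right 0) sequentially"
  unfolding filterlim_at
  by (intro conjI yseq_tendsto always_eventually allI) (use yseq_pos in \<open>auto simp: less_le\<close>)

text \<open>
  \<open>bdry u h\<close>: the conjugate Poisson integral of \<open>u\<close> is the Poisson integral of \<open>h\<close>, so \<open>h\<close> is the Hilbert
  transform of \<open>u\<close>. The stronger \<open>hil u h\<close> adds convergence in \<open>L\<^sup>1(nu)\<close> at the boundary.
\<close>
definition bdry :: "(real \<Rightarrow> real) \<Rightarrow> (real \<Rightarrow> real) \<Rightarrow> bool" where
  "bdry u h \<longleftrightarrow> integrable nu h \<and> (\<forall>y>0. \<forall>t. QI u y t = (\<integral>x. pois y (x - t) * h x \<partial>lborel))"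

definition hil :: "(real \<Rightarrow> real) \<Rightarrow> (real \<Rightarrow> real) \<Rightarrow> bool" where
  "hil u h \<longleftrightarrow> bdry u h \<and> (\<lambda>n. \<integral>x. \<bar>QI u (yseq n) x - h x\<bar> \<partial>nu) \<longlonglongrightarrow> 0"

text \<open>Domination by the density of \<open>nu\<close>: multiples of the dual unit ball of
  L^1(\<open>nu\<close>), written as functions to be integrated for Lebesgue measure. Such functions
  pair with every boundary function, and bounded functions on the interval are among them.\<close>

definition dom :: "real \<Rightarrow> (real \<Rightarrow> real) \<Rightarrow> bool" where
  "dom C u \<longleftrightarrow> u \<in> borel_measurable borel \<and> (\<forall>x. \<bar>u x\<bar> \<le> C * pois 1 x)"

lemma bdry_integrable: "bdry u h \<Longrightarrow> integrable nu h"
  and bdry_measurable: "bdry u h \<Longrightarrow> h \<in> borel_measurable borel"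
  unfolding bdry_def by (blast, metis borel_measurable_integrable measurable_nu_iff)

lemma hil_bdry: "hil u h \<Longrightarrow> bdry u h"
  by (simp add: hil_def)

lemma integrable_pois_1: "integrable lborel (pois 1)"
  using integrable_pois[of 1 0] by simp

lemma dom_facts:
  assumes "dom C u"
  shows dom_measurable: "u \<in> borel_measurable borel" and dom_nonneg: "0 \<le> C"
    and dom_bound: "\<bar>u x\<bar> \<le> C" and dom_integrable: "integrable lborel u"
    and dom_L1: "(\<integral>x. \<bar>u x\<bar> \<partial>lborel) \<le> C" and dom_integrable_nu: "integrable nu u"
proof -
  show m[measurable]: "u \<in> borel_measurable borel" using assms by (simp add: dom_def)
  have d: "\<bar>u x\<bar> \<le> C * pois 1 x" for x using assms by (simp add: dom_def)
  have "0 \<le> C * pois 1 0" using d[of 0] by (rule order_trans[OF abs_ge_zero])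
  then show C: "0 \<le> C" using pois_pos[of 1 0] by (simp add: zero_le_mult_iff)
  have b: "\<bar>u x\<bar> \<le> C" for x
    using order_trans[OF d mult_left_mono[OF pois_bound[of 1 x] C]] by simp
  then show "\<bar>u x\<bar> \<le> C" .
  show i: "integrable lborel u"
    by (rule Bochner_Integration.integrable_bound[OF integrable_mult_right[OF integrable_pois_1, of C]])
       (use d C pois_nonneg[of 1] in \<open>auto simp: abs_mult\<close>)
  have "(\<integral>x. \<bar>u x\<bar> \<partial>lborel) \<le> (\<integral>x. C * pois 1 x \<partial>lborel)"
    using i integrable_pois_1 d by (intro integral_mono) auto
  also have "\<dots> = C" using integral_pois[of 1 0] by simp
  finally show "(\<integral>x. \<bar>u x\<bar> \<partial>lborel) \<le> C" .
  show "integrable nu u" by (rule integrable_nu_bounded[OF m b])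
qed

lemma PI_le:
  assumes d: "dom C u" and y: "y > 0" shows "\<bar>PI u y t\<bar> \<le> C"
proof -
  have "norm (PI u y t) \<le> (\<integral>x. C * pois y (x - t) \<partial>lborel)"
    unfolding PI_def
  proof (rule integral_norm_le[OF integrable_mult_pois[OF dom_integrable[OF d] y]])
    show "norm (u x * pois y (x - t)) \<le> C * pois y (x - t)" for x
      using mult_right_mono[OF dom_bound[OF d, of x] pois_nonneg[OF y, of "x - t"]] pois_nonneg[OF y, of "x - t"]
      by (simp add: abs_mult)
  qed (use integrable_pois[OF y] in auto)
  also have "\<dots> = C" using integral_pois[OF y, of t] by simp
  finally show ?thesis by simp
qed

lemma PI_AE_tendsto:
  assumes u: "integrable lborel u"
  shows "AE t in lborel. ((\<lambda>y. PI u y t) \<longlongrightarrow> u t) (at_right 0)"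
proof -
  have [measurable]: "u \<in> borel_measurable borel" using u by auto
  have "integrable lborel (\<lambda>x. u x * pois 1 (x - 0))" by (rule integrable_mult_pois[OF u]) simp
  then have nu: "integrable nu u" by (subst integrable_nu_iff) (auto simp: mult.commute)
  show ?thesis using AE_lebesgue_point_integrable[OF u]
  proof eventually_elim
    case (elim t)
    show ?case using poisson_integral_tendsto(1)[OF nu elim] by (simp add: PI_def mult.commute)
  qed
qed

lemma PI_L1_tendsto:
  assumes d: "dom C u"
  shows "(\<lambda>n. \<integral>t. \<bar>PI u (yseq n) t - u t\<bar> \<partial>nu) \<longlonglongrightarrow> 0"
proof -
  note u = dom_integrable[OF d]
  have [measurable]: "u \<in> borel_measurable borel" "\<And>n. PI u (yseq n) \<in> borel_measurable borel"
    using u PI_measurable[OF u yseq_pos] by auto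
  have "(\<lambda>n. \<integral>t. \<bar>PI u (yseq n) t - u t\<bar> \<partial>nu) \<longlonglongrightarrow> (\<integral>t. 0 \<partial>nu)"
  proof (rule integral_dominated_convergence[where w="\<lambda>x. 2 * C"])
    show "AE x in nu. (\<lambda>n. \<bar>PI u (yseq n) x - u x\<bar>) \<longlonglongrightarrow> 0"
      unfolding AE_nu_iff using PI_AE_tendsto[OF u]
    proof eventually_elim
      case (elim t)
      have "(\<lambda>n. \<bar>PI u (yseq n) t - u t\<bar>) \<longlonglongrightarrow> \<bar>u t - u t\<bar>"
        by (intro tendsto_intros filterlim_compose[OF elim yseq_at_right])
      then show ?case by simp
    qed
    show "AE x in nu. norm \<bar>PI u (yseq n) x - u x\<bar> \<le> 2 * C" for n
    proof (rule AE_I2)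
      fix x
      have "\<bar>PI u (yseq n) x - u x\<bar> \<le> \<bar>PI u (yseq n) x\<bar> + \<bar>u x\<bar>" by simp
      then show "norm \<bar>PI u (yseq n) x - u x\<bar> \<le> 2 * C" using PI_le[OF d yseq_pos, of n x] dom_bound[OF d, of x] by simp
    qed
  qed auto
  then show ?thesis by simp
qed

section \<open>Existence of boundary functions\<close>

lemma Re_poisson_formula_i:
  assumes hol: "G holomorphic_on {z. Im z > - d}" and d: "d > 0"
    and B: "\<And>z. Im z \<ge> 0 \<Longrightarrow> cmod (G z) \<le> B"
  shows "(\<integral>s. pois 1 s * Re (G (of_real s)) \<partial>lborel) = Re (G \<i>)"
    and "integrable lborel (\<lambda>s. pois 1 s * Re (G (of_real s)))"
proof -
  have contG: "continuous_on UNIV (\<lambda>x::real. G (of_real x))"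
    by (rule continuous_on_compose2[OF holomorphic_on_imp_continuous_on[OF hol]])
       (use d in \<open>auto intro!: continuous_intros\<close>)
  then have [measurable]: "(\<lambda>x::real. G (of_real x)) \<in> borel_measurable borel"
    by (rule borel_measurable_continuous_onI)
  have int: "integrable lborel (\<lambda>s. of_real (pois 1 s) * G (of_real s))"
  proof (rule Bochner_Integration.integrable_bound[OF integrable_mult_right[OF integrable_pois_1, of B]])
    have B0: "B \<ge> 0" using order_trans[OF norm_ge_zero B[of 0]] by simp
    show "AE x in lborel. norm (of_real (pois 1 x) * G (of_real x)) \<le> norm (B * pois 1 x)"
    proof (rule AE_I2)
      fix x :: real
      have "norm (of_real (pois 1 x) * G (of_real x)) = pois 1 x * cmod (G (of_real x))" "norm (B * pois 1 x) = pois 1 x * B"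
        using B0 pois_nonneg[of 1 x] by (simp_all add: norm_mult)
      then show "norm (of_real (pois 1 x) * G (of_real x)) \<le> norm (B * pois 1 x)"
        using mult_left_mono[OF B[of "of_real x"] pois_nonneg[of 1 x]] by simp
    qed
  qed simp
  have eq: "pois 1 s * Re (G (of_real s)) = Re (of_real (pois 1 s) * G (of_real s))" for s by simp
  show "integrable lborel (\<lambda>s. pois 1 s * Re (G (of_real s)))" unfolding eq by (rule integrable_Re[OF int])
  show "(\<integral>s. pois 1 s * Re (G (of_real s)) \<partial>lborel) = Re (G \<i>)"
    unfolding eq integral_Re[OF int] by (simp only: poisson_formula_i[OF hol d B])
qed

text \<open>The real part of the square of a Cauchy integral is Q^2 - P^2. Poisson's formula for the
  difference of two raised Cauchy integrals thus bounds Q in L^2(\<open>nu\<close>) by P and the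
  value above \<i>; this plays the part of the L^2 isometry of the Hilbert transform.\<close>

lemma QI_diff_L2:
  assumes u: "integrable lborel u" and y: "y > 0" and s: "s > 0"
  shows "(\<integral>t. (QI u y t - QI u s t)\<^sup>2 \<partial>nu) \<le> (\<integral>t. (PI u y t - PI u s t)\<^sup>2 \<partial>nu) + (cmod (Fc u (Complex 0 (1 + y)) - Fc u (Complex 0 (1 + s))))\<^sup>2"
proof -
  let ?B = "\<lambda>y. (\<integral>x. \<bar>u x\<bar> \<partial>lborel) / (pi * y)"
  let ?G = "\<lambda>z. (Fc u (z + \<i> * of_real y) - Fc u (z + \<i> * of_real s))\<^sup>2"
  have [measurable]: "QI u y \<in> borel_measurable borel" "QI u s \<in> borel_measurable borel" "PI u y \<in> borel_measurable borel" "PI u s \<in> borel_measurable borel"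
    using QI_measurable[OF u] PI_measurable[OF u] y s by auto
  have hol: "?G holomorphic_on {z. Im z > - min y s}"
    by (intro holomorphic_intros; rule holomorphic_on_subset[OF Fc_shift(1)[OF u]]) (use y s in auto)
  have bd: "cmod (?G z) \<le> (?B y + ?B s)\<^sup>2" if "Im z \<ge> 0" for z
  proof -
    have "cmod (Fc u (z + \<i> * of_real y) - Fc u (z + \<i> * of_real s)) \<le> ?B y + ?B s"
      by (rule order_trans[OF norm_triangle_ineq4 add_mono[OF Fc_shift(2)[OF u y that] Fc_shift(2)[OF u s that]]])
    then show ?thesis unfolding norm_power by (intro power_mono) auto
  qed
  have R: "Re (?G (of_real t)) = (QI u y t - QI u s t)\<^sup>2 - (PI u y t - PI u s t)\<^sup>2" for t
    by (simp add: of_real_shift Fc_eq(1)[OF u y] Fc_eq(1)[OF u s] Re_power2)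
  have ib: "integrable nu (\<lambda>t. (QI u y t - QI u s t)\<^sup>2)" "integrable nu (\<lambda>t. (PI u y t - PI u s t)\<^sup>2)"
  proof -
    have "\<bar>(QI u y t - QI u s t)\<^sup>2\<bar> \<le> (?B y + ?B s)\<^sup>2" for t
    proof -
      have "\<bar>QI u y t - QI u s t\<bar> \<le> ?B y + ?B s"
        by (rule order_trans[OF abs_triangle_ineq4 add_mono[OF QI_bound[OF u y] QI_bound[OF u s]]])
      then have "\<bar>QI u y t - QI u s t\<bar>\<^sup>2 \<le> (?B y + ?B s)\<^sup>2" by (intro power_mono) auto
      then show ?thesis by simp
    qed
    then show "integrable nu (\<lambda>t. (QI u y t - QI u s t)\<^sup>2)" by (intro integrable_nu_bounded) auto
    have "\<bar>(PI u y t - PI u s t)\<^sup>2\<bar> \<le> (?B y + ?B s)\<^sup>2" for t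
    proof -
      have "\<bar>PI u y t - PI u s t\<bar> \<le> ?B y + ?B s"
        by (rule order_trans[OF abs_triangle_ineq4 add_mono[OF PI_bound[OF u y] PI_bound[OF u s]]])
      then have "\<bar>PI u y t - PI u s t\<bar>\<^sup>2 \<le> (?B y + ?B s)\<^sup>2" by (intro power_mono) auto
      then show ?thesis by simp
    qed
    then show "integrable nu (\<lambda>t. (PI u y t - PI u s t)\<^sup>2)" by (intro integrable_nu_bounded) auto
  qed
  have "(\<integral>t. (QI u y t - QI u s t)\<^sup>2 \<partial>nu) - (\<integral>t. (PI u y t - PI u s t)\<^sup>2 \<partial>nu) = (\<integral>t. (QI u y t - QI u s t)\<^sup>2 - (PI u y t - PI u s t)\<^sup>2 \<partial>nu)"
    using ib by simp
  also have "\<dots> = (\<integral>t. pois 1 t * Re (?G (of_real t)) \<partial>lborel)" by (subst integral_nu) (auto simp only: R, measurable)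
  also have "\<dots> = Re (?G \<i>)" by (rule Re_poisson_formula_i(1)[OF hol _ bd]) (use y s in auto)
  also have "\<dots> \<le> cmod (?G \<i>)" by (rule complex_Re_le_cmod)
  also have "\<dots> = (cmod (Fc u (Complex 0 (1 + y)) - Fc u (Complex 0 (1 + s))))\<^sup>2"
  proof -
    have "\<i> + \<i> * of_real y = Complex 0 (1 + y)" for y by (simp add: complex_eq_iff)
    then show ?thesis by (simp add: norm_power)
  qed
  finally show ?thesis by simp
qed

lemma Fc_yseq_tendsto:
  assumes u: "integrable lborel u" and s: "s > 0"
  shows "(\<lambda>n. Fc u (Complex t (s + yseq n))) \<longlonglongrightarrow> Fc u (Complex t s)"
proof -
  have "isCont (Fc u) (Complex t s)"
    using Fc_holomorphic[OF u] s holomorphic_on_imp_continuous_on continuous_on_eq_continuous_at[OF open_halfspace_Im_gt[of 0]] by force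
  moreover have "(\<lambda>n. Complex t (s + yseq n)) \<longlonglongrightarrow> Complex t (s + 0)"
    by (intro tendsto_intros yseq_tendsto)
  ultimately show ?thesis using isCont_tendsto_compose by fastforce
qed

lemma QI_yseq_tendsto:
  assumes u: "integrable lborel u" and s: "s > 0"
  shows "(\<lambda>n. QI u (s + yseq n) t) \<longlonglongrightarrow> QI u s t"
proof -
  have eq: "QI u y t = Re (Fc u (Complex t y))" if "y > 0" for y using Fc_eq(1)[OF u that] by simp
  have "(\<lambda>n. Re (Fc u (Complex t (s + yseq n)))) \<longlonglongrightarrow> Re (Fc u (Complex t s))"
    by (rule tendsto_Re[OF Fc_yseq_tendsto[OF u s]])
  then show ?thesis using s yseq_pos by (simp add: eq add_pos_pos)
qed

lemma poisson_L1_continuity: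
  assumes hn: "\<And>n. integrable nu (h n)" and h: "integrable nu h'" and lim: "(\<lambda>n. \<integral>x. \<bar>h n x - h' x\<bar> \<partial>nu) \<longlonglongrightarrow> 0"
    and y: "y > 0"
  shows "(\<lambda>n. \<integral>x. pois y (x - t) * h n x \<partial>lborel) \<longlonglongrightarrow> (\<integral>x. pois y (x - t) * h' x \<partial>lborel)"
proof (rule LIM_zero_cancel, rule Lim_null_comparison)
  let ?C = "y * (2 + (1 + 2 * t\<^sup>2) / y\<^sup>2)"
  have [measurable]: "h' \<in> borel_measurable borel" "\<And>n. h n \<in> borel_measurable borel"
    using hn h by (auto dest!: borel_measurable_integrable simp: measurable_nu_iff)
  have C: "?C \<ge> 0" using y by (intro mult_nonneg_nonneg add_nonneg_nonneg divide_nonneg_nonneg) auto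
  show "\<forall>\<^sub>F n in sequentially. norm ((\<integral>x. pois y (x - t) * h n x \<partial>lborel) - (\<integral>x. pois y (x - t) * h' x \<partial>lborel)) \<le> ?C * (\<integral>x. \<bar>h n x - h' x\<bar> \<partial>nu)"
  proof (rule always_eventually, rule allI)
    fix n
    have i: "integrable lborel (\<lambda>x. pois y (x - t) * h n x - pois y (x - t) * h' x)"
      by (intro Bochner_Integration.integrable_diff integrable_pois_mult hn h y)
    have "integrable nu (\<lambda>x. \<bar>h n x - h' x\<bar>)" using hn h by auto
    then have i2: "integrable lborel (\<lambda>x. pois 1 x * \<bar>h n x - h' x\<bar>)" by (subst (asm) integrable_nu_iff) auto
    have diff: "(\<integral>x. pois y (x - t) * h n x \<partial>lborel) - (\<integral>x. pois y (x - t) * h' x \<partial>lborel) = (\<integral>x. pois y (x - t) * h n x - pois y (x - t) * h' x \<partial>lborel)"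
      by (rule Bochner_Integration.integral_diff[symmetric]; rule integrable_pois_mult[OF _ y]) (auto intro: hn h)
    have "norm (\<integral>x. pois y (x - t) * h n x - pois y (x - t) * h' x \<partial>lborel) \<le> (\<integral>x. ?C * (pois 1 x * \<bar>h n x - h' x\<bar>) \<partial>lborel)"
    proof (rule integral_norm_le[OF i])
      show "integrable lborel (\<lambda>x. ?C * (pois 1 x * \<bar>h n x - h' x\<bar>))" by (rule integrable_mult_right[OF i2])
      fix x
      have "norm (pois y (x - t) * h n x - pois y (x - t) * h' x) = pois y (x - t) * \<bar>h n x - h' x\<bar>"
        using pois_nonneg[OF y, of "x - t"] by (simp add: abs_mult flip: right_diff_distrib)
      also have "\<dots> \<le> (?C * pois 1 x) * \<bar>h n x - h' x\<bar>" by (intro mult_right_mono pois_le_pois_1 y) auto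
      finally show "norm (pois y (x - t) * h n x - pois y (x - t) * h' x) \<le> ?C * (pois 1 x * \<bar>h n x - h' x\<bar>)" by (simp only: mult.assoc)
    qed
    also have "\<dots> = ?C * (\<integral>x. pois 1 x * \<bar>h n x - h' x\<bar> \<partial>lborel)"
      by (rule integral_mult_right_zero)
    also have "(\<integral>x. pois 1 x * \<bar>h n x - h' x\<bar> \<partial>lborel) = (\<integral>x. \<bar>h n x - h' x\<bar> \<partial>nu)"
      by (rule integral_nu[symmetric]) measurable
    finally show "norm ((\<integral>x. pois y (x - t) * h n x \<partial>lborel) - (\<integral>x. pois y (x - t) * h' x \<partial>lborel)) \<le> ?C * (\<integral>x. \<bar>h n x - h' x\<bar> \<partial>nu)"
      unfolding diff .
  qed
  show "(\<lambda>n. ?C * (\<integral>x. \<bar>h n x - h' x\<bar> \<partial>nu)) \<longlonglongrightarrow> 0"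
    by (rule tendsto_mult_right_zero[OF lim])
qed

text \<open>By \<open>QI_diff_L2\<close> the functions \<open>QI u (yseq n)\<close> are Cauchy in
  L^2(\<open>nu\<close>), because the \<open>PI u (yseq n)\<close> are and the values at \<i> + \<i>
  \<open>yseq n\<close> converge. As \<open>nu\<close> is finite they are Cauchy in
  L^1(\<open>nu\<close>), and the semigroup property identifies the limit as a boundary
  function.\<close>

theorem hil_exists:
  assumes d: "dom C u"
  shows "\<exists>h. hil u h"
proof -
  note u = dom_integrable[OF d]
  note C0 = dom_nonneg[OF d]
  have [measurable]: "\<And>n. QI u (yseq n) \<in> borel_measurable borel" "\<And>n. PI u (yseq n) \<in> borel_measurable borel" "u \<in> borel_measurable borel"
    using QI_measurable[OF u yseq_pos] PI_measurable[OF u yseq_pos] u by auto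
  have iQ: "integrable nu (QI u (yseq n))" for n
    by (rule integrable_nu_bounded[OF _ QI_bound[OF u yseq_pos]]) measurable
  have iP: "integrable nu (PI u (yseq n))" for n
    by (rule integrable_nu_bounded[OF _ PI_le[OF d yseq_pos]]) measurable
  note iu = dom_integrable_nu[OF d]
  have L2: "\<exists>N. \<forall>i\<ge>N. \<forall>j\<ge>N. (\<integral>t. (QI u (yseq i) t - QI u (yseq j) t)\<^sup>2 \<partial>nu) < e" if e: "e > 0" for e
  proof -
    define a where "a n = (\<integral>t. \<bar>PI u (yseq n) t - u t\<bar> \<partial>nu)" for n
    define F where "F n = Fc u (Complex 0 (1 + yseq n))" for n
    have "Cauchy F" unfolding F_def by (rule LIMSEQ_imp_Cauchy[OF Fc_yseq_tendsto[OF u]]) simp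
    moreover have "sqrt (e / 2) > 0" using e by simp
    ultimately obtain N1 where N1: "\<And>i j. i \<ge> N1 \<Longrightarrow> j \<ge> N1 \<Longrightarrow> cmod (F i - F j) < sqrt (e / 2)"
      by (metis Cauchy_def dist_norm)
    have "(\<lambda>n. 2 * C * a n) \<longlonglongrightarrow> 0"
      unfolding a_def using tendsto_mult_right_zero[OF PI_L1_tendsto[OF d], of "2 * C"] by simp
    from order_tendstoD(2)[OF this, of "e / 4"] e have "\<exists>N. \<forall>n\<ge>N. 2 * C * a n < e / 4"
      unfolding eventually_sequentially by simp
    then obtain N2 where N2: "\<And>n. n \<ge> N2 \<Longrightarrow> 2 * C * a n < e / 4" by blast
    have "(\<integral>t. (QI u (yseq i) t - QI u (yseq j) t)\<^sup>2 \<partial>nu) < e" if ij: "i \<ge> max N1 N2" "j \<ge> max N1 N2" for i j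
    proof -
      have "(\<integral>t. (PI u (yseq i) t - PI u (yseq j) t)\<^sup>2 \<partial>nu) \<le> (\<integral>t. 2 * C * \<bar>PI u (yseq i) t - u t\<bar> + 2 * C * \<bar>PI u (yseq j) t - u t\<bar> \<partial>nu)"
      proof (rule integral_mono)
        fix t
        let ?p = "PI u (yseq i) t" and ?q = "PI u (yseq j) t"
        \<comment> \<open>The bound by \<open>C\<close> upgrades the L^1 convergence of
          \<open>PI\<close> to L^2: one factor of the square is estimated by
          \<open>2 * C\<close>.\<close>
        have "\<bar>?p - ?q\<bar> \<le> 2 * C" using PI_le[OF d yseq_pos, of i t] PI_le[OF d yseq_pos, of j t] by linarith
        then have "\<bar>?p - ?q\<bar> * \<bar>?p - ?q\<bar> \<le> 2 * C * (\<bar>?p - u t\<bar> + \<bar>?q - u t\<bar>)" by (intro mult_mono) (use C0 in auto)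
        then show "(?p - ?q)\<^sup>2 \<le> 2 * C * \<bar>?p - u t\<bar> + 2 * C * \<bar>?q - u t\<bar>" by (simp add: power2_eq_square distrib_left abs_mult_self_eq)
      next
        have "\<bar>(PI u (yseq i) t - PI u (yseq j) t)\<^sup>2\<bar> \<le> (2 * C)\<^sup>2" for t
        proof -
          have "\<bar>PI u (yseq i) t - PI u (yseq j) t\<bar> \<le> 2 * C" using PI_le[OF d yseq_pos, of i t] PI_le[OF d yseq_pos, of j t] by linarith
          then have "\<bar>PI u (yseq i) t - PI u (yseq j) t\<bar>\<^sup>2 \<le> (2 * C)\<^sup>2" by (intro power_mono) auto
          then show ?thesis by simp
        qed
        then show "integrable nu (\<lambda>t. (PI u (yseq i) t - PI u (yseq j) t)\<^sup>2)" by (intro integrable_nu_bounded) auto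
        show "integrable nu (\<lambda>t. 2 * C * \<bar>PI u (yseq i) t - u t\<bar> + 2 * C * \<bar>PI u (yseq j) t - u t\<bar>)"
          using iP iu by auto
      qed
      also have "\<dots> = 2 * C * a i + 2 * C * a j"
        unfolding a_def using iP iu by (subst Bochner_Integration.integral_add) auto
      also have "\<dots> < e / 4 + e / 4" using N2 ij by (intro add_strict_mono) auto
      finally have "(\<integral>t. (PI u (yseq i) t - PI u (yseq j) t)\<^sup>2 \<partial>nu) < e / 2" by simp
      moreover have "(cmod (F i - F j))\<^sup>2 < e / 2"
      proof -
        have "(cmod (F i - F j))\<^sup>2 < (sqrt (e / 2))\<^sup>2" using N1 ij by (intro power_strict_mono) auto
        then show ?thesis using e by simp
      qed
      ultimately show ?thesis using QI_diff_L2[OF u yseq_pos yseq_pos, of i j] by (simp add: F_def)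
    qed
    then show ?thesis by blast
  qed
  have cau: "\<exists>N. \<forall>i\<ge>N. \<forall>j\<ge>N. (LINT x|nu. norm (QI u (yseq i) x - QI u (yseq j) x)) < e" if e: "e > 0" for e
  proof -
    have "e\<^sup>2 > 0" using e by simp
    from L2[OF this] obtain N where N: "\<forall>i\<ge>N. \<forall>j\<ge>N. (\<integral>t. (QI u (yseq i) t - QI u (yseq j) t)\<^sup>2 \<partial>nu) < e\<^sup>2" by blast
    have "(LINT x|nu. norm (QI u (yseq i) x - QI u (yseq j) x)) < e" if ij: "i \<ge> N" "j \<ge> N" for i j
    proof -
      let ?D = "\<lambda>x. QI u (yseq i) x - QI u (yseq j) x"
      let ?b = "\<lambda>n. (\<integral>x. \<bar>u x\<bar> \<partial>lborel) / (pi * yseq n)"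
      have iD: "integrable nu (\<lambda>t. (?D t)\<^sup>2)"
      proof (rule integrable_nu_bounded[where B="(?b i + ?b j)\<^sup>2"])
        fix t
        have "\<bar>?D t\<bar> \<le> ?b i + ?b j"
          by (rule order_trans[OF abs_triangle_ineq4 add_mono[OF QI_bound[OF u yseq_pos] QI_bound[OF u yseq_pos]]])
        then have "\<bar>?D t\<bar>\<^sup>2 \<le> (?b i + ?b j)\<^sup>2" by (intro power_mono) auto
        then show "\<bar>(?D t)\<^sup>2\<bar> \<le> (?b i + ?b j)\<^sup>2" by simp
      qed measurable
      have "(LINT x|nu. norm (?D x)) \<le> (LINT x|nu. e / 2 + (?D x)\<^sup>2 / (2 * e))"
      proof (rule integral_mono)
        fix x
        \<comment> \<open>The inequality 2 e \<bar>D\<bar> \<le> e^2 + D^2 replaces that of Cauchy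
          and Schwarz, as \<open>nu\<close> has mass 1.\<close>
        have "0 \<le> (\<bar>?D x\<bar> - e)\<^sup>2" by simp
        then have "2 * e * \<bar>?D x\<bar> \<le> e\<^sup>2 + (?D x)\<^sup>2" by (simp add: power2_diff algebra_simps)
        then show "norm (?D x) \<le> e / 2 + (?D x)\<^sup>2 / (2 * e)" using e by (simp add: field_simps power2_eq_square)
      qed (use iQ iD in auto)
      also have "\<dots> = e / 2 + (LINT x|nu. (?D x)\<^sup>2) / (2 * e)" using iD by (simp add: nu.prob_space[simplified])
      also have "\<dots> < e / 2 + e\<^sup>2 / (2 * e)" using N ij e by (intro add_strict_left_mono divide_strict_right_mono) auto
      also have "\<dots> = e" using e by (simp add: power2_eq_square field_simps)
      finally show ?thesis .
    qed
    then show ?thesis by blast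
  qed
  obtain h where h: "integrable nu h" "(\<lambda>n. \<integral>x. \<bar>QI u (yseq n) x - h x\<bar> \<partial>nu) \<longlonglongrightarrow> 0"
    using L1_complete[where u="\<lambda>n. QI u (yseq n)", OF iQ cau] by blast
  have "QI u y t = (\<integral>x. pois y (x - t) * h x \<partial>lborel)" if y: "y > 0" for y t
  proof -
    have "(\<lambda>n. \<integral>x. pois y (x - t) * QI u (yseq n) x \<partial>lborel) \<longlonglongrightarrow> (\<integral>x. pois y (x - t) * h x \<partial>lborel)"
      by (rule poisson_L1_continuity[OF iQ h y])
    then have "(\<lambda>n. QI u (y + yseq n) t) \<longlonglongrightarrow> (\<integral>x. pois y (x - t) * h x \<partial>lborel)"
      by (simp add: QI_semigroup[OF u yseq_pos y])
    with QI_yseq_tendsto[OF u y] show ?thesis by (rule LIMSEQ_unique)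
  qed
  with h show ?thesis unfolding hil_def bdry_def by blast
qed

lemma bdry_AE_QI:
  assumes "bdry u h"
  shows "AE t in lborel. ((\<lambda>y. QI u y t) \<longlongrightarrow> h t) (at_right 0)"
proof -
  have h: "integrable nu h" and m: "h \<in> borel_measurable borel" by (rule bdry_integrable[OF assms], rule bdry_measurable[OF assms])
  have "integrable lborel (\<lambda>x. pois 1 x * h x)" using h by (simp add: integrable_nu_iff[OF m])
  from AE_lebesgue_point_pois[OF this m] show ?thesis
  proof eventually_elim
    case (elim t)
    have ev: "eventually (\<lambda>y. (\<integral>x. pois y (x - t) * h x \<partial>lborel) = QI u y t) (at_right 0)"
      using eventually_at_right_less[of 0] by eventually_elim (use assms in \<open>simp add: bdry_def\<close>)
    show ?case using poisson_integral_tendsto(1)[OF h elim] tendsto_cong[OF ev] by simp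
  qed
qed

section \<open>Truncated integrals and principal values\<close>

definition htr :: "(real \<Rightarrow> real) \<Rightarrow> real \<Rightarrow> real \<Rightarrow> real" where
  "htr u e t = (\<integral>x. u x * (if e < \<bar>x - t\<bar> then 1 / (pi * (x - t)) else 0) \<partial>lborel)"

text \<open>Truncation at distance \<open>y\<close> is compared with the conjugate Poisson kernel at
  the same height \<open>y\<close>. The difference is odd and bounded by
  \<open>pois y\<close>.\<close>

definition kdiff :: "real \<Rightarrow> real \<Rightarrow> real" where
  "kdiff y s = (if y < \<bar>s\<bar> then 1 / (pi * s) else 0) - cpois y s"

lemma kdiff_measurable[measurable]: "kdiff y \<in> borel_measurable borel"
  unfolding kdiff_def by measurable

lemma kdiff_bound:
  assumes y: "y > 0" shows "\<bar>kdiff y s\<bar> \<le> pois y s"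
proof (cases "y < \<bar>s\<bar>")
  case True
  then have s: "s \<noteq> 0" using y by auto
  have p: "s\<^sup>2 + y\<^sup>2 > 0" using y by (rule sum_sq_pos)
  have "kdiff y s = y\<^sup>2 / (s * (pi * (s\<^sup>2 + y\<^sup>2)))"
    using True s p by (simp add: kdiff_def cpois_def divide_simps) (simp add: power2_eq_square algebra_simps)
  then have "\<bar>kdiff y s\<bar> = (y / \<bar>s\<bar>) * (y / (pi * (s\<^sup>2 + y\<^sup>2)))"
    using p y by (simp add: abs_mult power2_eq_square)
  also have "\<dots> \<le> 1 * (y / (pi * (s\<^sup>2 + y\<^sup>2)))" using True y p by (intro mult_right_mono) auto
  finally show ?thesis by (simp add: pois_def)
next
  case False
  have p: "s\<^sup>2 + y\<^sup>2 > 0" using y by (rule sum_sq_pos)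
  have "\<bar>kdiff y s\<bar> = \<bar>s\<bar> / (pi * (s\<^sup>2 + y\<^sup>2))" using False p by (simp add: kdiff_def cpois_def abs_mult)
  also have "\<dots> \<le> y / (pi * (s\<^sup>2 + y\<^sup>2))" using False p by (intro divide_right_mono) auto
  finally show ?thesis by (simp add: pois_def)
qed

lemma kdiff_minus: "kdiff y (- s) = - kdiff y s"
  by (simp add: kdiff_def cpois_minus)

lemma kdiff_integrable: "y > 0 \<Longrightarrow> integrable lborel (\<lambda>x. kdiff y (x - t))"
  by (rule Bochner_Integration.integrable_bound[OF integrable_pois[of y t]])
     (use kdiff_bound[of y] pois_nonneg[of y] in auto)

lemma kdiff_integral:
  assumes y: "y > 0" shows "(\<integral>x. kdiff y (x - t) \<partial>lborel) = 0"
proof -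
  have "(\<integral>x. kdiff y (x - t) \<partial>lborel) = \<bar>-1\<bar> *\<^sub>R (\<integral>x. kdiff y ((2 * t + (-1) * x) - t) \<partial>lborel)"
    by (rule lborel_integral_real_affine) simp
  also have "\<dots> = (\<integral>x. - kdiff y (x - t) \<partial>lborel)"
  proof -
    have "2 * t + (-1) * x - t = - (x - t)" for x by simp
    then show ?thesis by (simp only: kdiff_minus) simp
  qed
  finally show ?thesis by simp
qed

text \<open>\<open>kdiff\<close> has integral 0, so the constant \<open>u t\<close> may be
  subtracted from \<open>u\<close>. What remains is at most the Poisson integral of \<bar>u - u
  t\<bar>, which vanishes in the limit at Lebesgue points. So principal values exist a.e. and agree
  with the limits of \<open>QI\<close>.\<close>

lemma bdry_AE_htr:
  assumes b: "bdry u h" and u: "integrable lborel u"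
  shows "AE t in lborel. ((\<lambda>e. htr u e t) \<longlongrightarrow> h t) (at_right 0)"
proof -
  have [measurable]: "u \<in> borel_measurable borel" using u by auto
  have "integrable lborel (\<lambda>x. u x * pois 1 (x - 0))" by (rule integrable_mult_pois[OF u]) simp
  then have nu: "integrable nu u" by (subst integrable_nu_iff) (auto simp: mult.commute)
  show ?thesis using AE_lebesgue_point_integrable[OF u] bdry_AE_QI[OF b]
  proof eventually_elim
    case (elim t)
    have "((\<lambda>y. htr u y t - QI u y t) \<longlongrightarrow> 0) (at_right 0)"
    proof (rule tendsto_norm_zero_cancel, rule tendsto_ennreal_imp_tendsto_0[OF poisson_integral_tendsto(2)[OF nu elim(1)] _ norm_ge_zero])
      show "\<forall>\<^sub>F y in at_right 0. ennreal (norm (htr u y t - QI u y t)) \<le> (\<integral>\<^sup>+x. ennreal \<bar>u x - u t\<bar> * ennreal (pois y (x - t)) \<partial>lborel)"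
        using eventually_at_right_less[of 0]
      proof eventually_elim
        case (elim y)
        have ik: "integrable lborel (\<lambda>x. u x * kdiff y (x - t))"
        proof (rule Bochner_Integration.integrable_bound[OF integrable_mult_pois[OF u elim, of t]])
          show "AE x in lborel. norm (u x * kdiff y (x - t)) \<le> norm (u x * pois y (x - t))"
            using kdiff_bound[OF elim] pois_nonneg[OF elim] by (intro AE_I2) (auto simp: abs_mult intro!: mult_left_mono)
        qed measurable
        have eq1: "u x * (if y < \<bar>x - t\<bar> then 1 / (pi * (x - t)) else 0) = u x * kdiff y (x - t) + u x * cpois y (x - t)" for x
          by (simp add: kdiff_def algebra_simps)
        have "htr u y t = (\<integral>x. u x * kdiff y (x - t) \<partial>lborel) + QI u y t"
          unfolding htr_def eq1 QI_def by (rule Bochner_Integration.integral_add[OF ik integrable_mult_cpois[OF u elim]])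
        then have "htr u y t - QI u y t = (\<integral>x. u x * kdiff y (x - t) \<partial>lborel) - (\<integral>x. u t * kdiff y (x - t) \<partial>lborel)"
          using kdiff_integral[OF elim, of t] by simp
        also have "\<dots> = (\<integral>x. u x * kdiff y (x - t) - u t * kdiff y (x - t) \<partial>lborel)"
          by (rule Bochner_Integration.integral_diff[symmetric, OF ik integrable_mult_right[OF kdiff_integrable[OF elim]]])
        finally have "ennreal (norm (htr u y t - QI u y t)) \<le> (\<integral>\<^sup>+x. ennreal (norm (u x * kdiff y (x - t) - u t * kdiff y (x - t))) \<partial>lborel)"
          by (simp only:) (rule integral_norm_bound_ennreal[OF Bochner_Integration.integrable_diff[OF ik integrable_mult_right[OF kdiff_integrable[OF elim]]]])
        also have "\<dots> \<le> (\<integral>\<^sup>+x. ennreal \<bar>u x - u t\<bar> * ennreal (pois y (x - t)) \<partial>lborel)"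
        proof (intro nn_integral_mono)
          fix x
          have "norm (u x * kdiff y (x - t) - u t * kdiff y (x - t)) = \<bar>u x - u t\<bar> * \<bar>kdiff y (x - t)\<bar>"
            by (simp add: abs_mult flip: left_diff_distrib)
          also have "\<dots> \<le> \<bar>u x - u t\<bar> * pois y (x - t)" by (intro mult_left_mono kdiff_bound elim) auto
          finally have "ennreal (norm (u x * kdiff y (x - t) - u t * kdiff y (x - t))) \<le> ennreal (\<bar>u x - u t\<bar> * pois y (x - t))" by (rule ennreal_leI)
          then show "ennreal (norm (u x * kdiff y (x - t) - u t * kdiff y (x - t))) \<le> ennreal \<bar>u x - u t\<bar> * ennreal (pois y (x - t))"
            using pois_nonneg[OF elim, of "x - t"] by (simp add: ennreal_mult)
        qed
        finally show ?case .
      qed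
    qed
    from tendsto_add[OF this elim(2)] show ?case by simp
  qed
qed

section \<open>Duality of boundary functions\<close>

lemma QI_duality:
  assumes u: "integrable lborel u" and g: "integrable lborel g" and y: "y > 0"
  shows "(\<integral>t. QI u y t * g t \<partial>lborel) = - (\<integral>x. u x * QI g y x \<partial>lborel)"
proof -
  have [measurable]: "u \<in> borel_measurable borel" "g \<in> borel_measurable borel" using u g by auto
  have i0: "integrable (lborel \<Otimes>\<^sub>M lborel) (\<lambda>(x, t). u x * cpois y (x - t) * g t)"
  proof (rule lborel_pair.Fubini_integrable)
    show "AE x in lborel. integrable lborel (\<lambda>t. case (x, t) of (x, t) \<Rightarrow> u x * cpois y (x - t) * g t)"
    proof (rule AE_I2)
      fix x
      have "integrable lborel (\<lambda>t. - u x * (g t * cpois y (t - x)))"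
        by (intro integrable_mult_right integrable_mult_cpois g y)
      moreover have "- u x * (g t * cpois y (t - x)) = u x * cpois y (x - t) * g t" for t
        using cpois_minus[of y "t - x"] by simp
      ultimately show "integrable lborel (\<lambda>t. case (x, t) of (x, t) \<Rightarrow> u x * cpois y (x - t) * g t)" by (simp only: prod.case)
    qed
    let ?I = "\<lambda>x. \<integral>t. norm (case (x, t) of (x, t) \<Rightarrow> u x * cpois y (x - t) * g t) \<partial>lborel"
    show "integrable lborel ?I"
    proof (rule Bochner_Integration.integrable_bound[OF integrable_mult_right[OF u, of "(\<integral>t. \<bar>g t\<bar> \<partial>lborel) / y"]])
      show "AE x in lborel. norm (?I x) \<le> norm ((\<integral>t. \<bar>g t\<bar> \<partial>lborel) / y * u x)"
      proof (rule AE_I2)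
        fix x
        have le: "norm (u x * cpois y (x - t) * g t) \<le> \<bar>u x\<bar> / y * \<bar>g t\<bar>" for t
        proof -
          have "\<bar>u x\<bar> * \<bar>cpois y (x - t)\<bar> * \<bar>g t\<bar> \<le> \<bar>u x\<bar> * (1 / y) * \<bar>g t\<bar>"
            by (intro mult_right_mono mult_left_mono cpois_bound y) auto
          then show ?thesis by (simp add: abs_mult)
        qed
        have "?I x \<le> (\<integral>t. \<bar>u x\<bar> / y * \<bar>g t\<bar> \<partial>lborel)"
        proof (cases "integrable lborel (\<lambda>t. norm (u x * cpois y (x - t) * g t))")
          case True
          then show ?thesis using g le by (simp only: prod.case) (intro integral_mono, auto)
        next
          case False
          then show ?thesis using y by (simp add: not_integrable_integral_eq integral_nonneg_AE)
        qed
        moreover have "?I x \<ge> 0" by (rule integral_nonneg_AE) simp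
        ultimately show "norm (?I x) \<le> norm ((\<integral>t. \<bar>g t\<bar> \<partial>lborel) / y * u x)"
          using y by (simp add: abs_mult integral_nonneg_AE mult.commute)
      qed
    qed measurable
  qed measurable
  have "(\<integral>t. QI u y t * g t \<partial>lborel) = (\<integral>t. (\<integral>x. u x * cpois y (x - t) * g t \<partial>lborel) \<partial>lborel)"
    unfolding QI_def by simp
  also have "\<dots> = (\<integral>x. (\<integral>t. u x * cpois y (x - t) * g t \<partial>lborel) \<partial>lborel)"
    by (rule lborel_pair.Fubini_integral[OF i0])
  also have "\<dots> = (\<integral>x. - (u x * QI g y x) \<partial>lborel)"
  proof (rule Bochner_Integration.integral_cong[OF refl])
    fix x
    \<comment> \<open>The kernel is odd: exchanging the roles of \<open>x\<close> and
      \<open>t\<close> produces the minus sign of the duality.\<close>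
    have "(\<integral>t. u x * cpois y (x - t) * g t \<partial>lborel) = (\<integral>t. - u x * (g t * cpois y (t - x)) \<partial>lborel)"
      using cpois_minus[of y] by (intro Bochner_Integration.integral_cong[OF refl]) (metis (no_types) minus_diff_eq minus_mult_commute mult.assoc mult.commute mult_minus_right)
    then show "(\<integral>t. u x * cpois y (x - t) * g t \<partial>lborel) = - (u x * QI g y x)" by (simp add: QI_def)
  qed
  finally show ?thesis by simp
qed

lemma dom_mult_integrable:
  assumes g: "dom C g" and h: "integrable nu h"
  shows "integrable lborel (\<lambda>x. h x * g x)"
    and "\<bar>\<integral>x. h x * g x \<partial>lborel\<bar> \<le> C * (\<integral>x. \<bar>h x\<bar> \<partial>nu)"
proof -
  have [measurable]: "h \<in> borel_measurable borel" "g \<in> borel_measurable borel"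
    using h dom_measurable[OF g] by (auto dest!: borel_measurable_integrable simp: measurable_nu_iff)
  have i: "integrable lborel (\<lambda>x. C * (pois 1 x * \<bar>h x\<bar>))"
    using h integrable_nu_iff[of "\<lambda>x. \<bar>h x\<bar>"] by (intro integrable_mult_right) auto
  have le: "norm (h x * g x) \<le> C * (pois 1 x * \<bar>h x\<bar>)" for x
    using g mult_left_mono[of "\<bar>g x\<bar>" "C * pois 1 x" "\<bar>h x\<bar>"] by (auto simp: dom_def abs_mult mult_ac)
  show i2: "integrable lborel (\<lambda>x. h x * g x)"
  proof (rule Bochner_Integration.integrable_bound[OF i])
    show "AE x in lborel. norm (h x * g x) \<le> norm (C * (pois 1 x * \<bar>h x\<bar>))"
      by (rule AE_I2) (rule order_trans[OF le], simp only: real_norm_def abs_ge_self)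
  qed measurable
  have "norm (\<integral>x. h x * g x \<partial>lborel) \<le> (\<integral>x. C * (pois 1 x * \<bar>h x\<bar>) \<partial>lborel)"
    by (rule integral_norm_le[OF i2 i le])
  also have "\<dots> = C * (\<integral>x. \<bar>h x\<bar> \<partial>nu)" by (subst integral_nu) auto
  finally show "\<bar>\<integral>x. h x * g x \<partial>lborel\<bar> \<le> C * (\<integral>x. \<bar>h x\<bar> \<partial>nu)" by simp
qed

lemma dom_L1_limit:
  assumes g: "dom C g" and hn: "\<And>n. integrable nu (h n)" and h: "integrable nu h'" and lim: "(\<lambda>n. \<integral>x. \<bar>h n x - h' x\<bar> \<partial>nu) \<longlonglongrightarrow> 0"
  shows "(\<lambda>n. \<integral>x. h n x * g x \<partial>lborel) \<longlonglongrightarrow> (\<integral>x. h' x * g x \<partial>lborel)"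
proof (rule LIM_zero_cancel, rule Lim_null_comparison)
  show "\<forall>\<^sub>F n in sequentially. norm ((\<integral>x. h n x * g x \<partial>lborel) - (\<integral>x. h' x * g x \<partial>lborel)) \<le> C * (\<integral>x. \<bar>h n x - h' x\<bar> \<partial>nu)"
  proof (rule always_eventually, rule allI)
    fix n
    have "(\<integral>x. h n x * g x \<partial>lborel) - (\<integral>x. h' x * g x \<partial>lborel) = (\<integral>x. h n x * g x - h' x * g x \<partial>lborel)"
      by (rule Bochner_Integration.integral_diff[symmetric, OF dom_mult_integrable(1)[OF g hn] dom_mult_integrable(1)[OF g h]])
    also have "\<dots> = (\<integral>x. (h n x - h' x) * g x \<partial>lborel)" by (simp add: left_diff_distrib)
    finally show "norm ((\<integral>x. h n x * g x \<partial>lborel) - (\<integral>x. h' x * g x \<partial>lborel)) \<le> C * (\<integral>x. \<bar>h n x - h' x\<bar> \<partial>nu)"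
      using dom_mult_integrable(2)[OF g Bochner_Integration.integrable_diff[OF hn h]] by simp
  qed
  show "(\<lambda>n. C * (\<integral>x. \<bar>h n x - h' x\<bar> \<partial>nu)) \<longlonglongrightarrow> 0"
    by (rule tendsto_mult_right_zero[OF lim])
qed

text \<open>The identity holds at every height. The L^1(\<open>nu\<close>) convergence contained in
  \<open>hil\<close> passes to the limit against functions dominated by the density of
  \<open>nu\<close>.\<close>

theorem hil_duality:
  assumes u: "dom C u" "hil u h" and g: "dom D g" "hil g k"
  shows "(\<integral>x. h x * g x \<partial>lborel) = - (\<integral>x. u x * k x \<partial>lborel)"
proof -
  have iQ: "integrable nu (QI v (yseq n))" if "integrable lborel v" for v n
    by (rule integrable_nu_bounded[OF QI_measurable[OF that yseq_pos] QI_bound[OF that yseq_pos]])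
  note ui = dom_integrable[OF u(1)] and gi = dom_integrable[OF g(1)]
  have lim1: "(\<lambda>n. \<integral>x. QI u (yseq n) x * g x \<partial>lborel) \<longlonglongrightarrow> (\<integral>x. h x * g x \<partial>lborel)"
    by (rule dom_L1_limit[OF g(1) iQ[OF ui]]) (use u(2) in \<open>auto simp: hil_def bdry_def\<close>)
  have "(\<lambda>n. \<integral>x. QI g (yseq n) x * u x \<partial>lborel) \<longlonglongrightarrow> (\<integral>x. k x * u x \<partial>lborel)"
    by (rule dom_L1_limit[OF u(1) iQ[OF gi]]) (use g(2) in \<open>auto simp: hil_def bdry_def\<close>)
  then have lim2: "(\<lambda>n. - (\<integral>x. QI g (yseq n) x * u x \<partial>lborel)) \<longlonglongrightarrow> - (\<integral>x. k x * u x \<partial>lborel)" by (rule tendsto_minus)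
  have eq: "(\<integral>x. QI u (yseq n) x * g x \<partial>lborel) = - (\<integral>x. QI g (yseq n) x * u x \<partial>lborel)" for n
    by (subst QI_duality[OF ui gi yseq_pos]) (simp add: mult.commute)
  show ?thesis
    using LIMSEQ_unique[OF lim1[unfolded eq] lim2] by (simp add: mult.commute)
qed

subsection \<open>Transforms of functions in L log L\<close>

lemma cos_1_ge_half: "cos (1::real) \<ge> 1 / 2"
proof -
  have "cos (pi / 3) \<le> cos (1::real)" using pi_gt3 by (intro cos_monotone_0_pi_le) auto
  then show ?thesis by (simp add: cos_60)
qed

text \<open>Poisson's formula for exp (F / C) and exp (- F / C), with F the raised Cauchy integral.
  As \<bar>P\<bar> \<le> C, the imaginary part of the exponent lies in [-1, 1], where the cosine is
  at least 1/2; so twice the real part of the exponential dominates exp (Q / C), respectively exp (-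
  Q / C). Its value at \<i> is at most e, and adding both signs gives 4 e. Fatou's lemma reaches the
  boundary.\<close>

lemma hil_exp_integrable:
  assumes d: "dom C g" and C: "C > 0" and h: "hil g k"
  shows "(\<integral>\<^sup>+x. ennreal (exp (\<bar>k x\<bar> / C)) \<partial>nu) \<le> ennreal (4 * exp 1)"
proof -
  note g = dom_integrable[OF d]
  have [measurable]: "k \<in> borel_measurable borel" using bdry_measurable[OF hil_bdry[OF h]] .
  have [measurable]: "\<And>n. QI g (yseq n) \<in> borel_measurable borel" using QI_measurable[OF g yseq_pos] by auto
  have one: "(\<integral>\<^sup>+x. ennreal (exp (\<sigma> * QI g y x / C)) \<partial>nu) \<le> ennreal (2 * exp 1)"
    if y: "y > 0" and s: "\<sigma> = 1 \<or> \<sigma> = -1" for y \<sigma> :: real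
  proof -
    let ?B = "(\<integral>x. \<bar>g x\<bar> \<partial>lborel) / (pi * y)"
    let ?G = "\<lambda>z. exp (of_real (\<sigma> / C) * Fc g (z + \<i> * of_real y))"
    have [measurable]: "QI g y \<in> borel_measurable borel" by (rule QI_measurable[OF g y])
    have sC: "cmod (of_real (\<sigma> / C)) = 1 / C" by (subst norm_of_real) (use s C in auto)
    have hol: "?G holomorphic_on {z. Im z > - y}"
      by (intro holomorphic_intros Fc_shift(1)[OF g y])
    have nb: "cmod (?G z) \<le> exp (1 / C * cmod (Fc g (z + \<i> * of_real y)))" for z
      using norm_exp[of "of_real (\<sigma> / C) * Fc g (z + \<i> * of_real y)"] by (simp only: norm_mult sC)
    have bd: "cmod (?G z) \<le> exp (1 / C * ?B)" if "Im z \<ge> 0" for z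
      by (rule order_trans[OF nb], subst exp_le_cancel_iff, rule mult_left_mono[OF Fc_shift(2)[OF g y that]]) (use C in simp)
    have Rt: "Re (?G (of_real t)) = exp (\<sigma> * QI g y t / C) * cos (\<sigma> * PI g y t / C)" for t
      by (simp add: of_real_shift Fc_eq(1)[OF g y] Re_exp)
    have cosb: "cos (\<sigma> * PI g y t / C) \<ge> 1 / 2" for t
    proof -
      have "\<bar>PI g y t / C\<bar> \<le> 1" using PI_le[OF d y, of t] C by simp
      then have "cos 1 \<le> cos \<bar>PI g y t / C\<bar>" using pi_gt3 by (intro cos_monotone_0_pi_le) auto
      moreover have "cos (\<sigma> * PI g y t / C) = cos (PI g y t / C)" using s by auto
      moreover have "cos \<bar>PI g y t / C\<bar> = cos (PI g y t / C)" by (rule cos_abs_real)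
      ultimately show ?thesis using cos_1_ge_half by linarith
    qed
    have int: "integrable lborel (\<lambda>t. pois 1 t * Re (?G (of_real t)))"
      by (rule Re_poisson_formula_i(2)[OF hol y bd])
    have "(\<integral>\<^sup>+x. ennreal (exp (\<sigma> * QI g y x / C)) \<partial>nu) = (\<integral>\<^sup>+x. ennreal (exp (\<sigma> * QI g y x / C)) * ennreal (pois 1 x) \<partial>lborel)"
      by (rule nn_integral_nu) measurable
    also have "\<dots> \<le> (\<integral>\<^sup>+x. ennreal (2 * (pois 1 x * Re (?G (of_real x)))) \<partial>lborel)"
    proof (intro nn_integral_mono)
      fix x
      have "exp (\<sigma> * QI g y x / C) * pois 1 x * 1 \<le> exp (\<sigma> * QI g y x / C) * pois 1 x * (2 * cos (\<sigma> * PI g y x / C))"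
        using cosb[of x] pois_nonneg[of 1 x] by (intro mult_left_mono) auto
      then have "exp (\<sigma> * QI g y x / C) * pois 1 x \<le> 2 * (pois 1 x * Re (?G (of_real x)))" unfolding Rt by (simp add: mult_ac)
      then show "ennreal (exp (\<sigma> * QI g y x / C)) * ennreal (pois 1 x) \<le> ennreal (2 * (pois 1 x * Re (?G (of_real x))))"
        using pois_nonneg[of 1 x] by (simp add: ennreal_leI flip: ennreal_mult)
    qed
    also have "\<dots> = ennreal (\<integral>x. 2 * (pois 1 x * Re (?G (of_real x))) \<partial>lborel)"
    proof (rule nn_integral_eq_integral)
      show "AE x in lborel. 0 \<le> 2 * (pois 1 x * Re (?G (of_real x)))"
        unfolding Rt using cosb pois_nonneg[of 1] by (intro AE_I2 mult_nonneg_nonneg) (auto intro: order_trans[of 0 "1/2"])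
    qed (use int in simp)
    also have "(\<integral>x. 2 * (pois 1 x * Re (?G (of_real x))) \<partial>lborel) = 2 * Re (?G \<i>)"
      by (simp only: integral_mult_right_zero Re_poisson_formula_i(1)[OF hol y bd])
    also have "\<dots> \<le> 2 * exp 1"
    proof -
      have "cmod (Fc g (\<i> + \<i> * of_real y)) \<le> (\<integral>x. \<bar>g x\<bar> \<partial>lborel) / (pi * Im (\<i> + \<i> * of_real y))"
        by (rule Fc_bound[OF g]) (use y in simp)
      also have "\<dots> \<le> C / 1"
      proof (rule frac_le)
        have "1 * 1 \<le> pi * (1 + y)" using pi_gt3 y by (intro mult_mono) auto
        then show "1 \<le> pi * Im (\<i> + \<i> * of_real y)" by simp
      qed (use dom_L1[OF d] C in auto)
      finally have "1 / C * cmod (Fc g (\<i> + \<i> * of_real y)) \<le> 1" using C by simp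
      then have "cmod (?G \<i>) \<le> exp 1" by (intro order_trans[OF nb]) simp
      then show ?thesis using complex_Re_le_cmod[of "?G \<i>"] by linarith
    qed
    finally show ?thesis by (simp add: ennreal_leI)
  qed
  have y: "(\<integral>\<^sup>+x. ennreal (exp (\<bar>QI g (yseq n) x\<bar> / C)) \<partial>nu) \<le> ennreal (4 * exp 1)" for n
  proof -
    have "(\<integral>\<^sup>+x. ennreal (exp (\<bar>QI g (yseq n) x\<bar> / C)) \<partial>nu) \<le> (\<integral>\<^sup>+x. ennreal (exp (1 * QI g (yseq n) x / C)) + ennreal (exp ((-1) * QI g (yseq n) x / C)) \<partial>nu)"
    proof (intro nn_integral_mono)
      fix x
      show "ennreal (exp (\<bar>QI g (yseq n) x\<bar> / C)) \<le> ennreal (exp (1 * QI g (yseq n) x / C)) + ennreal (exp ((-1) * QI g (yseq n) x / C))"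
        by (cases "QI g (yseq n) x \<ge> 0") (auto simp: add_increasing add_increasing2)
    qed
    also have "\<dots> = (\<integral>\<^sup>+x. ennreal (exp (1 * QI g (yseq n) x / C)) \<partial>nu) + (\<integral>\<^sup>+x. ennreal (exp ((-1) * QI g (yseq n) x / C)) \<partial>nu)"
      by (rule nn_integral_add) measurable
    also have "\<dots> \<le> ennreal (2 * exp 1) + ennreal (2 * exp 1)"
      by (intro add_mono one yseq_pos) auto
    also have "\<dots> = ennreal (4 * exp 1)" by (simp flip: ennreal_plus)
    finally show ?thesis .
  qed
  have "(\<integral>\<^sup>+x. ennreal (exp (\<bar>k x\<bar> / C)) \<partial>nu) = (\<integral>\<^sup>+x. liminf (\<lambda>n. ennreal (exp (\<bar>QI g (yseq n) x\<bar> / C))) \<partial>nu)"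
  proof (rule nn_integral_cong_AE)
    show "AE x in nu. ennreal (exp (\<bar>k x\<bar> / C)) = liminf (\<lambda>n. ennreal (exp (\<bar>QI g (yseq n) x\<bar> / C)))"
      unfolding AE_nu_iff using bdry_AE_QI[OF hil_bdry[OF h]]
    proof eventually_elim
      case (elim x)
      have "(\<lambda>n. ennreal (exp (\<bar>QI g (yseq n) x\<bar> / C))) \<longlonglongrightarrow> ennreal (exp (\<bar>k x\<bar> / C))"
        using C by (intro tendsto_ennrealI tendsto_exp tendsto_divide tendsto_rabs tendsto_const filterlim_compose[OF elim yseq_at_right]) auto
      then show ?case using lim_imp_Liminf[of sequentially] by (metis sequentially_bot)
    qed
  qed
  also have "\<dots> \<le> liminf (\<lambda>n. \<integral>\<^sup>+x. ennreal (exp (\<bar>QI g (yseq n) x\<bar> / C)) \<partial>nu)"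
    by (rule nn_integral_liminf) measurable
  also have "\<dots> \<le> limsup (\<lambda>n. \<integral>\<^sup>+x. ennreal (exp (\<bar>QI g (yseq n) x\<bar> / C)) \<partial>nu)" by (rule Liminf_le_Limsup) simp
  also have "\<dots> \<le> ennreal (4 * exp 1)" by (rule Limsup_bounded) (simp add: y)
  finally show ?thesis .
qed

lemma pois_1_ge: "x \<in> {-1<..<1} \<Longrightarrow> 1 \<le> 2 * pi * pois 1 x"
proof -
  assume "x \<in> {-1<..<1}"
  then have "x\<^sup>2 \<le> 1" by (auto simp: abs_square_le_1 abs_le_iff)
  then have "x\<^sup>2 + 1 \<le> 2" by simp
  then show ?thesis by (simp add: pois_def add_nonneg_pos le_divide_eq)
qed

lemma nn_integral_mu_le_nu:
  assumes [measurable]: "f \<in> borel_measurable borel"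
  shows "(\<integral>\<^sup>+x. f x \<partial>mu) \<le> ennreal (2 * pi) * (\<integral>\<^sup>+x. f x \<partial>nu)"
proof -
  have "(\<integral>\<^sup>+x. f x \<partial>mu) \<le> (\<integral>\<^sup>+x. ennreal (2 * pi) * (f x * ennreal (pois 1 x)) \<partial>lborel)"
    unfolding nn_integral_mu
  proof (intro nn_integral_mono)
    fix x :: real
    show "f x * indicator {-1<..<1} x \<le> ennreal (2 * pi) * (f x * ennreal (pois 1 x))"
    proof (cases "x \<in> {-1<..<1}")
      case True
      have "f x * 1 \<le> f x * ennreal (2 * pi * pois 1 x)"
        using ennreal_leI[OF pois_1_ge[OF True]] by (intro mult_left_mono) auto
      then show ?thesis using True pois_nonneg[of 1 x] by (simp add: ennreal_mult mult_ac)
    qed simp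
  qed
  also have "\<dots> = ennreal (2 * pi) * (\<integral>\<^sup>+x. f x \<partial>nu)"
    by (subst nn_integral_nu) (auto intro!: nn_integral_cmult)
  finally show ?thesis .
qed

text \<open>This is 1 + K in \<open>exp_integrable_bound\<close>, where K is the exponential bound 4
  e for \<open>nu\<close> times 2 \<pi>, the factor in passing from \<open>nu\<close> to
  \<open>mu\<close>.\<close>

definition Kexp :: real where "Kexp = 1 + 2 * pi * (4 * exp 1)"

lemma Kexp_pos: "Kexp > 0" unfolding Kexp_def by (intro add_pos_nonneg) auto

lemma hil_pairing_bound:
  assumes f: "f \<in> L0" and d: "dom C g" and C: "C > 0" and h: "hil g k"
  shows "(\<integral>\<^sup>+x. ennreal (cmod (f x) * \<bar>k x\<bar>) \<partial>mu) \<le> ennreal (C * Kexp) * norm_LlogL f"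
proof -
  have [measurable]: "f \<in> borel_measurable mu" using f by (simp add: L0_def)
  have kb[measurable]: "k \<in> borel_measurable borel" using bdry_measurable[OF hil_bdry[OF h]] .
  have [measurable]: "k \<in> borel_measurable mu" by (rule borel_measurable_muI) measurable
  have e: "(\<integral>\<^sup>+x. ennreal (exp \<bar>k x / C\<bar>) \<partial>mu) \<le> ennreal (2 * pi * (4 * exp 1))"
  proof -
    have "(\<integral>\<^sup>+x. ennreal (exp \<bar>k x / C\<bar>) \<partial>mu) \<le> ennreal (2 * pi) * (\<integral>\<^sup>+x. ennreal (exp (\<bar>k x\<bar> / C)) \<partial>nu)"
      using C by (simp add: nn_integral_mu_le_nu)
    also have "\<dots> \<le> ennreal (2 * pi) * ennreal (4 * exp 1)"
      by (intro mult_left_mono hil_exp_integrable[OF d C h]) simp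
    also have "\<dots> = ennreal (2 * pi * (4 * exp 1))" by (rule ennreal_mult[symmetric]) auto
    finally show ?thesis .
  qed
  have "(\<integral>\<^sup>+x. ennreal (cmod (f x) * \<bar>k x\<bar>) \<partial>mu) = (\<integral>\<^sup>+x. ennreal C * ennreal (cmod (f x) * \<bar>k x / C\<bar>) \<partial>mu)"
    using C by (intro nn_integral_cong) (simp add: ennreal_mult[symmetric])
  also have "\<dots> = ennreal C * (\<integral>\<^sup>+x. ennreal (cmod (f x) * \<bar>k x / C\<bar>) \<partial>mu)"
    by (rule nn_integral_cmult) measurable
  also have "\<dots> \<le> ennreal C * (ennreal (1 + 2 * pi * (4 * exp 1)) * norm_LlogL f)"
    by (intro mult_left_mono exp_integrable_bound[OF f _ _ e]) auto
  also have "\<dots> = ennreal (C * Kexp) * norm_LlogL f"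
    unfolding Kexp_def[symmetric] using C Kexp_pos by (simp add: ennreal_mult mult.assoc)
  finally show ?thesis .
qed

lemma dom_mono: "dom C u \<Longrightarrow> C \<le> D \<Longrightarrow> dom D u"
  unfolding dom_def by (meson mult_right_mono order_trans pois_nonneg zero_less_one)

lemma domI_interval:
  assumes m: "u \<in> borel_measurable borel" and b: "\<And>x. \<bar>u x\<bar> \<le> M" and z: "\<And>x. x \<notin> {-1<..<1} \<Longrightarrow> u x = 0"
  shows "dom (2 * pi * M) u"
  unfolding dom_def
proof (intro conjI m allI)
  fix x
  have M: "M \<ge> 0" using order_trans[OF abs_ge_zero b] .
  show "\<bar>u x\<bar> \<le> 2 * pi * M * pois 1 x"
  proof (cases "x \<in> {-1<..<1}")
    case True
    have "\<bar>u x\<bar> \<le> M * 1" using b by simp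
    also have "\<dots> \<le> M * (2 * pi * pois 1 x)" using pois_1_ge[OF True] M by (intro mult_left_mono) auto
    finally show ?thesis by (simp add: mult_ac)
  next
    case False then show ?thesis using z M pois_nonneg[of 1 x] by simp
  qed
qed

lemma integral_mult_LlogL:
  fixes f :: "real \<Rightarrow> real"
  assumes fm[measurable]: "f \<in> borel_measurable borel" and z: "\<And>x. x \<notin> {-1<..<1} \<Longrightarrow> f x = 0"
    and fL: "(\<lambda>x. of_real (f x)) \<in> LlogL" and d: "dom C g" and h: "hil g k"
  shows "integrable lborel (\<lambda>x. f x * k x)"
    and "ennreal \<bar>\<integral>x. f x * k x \<partial>lborel\<bar> \<le> ennreal ((C + 1) * Kexp) * norm_LlogL (\<lambda>x. of_real (f x))"
proof -
  have kb[measurable]: "k \<in> borel_measurable borel" using bdry_measurable[OF hil_bdry[OF h]] .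
  \<comment> \<open>The pairing bound divides by the constant of \<open>dom\<close>, which may be 0;
    adding 1 makes it positive.\<close>
  have C1: "C + 1 > 0" using dom_nonneg[OF d] by simp
  have d1: "dom (C + 1) g" using dom_mono[OF d] by simp
  have "(\<integral>\<^sup>+x. ennreal (norm (f x * k x)) \<partial>lborel) = (\<integral>\<^sup>+x. ennreal (cmod (of_real (f x)) * \<bar>k x\<bar>) \<partial>mu)"
    unfolding nn_integral_mu using z by (intro nn_integral_cong) (auto simp: abs_mult indicator_def)
  also have "\<dots> \<le> ennreal ((C + 1) * Kexp) * norm_LlogL (\<lambda>x. of_real (f x))"
    by (rule hil_pairing_bound[OF _ d1 C1 h]) (use fL in \<open>simp add: LlogL_def\<close>)
  finally have b: "(\<integral>\<^sup>+x. ennreal (norm (f x * k x)) \<partial>lborel) \<le> ennreal ((C + 1) * Kexp) * norm_LlogL (\<lambda>x. of_real (f x))" .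
  also have "\<dots> < \<infinity>" using fL by (simp add: LlogL_def ennreal_mult_less_top)
  finally show i: "integrable lborel (\<lambda>x. f x * k x)" by (intro integrableI_bounded) auto
  have "ennreal (norm (\<integral>x. f x * k x \<partial>lborel)) \<le> (\<integral>\<^sup>+x. ennreal (norm (f x * k x)) \<partial>lborel)"
    by (rule integral_norm_bound_ennreal[OF i])
  with b show "ennreal \<bar>\<integral>x. f x * k x \<partial>lborel\<bar> \<le> ennreal ((C + 1) * Kexp) * norm_LlogL (\<lambda>x. of_real (f x))"
    by (simp add: order_trans)
qed

text \<open>
  Duality against \<open>g = sgn(h\<^sub>n - h\<^sub>m) w\<close>, with \<open>w\<close> the density of \<open>nu\<close>, shows that the transforms of the
  truncations of \<open>f\<close> are Cauchy in \<open>L\<^sup>1(nu)\<close>.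
\<close>
theorem bdry_exists_LlogL:
  fixes f :: "real \<Rightarrow> real"
  assumes fm[measurable]: "f \<in> borel_measurable borel" and z: "\<And>x. x \<notin> {-1<..<1} \<Longrightarrow> f x = 0"
    and fL: "(\<lambda>x. complex_of_real (f x)) \<in> LlogL"
  shows "integrable lborel f"
    and "\<exists>h. bdry f h \<and> (\<forall>C g k. dom C g \<longrightarrow> hil g k \<longrightarrow> (\<integral>x. h x * g x \<partial>lborel) = - (\<integral>x. f x * k x \<partial>lborel))"
proof -
  let ?c = "\<lambda>u x. complex_of_real (u x)"
  have f0: "?c f \<in> L0" using fL by (simp add: LlogL_def)
  have "(\<integral>\<^sup>+x. ennreal (norm (f x)) \<partial>lborel) = (\<integral>\<^sup>+x. ennreal (cmod (?c f x)) \<partial>mu)"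
    unfolding nn_integral_mu using z by (intro nn_integral_cong) (auto simp: indicator_def)
  also have "\<dots> < \<infinity>" using norm_LlogL_ge_L1[OF f0] fL by (auto simp: LlogL_def intro: le_less_trans)
  finally show fi: "integrable lborel f" by (intro integrableI_bounded) auto
  \<comment> \<open>Truncation by height: each \<open>F n\<close> is bounded, so its transform
    exists, and the removed tails tend to 0 in \<open>LlogL\<close>.\<close>
  define F where "F n x = (if \<bar>f x\<bar> \<le> real n then f x else 0)" for n :: nat and x
  have Fm[measurable]: "F n \<in> borel_measurable borel" for n unfolding F_def by measurable
  have Fz: "F n x = 0" if "x \<notin> {-1<..<1}" for n x using z[OF that] by (simp add: F_def)
  have dF: "dom (2 * pi * real n) (F n)" for n
    by (rule domI_interval[OF Fm _ Fz]) (auto simp: F_def)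
  have "\<forall>n. \<exists>h. hil (F n) h" using hil_exists[OF dF] by blast
  then obtain h where h: "\<And>n. hil (F n) (h n)" by metis
  note hb = hil_bdry[OF h]
  have hi: "integrable nu (h n)" for n by (rule bdry_integrable[OF hb])
  have hm[measurable]: "h n \<in> borel_measurable borel" for n by (rule bdry_measurable[OF hb])
  define e where "e n = norm_LlogL (\<lambda>x. if cmod (?c f x) \<le> real n then 0 else ?c f x)" for n :: nat
  have e0: "e \<longlonglongrightarrow> 0" unfolding e_def by (rule norm_LlogL_tail[OF fL])
  have FL: "?c (\<lambda>x. F n x - F m x) \<in> LlogL" for n m
    by (rule LlogL_ideal[OF fL]) (auto simp: L0_def F_def intro!: AE_I2 borel_measurable_muI)
  have FLe: "norm_LlogL (?c (\<lambda>x. F n x - F m x)) \<le> e N" if "N \<le> n" "N \<le> m" for n m N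
    unfolding e_def
    by (rule norm_LlogL_mono) (use that in \<open>auto simp: L0_def F_def intro!: AE_I2 borel_measurable_muI\<close>)
  have L1: "ennreal (\<integral>x. \<bar>h n x - h m x\<bar> \<partial>nu) \<le> ennreal ((1 + 1) * Kexp) * norm_LlogL (?c (\<lambda>x. F n x - F m x))" for n m
  proof -
    define g where "g x = sgn (h n x - h m x) * pois 1 x" for x
    have gm[measurable]: "g \<in> borel_measurable borel" unfolding g_def by measurable
    \<comment> \<open>The constant 1 does not depend on \<open>n\<close> and \<open>m\<close>, so
      the resulting bound involves them only through the norm of \<open>F n - F m\<close>.\<close>
    have dg: "dom 1 g" unfolding dom_def g_def using pois_nonneg[of 1] by (auto simp: abs_mult abs_sgn_eq intro: borel_measurable_times)
    obtain k where k: "hil g k" using hil_exists[OF dg] by blast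
    have ik: "integrable lborel (\<lambda>x. F j x * k x)" for j
    proof (rule integral_mult_LlogL(1)[OF Fm Fz _ dg k])
      show "?c (F j) \<in> LlogL" by (rule LlogL_ideal[OF fL]) (auto simp: L0_def F_def intro!: AE_I2 borel_measurable_muI)
    qed
    have "(\<integral>x. \<bar>h n x - h m x\<bar> \<partial>nu) = (\<integral>x. pois 1 x * \<bar>h n x - h m x\<bar> \<partial>lborel)" by (rule integral_nu) measurable
    also have "\<dots> = (\<integral>x. h n x * g x - h m x * g x \<partial>lborel)"
      by (rule Bochner_Integration.integral_cong[OF refl]) (simp add: g_def abs_sgn algebra_simps)
    also have "\<dots> = (\<integral>x. h n x * g x \<partial>lborel) - (\<integral>x. h m x * g x \<partial>lborel)"
      by (rule Bochner_Integration.integral_diff[OF dom_mult_integrable(1)[OF dg hi] dom_mult_integrable(1)[OF dg hi]])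
    also have "\<dots> = (\<integral>x. F m x * k x \<partial>lborel) - (\<integral>x. F n x * k x \<partial>lborel)"
      by (simp add: hil_duality[OF dF h dg k])
    also have "\<dots> = - (\<integral>x. F n x * k x - F m x * k x \<partial>lborel)"
      by (simp add: Bochner_Integration.integral_diff[OF ik ik])
    also have "\<dots> = - (\<integral>x. (F n x - F m x) * k x \<partial>lborel)" by (simp add: left_diff_distrib)
    finally have eq: "(\<integral>x. \<bar>h n x - h m x\<bar> \<partial>nu) = - (\<integral>x. (F n x - F m x) * k x \<partial>lborel)" .
    have "(\<integral>x. \<bar>h n x - h m x\<bar> \<partial>nu) \<ge> 0" by (rule integral_nonneg_AE) simp
    with eq have "(\<integral>x. \<bar>h n x - h m x\<bar> \<partial>nu) = \<bar>\<integral>x. (F n x - F m x) * k x \<partial>lborel\<bar>" by linarith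
    then show ?thesis
      using integral_mult_LlogL(2)[where f="\<lambda>x. F n x - F m x", OF _ _ FL dg k] Fz by simp
  qed
  have cau: "\<exists>N. \<forall>i\<ge>N. \<forall>j\<ge>N. (LINT x|nu. norm (h i x - h j x)) < \<epsilon>" if ep: "\<epsilon> > 0" for \<epsilon>
  proof -
    have "(\<lambda>n. ennreal ((1 + 1) * Kexp) * e n) \<longlonglongrightarrow> ennreal ((1 + 1) * Kexp) * 0"
      by (intro ennreal_tendsto_cmult e0) simp
    then have "eventually (\<lambda>n. ennreal ((1 + 1) * Kexp) * e n < ennreal \<epsilon>) sequentially"
      using ep by (simp add: order_tendsto_iff)
    then obtain N where N: "ennreal ((1 + 1) * Kexp) * e N < ennreal \<epsilon>" by (auto simp: eventually_sequentially)
    have "(LINT x|nu. norm (h i x - h j x)) < \<epsilon>" if ij: "i \<ge> N" "j \<ge> N" for i j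
    proof -
      have "ennreal (\<integral>x. \<bar>h i x - h j x\<bar> \<partial>nu) \<le> ennreal ((1 + 1) * Kexp) * e N"
        by (rule order_trans[OF L1 mult_left_mono[OF FLe[OF ij]]]) simp
      also have "\<dots> < ennreal \<epsilon>" by (rule N)
      finally show ?thesis using ep by (simp add: ennreal_less_iff integral_nonneg_AE)
    qed
    then show ?thesis by blast
  qed
  obtain H where H: "integrable nu H" "(\<lambda>n. \<integral>x. \<bar>h n x - H x\<bar> \<partial>nu) \<longlonglongrightarrow> 0"
    using L1_complete[where u=h, OF hi cau] by blast
  have Flim: "(\<lambda>n. F n x) \<longlonglongrightarrow> f x" for x
  proof (rule tendsto_eventually)
    show "eventually (\<lambda>n. F n x = f x) sequentially"
      using eventually_ge_at_top[of "nat \<lceil>\<bar>f x\<bar>\<rceil>"]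
    proof eventually_elim
      case (elim n)
      then have "\<bar>f x\<bar> \<le> real n" by linarith
      then show ?case by (simp add: F_def)
    qed
  qed
  have FQ: "(\<lambda>n. QI (F n) y t) \<longlonglongrightarrow> QI f y t" if y: "y > 0" for y t
    unfolding QI_def
  proof (rule integral_dominated_convergence[where w="\<lambda>x. \<bar>f x * cpois y (x - t)\<bar>"])
    show "integrable lborel (\<lambda>x. \<bar>f x * cpois y (x - t)\<bar>)" using integrable_mult_cpois[OF fi y] by simp
    show "AE x in lborel. (\<lambda>i. F i x * cpois y (x - t)) \<longlonglongrightarrow> f x * cpois y (x - t)"
      by (intro AE_I2 tendsto_mult Flim tendsto_const)
    show "AE x in lborel. norm (F i x * cpois y (x - t)) \<le> \<bar>f x * cpois y (x - t)\<bar>" for i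
      by (intro AE_I2) (auto simp: F_def)
  qed measurable
  have bH: "bdry f H"
    unfolding bdry_def
  proof (intro conjI H(1) allI impI)
    fix y t :: real assume y: "y > 0"
    have "QI (F n) y t = (\<integral>x. pois y (x - t) * h n x \<partial>lborel)" for n using hb[of n] y by (simp add: bdry_def)
    with FQ[OF y, of t] have "(\<lambda>n. \<integral>x. pois y (x - t) * h n x \<partial>lborel) \<longlonglongrightarrow> QI f y t" by simp
    then show "QI f y t = (\<integral>x. pois y (x - t) * H x \<partial>lborel)"
      using LIMSEQ_unique poisson_L1_continuity[OF hi H y] by blast
  qed
  moreover have "(\<integral>x. H x * g x \<partial>lborel) = - (\<integral>x. f x * k x \<partial>lborel)" if dg: "dom C g" and k: "hil g k" for C g k
  proof -
    have [measurable]: "k \<in> borel_measurable borel" by (rule bdry_measurable[OF hil_bdry[OF k]])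
    have fk: "integrable lborel (\<lambda>x. f x * k x)" by (rule integral_mult_LlogL(1)[OF fm z fL dg k])
    have "(\<lambda>n. \<integral>x. h n x * g x \<partial>lborel) \<longlonglongrightarrow> (\<integral>x. H x * g x \<partial>lborel)"
      by (rule dom_L1_limit[OF dg hi H])
    moreover have "(\<integral>x. h n x * g x \<partial>lborel) = - (\<integral>x. F n x * k x \<partial>lborel)" for n
      by (rule hil_duality[OF dF h dg k])
    ultimately have 1: "(\<lambda>n. - (\<integral>x. F n x * k x \<partial>lborel)) \<longlonglongrightarrow> (\<integral>x. H x * g x \<partial>lborel)" by simp
    have "(\<lambda>n. \<integral>x. F n x * k x \<partial>lborel) \<longlonglongrightarrow> (\<integral>x. f x * k x \<partial>lborel)"
    proof (rule integral_dominated_convergence[where w="\<lambda>x. \<bar>f x * k x\<bar>"])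
      show "integrable lborel (\<lambda>x. \<bar>f x * k x\<bar>)" using fk by simp
      show "AE x in lborel. (\<lambda>i. F i x * k x) \<longlonglongrightarrow> f x * k x"
        by (intro AE_I2 tendsto_mult Flim tendsto_const)
      show "AE x in lborel. norm (F i x * k x) \<le> \<bar>f x * k x\<bar>" for i
        by (intro AE_I2) (auto simp: F_def)
    qed measurable
    then have "(\<lambda>n. - (\<integral>x. F n x * k x \<partial>lborel)) \<longlonglongrightarrow> - (\<integral>x. f x * k x \<partial>lborel)" by (rule tendsto_minus)
    with 1 show ?thesis by (rule LIMSEQ_unique)
  qed
  ultimately show "\<exists>h. bdry f h \<and> (\<forall>C g k. dom C g \<longrightarrow> hil g k \<longrightarrow> (\<integral>x. h x * g x \<partial>lborel) = - (\<integral>x. f x * k x \<partial>lborel))" by blast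
qed

subsection \<open>The entropy bound\<close>

text \<open>Poisson's formula for the Cauchy kernel with its pole at x - \<i> \<epsilon>, below the
  axis; the two claims are its real and imaginary parts.\<close>

lemma poisson_cauchy_kernel:
  fixes x t y \<epsilon> :: real
  assumes y: "y > 0" and e: "\<epsilon> > 0"
  shows "(\<integral>s. pois y (s - t) * cpois \<epsilon> (s - x) \<partial>lborel) = cpois (y + \<epsilon>) (t - x)"
    and "(\<integral>s. pois y (s - t) * pois \<epsilon> (s - x) \<partial>lborel) = pois (y + \<epsilon>) (t - x)"
proof -
  let ?G = "\<lambda>z. 1 / (of_real pi * (z - Complex x (- \<epsilon>)))"
  have nz: "z - Complex x (- \<epsilon>) \<noteq> 0" if "Im z > - \<epsilon>" for z using that by (auto simp: complex_eq_iff)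
  have hol: "?G holomorphic_on {z. Im z > - \<epsilon>}" by (intro holomorphic_intros) (use nz in auto)
  have bd: "cmod (?G z) \<le> 1 / (pi * \<epsilon>)" if "Im z \<ge> 0" for z
  proof -
    have "\<epsilon> \<le> cmod (z - Complex x (- \<epsilon>))" using abs_Im_le_cmod[of "z - Complex x (- \<epsilon>)"] that e by simp
    then have "pi * \<epsilon> \<le> pi * cmod (z - Complex x (- \<epsilon>))" by simp
    then have "1 / (pi * cmod (z - Complex x (- \<epsilon>))) \<le> 1 / (pi * \<epsilon>)" using e by (intro divide_left_mono) (auto intro!: mult_pos_pos)
    then show ?thesis by (simp add: norm_divide norm_mult)
  qed
  have val: "1 / (of_real pi * (of_real x - Complex s d)) = Complex (cpois d (x - s)) (pois d (x - s))" if "d > 0" for x s d :: real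
    by (rule cauchy_kernel_eq[OF that])
  have Gr: "?G (Complex s r) = Complex (cpois (r + \<epsilon>) (s - x)) (- pois (r + \<epsilon>) (s - x))" if "r + \<epsilon> > 0" for s r
  proof -
    have "Complex s r - Complex x (- \<epsilon>) = - (of_real x - Complex s (r + \<epsilon>))" by (simp add: complex_eq_iff)
    then have "?G (Complex s r) = - (1 / (of_real pi * (of_real x - Complex s (r + \<epsilon>))))"
      by (simp only: mult_minus_right divide_minus_right)
    also have "\<dots> = Complex (cpois (r + \<epsilon>) (s - x)) (- pois (r + \<epsilon>) (s - x))"
      unfolding val[OF that] using cpois_minus[of "r + \<epsilon>" "s - x"] pois_minus[of "r + \<epsilon>" "s - x"] by (simp add: complex_eq_iff)
    finally show ?thesis .
  qed
  have b1: "integrable lborel (\<lambda>s. pois y (s - t) * cpois \<epsilon> (s - x))"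
    by (rule integrable_pois_bounded[OF _ cpois_bound[OF e] y]) measurable
  have b2: "integrable lborel (\<lambda>s. pois y (s - t) * pois \<epsilon> (s - x))"
    by (rule integrable_pois_bounded[where B="1/\<epsilon>", OF _ _ y]) (use pois_bound[OF e] pois_nonneg[OF e] in \<open>auto\<close>)
  have "(\<integral>s. of_real (pois y (s - t)) * ?G (of_real s) \<partial>lborel) = ?G (Complex t y)"
    by (rule poisson_formula[OF hol e bd y])
  moreover have "of_real (pois y (s - t)) * ?G (of_real s) = of_real (pois y (s - t) * cpois \<epsilon> (s - x)) - \<i> * of_real (pois y (s - t) * pois \<epsilon> (s - x))" for s
  proof -
    have "?G (of_real s) = Complex (cpois \<epsilon> (s - x)) (- pois \<epsilon> (s - x))"
      using Gr[of 0 s] e by (simp only: complex_of_real_def[of s] add_0)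
    then show ?thesis by (simp only:) (simp add: complex_eq_iff)
  qed
  ultimately have "(\<integral>s. of_real (pois y (s - t) * cpois \<epsilon> (s - x)) - \<i> * of_real (pois y (s - t) * pois \<epsilon> (s - x)) \<partial>lborel) = Complex (cpois (y + \<epsilon>) (t - x)) (- pois (y + \<epsilon>) (t - x))"
    by (simp only: Gr[OF add_pos_pos[OF y e]])
  moreover have "(\<integral>s. of_real (pois y (s - t) * cpois \<epsilon> (s - x)) - \<i> * of_real (pois y (s - t) * pois \<epsilon> (s - x)) \<partial>lborel) =
     of_real (\<integral>s. pois y (s - t) * cpois \<epsilon> (s - x) \<partial>lborel) - \<i> * of_real (\<integral>s. pois y (s - t) * pois \<epsilon> (s - x) \<partial>lborel)"
    by (subst Bochner_Integration.integral_diff) (use b1 b2 in \<open>auto intro!: integrable_of_real integrable_mult_right simp del: of_real_mult\<close>)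
  ultimately show "(\<integral>s. pois y (s - t) * cpois \<epsilon> (s - x) \<partial>lborel) = cpois (y + \<epsilon>) (t - x)"
    and "(\<integral>s. pois y (s - t) * pois \<epsilon> (s - x) \<partial>lborel) = pois (y + \<epsilon>) (t - x)"
    by (auto simp: complex_eq_iff)
qed

section \<open>Cutting Poisson kernels off to the interval\<close>

lemma cpois_tendsto: "x \<noteq> 0 \<Longrightarrow> (\<lambda>n. cpois (yseq n) x) \<longlonglongrightarrow> 1 / (pi * x)"
proof -
  assume x: "x \<noteq> 0"
  have "(\<lambda>n. x / (pi * (x\<^sup>2 + (yseq n)\<^sup>2))) \<longlonglongrightarrow> x / (pi * (x\<^sup>2 + 0\<^sup>2))"
    using x by (intro tendsto_intros yseq_tendsto) auto
  then show ?thesis using x by (simp add: cpois_def power2_eq_square)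
qed

lemma cpois_le_inverse: "\<bar>cpois y s\<bar> \<le> 1 / (pi * \<bar>s\<bar>)"
proof (cases "s = 0")
  case False
  have "\<bar>cpois y s\<bar> = \<bar>s\<bar> / (pi * (s\<^sup>2 + y\<^sup>2))" by (simp add: cpois_def abs_mult)
  also have "\<dots> \<le> \<bar>s\<bar> / (pi * s\<^sup>2)" using False by (intro divide_left_mono mult_left_mono mult_pos_pos) (auto simp: add_pos_nonneg)
  also have "\<dots> = 1 / (pi * \<bar>s\<bar>)" using False by (simp add: power2_eq_square field_simps abs_if)
  finally show ?thesis .
qed (simp add: cpois_def)

text \<open>The kernel 1 / (\<pi> (s - x)) off the interval. For each \<open>x\<close> inside it is
  bounded in \<open>s\<close>, so its integrals against Poisson kernels converge absolutely, without
  principal values.\<close>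

definition outer :: "real \<Rightarrow> real \<Rightarrow> real" where
  "outer x s = (if \<bar>s\<bar> < 1 then 0 else 1 / (pi * (s - x)))"

lemma outer_measurable[measurable]: "outer x \<in> borel_measurable borel"
  unfolding outer_def by measurable

lemma outer_measurable2[measurable]: "(\<lambda>(x, s). outer x s) \<in> borel_measurable (borel \<Otimes>\<^sub>M borel)"
  unfolding outer_def by measurable

lemma outer_bound: "\<bar>x\<bar> < 1 \<Longrightarrow> \<bar>outer x s\<bar> \<le> 1 / (pi * (1 - \<bar>x\<bar>))"
proof (cases "\<bar>s\<bar> < 1")
  case False
  assume x: "\<bar>x\<bar> < 1"
  have "1 - \<bar>x\<bar> \<le> \<bar>s - x\<bar>" using False by linarith
  then have "1 / (pi * \<bar>s - x\<bar>) \<le> 1 / (pi * (1 - \<bar>x\<bar>))" using x by (intro divide_left_mono mult_left_mono mult_pos_pos) auto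
  then show ?thesis using False by (simp add: outer_def abs_mult)
qed (simp add: outer_def)

text \<open>
  The conjugate Poisson kernel is, on the interval, the transform of the Poisson kernel restricted to
  the interval plus the contribution of the part of the Poisson kernel outside.
\<close>
lemma cpois_decomposition:
  fixes t y :: real
  assumes y: "y > 0"
  defines "g \<equiv> (\<lambda>s. if \<bar>s\<bar> < 1 then pois y (s - t) else 0)"
  assumes k: "hil g k"
  shows "AE x in lborel. \<bar>x\<bar> < 1 \<longrightarrow> cpois y (t - x) = k x + (\<integral>s. pois y (s - t) * outer x s \<partial>lborel)"
  using bdry_AE_QI[OF hil_bdry[OF k]]
proof eventually_elim
  case (elim x)
  show ?case
  proof
    assume x: "\<bar>x\<bar> < 1"
    let ?o = "\<lambda>s. if \<bar>s\<bar> < 1 then 0 else pois y (s - t)"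
    have int: "integrable lborel (\<lambda>s. pois y (s - t))" by (rule integrable_pois[OF y])
    have gi: "integrable lborel g"
      unfolding g_def by (rule Bochner_Integration.integrable_bound[OF int]) auto
    have oi: "integrable lborel ?o"
      by (rule Bochner_Integration.integrable_bound[OF int]) auto
    have split: "cpois (y + yseq n) (t - x) = QI g (yseq n) x + (\<integral>s. ?o s * cpois (yseq n) (s - x) \<partial>lborel)" for n
    proof -
      have "cpois (y + yseq n) (t - x) = (\<integral>s. pois y (s - t) * cpois (yseq n) (s - x) \<partial>lborel)"
        by (rule poisson_cauchy_kernel(1)[OF y yseq_pos, symmetric])
      also have "\<dots> = (\<integral>s. g s * cpois (yseq n) (s - x) + ?o s * cpois (yseq n) (s - x) \<partial>lborel)"
        by (rule Bochner_Integration.integral_cong[OF refl]) (simp add: g_def)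
      also have "\<dots> = QI g (yseq n) x + (\<integral>s. ?o s * cpois (yseq n) (s - x) \<partial>lborel)"
        unfolding QI_def by (rule Bochner_Integration.integral_add[OF integrable_mult_cpois[OF gi yseq_pos] integrable_mult_cpois[OF oi yseq_pos]])
      finally show ?thesis .
    qed
    have l1: "(\<lambda>n. QI g (yseq n) x) \<longlonglongrightarrow> k x" by (rule filterlim_compose[OF elim yseq_at_right])
    have l2: "(\<lambda>n. \<integral>s. ?o s * cpois (yseq n) (s - x) \<partial>lborel) \<longlonglongrightarrow> (\<integral>s. pois y (s - t) * outer x s \<partial>lborel)"
    proof (rule integral_dominated_convergence[where w="\<lambda>s. pois y (s - t) * (1 / (pi * (1 - \<bar>x\<bar>)))"])
      show "integrable lborel (\<lambda>s. pois y (s - t) * (1 / (pi * (1 - \<bar>x\<bar>))))" by (rule integrable_mult_left[OF int])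
      show "AE s in lborel. (\<lambda>n. ?o s * cpois (yseq n) (s - x)) \<longlonglongrightarrow> pois y (s - t) * outer x s"
      proof (rule AE_I2)
        fix s :: real
        show "(\<lambda>n. ?o s * cpois (yseq n) (s - x)) \<longlonglongrightarrow> pois y (s - t) * outer x s"
        proof (cases "\<bar>s\<bar> < 1")
          case False
          then have "s - x \<noteq> 0" using x by auto
          from tendsto_mult_left[OF cpois_tendsto[OF this], of "pois y (s - t)"] show ?thesis using False by (simp add: outer_def)
        qed (simp add: outer_def)
      qed
      show "AE s in lborel. norm (?o s * cpois (yseq n) (s - x)) \<le> pois y (s - t) * (1 / (pi * (1 - \<bar>x\<bar>)))" for n
      proof (rule AE_I2)
        fix s :: real
        show "norm (?o s * cpois (yseq n) (s - x)) \<le> pois y (s - t) * (1 / (pi * (1 - \<bar>x\<bar>)))"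
        proof (cases "\<bar>s\<bar> < 1")
          case True then show ?thesis using x pois_nonneg[OF y, of "s - t"] by simp
        next
          case False
          have "\<bar>cpois (yseq n) (s - x)\<bar> \<le> 1 / (pi * \<bar>s - x\<bar>)" by (rule cpois_le_inverse)
          also have "\<dots> = \<bar>outer x s\<bar>" using False by (simp add: outer_def abs_mult)
          also have "\<dots> \<le> 1 / (pi * (1 - \<bar>x\<bar>))" by (rule outer_bound[OF x])
          finally have "pois y (s - t) * \<bar>cpois (yseq n) (s - x)\<bar> \<le> pois y (s - t) * (1 / (pi * (1 - \<bar>x\<bar>)))"
            by (intro mult_left_mono pois_nonneg y)
          then show ?thesis using False pois_nonneg[OF y, of "s - t"] by (simp add: abs_mult)
        qed
      qed
    qed measurable
    have "(\<lambda>n. (t - x) / (pi * ((t - x)\<^sup>2 + (y + yseq n)\<^sup>2))) \<longlonglongrightarrow> (t - x) / (pi * ((t - x)\<^sup>2 + (y + 0)\<^sup>2))"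
      using sum_sq_pos[OF y, of "t - x"] by (intro tendsto_intros yseq_tendsto) auto
    then have "(\<lambda>n. cpois (y + yseq n) (t - x)) \<longlonglongrightarrow> cpois y (t - x)" by (simp add: cpois_def)
    then have "(\<lambda>n. QI g (yseq n) x + (\<integral>s. ?o s * cpois (yseq n) (s - x) \<partial>lborel)) \<longlonglongrightarrow> cpois y (t - x)"
      by (simp only: split)
    with tendsto_add[OF l1 l2] show "cpois y (t - x) = k x + (\<integral>s. pois y (s - t) * outer x s \<partial>lborel)"
      using LIMSEQ_unique by blast
  qed
qed

text \<open>Up to the factor \<open>\<pi>\<close>, the transform of the indicator of \<open>(-1,1)\<close>.\<close>
definition L1fun :: "real \<Rightarrow> real" where
  "L1fun x = ln ((1 - x) / (1 + x))"

lemma L1fun_measurable[measurable]: "L1fun \<in> borel_measurable borel"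
  unfolding L1fun_def by measurable

text \<open>On [1, 2] the Poisson kernel is at most 1 and 1 / (s - x) integrates to the logarithm;
  beyond 2 the factor 1 / (s - x) is at most 1 and the Poisson kernel has mass 1.\<close>

lemma outer_half:
  assumes x: "\<bar>x\<bar> < 1"
  shows "(\<integral>\<^sup>+s\<in>{1..}. ennreal (1 / (s - x)) * ennreal (pois 1 s) \<partial>lborel) \<le> ennreal (ln ((2 - x) / (1 - x)) + 1)"
proof -
  have lnn: "ln (2 - x) - ln (1 - x) \<ge> 0" using x by simp
  have p1: "pois 1 s \<le> 1" for s using pois_bound[of 1 s] by simp
  have "(\<integral>\<^sup>+s\<in>{1..}. ennreal (1 / (s - x)) * ennreal (pois 1 s) \<partial>lborel) \<le> (\<integral>\<^sup>+s. ennreal (1 / (s - x)) * indicator {1..2} s + ennreal (pois 1 s) \<partial>lborel)"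
  proof (intro nn_integral_mono)
    fix s :: real
    show "ennreal (1 / (s - x)) * ennreal (pois 1 s) * indicator {1..} s \<le> ennreal (1 / (s - x)) * indicator {1..2} s + ennreal (pois 1 s)"
    proof (cases "s \<ge> 1")
      case True
      show ?thesis
      proof (cases "s \<le> 2")
        case s2: True
        have "ennreal (1 / (s - x)) * ennreal (pois 1 s) \<le> ennreal (1 / (s - x)) * ennreal 1"
          by (intro mult_left_mono ennreal_leI p1) simp
        then show ?thesis using True s2 by (simp add: add_increasing2)
      next
        case False
        have "1 / (s - x) \<le> 1" using False x by simp
        then have "ennreal (1 / (s - x)) * ennreal (pois 1 s) \<le> ennreal 1 * ennreal (pois 1 s)"
          by (intro mult_right_mono ennreal_leI) auto
        then show ?thesis using True False by (simp add: add_increasing)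
      qed
    qed simp
  qed
  also have "\<dots> = (\<integral>\<^sup>+s\<in>{1..2}. ennreal (1 / (s - x)) \<partial>lborel) + (\<integral>\<^sup>+s. ennreal (pois 1 s) \<partial>lborel)"
    by (rule nn_integral_add) measurable
  also have "(\<integral>\<^sup>+s\<in>{1..2}. ennreal (1 / (s - x)) \<partial>lborel) = ennreal (ln (2 - x) - ln (1 - x))"
    by (rule nn_integral_FTC_Icc) (use x in \<open>auto intro!: derivative_eq_intros\<close>)
  also have "(\<integral>\<^sup>+s. ennreal (pois 1 s) \<partial>lborel) = ennreal 1"
    using nn_integral_eq_integral[OF integrable_pois_1] integral_pois[of 1 0] pois_nonneg[of 1] by simp
  also have "ennreal (ln (2 - x) - ln (1 - x)) + ennreal 1 = ennreal (ln ((2 - x) / (1 - x)) + 1)"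
    using lnn x by (subst ennreal_plus[symmetric]) (auto simp: ln_div)
  finally show ?thesis .
qed

text \<open>The two half-lines contribute one logarithm each, singular at 1 and at -1 respectively.
  Only one of them can be large at a time, so their sum is at most 2 plus the modulus of the
  difference of ln (1 - x) and ln (1 + x), which is \<open>L1fun\<close>. The remaining 2 of the
  constant is the mass of the two tails.\<close>

lemma outer_integral_bound:
  assumes x: "\<bar>x\<bar> < 1"
  shows "(\<integral>\<^sup>+s. ennreal \<bar>outer x s\<bar> * ennreal (pois 1 s) \<partial>lborel) \<le> ennreal (4 + \<bar>L1fun x\<bar>)"
proof -
  have "(\<integral>\<^sup>+s. ennreal \<bar>outer x s\<bar> * ennreal (pois 1 s) \<partial>lborel) \<le>
    (\<integral>\<^sup>+s. ennreal (1 / (s - x)) * ennreal (pois 1 s) * indicator {1..} s + ennreal (1 / (- s - - x)) * ennreal (pois 1 (- s)) * indicator {1..} (- s) \<partial>lborel)"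
  proof (intro nn_integral_mono)
    fix s :: real
    have pi1: "1 / (pi * d) \<le> 1 / d" if "d > 0" for d
      using that pi_gt3 by (intro divide_left_mono) auto
    consider "\<bar>s\<bar> < 1" | "s \<ge> 1" | "s \<le> -1" by linarith
    then show "ennreal \<bar>outer x s\<bar> * ennreal (pois 1 s) \<le> ennreal (1 / (s - x)) * ennreal (pois 1 s) * indicator {1..} s + ennreal (1 / (- s - - x)) * ennreal (pois 1 (- s)) * indicator {1..} (- s)"
    proof cases
      case 1 then show ?thesis by (simp add: outer_def)
    next
      case 2
      then have "\<bar>outer x s\<bar> = 1 / (pi * (s - x))" using x by (simp add: outer_def abs_mult)
      also have "\<dots> \<le> 1 / (s - x)" using pi1[of "s - x"] 2 x by simp
      finally have "ennreal \<bar>outer x s\<bar> * ennreal (pois 1 s) \<le> ennreal (1 / (s - x)) * ennreal (pois 1 s)"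
        by (intro mult_right_mono ennreal_leI) auto
      then show ?thesis using 2 by simp
    next
      case 3
      then have "\<bar>outer x s\<bar> = 1 / (pi * (x - s))" using x by (simp add: outer_def abs_mult)
      also have "\<dots> \<le> 1 / (x - s)" using pi1[of "x - s"] 3 x by simp
      finally have "ennreal \<bar>outer x s\<bar> * ennreal (pois 1 s) \<le> ennreal (1 / (- s - - x)) * ennreal (pois 1 (- s))"
        by (simp add: pois_minus) (intro mult_right_mono ennreal_leI, auto)
      then show ?thesis using 3 by simp
    qed
  qed
  also have "\<dots> = (\<integral>\<^sup>+s\<in>{1..}. ennreal (1 / (s - x)) * ennreal (pois 1 s) \<partial>lborel) + (\<integral>\<^sup>+s. ennreal (1 / (- s - - x)) * ennreal (pois 1 (- s)) * indicator {1..} (- s) \<partial>lborel)"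
    by (rule nn_integral_add) measurable
  also have "(\<integral>\<^sup>+s. ennreal (1 / (- s - - x)) * ennreal (pois 1 (- s)) * indicator {1..} (- s) \<partial>lborel) = (\<integral>\<^sup>+s\<in>{1..}. ennreal (1 / (s - - x)) * ennreal (pois 1 s) \<partial>lborel)"
    using nn_integral_real_affine[of "\<lambda>s. ennreal (1 / (s - - x)) * ennreal (pois 1 s) * indicator {1..} s" "-1" 0] by simp
  also have "(\<integral>\<^sup>+s\<in>{1..}. ennreal (1 / (s - x)) * ennreal (pois 1 s) \<partial>lborel) + (\<integral>\<^sup>+s\<in>{1..}. ennreal (1 / (s - - x)) * ennreal (pois 1 s) \<partial>lborel)
    \<le> ennreal (ln ((2 - x) / (1 - x)) + 1) + ennreal (ln ((2 - - x) / (1 - - x)) + 1)"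
    using outer_half[of x] outer_half[of "- x"] x by (intro add_mono) auto
  also have "\<dots> \<le> ennreal (4 + \<bar>L1fun x\<bar>)"
  proof -
    have pos: "1 - x > 0" "1 + x > 0" "2 - x > 0" "2 + x > 0" using x by auto
    have g: "ln ((2 - x) / (1 - x)) \<ge> 0" "ln ((2 + x) / (1 + x)) \<ge> 0" using pos by (auto intro!: ln_ge_zero simp: le_divide_eq)
    have l2: "ln (2::real) \<le> 1" using ln_le_minus_one[of 2] by simp
    have e: "ln ((2 - x) / (1 - x)) = ln (2 - x) - ln (1 - x)" "ln ((2 + x) / (1 + x)) = ln (2 + x) - ln (1 + x)"
      "L1fun x = ln (1 - x) - ln (1 + x)" using pos by (auto simp: ln_div L1fun_def)
    have a: "\<bar>a\<bar> \<ge> a" "\<bar>a\<bar> \<ge> - a" for a :: real by auto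
    have "ln ((2 - x) / (1 - x)) + ln ((2 + x) / (1 + x)) \<le> 2 + \<bar>L1fun x\<bar>"
    proof (cases "x \<ge> 0")
      case True
      have 1: "ln (2 - x) \<le> ln 2" "ln (2 + x) \<le> ln (2 * (1 + x))" using True pos by auto
      have 2: "ln (1 + x) \<ge> 0" using True by simp
      have 3: "ln (2 * (1 + x)) = ln 2 + ln (1 + x)" by (rule ln_mult_pos) (use pos in auto)
      show ?thesis unfolding e using 1 2 3 l2 a(2)[of "ln (1 - x) - ln (1 + x)"] by linarith
    next
      case False
      have 1: "ln (2 + x) \<le> ln 2" "ln (2 - x) \<le> ln (2 * (1 - x))" using False pos by auto
      have 2: "ln (1 - x) \<ge> 0" using False by simp
      have 3: "ln (2 * (1 - x)) = ln 2 + ln (1 - x)" by (rule ln_mult_pos) (use pos in auto)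
      show ?thesis unfolding e using 1 2 3 l2 a(1)[of "ln (1 - x) - ln (1 + x)"] by linarith
    qed
    then have "(ln ((2 - x) / (1 - x)) + 1) + (ln ((2 + x) / (1 + x)) + 1) \<le> 4 + \<bar>L1fun x\<bar>" by simp
    then have "ennreal ((ln ((2 - x) / (1 - x)) + 1) + (ln ((2 + x) / (1 + x)) + 1)) \<le> ennreal (4 + \<bar>L1fun x\<bar>)" by (rule ennreal_leI)
    then show ?thesis using g by (subst (asm) ennreal_plus) auto
  qed
  finally show ?thesis .
qed

text \<open>Averaging over harmonic measure raises the kernel to height y + 1. This lies between 1
  and 2, so the numerator at most doubles and the denominator does not decrease.\<close>

lemma pois_semigroup_nn:
  assumes y: "y > 0" "y \<le> 1"
  shows "(\<integral>\<^sup>+t. ennreal (pois y (s - t)) \<partial>nu) \<le> 2 * ennreal (pois 1 s)"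
proof -
  have eq: "pois y (s - t) = pois y (t - s)" for t using pois_minus[of y "t - s"] by simp
  have i: "integrable lborel (\<lambda>t. pois y (t - s) * pois 1 (t - 0))"
    by (rule integrable_pois_bounded[where B=1, OF _ _ y(1)]) (use pois_bound[of 1] pois_nonneg[of 1] in auto)
  have "(\<integral>\<^sup>+t. ennreal (pois y (s - t)) \<partial>nu) = (\<integral>\<^sup>+t. ennreal (pois y (t - s) * pois 1 (t - 0)) \<partial>lborel)"
    unfolding eq by (subst nn_integral_nu) (auto simp: ennreal_mult pois_nonneg y)
  also have "\<dots> = ennreal (pois (y + 1) (s - 0))"
    unfolding poisson_cauchy_kernel(2)[OF y(1) zero_less_one, of s 0, symmetric]
    by (rule nn_integral_eq_integral[OF i]) (auto simp: pois_nonneg y)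
  also have "pois (y + 1) (s - 0) \<le> 2 * pois 1 s"
  proof -
    have "1 \<le> (y + 1)\<^sup>2" using y by (simp add: one_le_power)
    then have "(y + 1) / (pi * (s\<^sup>2 + (y + 1)\<^sup>2)) \<le> 2 / (pi * (s\<^sup>2 + 1\<^sup>2))"
      using y by (intro frac_le mult_left_mono mult_pos_pos) (auto simp: add_nonneg_pos)
    then show ?thesis by (simp add: pois_def)
  qed
  then have "ennreal (pois (y + 1) (s - 0)) \<le> 2 * ennreal (pois 1 s)"
    by (metis ennreal_leI ennreal_mult'' ennreal_numeral pois_nonneg zero_less_one)
  finally show ?thesis .
qed

text \<open>\<open>h\<close> plays the part of the transform of \<open>u\<close> in a weak sense: it
  is known only through test functions on the interval, and \<open>u\<close> is not assumed to lie
  in \<open>LlogL\<close>. This covers both uses: \<open>h\<close> from a vector integral, and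
  \<open>h\<close> the restricted boundary function of \<open>u\<close>.\<close>

context
  fixes u h :: "real \<Rightarrow> real"
  assumes um[measurable]: "u \<in> borel_measurable borel" and u0: "\<And>x. u x \<ge> 0" and uz: "\<And>x. x \<notin> {-1<..<1} \<Longrightarrow> u x = 0"
    and ui: "integrable lborel u"
    and hm[measurable]: "h \<in> borel_measurable borel"
    and hi: "integrable lborel h"
    and dual: "\<And>g k M. g \<in> borel_measurable borel \<Longrightarrow> (\<And>x. \<bar>g x\<bar> \<le> M) \<Longrightarrow> (\<And>x. x \<notin> {-1<..<1} \<Longrightarrow> g x = 0) \<Longrightarrow> hil g k \<Longrightarrow>
       integrable lborel (\<lambda>x. u x * k x) \<and> (\<integral>x. u x * k x \<partial>lborel) = - (\<integral>x. h x * g x \<partial>lborel)"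
begin

text \<open>The test function is the Poisson kernel of t + \<i> y cut off to the interval. By
  \<open>cpois_decomposition\<close> its transform and the outer part add up to the kernel of
  \<open>QI\<close> up to sign; duality turns the first into an integral of
  \<open>h\<close>.\<close>

lemma QI_pointwise_bound:
  assumes y: "y > 0"
  shows "ennreal \<bar>QI u y t\<bar> \<le> (\<integral>\<^sup>+s. ennreal \<bar>h s\<bar> * ennreal (pois y (s - t)) \<partial>lborel) +
     (\<integral>\<^sup>+x. ennreal (u x) * (\<integral>\<^sup>+s. ennreal \<bar>outer x s\<bar> * ennreal (pois y (s - t)) \<partial>lborel) \<partial>lborel)"
proof -
  define g where "g = (\<lambda>s. if \<bar>s\<bar> < 1 then pois y (s - t) else 0)"
  have gm[measurable]: "g \<in> borel_measurable borel" unfolding g_def by measurable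
  have gb: "\<bar>g s\<bar> \<le> 1 / y" for s using pois_bound[OF y] pois_nonneg[OF y] y by (auto simp: g_def)
  have gz: "g s = 0" if "s \<notin> {-1<..<1}" for s using that by (auto simp: g_def abs_if split: if_splits)
  obtain k where k: "hil g k" using hil_exists[OF domI_interval[OF gm gb gz]] by blast
  have km[measurable]: "k \<in> borel_measurable borel" by (rule bdry_measurable[OF hil_bdry[OF k]])
  have uk: "integrable lborel (\<lambda>x. u x * k x)" "(\<integral>x. u x * k x \<partial>lborel) = - (\<integral>x. h x * g x \<partial>lborel)"
    using dual[OF gm gb gz k] by auto
  let ?O = "\<lambda>x. \<integral>s. pois y (s - t) * outer x s \<partial>lborel"
  have ic: "integrable lborel (\<lambda>x. u x * cpois y (x - t))" by (rule integrable_mult_cpois[OF ui y])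
  have dec: "AE x in lborel. u x * cpois y (x - t) = - (u x * k x) - u x * ?O x"
    using cpois_decomposition[OF y k[unfolded g_def]]
  proof eventually_elim
    case (elim x)
    show ?case
    proof (cases "\<bar>x\<bar> < 1")
      case True
      then have "cpois y (t - x) = k x + ?O x" using elim by simp
      moreover have "cpois y (x - t) = - cpois y (t - x)" using cpois_minus[of y "t - x"] by simp
      ultimately have "cpois y (x - t) = - k x - ?O x" by linarith
      then show ?thesis by (simp only: right_diff_distrib mult_minus_right)
    next
      case False then have "u x = 0" by (intro uz) auto
      then show ?thesis by simp
    qed
  qed
  have dec2: "AE x in lborel. u x * ?O x = - (u x * k x) - u x * cpois y (x - t)"
    using dec by eventually_elim simp
  \<comment> \<open>Integrability is read off from the identity, as a difference of integrable
    functions, since the inner integral may be unbounded near the endpoints.\<close>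
  have iO: "integrable lborel (\<lambda>x. u x * ?O x)"
    by (subst integrable_cong_AE[OF _ _ dec2]) (use uk(1) ic in auto)
  have "QI u y t = (\<integral>x. - (u x * k x) - u x * ?O x \<partial>lborel)"
    unfolding QI_def by (rule integral_cong_AE[OF _ _ dec]) measurable
  also have "\<dots> = (\<integral>x. h x * g x \<partial>lborel) - (\<integral>x. u x * ?O x \<partial>lborel)"
    using uk iO by simp
  finally have eq: "QI u y t = (\<integral>x. h x * g x \<partial>lborel) - (\<integral>x. u x * ?O x \<partial>lborel)" .
  have "ennreal \<bar>QI u y t\<bar> \<le> ennreal (norm (\<integral>x. h x * g x \<partial>lborel) + norm (\<integral>x. u x * ?O x \<partial>lborel))"
    unfolding eq by (intro ennreal_leI) simp
  also have "\<dots> = ennreal (norm (\<integral>x. h x * g x \<partial>lborel)) + ennreal (norm (\<integral>x. u x * ?O x \<partial>lborel))" by simp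
  also have "ennreal (norm (\<integral>x. h x * g x \<partial>lborel)) \<le> (\<integral>\<^sup>+s. ennreal \<bar>h s\<bar> * ennreal (pois y (s - t)) \<partial>lborel)"
  proof -
    have "integrable lborel (\<lambda>x. h x * g x)"
    proof (rule Bochner_Integration.integrable_bound[OF integrable_mult_right[OF hi, of "1/y"]])
      show "AE x in lborel. norm (h x * g x) \<le> norm (1 / y * h x)"
        using mult_left_mono[OF gb abs_ge_zero] y by (intro AE_I2) (simp add: abs_mult)
    qed measurable
    then have "ennreal (norm (\<integral>x. h x * g x \<partial>lborel)) \<le> (\<integral>\<^sup>+x. ennreal (norm (h x * g x)) \<partial>lborel)"
      by (rule integral_norm_bound_ennreal)
    also have "\<dots> \<le> (\<integral>\<^sup>+s. ennreal \<bar>h s\<bar> * ennreal (pois y (s - t)) \<partial>lborel)"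
      by (intro nn_integral_mono) (auto simp: g_def abs_mult ennreal_mult pois_nonneg y)
    finally show ?thesis .
  qed
  also have "ennreal (norm (\<integral>x. u x * ?O x \<partial>lborel)) \<le> (\<integral>\<^sup>+x. ennreal (u x) * (\<integral>\<^sup>+s. ennreal \<bar>outer x s\<bar> * ennreal (pois y (s - t)) \<partial>lborel) \<partial>lborel)"
  proof -
    have "ennreal (norm (\<integral>x. u x * ?O x \<partial>lborel)) \<le> (\<integral>\<^sup>+x. ennreal (norm (u x * ?O x)) \<partial>lborel)"
      by (rule integral_norm_bound_ennreal[OF iO])
    also have "\<dots> \<le> (\<integral>\<^sup>+x. ennreal (u x) * (\<integral>\<^sup>+s. ennreal \<bar>outer x s\<bar> * ennreal (pois y (s - t)) \<partial>lborel) \<partial>lborel)"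
    proof (intro nn_integral_mono)
      fix x
      have "ennreal (norm (?O x)) \<le> (\<integral>\<^sup>+s. ennreal (norm (pois y (s - t) * outer x s)) \<partial>lborel)"
      \<comment> \<open>The Bochner integral of a function that is not integrable is 0, so the bound
        is trivial in that case.\<close>
      proof (cases "integrable lborel (\<lambda>s. pois y (s - t) * outer x s)")
        case True then show ?thesis by (rule integral_norm_bound_ennreal)
      qed (simp add: not_integrable_integral_eq)
      also have "\<dots> = (\<integral>\<^sup>+s. ennreal \<bar>outer x s\<bar> * ennreal (pois y (s - t)) \<partial>lborel)"
        by (intro nn_integral_cong) (simp add: abs_mult ennreal_mult pois_nonneg y mult.commute)
      finally have "ennreal (u x) * ennreal (norm (?O x)) \<le> ennreal (u x) * (\<integral>\<^sup>+s. ennreal \<bar>outer x s\<bar> * ennreal (pois y (s - t)) \<partial>lborel)"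
        by (intro mult_left_mono) auto
      then show "ennreal (norm (u x * ?O x)) \<le> ennreal (u x) * (\<integral>\<^sup>+s. ennreal \<bar>outer x s\<bar> * ennreal (pois y (s - t)) \<partial>lborel)"
        using u0[of x] by (simp add: abs_mult ennreal_mult)
    qed
    finally show ?thesis .
  qed
  finally show ?thesis by (simp add: add_mono)
qed

text \<open>Averaging the pointwise bound over \<open>t\<close> replaces every Poisson kernel by at
  most twice \<open>pois 1\<close>, uniformly for heights up to 1; the outer part is then bounded by
  \<open>outer_integral_bound\<close>.\<close>

lemma QI_nu_bound:
  assumes y: "y > 0" "y \<le> 1"
  shows "(\<integral>\<^sup>+t. ennreal \<bar>QI u y t\<bar> \<partial>nu) \<le> 2 * ((\<integral>\<^sup>+s. ennreal \<bar>h s\<bar> \<partial>lborel) + (\<integral>\<^sup>+x. ennreal (u x) * ennreal (4 + \<bar>L1fun x\<bar>) \<partial>lborel))"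
proof -
  interpret N: pair_sigma_finite nu lborel ..
  have inner: "(\<integral>\<^sup>+t. (\<integral>\<^sup>+s. f s * ennreal (pois y (s - t)) \<partial>lborel) \<partial>nu) \<le> 2 * (\<integral>\<^sup>+s. f s * ennreal (pois 1 s) \<partial>lborel)"
    if [measurable]: "f \<in> borel_measurable borel" for f :: "real \<Rightarrow> ennreal"
  proof -
    have "(\<integral>\<^sup>+t. (\<integral>\<^sup>+s. f s * ennreal (pois y (s - t)) \<partial>lborel) \<partial>nu) = (\<integral>\<^sup>+s. (\<integral>\<^sup>+t. f s * ennreal (pois y (s - t)) \<partial>nu) \<partial>lborel)"
      by (rule N.Fubini'[symmetric]) (simp add: pois_def, measurable)
    also have "\<dots> = (\<integral>\<^sup>+s. f s * (\<integral>\<^sup>+t. ennreal (pois y (s - t)) \<partial>nu) \<partial>lborel)"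
      by (intro nn_integral_cong nn_integral_cmult) measurable
    also have "\<dots> \<le> (\<integral>\<^sup>+s. f s * (2 * ennreal (pois 1 s)) \<partial>lborel)"
      by (intro nn_integral_mono mult_left_mono pois_semigroup_nn y) auto
    also have "\<dots> = (\<integral>\<^sup>+s. 2 * (f s * ennreal (pois 1 s)) \<partial>lborel)" by (simp only: mult.left_commute)
    also have "\<dots> = 2 * (\<integral>\<^sup>+s. f s * ennreal (pois 1 s) \<partial>lborel)"
      by (rule nn_integral_cmult) measurable
    finally show ?thesis .
  qed
  have m1[measurable]: "(\<lambda>(t, x). ennreal (u x) * (\<integral>\<^sup>+s. ennreal \<bar>outer x s\<bar> * ennreal (pois y (s - t)) \<partial>lborel)) \<in> borel_measurable (nu \<Otimes>\<^sub>M lborel)"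
    unfolding outer_def pois_def by measurable
  have m2: "(\<lambda>t. \<integral>\<^sup>+s. ennreal \<bar>h s\<bar> * ennreal (pois y (s - t)) \<partial>lborel) \<in> borel_measurable nu"
    unfolding pois_def by measurable
  have "(\<integral>\<^sup>+t. ennreal \<bar>QI u y t\<bar> \<partial>nu) \<le> (\<integral>\<^sup>+t. (\<integral>\<^sup>+s. ennreal \<bar>h s\<bar> * ennreal (pois y (s - t)) \<partial>lborel) +
     (\<integral>\<^sup>+x. ennreal (u x) * (\<integral>\<^sup>+s. ennreal \<bar>outer x s\<bar> * ennreal (pois y (s - t)) \<partial>lborel) \<partial>lborel) \<partial>nu)"
    by (intro nn_integral_mono QI_pointwise_bound y)
  also have "\<dots> = (\<integral>\<^sup>+t. (\<integral>\<^sup>+s. ennreal \<bar>h s\<bar> * ennreal (pois y (s - t)) \<partial>lborel) \<partial>nu) +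
     (\<integral>\<^sup>+t. (\<integral>\<^sup>+x. ennreal (u x) * (\<integral>\<^sup>+s. ennreal \<bar>outer x s\<bar> * ennreal (pois y (s - t)) \<partial>lborel) \<partial>lborel) \<partial>nu)"
    by (rule nn_integral_add[OF m2]) measurable
  also have "(\<integral>\<^sup>+t. (\<integral>\<^sup>+x. ennreal (u x) * (\<integral>\<^sup>+s. ennreal \<bar>outer x s\<bar> * ennreal (pois y (s - t)) \<partial>lborel) \<partial>lborel) \<partial>nu) =
     (\<integral>\<^sup>+x. (\<integral>\<^sup>+t. ennreal (u x) * (\<integral>\<^sup>+s. ennreal \<bar>outer x s\<bar> * ennreal (pois y (s - t)) \<partial>lborel) \<partial>nu) \<partial>lborel)"
    by (rule N.Fubini'[symmetric, OF m1])
  also have "\<dots> = (\<integral>\<^sup>+x. ennreal (u x) * (\<integral>\<^sup>+t. (\<integral>\<^sup>+s. ennreal \<bar>outer x s\<bar> * ennreal (pois y (s - t)) \<partial>lborel) \<partial>nu) \<partial>lborel)"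
    by (intro nn_integral_cong nn_integral_cmult) (simp add: pois_def)
  also have "\<dots> \<le> (\<integral>\<^sup>+x. 2 * (ennreal (u x) * ennreal (4 + \<bar>L1fun x\<bar>)) \<partial>lborel)"
  proof (intro nn_integral_mono)
    fix x
    show "ennreal (u x) * (\<integral>\<^sup>+t. (\<integral>\<^sup>+s. ennreal \<bar>outer x s\<bar> * ennreal (pois y (s - t)) \<partial>lborel) \<partial>nu) \<le> 2 * (ennreal (u x) * ennreal (4 + \<bar>L1fun x\<bar>))"
    proof (cases "\<bar>x\<bar> < 1")
      case True
      have "(\<integral>\<^sup>+t. (\<integral>\<^sup>+s. ennreal \<bar>outer x s\<bar> * ennreal (pois y (s - t)) \<partial>lborel) \<partial>nu) \<le> 2 * (\<integral>\<^sup>+s. ennreal \<bar>outer x s\<bar> * ennreal (pois 1 s) \<partial>lborel)"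
        by (rule inner) measurable
      also have "\<dots> \<le> 2 * ennreal (4 + \<bar>L1fun x\<bar>)" by (intro mult_left_mono outer_integral_bound True) simp
      finally have "ennreal (u x) * (\<integral>\<^sup>+t. (\<integral>\<^sup>+s. ennreal \<bar>outer x s\<bar> * ennreal (pois y (s - t)) \<partial>lborel) \<partial>nu) \<le> ennreal (u x) * (2 * ennreal (4 + \<bar>L1fun x\<bar>))"
        by (intro mult_left_mono) auto
      then show ?thesis by (simp only: mult.left_commute)
    next
      case False then have "u x = 0" by (intro uz) auto
      then show ?thesis by simp
    qed
  qed
  also have "\<dots> = 2 * (\<integral>\<^sup>+x. ennreal (u x) * ennreal (4 + \<bar>L1fun x\<bar>) \<partial>lborel)"
    by (rule nn_integral_cmult) measurable
  also have "(\<integral>\<^sup>+t. (\<integral>\<^sup>+s. ennreal \<bar>h s\<bar> * ennreal (pois y (s - t)) \<partial>lborel) \<partial>nu) \<le> 2 * (\<integral>\<^sup>+s. ennreal \<bar>h s\<bar> * ennreal (pois 1 s) \<partial>lborel)"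
    by (rule inner) measurable
  also have "(\<integral>\<^sup>+s. ennreal \<bar>h s\<bar> * ennreal (pois 1 s) \<partial>lborel) \<le> (\<integral>\<^sup>+s. ennreal \<bar>h s\<bar> * ennreal 1 \<partial>lborel)"
    using pois_bound[of 1] by (intro nn_integral_mono mult_left_mono ennreal_leI) auto
  finally show ?thesis by (simp add: distrib_left add_mono mult_left_mono)
qed

text \<open>
  Poisson's formula for \<open>X log X\<close> with \<open>X = 1 + P - iQ\<close>: its real part is at least \<open>(1 + P) ln (1 + P) - \<pi> \<bar>Q\<bar>\<close>.
\<close>
lemma entropy_PI_le:
  assumes y: "y > 0"
  defines "N \<equiv> (\<integral>x. \<bar>u x\<bar> \<partial>lborel)"
  shows "(\<integral>\<^sup>+t. ennreal ((1 + PI u y t) * ln (1 + PI u y t)) \<partial>nu) \<le> ennreal ((1 + N) * (5 + N)) + ennreal pi * (\<integral>\<^sup>+t. ennreal \<bar>QI u y t\<bar> \<partial>nu)"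
proof -
  have N0: "N \<ge> 0" unfolding N_def by (rule integral_nonneg_AE) simp
  have [measurable]: "QI u y \<in> borel_measurable borel" "PI u y \<in> borel_measurable borel"
    using QI_measurable[OF ui y] PI_measurable[OF ui y] by auto
  have P0: "PI u r t \<ge> 0" if "r > 0" for r t
    unfolding PI_def by (rule integral_nonneg_AE) (use u0 pois_nonneg[OF that] in auto)
  let ?X = "\<lambda>z. 1 - \<i> * Fc u (z + \<i> * of_real y)"
  let ?G = "\<lambda>z. ?X z * Ln (?X z)"
  \<comment> \<open>P \<ge> 0 because \<open>u\<close> is nonnegative. So X stays away from the
    branch cut of the logarithm, and log \<bar>X\<bar> is nonnegative.\<close>
  have ReX: "Re (?X z) \<ge> 1" if z: "Im z > - y" for z
  proof -
    have p: "Im (z + \<i> * of_real y) > 0" using z by simp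
    have "Fc u (z + \<i> * of_real y) = Complex (QI u (Im (z + \<i> * of_real y)) (Re (z + \<i> * of_real y))) (PI u (Im (z + \<i> * of_real y)) (Re (z + \<i> * of_real y)))"
      using Fc_eq(1)[OF ui p, of "Re (z + \<i> * of_real y)"] by (simp only: complex.collapse)
    then show ?thesis using P0[OF p] by simp
  qed
  have Xnz: "?X z \<noteq> 0" "?X z \<notin> \<real>\<^sub>\<le>\<^sub>0" if "Im z > - y" for z
  proof -
    show "?X z \<noteq> 0" using ReX[OF that] by (metis not_one_le_zero zero_complex.sel(1))
    show "?X z \<notin> \<real>\<^sub>\<le>\<^sub>0" using ReX[OF that] by (simp only: complex_nonpos_Reals_iff) linarith
  qed
  have holX: "?X holomorphic_on {z. Im z > - y}"
    by (intro holomorphic_intros Fc_shift(1)[OF ui y])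
  have hol: "?G holomorphic_on {z. Im z > - y}"
    by (intro holomorphic_on_mult holX holomorphic_on_Ln') (use Xnz in auto)
  have Xge1: "cmod (?X z) \<ge> 1" if "Im z > - y" for z
    using order_trans[OF ReX[OF that] complex_Re_le_cmod] .
  have Gb: "cmod (?G z) \<le> cmod (?X z) * (cmod (?X z) + pi)" if z: "Im z > - y" for z
  proof -
    have "cmod (Ln (?X z)) \<le> \<bar>Re (Ln (?X z))\<bar> + \<bar>Im (Ln (?X z))\<bar>" by (rule cmod_le)
    also have "Re (Ln (?X z)) = ln (cmod (?X z))" using Xnz(1)[OF z] by simp
    also have "\<bar>ln (cmod (?X z))\<bar> \<le> cmod (?X z)"
    proof -
      have "0 < cmod (?X z)" using Xge1[OF z] by linarith
      then have "ln (cmod (?X z)) \<le> cmod (?X z) - 1" by (rule ln_le_minus_one)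
      moreover have "0 \<le> ln (cmod (?X z))" by (rule ln_ge_zero[OF Xge1[OF z]])
      ultimately show ?thesis by linarith
    qed
    also have "\<bar>Im (Ln (?X z))\<bar> \<le> pi" using mpi_less_Im_Ln[OF Xnz(1)[OF z]] Im_Ln_le_pi[OF Xnz(1)[OF z]] by simp
    finally have "cmod (Ln (?X z)) \<le> cmod (?X z) + pi" by simp
    then show ?thesis unfolding norm_mult by (intro mult_left_mono) auto
  qed
  let ?B = "(\<integral>x. \<bar>u x\<bar> \<partial>lborel) / (pi * y)"
  have bd: "cmod (?G z) \<le> (1 + ?B) * ((1 + ?B) + pi)" if z: "Im z \<ge> 0" for z
  proof -
    have "cmod (?X z) \<le> cmod 1 + cmod (\<i> * Fc u (z + \<i> * of_real y))" by (rule norm_triangle_ineq4)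
    also have "\<dots> \<le> 1 + ?B" using Fc_shift(2)[OF ui y z] by (simp add: norm_mult)
    finally have "cmod (?X z) * (cmod (?X z) + pi) \<le> (1 + ?B) * ((1 + ?B) + pi)"
      by (intro mult_mono add_mono) (auto intro: order_trans[OF norm_ge_zero])
    with Gb[of z] z y show ?thesis by simp
  qed
  have Xt: "?X (of_real t) = Complex (1 + PI u y t) (- QI u y t)" for t
    by (simp add: of_real_shift Fc_eq(1)[OF ui y] complex_eq_iff)
  have lower: "(1 + PI u y t) * ln (1 + PI u y t) \<le> Re (?G (of_real t)) + pi * \<bar>QI u y t\<bar>" for t
  proof -
    let ?x = "?X (of_real t)"
    have x0: "?x \<noteq> 0" using Xnz(1)[of "of_real t"] y by simp
    have "1 + PI u y t \<le> cmod ?x" using complex_Re_le_cmod[of ?x] by (simp add: Xt)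
    then have "ln (1 + PI u y t) \<le> ln (cmod ?x)" using P0[OF y, of t] by (intro ln_mono) auto
    then have "(1 + PI u y t) * ln (1 + PI u y t) \<le> (1 + PI u y t) * ln (cmod ?x)"
      using P0[OF y, of t] by (intro mult_left_mono) auto
    moreover have "Re (?G (of_real t)) = (1 + PI u y t) * ln (cmod ?x) + QI u y t * Im (Ln ?x)"
    proof -
      have "Re (?x * Ln ?x) = Re ?x * Re (Ln ?x) - Im ?x * Im (Ln ?x)" by (rule times_complex.sel(1))
      moreover have "Re (Ln ?x) = ln (cmod ?x)" using x0 by simp
      moreover have "Re ?x = 1 + PI u y t" "Im ?x = - QI u y t" unfolding Xt by auto
      ultimately show ?thesis by simp
    qed
    moreover have "\<bar>QI u y t * Im (Ln ?x)\<bar> \<le> \<bar>QI u y t\<bar> * pi"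
      unfolding abs_mult using mpi_less_Im_Ln[OF x0] Im_Ln_le_pi[OF x0] by (intro mult_left_mono) auto
    ultimately show ?thesis by (simp add: abs_le_iff mult.commute)
  qed
  have nn: "0 \<le> (1 + PI u y t) * ln (1 + PI u y t)" for t
    using P0[OF y, of t] by (intro mult_nonneg_nonneg ln_ge_zero) auto
  have iG: "integrable lborel (\<lambda>t. pois 1 t * Re (?G (of_real t)))"
    by (rule Re_poisson_formula_i(2)[OF hol y bd])
  have iQ: "integrable nu (\<lambda>t. \<bar>QI u y t\<bar>)"
    by (rule integrable_nu_bounded[where B="?B"]) (use QI_bound[OF ui y] in auto)
  then have iQ2: "integrable lborel (\<lambda>t. pois 1 t * \<bar>QI u y t\<bar>)" by (subst (asm) integrable_nu_iff) auto
  have iR: "integrable lborel (\<lambda>t. pois 1 t * Re (?G (of_real t)) + pi * (pois 1 t * \<bar>QI u y t\<bar>))"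
    by (intro Bochner_Integration.integrable_add iG integrable_mult_right iQ2)
  have "(\<integral>\<^sup>+t. ennreal ((1 + PI u y t) * ln (1 + PI u y t)) \<partial>nu) = (\<integral>\<^sup>+t. ennreal ((1 + PI u y t) * ln (1 + PI u y t)) * ennreal (pois 1 t) \<partial>lborel)"
    by (rule nn_integral_nu) measurable
  also have "\<dots> \<le> (\<integral>\<^sup>+t. ennreal (pois 1 t * Re (?G (of_real t)) + pi * (pois 1 t * \<bar>QI u y t\<bar>)) \<partial>lborel)"
  proof (intro nn_integral_mono)
    fix t
    have "pois 1 t * ((1 + PI u y t) * ln (1 + PI u y t)) \<le> pois 1 t * (Re (?G (of_real t)) + pi * \<bar>QI u y t\<bar>)"
      by (intro mult_left_mono lower pois_nonneg) simp
    also have "\<dots> = pois 1 t * Re (?G (of_real t)) + pi * (pois 1 t * \<bar>QI u y t\<bar>)" by (simp only: distrib_left mult.left_commute)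
    finally have "ennreal (pois 1 t * ((1 + PI u y t) * ln (1 + PI u y t))) \<le> ennreal (pois 1 t * Re (?G (of_real t)) + pi * (pois 1 t * \<bar>QI u y t\<bar>))"
      by (rule ennreal_leI)
    then show "ennreal ((1 + PI u y t) * ln (1 + PI u y t)) * ennreal (pois 1 t) \<le> ennreal (pois 1 t * Re (?G (of_real t)) + pi * (pois 1 t * \<bar>QI u y t\<bar>))"
      using nn[of t] pois_nonneg[of 1 t] by (simp only: mult.commute[of "ennreal (pois 1 t)"] mult.commute[of "pois 1 t" "_ * _"] ennreal_mult)
  qed
  also have "\<dots> = ennreal (\<integral>t. pois 1 t * Re (?G (of_real t)) + pi * (pois 1 t * \<bar>QI u y t\<bar>) \<partial>lborel)"
  proof (rule nn_integral_eq_integral[OF iR], rule AE_I2)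
    fix t
    have "0 \<le> pois 1 t * (Re (?G (of_real t)) + pi * \<bar>QI u y t\<bar>)"
      by (intro mult_nonneg_nonneg pois_nonneg order_trans[OF nn lower]) simp
    then show "0 \<le> pois 1 t * Re (?G (of_real t)) + pi * (pois 1 t * \<bar>QI u y t\<bar>)" by (simp only: distrib_left mult.left_commute)
  qed
  also have "(\<integral>t. pois 1 t * Re (?G (of_real t)) + pi * (pois 1 t * \<bar>QI u y t\<bar>) \<partial>lborel) = Re (?G \<i>) + pi * (\<integral>t. \<bar>QI u y t\<bar> \<partial>nu)"
    by (subst Bochner_Integration.integral_add[OF iG integrable_mult_right[OF iQ2]], subst integral_nu)
       (simp_all only: integral_mult_right_zero Re_poisson_formula_i(1)[OF hol y bd], measurable)
  \<comment> \<open>At \<i> one has \<bar>X\<bar> \<le> 1 + N and \<bar>Ln X\<bar> \<le>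
    \<bar>X\<bar> + \<pi>, and \<pi> < 4.\<close>
  also have "ennreal (Re (?G \<i>) + pi * (\<integral>t. \<bar>QI u y t\<bar> \<partial>nu)) \<le> ennreal ((1 + N) * (5 + N) + pi * (\<integral>t. \<bar>QI u y t\<bar> \<partial>nu))"
  proof (rule ennreal_leI, rule add_right_mono)
    have "cmod (Fc u (\<i> + \<i> * of_real y)) \<le> N / (pi * Im (\<i> + \<i> * of_real y))"
      unfolding N_def by (rule Fc_bound[OF ui]) (use y in simp)
    also have "\<dots> \<le> N / 1"
    proof (rule divide_left_mono[OF _ N0])
      have "1 * 1 \<le> pi * (1 + y)" using pi_gt3 y by (intro mult_mono) auto
      then show "1 \<le> pi * Im (\<i> + \<i> * of_real y)" by simp
      then show "0 < pi * Im (\<i> + \<i> * of_real y) * 1" by linarith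
    qed
    finally have "cmod (?X \<i>) \<le> 1 + N" using norm_triangle_ineq4[of 1 "\<i> * Fc u (\<i> + \<i> * of_real y)"] by (simp add: norm_mult)
    then have "cmod (?X \<i>) * (cmod (?X \<i>) + pi) \<le> (1 + N) * (5 + N)"
      using pi_less_4 by (intro mult_mono) (auto intro: order_trans[OF norm_ge_zero])
    then show "Re (?G \<i>) \<le> (1 + N) * (5 + N)"
      using Gb[of \<i>] y complex_Re_le_cmod[of "?G \<i>"] by simp
  qed
  also have "\<dots> = ennreal ((1 + N) * (5 + N)) + ennreal pi * ennreal (\<integral>t. \<bar>QI u y t\<bar> \<partial>nu)"
    using N0 by (subst ennreal_plus) (auto simp: ennreal_mult integral_nonneg_AE)
  also have "ennreal (\<integral>t. \<bar>QI u y t\<bar> \<partial>nu) = (\<integral>\<^sup>+t. ennreal \<bar>QI u y t\<bar> \<partial>nu)"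
    by (rule nn_integral_eq_integral[OF iQ, symmetric]) simp
  finally show ?thesis .
qed

theorem entropy_bound:
  defines "N \<equiv> (\<integral>x. \<bar>u x\<bar> \<partial>lborel)"
  shows "(\<integral>\<^sup>+x. ennreal ((1 + u x) * ln (1 + u x)) \<partial>mu) \<le> ennreal (2 * pi) * (ennreal ((1 + N) * (5 + N)) +
    ennreal pi * (2 * ((\<integral>\<^sup>+s. ennreal \<bar>h s\<bar> \<partial>lborel) + (\<integral>\<^sup>+x. ennreal (u x) * ennreal (4 + \<bar>L1fun x\<bar>) \<partial>lborel))))"
proof -
  let ?R = "ennreal ((1 + N) * (5 + N)) +
    ennreal pi * (2 * ((\<integral>\<^sup>+s. ennreal \<bar>h s\<bar> \<partial>lborel) + (\<integral>\<^sup>+x. ennreal (u x) * ennreal (4 + \<bar>L1fun x\<bar>) \<partial>lborel)))"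
  have [measurable]: "\<And>n. PI u (yseq n) \<in> borel_measurable borel"
    using PI_measurable[OF ui yseq_pos] by auto
  have one: "(\<integral>\<^sup>+t. ennreal ((1 + PI u (yseq n) t) * ln (1 + PI u (yseq n) t)) \<partial>nu) \<le> ?R" for n
    unfolding N_def
    by (rule order_trans[OF entropy_PI_le[OF yseq_pos]]) (intro add_left_mono mult_left_mono QI_nu_bound yseq_pos yseq_le_1, simp)
  have "(\<integral>\<^sup>+x. ennreal ((1 + u x) * ln (1 + u x)) \<partial>nu) = (\<integral>\<^sup>+x. liminf (\<lambda>n. ennreal ((1 + PI u (yseq n) x) * ln (1 + PI u (yseq n) x))) \<partial>nu)"
  proof (rule nn_integral_cong_AE)
    show "AE x in nu. ennreal ((1 + u x) * ln (1 + u x)) = liminf (\<lambda>n. ennreal ((1 + PI u (yseq n) x) * ln (1 + PI u (yseq n) x)))"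
      unfolding AE_nu_iff using PI_AE_tendsto[OF ui]
    proof eventually_elim
      case (elim x)
      have l: "(\<lambda>n. PI u (yseq n) x) \<longlonglongrightarrow> u x" by (rule filterlim_compose[OF elim yseq_at_right])
      have "(\<lambda>n. ennreal ((1 + PI u (yseq n) x) * ln (1 + PI u (yseq n) x))) \<longlonglongrightarrow> ennreal ((1 + u x) * ln (1 + u x))"
        using u0[of x] by (intro tendsto_ennrealI tendsto_mult tendsto_ln tendsto_add tendsto_const l) auto
      then show ?case using lim_imp_Liminf[of sequentially] by (metis sequentially_bot)
    qed
  qed
  also have "\<dots> \<le> liminf (\<lambda>n. \<integral>\<^sup>+x. ennreal ((1 + PI u (yseq n) x) * ln (1 + PI u (yseq n) x)) \<partial>nu)"
    by (rule nn_integral_liminf) measurable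
  also have "\<dots> \<le> limsup (\<lambda>n. \<integral>\<^sup>+x. ennreal ((1 + PI u (yseq n) x) * ln (1 + PI u (yseq n) x)) \<partial>nu)" by (rule Liminf_le_Limsup) simp
  also have "\<dots> \<le> ?R" by (rule Limsup_bounded, rule always_eventually, rule allI, rule one)
  finally have "(\<integral>\<^sup>+x. ennreal ((1 + u x) * ln (1 + u x)) \<partial>nu) \<le> ?R" .
  then have "ennreal (2 * pi) * (\<integral>\<^sup>+x. ennreal ((1 + u x) * ln (1 + u x)) \<partial>nu) \<le> ennreal (2 * pi) * ?R" by (rule mult_left_mono) simp
  moreover have "(\<integral>\<^sup>+x. ennreal ((1 + u x) * ln (1 + u x)) \<partial>mu) \<le> ennreal (2 * pi) * (\<integral>\<^sup>+x. ennreal ((1 + u x) * ln (1 + u x)) \<partial>nu)"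
    by (rule nn_integral_mu_le_nu) measurable
  ultimately show ?thesis by (rule order_trans[rotated])
qed

end

section \<open>Transforms of indicators of intervals\<close>

lemma QI_indicator:
  fixes a b x y :: real
  assumes ab: "a \<le> b" and y: "y > 0"
  shows "QI (indicator {a..b}) y x = (ln ((b - x)\<^sup>2 + y\<^sup>2) - ln ((a - x)\<^sup>2 + y\<^sup>2)) / (2 * pi)"
proof -
  have p: "(s - x)\<^sup>2 + y\<^sup>2 > 0" for s using y by (rule sum_sq_pos)
  have "(\<integral>s. cpois y (s - x) * indicator {a..b} s \<partial>lborel) = ln ((b - x)\<^sup>2 + y\<^sup>2) / (2 * pi) - ln ((a - x)\<^sup>2 + y\<^sup>2) / (2 * pi)"
  proof (rule integral_FTC_Icc_real[OF ab])
    fix s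
    have d1: "((\<lambda>s. (s - x)\<^sup>2 + y\<^sup>2) has_real_derivative 2 * (s - x)) (at s)"
      by (auto intro!: derivative_eq_intros)
    have "((\<lambda>s. ln ((s - x)\<^sup>2 + y\<^sup>2) / (2 * pi)) has_real_derivative (1 / ((s - x)\<^sup>2 + y\<^sup>2) * (2 * (s - x))) / (2 * pi)) (at s)"
      by (rule DERIV_cdivide[OF DERIV_chain2[OF DERIV_ln_divide[OF p] d1]])
    moreover have "(1 / D * (2 * d)) / (2 * p) = d / (p * D)" for d p D :: real by simp
    ultimately show "((\<lambda>s. ln ((s - x)\<^sup>2 + y\<^sup>2) / (2 * pi)) has_real_derivative cpois y (s - x)) (at s)"
      by (simp only: cpois_def)
    show "isCont (\<lambda>s. cpois y (s - x)) s"
      unfolding cpois_def using p[of s] by (intro continuous_intros) auto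
  qed
  then show ?thesis unfolding QI_def by (simp add: mult.commute diff_divide_distrib)
qed

lemma hil_indicator:
  fixes a b :: real
  assumes ab: "a \<le> b" and h: "hil (indicator {a..b}) k"
  shows "AE x in lborel. k x = (ln \<bar>b - x\<bar> - ln \<bar>a - x\<bar>) / pi"
  using bdry_AE_QI[OF hil_bdry[OF h]] AE_lborel_singleton[of a] AE_lborel_singleton[of b]
proof eventually_elim
  case (elim x)
  have "(\<lambda>n. QI (indicator {a..b}) (yseq n) x) \<longlonglongrightarrow> k x" by (rule filterlim_compose[OF elim(1) yseq_at_right])
  moreover have "(\<lambda>n. (ln ((b - x)\<^sup>2 + (yseq n)\<^sup>2) - ln ((a - x)\<^sup>2 + (yseq n)\<^sup>2)) / (2 * pi)) \<longlonglongrightarrow> (ln ((b - x)\<^sup>2 + 0\<^sup>2) - ln ((a - x)\<^sup>2 + 0\<^sup>2)) / (2 * pi)"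
    using elim by (intro tendsto_intros yseq_tendsto) auto
  ultimately have "k x = (ln ((b - x)\<^sup>2 + 0\<^sup>2) - ln ((a - x)\<^sup>2 + 0\<^sup>2)) / (2 * pi)"
    unfolding QI_indicator[OF ab yseq_pos] by (rule LIMSEQ_unique)
  moreover have "ln (d\<^sup>2 + 0\<^sup>2) = 2 * ln \<bar>d\<bar>" if "d \<noteq> 0" for d :: real
    using ln_realpow[of "\<bar>d\<bar>" 2] that by simp
  ultimately show ?case using elim by (simp add: diff_divide_distrib)
qed

subsection \<open>The finite Hilbert transform\<close>

text \<open>Extension by zero: values off the interval do not matter for elements of
  \<open>L0\<close>, but they would enter transforms on the line.\<close>

definition rp :: "(real \<Rightarrow> complex) \<Rightarrow> real \<Rightarrow> real" where
  "rp f x = (if x \<in> {-1<..<1} then Re (f x) else 0)"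

definition ip :: "(real \<Rightarrow> complex) \<Rightarrow> real \<Rightarrow> real" where
  "ip f x = (if x \<in> {-1<..<1} then Im (f x) else 0)"

lemma rp_ip_eq: "x \<in> {-1<..<1} \<Longrightarrow> Complex (rp f x) (ip f x) = f x"
  by (simp add: rp_def ip_def)

lemma rp_outside: "x \<notin> {-1<..<1} \<Longrightarrow> rp f x = 0" and ip_outside: "x \<notin> {-1<..<1} \<Longrightarrow> ip f x = 0"
  by (auto simp: rp_def ip_def)

lemma rp_measurable: "f \<in> L0 \<Longrightarrow> rp f \<in> borel_measurable borel"
  and ip_measurable: "f \<in> L0 \<Longrightarrow> ip f \<in> borel_measurable borel"
proof -
  assume "f \<in> L0"
  then have m[measurable]: "(\<lambda>x. indicator {-1<..<1} x *\<^sub>R f x) \<in> borel_measurable borel"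
    by (simp add: L0_def measurable_mu_iff)
  have "rp f = (\<lambda>x. Re (indicator {-1<..<1} x *\<^sub>R f x))" "ip f = (\<lambda>x. Im (indicator {-1<..<1} x *\<^sub>R f x))"
    by (auto simp: rp_def ip_def fun_eq_iff)
  moreover have "(\<lambda>x. Re (indicator {-1<..<1} x *\<^sub>R f x)) \<in> borel_measurable borel"
    "(\<lambda>x. Im (indicator {-1<..<1} x *\<^sub>R f x)) \<in> borel_measurable borel" by measurable
  ultimately show "rp f \<in> borel_measurable borel" "ip f \<in> borel_measurable borel" by (simp_all only:)
qed

lemma integrable_mu_iff:
  fixes f :: "real \<Rightarrow> 'a::{banach, second_countable_topology}"
  shows "integrable mu f \<longleftrightarrow> integrable lborel (\<lambda>x. indicator {-1<..<1} x *\<^sub>R f x)"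
  unfolding mu_def by (rule integrable_restrict_space) simp

lemma integral_mu:
  fixes f :: "real \<Rightarrow> 'a::{banach, second_countable_topology}"
  shows "integral\<^sup>L mu f = (\<integral>x. indicator {-1<..<1} x *\<^sub>R f x \<partial>lborel)"
  unfolding mu_def by (rule integral_restrict_space) simp

lemma rp_ip_indicator: "indicator {-1<..<1} x *\<^sub>R f x = complex_of_real (rp f x) + \<i> * complex_of_real (ip f x)"
  by (simp add: rp_def ip_def complex_eq_iff)

lemma rp_ip_integrable:
  assumes "integrable mu f"
  shows rp_integrable: "integrable lborel (rp f)" and ip_integrable: "integrable lborel (ip f)"
proof -
  have i: "integrable lborel (\<lambda>x. indicator {-1<..<1} x *\<^sub>R f x)" using assms by (simp only: integrable_mu_iff)
  show "integrable lborel (rp f)" using integrable_Re[OF i] by (simp only: rp_ip_indicator) simp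
  show "integrable lborel (ip f)" using integrable_Im[OF i] by (simp only: rp_ip_indicator) simp
qed

definition ctr :: "(real \<Rightarrow> complex) \<Rightarrow> real \<Rightarrow> real \<Rightarrow> complex" where
  "ctr f e t = complex_of_real (htr (rp f) e t) + \<i> * complex_of_real (htr (ip f) e t)"

lemma integrable_htr:
  assumes u: "integrable lborel u" and e: "e > 0"
  shows "integrable lborel (\<lambda>x. u x * (if e < \<bar>x - t\<bar> then 1 / (pi * (x - t)) else 0))"
proof -
  have [measurable]: "u \<in> borel_measurable borel" using u by (simp add: borel_measurable_integrable)
  have b: "\<bar>if e < \<bar>x - t\<bar> then 1 / (pi * (x - t)) else 0\<bar> \<le> 1 / (pi * e)" for x
    using e by (auto simp: abs_mult intro!: divide_left_mono mult_left_mono mult_pos_pos)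
  show ?thesis
  proof (rule Bochner_Integration.integrable_bound[OF integrable_mult_right[OF u, of "1 / (pi * e)"]])
    show "AE x in lborel. norm (u x * (if e < \<bar>x - t\<bar> then 1 / (pi * (x - t)) else 0)) \<le> norm (1 / (pi * e) * u x)"
      using mult_left_mono[OF b abs_ge_zero] e by (intro always_eventually allI) (simp add: abs_mult mult.commute)
  qed measurable
qed

lemma truncated_hilbert_eq:
  assumes f: "integrable mu f" and t: "-1 < t" "t < 1" and e: "e > 0"
  shows "truncated_hilbert f t e = ctr f e t"
proof -
  let ?k = "\<lambda>x. if e < \<bar>x - t\<bar> then 1 / (pi * (x - t)) else 0"
  let ?K = "\<lambda>x. complex_of_real (rp f x * ?k x) + \<i> * complex_of_real (ip f x * ?k x)"
  have i: "integrable lborel ?K"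
    using integrable_htr[OF rp_integrable[OF f] e, of t] integrable_htr[OF ip_integrable[OF f] e, of t]
    by (intro Bochner_Integration.integrable_add integrable_mult_right integrable_of_real)
  have K: "?K x = complex_of_real (?k x) * (indicator {-1<..<1} x *\<^sub>R f x)" for x
    unfolding rp_ip_indicator by (simp add: algebra_simps)
  have iA: "integrable lborel (\<lambda>x. indicator A x *\<^sub>R (complex_of_real pi * ?K x))" if "A \<in> sets borel" for A
    using i that by (intro integrable_mult_indicator integrable_mult_right) auto
  \<comment> \<open>As \<open>?K\<close> vanishes off the interval, half-lines may replace the two
    ranges of integration, even when \<open>t - e\<close> or \<open>t + e\<close> lies outside the
    interval.\<close>
  have "indicator {-1<..<t - e} x *\<^sub>R (f x / complex_of_real (x - t)) = indicator {..<t - e} x *\<^sub>R (complex_of_real pi * ?K x)"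
    "indicator {t + e<..<1} x *\<^sub>R (f x / complex_of_real (x - t)) = indicator {t + e<..} x *\<^sub>R (complex_of_real pi * ?K x)" for x
    unfolding K using t e by (auto simp: indicator_def divide_simps)
  then have "(LINT x:{-1<..<t - e}|lborel. f x / complex_of_real (x - t)) + (LINT x:{t + e<..<1}|lborel. f x / complex_of_real (x - t))
      = (\<integral>x. indicator {..<t - e} x *\<^sub>R (complex_of_real pi * ?K x) \<partial>lborel) + (\<integral>x. indicator {t + e<..} x *\<^sub>R (complex_of_real pi * ?K x) \<partial>lborel)"
    unfolding set_lebesgue_integral_def by simp
  also have "\<dots> = (\<integral>x. indicator {..<t - e} x *\<^sub>R (complex_of_real pi * ?K x) + indicator {t + e<..} x *\<^sub>R (complex_of_real pi * ?K x) \<partial>lborel)"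
    by (rule Bochner_Integration.integral_add[symmetric]) (rule iA, simp)+
  also have "\<dots> = (\<integral>x. complex_of_real pi * ?K x \<partial>lborel)"
    by (rule Bochner_Integration.integral_cong[OF refl]) (use e in \<open>auto simp: indicator_def\<close>)
  also have "\<dots> = complex_of_real pi * ((\<integral>x. complex_of_real (rp f x * ?k x) \<partial>lborel) + (\<integral>x. \<i> * complex_of_real (ip f x * ?k x) \<partial>lborel))"
    using integrable_htr[OF rp_integrable[OF f] e, of t] integrable_htr[OF ip_integrable[OF f] e, of t]
    by (subst integral_mult_right_zero, subst Bochner_Integration.integral_add)
       (auto intro!: integrable_mult_right integrable_of_real simp del: of_real_mult)
  also have "\<dots> = complex_of_real pi * ctr f e t"
    unfolding ctr_def htr_def by (simp only: integral_mult_right_zero integral_complex_of_real)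
  finally have eq: "(LINT x:{-1<..<t - e}|lborel. f x / complex_of_real (x - t)) + (LINT x:{t + e<..<1}|lborel. f x / complex_of_real (x - t)) = complex_of_real pi * ctr f e t" .
  show ?thesis unfolding truncated_hilbert_def eq by simp
qed

text \<open>Where the limit exists it is the limit along one sequence, which depends measurably on
  \<open>t\<close>. Measurability of the transform is thereby reduced to that of the condition for
  existence.\<close>

lemma finite_hilbert_eq_ctr:
  assumes f: "integrable mu f" and t: "-1 < t" "t < 1"
  shows "finite_hilbert f t = (if \<exists>l. ((\<lambda>e. ctr f e t) \<longlongrightarrow> l) (at_right 0)
    then lim (\<lambda>n. ctr f (yseq n) t) else 0)"
proof -
  have ev: "\<forall>\<^sub>F e in at_right 0. truncated_hilbert f t e = ctr f e t"
    by (rule eventually_at_rightI[of 0 1]) (use truncated_hilbert_eq[OF f t] in auto)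
  have iff: "(truncated_hilbert f t \<longlongrightarrow> l) (at_right 0) \<longleftrightarrow> ((\<lambda>e. ctr f e t) \<longlongrightarrow> l) (at_right 0)" for l
    by (rule tendsto_cong[OF ev])
  have "Lim (at_right 0) (truncated_hilbert f t) = lim (\<lambda>n. ctr f (yseq n) t)" if l: "((\<lambda>e. ctr f e t) \<longlongrightarrow> l) (at_right 0)" for l
  proof -
    have "Lim (at_right 0) (truncated_hilbert f t) = l" using l iff[of l] by (intro tendsto_Lim) auto
    moreover have "lim (\<lambda>n. ctr f (yseq n) t) = l" by (rule limI, rule filterlim_compose[OF l yseq_at_right])
    ultimately show ?thesis by simp
  qed
  then show ?thesis unfolding finite_hilbert_def iff by auto
qed

lemma finite_hilbert_AE:
  assumes f: "integrable mu f" and h1: "bdry (rp f) h1" and h2: "bdry (ip f) h2"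
  shows "AE t in mu. finite_hilbert f t = Complex (h1 t) (h2 t)"
  unfolding AE_mu_iff
  using bdry_AE_htr[OF h1 rp_integrable[OF f]] bdry_AE_htr[OF h2 ip_integrable[OF f]]
proof eventually_elim
  case (elim t)
  have l: "((\<lambda>e. ctr f e t) \<longlongrightarrow> complex_of_real (h1 t) + \<i> * complex_of_real (h2 t)) (at_right 0)"
    unfolding ctr_def using elim by (intro tendsto_intros)
  have "lim (\<lambda>n. ctr f (yseq n) t) = complex_of_real (h1 t) + \<i> * complex_of_real (h2 t)"
    by (rule limI, rule filterlim_compose[OF l yseq_at_right])
  then show ?case using finite_hilbert_eq_ctr[OF f, of t] l by (auto simp: complex_eq_iff)
qed

text \<open>The strict inequality in the kernel makes it right-continuous in the truncation
  parameter, and the kernel at \<open>e\<close> dominates those at larger parameters. Right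
  continuity carries the Cauchy criterion from rational to real parameters.\<close>

lemma htr_seq_right:
  assumes u: "integrable lborel u" and e: "e > 0" and d: "d \<longlonglongrightarrow> e" "\<And>n. d n > e"
  shows "(\<lambda>n. htr u (d n) t) \<longlonglongrightarrow> htr u e t"
  unfolding htr_def
proof (rule integral_dominated_convergence)
  have [measurable]: "u \<in> borel_measurable borel" using u by (simp add: borel_measurable_integrable)
  show "(\<lambda>x. u x * (if e < \<bar>x - t\<bar> then 1 / (pi * (x - t)) else 0)) \<in> borel_measurable lborel"
    "\<And>n. (\<lambda>x. u x * (if d n < \<bar>x - t\<bar> then 1 / (pi * (x - t)) else 0)) \<in> borel_measurable lborel" by measurable
  show "integrable lborel (\<lambda>x. \<bar>u x * (if e < \<bar>x - t\<bar> then 1 / (pi * (x - t)) else 0)\<bar>)"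
    by (rule integrable_abs, rule integrable_htr[OF u e])
  show "AE x in lborel. norm (u x * (if d n < \<bar>x - t\<bar> then 1 / (pi * (x - t)) else 0)) \<le> \<bar>u x * (if e < \<bar>x - t\<bar> then 1 / (pi * (x - t)) else 0)\<bar>" for n
    using d(2)[of n] by (intro always_eventually allI) auto
  show "AE x in lborel. (\<lambda>n. u x * (if d n < \<bar>x - t\<bar> then 1 / (pi * (x - t)) else 0)) \<longlonglongrightarrow> u x * (if e < \<bar>x - t\<bar> then 1 / (pi * (x - t)) else 0)"
  proof (intro always_eventually allI tendsto_mult tendsto_const)
    fix x
    show "(\<lambda>n. if d n < \<bar>x - t\<bar> then 1 / (pi * (x - t)) else 0) \<longlonglongrightarrow> (if e < \<bar>x - t\<bar> then 1 / (pi * (x - t)) else 0)"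
    proof (cases "e < \<bar>x - t\<bar>")
      case True
      with order_tendstoD(2)[OF d(1)] have "\<forall>\<^sub>F n in sequentially. d n < \<bar>x - t\<bar>" by blast
      then show ?thesis by (rule tendsto_eventually[OF eventually_mono]) (use True in auto)
    next
      case False
      then have "\<not> d n < \<bar>x - t\<bar>" for n using d(2)[of n] by auto
      with False show ?thesis by simp
    qed
  qed
qed

lemma rat_seq_right: "\<exists>q :: nat \<Rightarrow> rat. (\<lambda>n. real_of_rat (q n)) \<longlonglongrightarrow> e \<and> (\<forall>n. real_of_rat (q n) > e)" for e :: real
proof -
  have "\<forall>n. \<exists>q. e < real_of_rat q \<and> real_of_rat q < e + yseq n" using of_rat_dense[of e "e + yseq _"] yseq_pos by simp
  then obtain q where q: "\<And>n. e < real_of_rat (q n)" "\<And>n. real_of_rat (q n) < e + yseq n" by metis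
  have "(\<lambda>n. real_of_rat (q n)) \<longlonglongrightarrow> e"
  proof (rule tendsto_sandwich[OF _ _ tendsto_const])
    show "(\<lambda>n. e + yseq n) \<longlonglongrightarrow> e" using tendsto_add[OF tendsto_const yseq_tendsto] by simp
  qed (use q in \<open>auto intro!: always_eventually less_imp_le\<close>)
  with q show ?thesis by blast
qed

text \<open>
  Restricting the Cauchy criterion to rational truncation parameters makes the set where the limit
  exists visibly measurable. Completion of \<open>mu\<close> is not available, so equality almost everywhere would not suffice.
\<close>
lemma convergent_at_right_rat_Cauchy:
  fixes g :: "real \<Rightarrow> complex"
  assumes rc: "\<And>e d. e > 0 \<Longrightarrow> d \<longlonglongrightarrow> e \<Longrightarrow> (\<And>n. d n > e) \<Longrightarrow> (\<lambda>n. g (d n)) \<longlonglongrightarrow> g e"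
  shows "(\<exists>l. (g \<longlongrightarrow> l) (at_right 0)) \<longleftrightarrow> (\<forall>k. \<exists>j. \<forall>p q :: rat. 0 < p \<longrightarrow> 0 < q \<longrightarrow>
      real_of_rat p < yseq j \<longrightarrow> real_of_rat q < yseq j \<longrightarrow> dist (g (real_of_rat p)) (g (real_of_rat q)) \<le> yseq k)"
proof (intro iffI allI)
  fix k
  assume "\<exists>l. (g \<longlongrightarrow> l) (at_right 0)"
  then obtain l where "(g \<longlongrightarrow> l) (at_right 0)" by blast
  from tendstoD[OF this, of "yseq k / 2"] yseq_pos[of k] obtain b where b: "b > 0" "\<And>e. 0 < e \<Longrightarrow> e < b \<Longrightarrow> dist (g e) l < yseq k / 2"
    unfolding eventually_at_right_field by auto
  obtain j where j: "yseq j < b" using order_tendstoD(2)[OF yseq_tendsto b(1)] by (auto simp: eventually_sequentially)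
  show "\<exists>j. \<forall>p q :: rat. 0 < p \<longrightarrow> 0 < q \<longrightarrow> real_of_rat p < yseq j \<longrightarrow> real_of_rat q < yseq j \<longrightarrow> dist (g (real_of_rat p)) (g (real_of_rat q)) \<le> yseq k"
  proof (intro exI[of _ j] allI impI)
    fix p q :: rat assume "0 < p" "0 < q" "real_of_rat p < yseq j" "real_of_rat q < yseq j"
    then have "dist (g (real_of_rat p)) l < yseq k / 2" "dist (g (real_of_rat q)) l < yseq k / 2"
      using j b(2)[of "real_of_rat p"] b(2)[of "real_of_rat q"] by (simp_all only: zero_less_of_rat_iff)
    then show "dist (g (real_of_rat p)) (g (real_of_rat q)) \<le> yseq k"
      using dist_triangle2[of "g (real_of_rat p)" "g (real_of_rat q)" l] by simp
  qed
next
  assume C: "\<forall>k. \<exists>j. \<forall>p q :: rat. 0 < p \<longrightarrow> 0 < q \<longrightarrow>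
      real_of_rat p < yseq j \<longrightarrow> real_of_rat q < yseq j \<longrightarrow> dist (g (real_of_rat p)) (g (real_of_rat q)) \<le> yseq k"
  have "cauchy_filter (filtermap g (at_right 0))"
    unfolding cauchy_filter_metric_filtermap
  proof (intro allI impI)
    fix \<epsilon> :: real assume "\<epsilon> > 0"
    then obtain k where k: "yseq k < \<epsilon>" using order_tendstoD(2)[OF yseq_tendsto] by (meson eventually_sequentially order_refl)
    from C[rule_format, of k] obtain j where j: "\<forall>p q :: rat. 0 < p \<longrightarrow> 0 < q \<longrightarrow>
      real_of_rat p < yseq j \<longrightarrow> real_of_rat q < yseq j \<longrightarrow> dist (g (real_of_rat p)) (g (real_of_rat q)) \<le> yseq k"
      by blast
    have "dist (g a) (g b) \<le> yseq k" if ab: "0 < a" "a < yseq j" "0 < b" "b < yseq j" for a b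
    proof -
      obtain p where p: "(\<lambda>n. real_of_rat (p n)) \<longlonglongrightarrow> a" "\<And>n. real_of_rat (p n) > a" using rat_seq_right by metis
      obtain q where q: "(\<lambda>n. real_of_rat (q n)) \<longlonglongrightarrow> b" "\<And>n. real_of_rat (q n) > b" using rat_seq_right by metis
      have pos: "0 < p n" "0 < q n" for n
        using order_less_trans[OF ab(1) p(2)[of n]] order_less_trans[OF ab(3) q(2)[of n]] by (simp_all only: zero_less_of_rat_iff)
      have "(\<lambda>n. dist (g (real_of_rat (p n))) (g (real_of_rat (q n)))) \<longlonglongrightarrow> dist (g a) (g b)"
        using p q ab by (intro tendsto_dist rc)
      moreover have "\<forall>\<^sub>F n in sequentially. dist (g (real_of_rat (p n))) (g (real_of_rat (q n))) \<le> yseq k"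
        using order_tendstoD(2)[OF p(1) ab(2)] order_tendstoD(2)[OF q(1) ab(4)] by eventually_elim (rule j[rule_format, OF pos])
      ultimately show ?thesis by (rule tendsto_upperbound) simp
    qed
    then have "\<And>a b. (0 < a \<and> a < yseq j) \<and> (0 < b \<and> b < yseq j) \<Longrightarrow> dist (g a) (g b) < \<epsilon>" using k by fastforce
    moreover have "\<forall>\<^sub>F a in at_right 0. 0 < a \<and> a < yseq j"
      by (rule eventually_at_rightI[of 0 "yseq j"]) (use yseq_pos in auto)
    ultimately show "\<exists>P. eventually P (at_right 0) \<and> (\<forall>x y. P x \<and> P y \<longrightarrow> dist (g x) (g y) < \<epsilon>)" by blast
  qed
  then have "\<exists>l. filtermap g (at_right 0) \<le> nhds l"
    using complete_UNIV[where 'a=complex] unfolding complete_uniform by (auto simp: filtermap_bot_iff)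
  then show "\<exists>l. (g \<longlongrightarrow> l) (at_right 0)" by (simp add: filterlim_def)
qed

lemma htr_measurable:
  assumes "integrable lborel u"
  shows "htr u e \<in> borel_measurable borel"
proof -
  have [measurable]: "u \<in> borel_measurable borel" using assms by (simp add: borel_measurable_integrable)
  have "(\<lambda>t. \<integral>x. u x * (if e < \<bar>x - t\<bar> then 1 / (pi * (x - t)) else 0) \<partial>lborel) \<in> borel_measurable borel"
    by (rule lborel.borel_measurable_lebesgue_integral) measurable
  then show ?thesis by (simp add: htr_def[abs_def])
qed

lemma finite_hilbert_measurable:
  assumes f: "integrable mu f"
  shows "finite_hilbert f \<in> borel_measurable mu"
proof -
  have [measurable]: "(\<lambda>t. ctr f e t) \<in> borel_measurable borel" for e
    unfolding ctr_def using htr_measurable[OF rp_integrable[OF f]] htr_measurable[OF ip_integrable[OF f]] by measurable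
  have rc: "(\<lambda>n. ctr f (d n) t) \<longlonglongrightarrow> ctr f e t" if "e > 0" "d \<longlonglongrightarrow> e" "\<And>n. d n > e" for d e t
    unfolding ctr_def using htr_seq_right[OF rp_integrable[OF f] that] htr_seq_right[OF ip_integrable[OF f] that]
    by (intro tendsto_intros)
  define P where "P t \<longleftrightarrow> (\<forall>k. \<exists>j. \<forall>p q :: rat. 0 < p \<longrightarrow> 0 < q \<longrightarrow> real_of_rat p < yseq j \<longrightarrow> real_of_rat q < yseq j \<longrightarrow>
    dist (ctr f (real_of_rat p) t) (ctr f (real_of_rat q) t) \<le> yseq k)" for t
  have [measurable]: "Measurable.pred borel P" unfolding P_def by measurable
  have "(\<lambda>t. if P t then lim (\<lambda>n. ctr f (yseq n) t) else 0) \<in> borel_measurable borel"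
    by measurable
  then have "(\<lambda>t. if P t then lim (\<lambda>n. ctr f (yseq n) t) else 0) \<in> borel_measurable mu" by (rule borel_measurable_muI)
  moreover have Pe: "P t \<longleftrightarrow> (\<exists>l. ((\<lambda>e. ctr f e t) \<longlongrightarrow> l) (at_right 0))" for t
    unfolding P_def by (rule convergent_at_right_rat_Cauchy[symmetric], rule rc)
  moreover have "finite_hilbert f t = (if P t then lim (\<lambda>n. ctr f (yseq n) t) else 0)" if "t \<in> space mu" for t
    unfolding Pe by (rule finite_hilbert_eq_ctr[OF f]) (use that in \<open>auto simp: space_mu\<close>)
  ultimately show ?thesis
    using measurable_cong[of mu "finite_hilbert f" "\<lambda>t. if P t then lim (\<lambda>n. ctr f (yseq n) t) else 0" borel] by blast
qed

section \<open>Essentially bounded functions and the Parseval formula\<close>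

lemma AE_norm_Linf:
  assumes "norm_Linf g \<le> ennreal M" and M: "M \<ge> 0"
  shows "AE x in mu. cmod (g x) \<le> M"
  using esssup_AE[of "\<lambda>x. ennreal (cmod (g x))" mu]
proof eventually_elim
  case (elim x)
  with assms(1) have "ennreal (cmod (g x)) \<le> ennreal M" unfolding norm_Linf_def by (rule order_trans[rotated])
  then show ?case using M by simp
qed

lemma norm_Linf_le:
  assumes "g \<in> L0" and "AE x in mu. cmod (g x) \<le> M"
  shows "norm_Linf g \<le> ennreal M"
  unfolding norm_Linf_def
proof (rule esssup_I)
  show "(\<lambda>x. ennreal (cmod (g x))) \<in> borel_measurable mu" using assms(1) by (simp add: L0_def)
  show "AE x in mu. ennreal (cmod (g x)) \<le> ennreal M" using assms(2) by eventually_elim (rule ennreal_leI)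
qed

lemma Linf_bound:
  assumes "g \<in> Linf"
  obtains M where "M > 0" "norm_Linf g \<le> ennreal M"
proof -
  have "norm_Linf g < top" using assms by (simp add: Linf_def)
  then obtain r where "norm_Linf g = ennreal r" by (auto simp: less_top_ennreal)
  then have "norm_Linf g \<le> ennreal (max 1 r)" by (simp add: ennreal_leI)
  then show ?thesis by (intro that[of "max 1 r"]) auto
qed

lemma bdry_cong:
  assumes "bdry u h" and "u \<in> borel_measurable borel" "v \<in> borel_measurable borel" and "AE x in lborel. u x = v x"
  shows "bdry v h"
proof -
  have "QI v y t = QI u y t" for y t
    unfolding QI_def
  proof (rule integral_cong_AE)
    show "AE x in lborel. v x * cpois y (x - t) = u x * cpois y (x - t)" using assms(4) by eventually_elim simp
  qed (use assms(2,3) in measurable)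
  then show ?thesis using assms(1) by (simp add: bdry_def)
qed

lemma bounded_integrable_mu:
  assumes "g \<in> L0" "AE x in mu. cmod (g x) \<le> M"
  shows "integrable mu g"
  using assms by (intro mu.integrable_const_bound[where B=M]) (auto simp: L0_def)

lemma Linf_hil:
  assumes g: "g \<in> L0" "norm_Linf g \<le> ennreal M" and M: "M > 0"
  obtains g1 g2 k1 k2 where "dom (2 * pi * M) g1" "dom (2 * pi * M) g2" "hil g1 k1" "hil g2 k2"
    "\<forall>x. x \<notin> {-1<..<1} \<longrightarrow> g1 x = 0 \<and> g2 x = 0"
    "AE x in mu. g x = Complex (g1 x) (g2 x)" "AE x in mu. finite_hilbert g x = Complex (k1 x) (k2 x)"
    "integrable mu g"
proof -
  \<comment> \<open>\<open>g\<close> is bounded by \<open>M\<close> only almost everywhere, whereas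
    \<open>dom\<close> is a pointwise condition; so larger values are replaced by 0.\<close>
  define g1 where "g1 x = (if \<bar>rp g x\<bar> \<le> M then rp g x else 0)" for x
  define g2 where "g2 x = (if \<bar>ip g x\<bar> \<le> M then ip g x else 0)" for x
  note rm[measurable] = rp_measurable[OF g(1)] ip_measurable[OF g(1)]
  have gm[measurable]: "g1 \<in> borel_measurable borel" "g2 \<in> borel_measurable borel" unfolding g1_def g2_def by measurable
  have z: "g1 x = 0" "g2 x = 0" if "x \<notin> {-1<..<1}" for x
    using rp_outside[OF that] ip_outside[OF that] by (auto simp: g1_def g2_def)
  have d: "dom (2 * pi * M) g1" "dom (2 * pi * M) g2"
    by (rule domI_interval[OF gm(1) _ z(1)] domI_interval[OF gm(2) _ z(2)]; use M in \<open>simp add: g1_def g2_def\<close>)+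
  from hil_exists[OF d(1)] hil_exists[OF d(2)] obtain k1 k2 where k: "hil g1 k1" "hil g2 k2" by blast
  have bd: "AE x in mu. cmod (g x) \<le> M" using AE_norm_Linf[OF g(2)] M by simp
  have e: "AE x in lborel. g1 x = rp g x \<and> g2 x = ip g x"
    using bd unfolding AE_mu_iff
  proof eventually_elim
    case (elim x)
    then show ?case using abs_Re_le_cmod[of "g x"] abs_Im_le_cmod[of "g x"]
      by (auto simp: g1_def g2_def rp_def ip_def)
  qed
  have i: "integrable mu g" by (rule bounded_integrable_mu[OF g(1) bd])
  have e1: "AE x in lborel. g1 x = rp g x" and e2: "AE x in lborel. g2 x = ip g x" using e by auto
  have b: "bdry (rp g) k1" "bdry (ip g) k2"
    by (rule bdry_cong[OF hil_bdry[OF k(1)] gm(1) rm(1) e1], rule bdry_cong[OF hil_bdry[OF k(2)] gm(2) rm(2) e2])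
  have "AE x in mu. g x = Complex (g1 x) (g2 x)"
    unfolding AE_mu_iff using e by eventually_elim (auto simp: rp_ip_eq)
  then show ?thesis using z by (intro that[OF d k _ _ finite_hilbert_AE[OF i b] i]) auto
qed

lemma cmod_Complex_le: "cmod (Complex a b) \<le> \<bar>a\<bar> + \<bar>b\<bar>"
  using cmod_le[of "Complex a b"] by simp

lemma finite_hilbert_pairing_bound:
  assumes f: "f \<in> L0" and g: "g \<in> L0" "norm_Linf g \<le> ennreal M" and M: "M > 0"
  shows "(\<integral>\<^sup>+x. ennreal (cmod (f x) * cmod (finite_hilbert g x)) \<partial>mu) \<le> ennreal (4 * pi * M * Kexp) * norm_LlogL f"
proof -
  obtain g1 g2 k1 k2 where d: "dom (2 * pi * M) g1" "dom (2 * pi * M) g2" and k: "hil g1 k1" "hil g2 k2"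
    and e: "AE x in mu. finite_hilbert g x = Complex (k1 x) (k2 x)" by (rule Linf_hil[OF g M])
  have C: "2 * pi * M > 0" using M by simp
  have [measurable]: "f \<in> borel_measurable mu" using f by (simp add: L0_def)
  have [measurable]: "k1 \<in> borel_measurable mu" "k2 \<in> borel_measurable mu"
    using k by (auto intro!: borel_measurable_muI bdry_measurable hil_bdry)
  have "(\<integral>\<^sup>+x. ennreal (cmod (f x) * cmod (finite_hilbert g x)) \<partial>mu)
      \<le> (\<integral>\<^sup>+x. ennreal (cmod (f x) * \<bar>k1 x\<bar>) + ennreal (cmod (f x) * \<bar>k2 x\<bar>) \<partial>mu)"
  proof (rule nn_integral_mono_AE, use e in eventually_elim)
    case (elim x)
    have "cmod (f x) * cmod (finite_hilbert g x) \<le> cmod (f x) * \<bar>k1 x\<bar> + cmod (f x) * \<bar>k2 x\<bar>"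
      unfolding elim using mult_left_mono[OF cmod_Complex_le norm_ge_zero] by (simp add: distrib_left)
    from ennreal_leI[OF this] show ?case by (simp add: ennreal_plus)
  qed
  also have "\<dots> = (\<integral>\<^sup>+x. ennreal (cmod (f x) * \<bar>k1 x\<bar>) \<partial>mu) + (\<integral>\<^sup>+x. ennreal (cmod (f x) * \<bar>k2 x\<bar>) \<partial>mu)"
    by (rule nn_integral_add) measurable
  also have "\<dots> \<le> ennreal (2 * pi * M * Kexp) * norm_LlogL f + ennreal (2 * pi * M * Kexp) * norm_LlogL f"
    by (rule add_mono[OF hil_pairing_bound[OF f d(1) C k(1)] hil_pairing_bound[OF f d(2) C k(2)]])
  also have "\<dots> = (ennreal (2 * pi * M * Kexp) + ennreal (2 * pi * M * Kexp)) * norm_LlogL f" by (rule distrib_right[symmetric])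
  also have "ennreal (2 * pi * M * Kexp) + ennreal (2 * pi * M * Kexp) = ennreal (4 * pi * M * Kexp)"
    using M Kexp_pos by (subst ennreal_plus[symmetric]) (auto intro!: mult_nonneg_nonneg)
  finally show ?thesis .
qed

lemma LlogL_rp_ip:
  assumes "f \<in> LlogL"
  shows LlogL_rp: "(\<lambda>x. complex_of_real (rp f x)) \<in> LlogL" and LlogL_ip: "(\<lambda>x. complex_of_real (ip f x)) \<in> LlogL"
proof -
  have f0: "f \<in> L0" using assms by (simp add: LlogL_def)
  have "(\<lambda>x. complex_of_real (rp f x)) \<in> L0" "(\<lambda>x. complex_of_real (ip f x)) \<in> L0"
    using borel_measurable_muI[OF rp_measurable[OF f0]] borel_measurable_muI[OF ip_measurable[OF f0]] by (simp_all add: L0_def)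
  note m = this
  show "(\<lambda>x. complex_of_real (rp f x)) \<in> LlogL"
    by (rule LlogL_ideal[OF assms m(1)]) (simp add: rp_def abs_Re_le_cmod)
  show "(\<lambda>x. complex_of_real (ip f x)) \<in> LlogL"
    by (rule LlogL_ideal[OF assms m(2)]) (simp add: ip_def abs_Im_le_cmod)
qed

lemma LlogL_integrable:
  assumes "f \<in> LlogL"
  shows "integrable mu f"
proof (rule integrableI_bounded)
  have f: "f \<in> L0" "norm_LlogL f < \<infinity>" using assms by (auto simp: LlogL_def)
  show "f \<in> borel_measurable mu" using f by (simp add: L0_def)
  show "(\<integral>\<^sup>+x. ennreal (norm (f x)) \<partial>mu) < \<infinity>" using norm_LlogL_ge_L1[OF f(1)] f(2) by (rule le_less_trans)
qed

lemma integrable_nu_imp_mu: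
  fixes h :: "real \<Rightarrow> real"
  assumes "integrable nu h"
  shows "integrable mu h"
proof (rule integrableI_bounded)
  have h: "h \<in> borel_measurable borel" "(\<integral>\<^sup>+x. ennreal (norm (h x)) \<partial>nu) < \<infinity>"
    using assms by (auto simp: integrable_iff_bounded measurable_nu_iff)
  then show "h \<in> borel_measurable mu" by (intro borel_measurable_muI)
  have "(\<integral>\<^sup>+x. ennreal (norm (h x)) \<partial>mu) \<le> ennreal (2 * pi) * (\<integral>\<^sup>+x. ennreal (norm (h x)) \<partial>nu)"
    using h(1) by (intro nn_integral_mu_le_nu) measurable
  also have "\<dots> < \<infinity>" using h(2) by (simp add: ennreal_mult_less_top)
  finally show "(\<integral>\<^sup>+x. ennreal (norm (h x)) \<partial>mu) < \<infinity>" .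
qed

theorem finite_hilbert_duality:
  assumes f: "f \<in> LlogL"
  shows finite_hilbert_L1: "finite_hilbert f \<in> L1"
    and finite_hilbert_dual_integrable: "g \<in> Linf \<Longrightarrow> integrable mu (\<lambda>x. f x * finite_hilbert g x)"
    and dual_pairing_finite_hilbert: "g \<in> Linf \<Longrightarrow> dual_pairing (finite_hilbert f) g = - (\<integral>x. f x * finite_hilbert g x \<partial>mu)"
proof -
  have f0: "f \<in> L0" using f by (simp add: LlogL_def)
  note rm = rp_measurable[OF f0] ip_measurable[OF f0]
  note ex1 = bdry_exists_LlogL[OF rm(1) rp_outside LlogL_rp[OF f]]
  note ex2 = bdry_exists_LlogL[OF rm(2) ip_outside LlogL_ip[OF f]]
  obtain h1 where h1: "bdry (rp f) h1" and d1: "\<And>C g k. dom C g \<Longrightarrow> hil g k \<Longrightarrow> (\<integral>x. h1 x * g x \<partial>lborel) = - (\<integral>x. rp f x * k x \<partial>lborel)"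
    using ex1(2) by blast
  obtain h2 where h2: "bdry (ip f) h2" and d2: "\<And>C g k. dom C g \<Longrightarrow> hil g k \<Longrightarrow> (\<integral>x. h2 x * g x \<partial>lborel) = - (\<integral>x. ip f x * k x \<partial>lborel)"
    using ex2(2) by blast
  have fi: "integrable mu f" by (rule LlogL_integrable[OF f])
  note hm = finite_hilbert_measurable[OF fi]
  have fh: "AE t in mu. finite_hilbert f t = Complex (h1 t) (h2 t)" by (rule finite_hilbert_AE[OF fi h1 h2])
  have hi: "integrable mu (\<lambda>t. complex_of_real (h1 t) + \<i> * complex_of_real (h2 t))"
    using integrable_nu_imp_mu[OF bdry_integrable[OF h1]] integrable_nu_imp_mu[OF bdry_integrable[OF h2]]
    by (intro Bochner_Integration.integrable_add integrable_mult_right integrable_of_real)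
  have fh': "AE t in mu. complex_of_real (h1 t) + \<i> * complex_of_real (h2 t) = finite_hilbert f t"
    using fh by eventually_elim (simp add: complex_eq_iff)
  show "finite_hilbert f \<in> L1"
    unfolding L1_def mem_Collect_eq by (rule integrable_cong_AE_imp[OF hi hm fh'])
  assume g: "g \<in> Linf"
  obtain M where M: "M > 0" "norm_Linf g \<le> ennreal M" by (rule Linf_bound[OF g])
  have g0: "g \<in> L0" using g by (simp add: Linf_def)
  obtain g1 g2 k1 k2 where d: "dom (2 * pi * M) g1" "dom (2 * pi * M) g2" and k: "hil g1 k1" "hil g2 k2"
    and z: "\<forall>x. x \<notin> {-1<..<1} \<longrightarrow> g1 x = 0 \<and> g2 x = 0"
    and ge: "AE x in mu. g x = Complex (g1 x) (g2 x)" and e: "AE x in mu. finite_hilbert g x = Complex (k1 x) (k2 x)"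
    and gi: "integrable mu g" by (rule Linf_hil[OF g0 M(2,1)])
  let ?c = complex_of_real
  have gm: "g \<in> borel_measurable mu" "f \<in> borel_measurable mu" using f0 g0 by (simp_all add: L0_def)
  \<comment> \<open>Both sides of the Parseval formula integrate a product (a1 + \<i> a2) (b1 + \<i>
    b2). This is the common expansion into four real integrals, to each of which the real duality
    applies.\<close>
  have comb: "integrable lborel (\<lambda>x. ?c (a1 x * b1 x - a2 x * b2 x) + \<i> * ?c (a1 x * b2 x + a2 x * b1 x))
    \<and> (\<integral>x. ?c (a1 x * b1 x - a2 x * b2 x) + \<i> * ?c (a1 x * b2 x + a2 x * b1 x) \<partial>lborel)
      = ?c ((\<integral>x. a1 x * b1 x \<partial>lborel) - (\<integral>x. a2 x * b2 x \<partial>lborel)) + \<i> * ?c ((\<integral>x. a1 x * b2 x \<partial>lborel) + (\<integral>x. a2 x * b1 x \<partial>lborel))"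
    if "integrable lborel (\<lambda>x. a1 x * b1 x)" "integrable lborel (\<lambda>x. a2 x * b2 x)"
      "integrable lborel (\<lambda>x. a1 x * b2 x)" "integrable lborel (\<lambda>x. a2 x * b1 x)" for a1 a2 b1 b2 :: "real \<Rightarrow> real"
  proof -
    have i1: "integrable lborel (\<lambda>x. ?c (a1 x * b1 x - a2 x * b2 x))" "integrable lborel (\<lambda>x. \<i> * ?c (a1 x * b2 x + a2 x * b1 x))"
      using that by (auto intro!: integrable_mult_right integrable_of_real simp del: of_real_add of_real_diff)
    show ?thesis
      by (intro conjI Bochner_Integration.integrable_add i1, subst Bochner_Integration.integral_add[OF i1],
          simp only: integral_mult_right_zero integral_complex_of_real Bochner_Integration.integral_diff[OF that(1,2)] Bochner_Integration.integral_add[OF that(3,4)])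
  qed
  have hg: "integrable lborel (\<lambda>x. h x * g x)" if "bdry u h" "dom (2 * pi * M) g" for u h g
    by (rule dom_mult_integrable(1)[OF that(2) bdry_integrable[OF that(1)]])
  have fk: "integrable lborel (\<lambda>x. rp f x * k x)" "integrable lborel (\<lambda>x. ip f x * k x)" if "dom C g" "hil g k" for C g k
    by (rule integral_mult_LlogL(1)[OF rm(1) rp_outside LlogL_rp[OF f] that], assumption,
        rule integral_mult_LlogL(1)[OF rm(2) ip_outside LlogL_ip[OF f] that])
  note c1 = comb[OF hg[OF h1 d(1)] hg[OF h2 d(2)] hg[OF h1 d(2)] hg[OF h2 d(1)]]
  note c2 = comb[OF fk(1)[OF d(1) k(1)] fk(2)[OF d(2) k(2)] fk(1)[OF d(2) k(2)] fk(2)[OF d(1) k(1)]]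
  let ?F = "\<lambda>x. ?c (rp f x * k1 x - ip f x * k2 x) + \<i> * ?c (rp f x * k2 x + ip f x * k1 x)"
  let ?G = "\<lambda>x. ?c (h1 x * g1 x - h2 x * g2 x) + \<i> * ?c (h1 x * g2 x + h2 x * g1 x)"
  have Fz: "indicator {-1<..<1} x *\<^sub>R ?F x = ?F x" for x
    by (cases "x \<in> {-1<..<1}") (simp_all add: rp_outside ip_outside)
  have Gz: "indicator {-1<..<1} x *\<^sub>R ?G x = ?G x" for x
    by (cases "x \<in> {-1<..<1}") (simp_all add: z)
  have Fe: "AE x in mu. ?F x = f x * finite_hilbert g x"
    using e AE_space
  proof eventually_elim
    case (elim x)
    then have "f x = Complex (rp f x) (ip f x)" by (simp add: rp_ip_eq space_mu)
    then show ?case unfolding elim(1) by (simp add: complex_eq_iff)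
  qed
  have Ge: "AE x in mu. ?G x = finite_hilbert f x * g x"
    using fh ge by eventually_elim (simp add: complex_eq_iff)
  have Fi: "integrable mu ?F" unfolding integrable_mu_iff Fz using c2 by blast
  have Gi: "integrable mu ?G" unfolding integrable_mu_iff Gz using c1 by blast
  have m: "(\<lambda>x. f x * finite_hilbert g x) \<in> borel_measurable mu" "(\<lambda>x. finite_hilbert f x * g x) \<in> borel_measurable mu"
    using gm hm finite_hilbert_measurable[OF gi] by measurable
  show "integrable mu (\<lambda>x. f x * finite_hilbert g x)" by (rule integrable_cong_AE_imp[OF Fi m(1) Fe])
  have "dual_pairing (finite_hilbert f) g = (\<integral>x. ?G x \<partial>mu)"
    unfolding dual_pairing_def by (rule integral_cong_AE[OF m(2) borel_measurable_integrable[OF Gi]]) (use Ge in eventually_elim, simp)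
  also have "\<dots> = - (\<integral>x. ?F x \<partial>mu)"
    unfolding integral_mu Fz Gz c1[THEN conjunct2] c2[THEN conjunct2] d1[OF d(1) k(1)] d2[OF d(2) k(2)] d1[OF d(2) k(2)] d2[OF d(1) k(1)]
    by (simp add: algebra_simps)
  also have "(\<integral>x. ?F x \<partial>mu) = (\<integral>x. f x * finite_hilbert g x \<partial>mu)"
    by (rule integral_cong_AE[OF borel_measurable_integrable[OF Fi] m(1) Fe])
  finally show "dual_pairing (finite_hilbert f) g = - (\<integral>x. f x * finite_hilbert g x \<partial>mu)" .
qed

lemma m_L1_scalar_eq:
  assumes g: "g \<in> Linf" and A: "A \<in> sets mu"
  shows "m_L1_scalar g A = (\<integral>x. indicator A x *\<^sub>R (- finite_hilbert g x) \<partial>mu)"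
proof -
  have "indicator A \<in> L0" using A by (simp add: L0_def)
  moreover have "AE x in mu. cmod (indicator A x) \<le> 1" by (simp add: indicator_def)
  ultimately have "indicator A \<in> LlogL" by (rule bounded_in_LlogL)
  from dual_pairing_finite_hilbert[OF this g]
  have "m_L1_scalar g A = - (\<integral>x. indicator A x * finite_hilbert g x \<partial>mu)" by (simp add: m_L1_scalar_def m_L1_def)
  moreover have "indicator A x *\<^sub>R (- finite_hilbert g x) = - (indicator A x * finite_hilbert g x)" for x
    by (simp add: indicator_def)
  ultimately show ?thesis by simp
qed

subsection \<open>Complex measures with a density\<close>

lemma partition_on_sum_indicator:
  assumes "partition_on A P" "finite P"
  shows "(\<Sum>B\<in>P. indicator B x) = (indicator A x :: real)"
proof -
  have "disjoint_family_on (\<lambda>B. B) P" using assms(1) by (auto simp: partition_on_def disjoint_def disjoint_family_on_def)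
  then have "indicator (\<Union>B\<in>P. B) x = (\<Sum>B\<in>P. indicator B x :: real)" by (rule indicator_UN_disjoint[OF assms(2)])
  then show ?thesis using assms(1) by (simp add: partition_on_def)
qed

context
  fixes M :: "'a measure" and k :: "'a \<Rightarrow> complex" and \<nu> :: "'a set \<Rightarrow> complex"
  assumes fin: "finite_measure M" and k: "integrable M k"
    and nu: "\<And>B. B \<in> sets M \<Longrightarrow> \<nu> B = (\<integral>x. indicator B x *\<^sub>R k x \<partial>M)"
begin

lemma density_function_measurable: "k \<in> borel_measurable M"
  using k by (rule borel_measurable_integrable)

lemma sum_integral_partition:
  fixes w :: "'a \<Rightarrow> real"
  assumes P: "partition_on A P" "finite P" "P \<subseteq> sets M" and w: "integrable M w"
  shows "(\<Sum>B\<in>P. \<integral>x. indicator B x * w x \<partial>M) = (\<integral>x. indicator A x * w x \<partial>M)"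
proof -
  have "integrable M (\<lambda>x. indicator B x * w x)" if "B \<in> P" for B
    using integrable_mult_indicator[OF _ w, of B] that P(3) by auto
  then have "(\<Sum>B\<in>P. \<integral>x. indicator B x * w x \<partial>M) = (\<integral>x. (\<Sum>B\<in>P. indicator B x * w x) \<partial>M)"
    by (subst Bochner_Integration.integral_sum) auto
  then show ?thesis by (simp add: sum_distrib_right[symmetric] partition_on_sum_indicator[OF P(1,2)])
qed

text \<open>For the lower bound, partition \<open>A\<close> by the level sets of a simple function
  close to \<open>k\<close> in L^1. It is constant on each block, so the modulus of its integral is
  the integral of its modulus; passing from \<open>k\<close> to it and back costs at most twice the
  L^1 distance.\<close>

lemma variation_eq:
  assumes A: "A \<in> sets M"
  shows "variation M \<nu> A = (\<integral>\<^sup>+x. ennreal (cmod (k x)) * indicator A x \<partial>M)"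
proof -
  interpret finite_measure M by (rule fin)
  note density_function_measurable[measurable]
  have kn: "integrable M (\<lambda>x. cmod (k x))" using k by (rule integrable_norm)
  have iA: "integrable M (\<lambda>x. indicator B x * w x)" if "B \<in> sets M" "integrable M w" for B and w :: "'a \<Rightarrow> real"
    using integrable_mult_indicator[OF that] by simp
  have R: "(\<integral>\<^sup>+x. ennreal (cmod (k x)) * indicator A x \<partial>M) = ennreal (\<integral>x. indicator A x * cmod (k x) \<partial>M)"
    by (subst nn_integral_eq_integral[symmetric, OF iA[OF A kn]]) (auto intro!: nn_integral_cong simp: indicator_def)
  have up: "cmod (\<nu> B) \<le> (\<integral>x. indicator B x * cmod (k x) \<partial>M)" if B: "B \<in> sets M" for B
    unfolding nu[OF B] by (rule order_trans[OF integral_norm_bound]) simp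
  have "variation M \<nu> A \<le> ennreal (\<integral>x. indicator A x * cmod (k x) \<partial>M)"
    unfolding variation_def
  proof (rule SUP_least)
    fix P assume "P \<in> {P. finite P \<and> P \<subseteq> sets M \<and> partition_on A P}"
    then have P: "partition_on A P" "finite P" "P \<subseteq> sets M" by auto
    have "(\<Sum>B\<in>P. cmod (\<nu> B)) \<le> (\<Sum>B\<in>P. \<integral>x. indicator B x * cmod (k x) \<partial>M)"
      by (rule sum_mono) (use up P(3) in auto)
    then show "(\<Sum>B\<in>P. ennreal (cmod (\<nu> B))) \<le> ennreal (\<integral>x. indicator A x * cmod (k x) \<partial>M)"
      unfolding sum_integral_partition[OF P kn] by (subst sum_ennreal) (auto intro: ennreal_leI)
  qed
  moreover have "ennreal (\<integral>x. indicator A x * cmod (k x) \<partial>M) \<le> variation M \<nu> A"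
  proof -
    obtain s where s: "\<And>i. simple_function M (s i)" "\<And>x. x \<in> space M \<Longrightarrow> (\<lambda>i. s i x) \<longlonglongrightarrow> k x"
      "\<And>i x. x \<in> space M \<Longrightarrow> norm (s i x) \<le> 2 * norm (k x)"
      using integrable_implies_simple_function_sequence[OF k] by metis
    have sm[measurable]: "s i \<in> borel_measurable M" for i using s(1) by (rule borel_measurable_simple_function)
    have si: "integrable M (s i)" for i
      by (rule Bochner_Integration.integrable_bound[OF integrable_mult_right[OF kn, of 2] sm]) (use s(3) in auto)
    define \<delta> where "\<delta> i = (\<integral>x. cmod (k x - s i x) \<partial>M)" for i
    have \<delta>: "\<delta> \<longlonglongrightarrow> (\<integral>x. (0::real) \<partial>M)"
      unfolding \<delta>_def
    proof (rule integral_dominated_convergence[where w="\<lambda>x. 3 * cmod (k x)"])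
      show "integrable M (\<lambda>x. 3 * cmod (k x))" using kn by simp
      show "AE x in M. (\<lambda>i. cmod (k x - s i x)) \<longlonglongrightarrow> 0"
      proof (rule AE_I2)
        fix x assume "x \<in> space M"
        from tendsto_norm[OF tendsto_diff[OF tendsto_const[of "k x"] s(2)[OF this]]]
        show "(\<lambda>i. cmod (k x - s i x)) \<longlonglongrightarrow> 0" by simp
      qed
      show "AE x in M. norm (cmod (k x - s i x)) \<le> 3 * cmod (k x)" for i
      proof (rule AE_I2)
        fix x assume "x \<in> space M"
        with s(3)[of x i] norm_triangle_ineq4[of "k x" "s i x"] show "norm (cmod (k x - s i x)) \<le> 3 * cmod (k x)" by simp
      qed
    qed measurable
    have low: "ennreal ((\<integral>x. indicator A x * cmod (k x) \<partial>M) - 2 * \<delta> i) \<le> variation M \<nu> A" for i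
    proof -
      \<comment> \<open>Empty blocks are removed because \<open>partition_on\<close> forbids
        them.\<close>
      define P where "P = (\<lambda>y. A \<inter> (s i -` {y} \<inter> space M)) ` (s i ` space M) - {{}}"
      have P1: "partition_on A P" using sets.sets_into_space[OF A]
        by (auto simp: partition_on_def disjoint_def P_def)
      have P2: "finite P" using s(1)[of i] by (auto simp: P_def simple_function_def)
      have P3: "P \<subseteq> sets M" using A s(1)[of i] by (auto simp: P_def simple_function_def)
      have di: "integrable M (\<lambda>x. cmod (k x - s i x))" using k si[of i] by auto
      have one: "(\<integral>x. indicator B x * cmod (k x) \<partial>M) - 2 * (\<integral>x. indicator B x * cmod (k x - s i x) \<partial>M) \<le> cmod (\<nu> B)" if B: "B \<in> P" for B
      proof -
        have Bs: "B \<in> sets M" using B P3 by auto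
        obtain y where y: "\<And>x. x \<in> B \<Longrightarrow> s i x = y" using B by (auto simp: P_def)
        have "indicator B x *\<^sub>R s i x = indicator B x *\<^sub>R y" "indicator B x * cmod (s i x) = indicator B x * cmod y" for x
          using y by (auto simp: indicator_def)
        then have "cmod (\<integral>x. indicator B x *\<^sub>R s i x \<partial>M) = cmod (\<integral>x. indicator B x *\<^sub>R y \<partial>M)"
          "(\<integral>x. indicator B x * cmod (s i x) \<partial>M) = (\<integral>x. indicator B x * cmod y \<partial>M)" by (simp_all only:)
        then have eq: "cmod (\<integral>x. indicator B x *\<^sub>R s i x \<partial>M) = (\<integral>x. indicator B x * cmod (s i x) \<partial>M)"
          using integral_scaleR_left[of y M "indicator B"] Bs by (simp add: less_top[symmetric])
        have ib: "integrable M (\<lambda>x. indicator B x *\<^sub>R s i x)" "integrable M (\<lambda>x. indicator B x *\<^sub>R k x)"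
          using Bs si k by (auto intro!: integrable_mult_indicator)
        have "(\<integral>x. indicator B x *\<^sub>R s i x \<partial>M) - \<nu> B = (\<integral>x. indicator B x *\<^sub>R (s i x - k x) \<partial>M)"
          unfolding nu[OF Bs] by (subst Bochner_Integration.integral_diff[OF ib, symmetric]) (simp add: scaleR_diff_right)
        moreover have "cmod (\<integral>x. indicator B x *\<^sub>R (s i x - k x) \<partial>M) \<le> (\<integral>x. indicator B x * cmod (k x - s i x) \<partial>M)"
          by (rule order_trans[OF integral_norm_bound]) (simp add: norm_minus_commute)
        ultimately have a: "(\<integral>x. indicator B x * cmod (s i x) \<partial>M) - (\<integral>x. indicator B x * cmod (k x - s i x) \<partial>M) \<le> cmod (\<nu> B)"
          using norm_triangle_ineq2[of "\<integral>x. indicator B x *\<^sub>R s i x \<partial>M" "\<nu> B"] eq by simp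
        have "(\<integral>x. indicator B x * cmod (k x) \<partial>M) \<le> (\<integral>x. indicator B x * cmod (s i x) + indicator B x * cmod (k x - s i x) \<partial>M)"
        proof (rule integral_mono)
          show "integrable M (\<lambda>x. indicator B x * cmod (s i x) + indicator B x * cmod (k x - s i x))"
            using iA[OF Bs di] iA[OF Bs integrable_norm[OF si[of i]]] by auto
          show "indicator B x * cmod (k x) \<le> indicator B x * cmod (s i x) + indicator B x * cmod (k x - s i x)" for x
            using norm_triangle_sub[of "k x" "s i x"] by (auto simp: indicator_def)
        qed (rule iA[OF Bs kn])
        also have "\<dots> = (\<integral>x. indicator B x * cmod (s i x) \<partial>M) + (\<integral>x. indicator B x * cmod (k x - s i x) \<partial>M)"
          by (rule Bochner_Integration.integral_add[OF iA[OF Bs integrable_norm[OF si]] iA[OF Bs di]])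
        finally show ?thesis using a by simp
      qed
      have "(\<integral>x. indicator A x * cmod (k x - s i x) \<partial>M) \<le> \<delta> i"
        unfolding \<delta>_def by (rule integral_mono[OF iA[OF A di] di]) (auto simp: indicator_def)
      then have "(\<integral>x. indicator A x * cmod (k x) \<partial>M) - 2 * \<delta> i
        \<le> (\<integral>x. indicator A x * cmod (k x) \<partial>M) - 2 * (\<integral>x. indicator A x * cmod (k x - s i x) \<partial>M)" by simp
      also have "\<dots> = (\<Sum>B\<in>P. (\<integral>x. indicator B x * cmod (k x) \<partial>M) - 2 * (\<integral>x. indicator B x * cmod (k x - s i x) \<partial>M))"
        unfolding sum_subtractf sum_distrib_left[symmetric] sum_integral_partition[OF P1 P2 P3 kn] sum_integral_partition[OF P1 P2 P3 di] ..
      also have "\<dots> \<le> (\<Sum>B\<in>P. cmod (\<nu> B))" by (rule sum_mono) (rule one)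
      finally have "ennreal ((\<integral>x. indicator A x * cmod (k x) \<partial>M) - 2 * \<delta> i) \<le> (\<Sum>B\<in>P. ennreal (cmod (\<nu> B)))"
        by (subst sum_ennreal) (auto intro: ennreal_leI)
      also have "\<dots> \<le> variation M \<nu> A" unfolding variation_def by (rule SUP_upper) (use P1 P2 P3 in auto)
      finally show ?thesis .
    qed
    have "(\<lambda>i. ennreal ((\<integral>x. indicator A x * cmod (k x) \<partial>M) - 2 * \<delta> i)) \<longlonglongrightarrow> ennreal ((\<integral>x. indicator A x * cmod (k x) \<partial>M) - 2 * (\<integral>x. (0::real) \<partial>M))"
      by (intro tendsto_ennrealI tendsto_intros \<delta>)
    from LIMSEQ_le_const2[OF this] low show ?thesis by simp
  qed
  ultimately show ?thesis unfolding R by (rule antisym)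
qed

lemma variation_measure_eq: "variation_measure M \<nu> = density M (\<lambda>x. ennreal (cmod (k x)))"
proof -
  let ?D = "density M (\<lambda>x. ennreal (cmod (k x)))"
  note density_function_measurable[measurable]
  have "variation_measure M \<nu> = measure_of (space M) (sets M) (emeasure ?D)"
    unfolding variation_measure_def
    by (rule measure_of_eq[OF sets.space_closed]) (simp add: variation_eq emeasure_density sets.sigma_sets_eq)
  also have "\<dots> = ?D" using measure_of_of_measure[of ?D] by simp
  finally show ?thesis .
qed

end

text \<open>The supremum over the subsets of \<open>A\<close> is attained at the part of
  \<open>A\<close> where \<open>r\<close> is positive. The density is the positive part of
  \<open>r\<close>, since \<open>ennreal\<close> sends negative values to 0.\<close>

lemma positive_part_eq:
  fixes r :: "'a \<Rightarrow> real"
  assumes r: "integrable M r" and \<sigma>: "\<And>B. B \<in> sets M \<Longrightarrow> \<sigma> B = (\<integral>x. indicator B x * r x \<partial>M)"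
  shows "positive_part M \<sigma> = density M (\<lambda>x. ennreal (r x))"
proof -
  let ?D = "density M (\<lambda>x. ennreal (r x))"
  have [measurable]: "r \<in> borel_measurable M" using r by (rule borel_measurable_integrable)
  have eq: "(SUP B \<in> {B \<in> sets M. B \<subseteq> A}. ennreal (\<sigma> B)) = emeasure ?D A" if A: "A \<in> sets M" for A
  proof (rule antisym)
    show "(SUP B \<in> {B \<in> sets M. B \<subseteq> A}. ennreal (\<sigma> B)) \<le> emeasure ?D A"
    proof (rule SUP_least)
      fix B assume "B \<in> {B \<in> sets M. B \<subseteq> A}"
      then have B: "B \<in> sets M" "B \<subseteq> A" by auto
      have i: "integrable M (\<lambda>x. indicator B x * r x)" using integrable_mult_indicator[OF B(1) r] by simp
      have i': "integrable M (\<lambda>x. max 0 (indicator B x * r x))" using i by simp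
      have "ennreal (\<sigma> B) \<le> ennreal (\<integral>x. max 0 (indicator B x * r x) \<partial>M)"
        unfolding \<sigma>[OF B(1)] by (intro ennreal_leI integral_mono i i') simp
      also have "\<dots> = (\<integral>\<^sup>+x. ennreal (max 0 (indicator B x * r x)) \<partial>M)"
        by (rule nn_integral_eq_integral[OF i', symmetric]) simp
      also have "\<dots> \<le> (\<integral>\<^sup>+x. ennreal (r x) * indicator A x \<partial>M)"
        using B(2) by (intro nn_integral_mono) (auto simp: indicator_def max_def)
      also have "\<dots> = emeasure ?D A" using A by (simp add: emeasure_density)
      finally show "ennreal (\<sigma> B) \<le> emeasure ?D A" .
    qed
    let ?B = "A \<inter> {x \<in> space M. r x > 0}"
    have B: "?B \<in> sets M" using A by measurable
    have i: "integrable M (\<lambda>x. indicator ?B x * r x)" using integrable_mult_indicator[OF B r] by simp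
    have "emeasure ?D A = (\<integral>\<^sup>+x. ennreal (r x) * indicator A x \<partial>M)" using A by (simp add: emeasure_density)
    also have "\<dots> = (\<integral>\<^sup>+x. ennreal (indicator ?B x * r x) \<partial>M)"
      by (rule nn_integral_cong) (auto simp: indicator_def ennreal_neg)
    also have "\<dots> = ennreal (\<sigma> ?B)"
      unfolding \<sigma>[OF B] by (rule nn_integral_eq_integral[OF i]) (auto simp: indicator_def)
    also have "\<dots> \<le> (SUP B \<in> {B \<in> sets M. B \<subseteq> A}. ennreal (\<sigma> B))" by (rule SUP_upper) (use B in auto)
    finally show "emeasure ?D A \<le> (SUP B \<in> {B \<in> sets M. B \<subseteq> A}. ennreal (\<sigma> B))" .
  qed
  have "positive_part M \<sigma> = measure_of (space M) (sets M) (emeasure ?D)"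
    unfolding positive_part_def by (rule measure_of_eq[OF sets.space_closed]) (simp add: eq sets.sigma_sets_eq)
  also have "\<dots> = ?D" using measure_of_of_measure[of ?D] by simp
  finally show ?thesis .
qed

text \<open>The real and imaginary parts of the density split into positive and negative parts; each
  difference of two integrals recombines to one integral against a signed density. The domination by
  \<bar>f k\<bar> makes every piece integrable.\<close>

lemma complex_measure_integral_eq:
  assumes k: "integrable M k" and nu: "\<And>B. B \<in> sets M \<Longrightarrow> \<nu> B = (\<integral>x. indicator B x *\<^sub>R k x \<partial>M)"
    and f[measurable]: "f \<in> borel_measurable M" and fk: "integrable M (\<lambda>x. f x * k x)" and A[measurable]: "A \<in> sets M"
  shows "complex_measure_integral M \<nu> A f = (\<integral>x. indicator A x *\<^sub>R (f x * k x) \<partial>M)"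
proof -
  have [measurable]: "k \<in> borel_measurable M" using k by (rule borel_measurable_integrable)
  have ib: "integrable M (\<lambda>x. indicator B x *\<^sub>R k x)" if "B \<in> sets M" for B using that k by (rule integrable_mult_indicator)
  have re: "Re (\<nu> B) = (\<integral>x. indicator B x * Re (k x) \<partial>M)" "Im (\<nu> B) = (\<integral>x. indicator B x * Im (k x) \<partial>M)" if "B \<in> sets M" for B
    using integral_Re[OF ib[OF that]] integral_Im[OF ib[OF that]] unfolding nu[OF that] by simp_all
  have part: "integrable M (\<lambda>x. r x *\<^sub>R (indicator A x *\<^sub>R f x)) \<and>
      (LINT x:A|positive_part M \<sigma>. f x) - (LINT x:A|positive_part M (\<lambda>B. - \<sigma> B). f x) = (\<integral>x. r x *\<^sub>R (indicator A x *\<^sub>R f x) \<partial>M)"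
    if r: "integrable M r" "\<And>x. \<bar>r x\<bar> \<le> cmod (k x)" and \<sigma>: "\<And>B. B \<in> sets M \<Longrightarrow> \<sigma> B = (\<integral>x. indicator B x * r x \<partial>M)" for r \<sigma>
  proof -
    have [measurable]: "r \<in> borel_measurable M" using r(1) by (rule borel_measurable_integrable)
    have bound: "integrable M (\<lambda>x. p x *\<^sub>R (indicator A x *\<^sub>R f x))" if "p \<in> borel_measurable M" "\<And>x. \<bar>p x\<bar> \<le> \<bar>r x\<bar>" for p :: "'a \<Rightarrow> real"
    proof (rule Bochner_Integration.integrable_bound[OF fk])
      show "AE x in M. norm (p x *\<^sub>R indicator A x *\<^sub>R f x) \<le> norm (f x * k x)"
      proof (rule AE_I2)
        fix x
        have "\<bar>p x\<bar> \<le> cmod (k x)" using that(2)[of x] r(2)[of x] by simp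
        from mult_right_mono[OF this norm_ge_zero[of "f x"]] show "norm (p x *\<^sub>R indicator A x *\<^sub>R f x) \<le> norm (f x * k x)"
          by (simp add: norm_mult indicator_def mult.commute)
      qed
    qed (use that(1) in measurable)
    \<comment> \<open>Negative values of \<open>p\<close> become 0 under \<open>ennreal\<close>, so
      the density acts as the positive part of \<open>p\<close>.\<close>
    have dens: "(LINT x:A|density M (\<lambda>x. ennreal (p x)). f x) = (\<integral>x. max 0 (p x) *\<^sub>R (indicator A x *\<^sub>R f x) \<partial>M)"
      if [measurable]: "p \<in> borel_measurable M" for p
    proof -
      have "density M (\<lambda>x. ennreal (p x)) = density M (\<lambda>x. ennreal (max 0 (p x)))"
        by (rule density_cong) (auto simp: max_def ennreal_neg)
      then show ?thesis unfolding set_lebesgue_integral_def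
        by (simp only:) (rule integral_density; simp)
    qed
    have m0: "positive_part M \<sigma> = density M (\<lambda>x. ennreal (r x))"
      by (rule positive_part_eq) (use r(1) \<sigma> in auto)
    have m: "positive_part M (\<lambda>B. - \<sigma> B) = density M (\<lambda>x. ennreal (- r x))"
      by (rule positive_part_eq) (use r(1) \<sigma> in auto)
    have "(LINT x:A|positive_part M \<sigma>. f x) - (LINT x:A|positive_part M (\<lambda>B. - \<sigma> B). f x)
        = (\<integral>x. max 0 (r x) *\<^sub>R (indicator A x *\<^sub>R f x) \<partial>M) - (\<integral>x. max 0 (- r x) *\<^sub>R (indicator A x *\<^sub>R f x) \<partial>M)"
      unfolding m m0 by (simp only: dens borel_measurable_uminus \<open>r \<in> borel_measurable M\<close>)
    also have "\<dots> = (\<integral>x. max 0 (r x) *\<^sub>R (indicator A x *\<^sub>R f x) - max 0 (- r x) *\<^sub>R (indicator A x *\<^sub>R f x) \<partial>M)"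
      by (rule Bochner_Integration.integral_diff[symmetric]; rule bound) auto
    also have "\<dots> = (\<integral>x. r x *\<^sub>R (indicator A x *\<^sub>R f x) \<partial>M)"
      by (rule Bochner_Integration.integral_cong[OF refl]) (auto simp: max_def)
    finally show ?thesis using bound[of r] by auto
  qed
  note p1 = part[OF integrable_Re[OF k] abs_Re_le_cmod re(1)]
  note p2 = part[OF integrable_Im[OF k] abs_Im_le_cmod re(2)]
  have "complex_measure_integral M \<nu> A f = (\<integral>x. Re (k x) *\<^sub>R (indicator A x *\<^sub>R f x) \<partial>M) + \<i> * (\<integral>x. Im (k x) *\<^sub>R (indicator A x *\<^sub>R f x) \<partial>M)"
    unfolding complex_measure_integral_def using p1 p2 by simp
  also have "\<dots> = (\<integral>x. Re (k x) *\<^sub>R (indicator A x *\<^sub>R f x) + \<i> * (Im (k x) *\<^sub>R (indicator A x *\<^sub>R f x)) \<partial>M)"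
    by (subst Bochner_Integration.integral_add[OF p1[THEN conjunct1] integrable_mult_right[OF p2[THEN conjunct1]]], assumption, assumption)
       (simp only: integral_mult_right_zero)
  also have "\<dots> = (\<integral>x. indicator A x *\<^sub>R (f x * k x) \<partial>M)"
    by (rule Bochner_Integration.integral_cong[OF refl]) (simp add: complex_eq_iff algebra_simps)
  finally show ?thesis .
qed

subsection \<open>The vector measure\<close>

lemma Linf_L0: "g \<in> Linf \<Longrightarrow> g \<in> L0"
  by (simp add: Linf_def)

lemma Linf_integrable: "g \<in> Linf \<Longrightarrow> integrable mu g"
  by (metis AE_norm_Linf Linf_L0 Linf_bound bounded_integrable_mu less_imp_le)

lemma finite_hilbert_Linf_measurable: "g \<in> Linf \<Longrightarrow> finite_hilbert g \<in> borel_measurable mu"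
  by (rule finite_hilbert_measurable[OF Linf_integrable])

lemma finite_hilbert_Linf_integrable:
  assumes g: "g \<in> Linf"
  shows "integrable mu (finite_hilbert g)"
proof -
  have "(\<lambda>x. 1) \<in> LlogL" by (rule bounded_in_LlogL[where M=1]) (simp_all add: L0_def)
  from finite_hilbert_dual_integrable[OF this g] show ?thesis by simp
qed

lemma variation_measure_m_L1:
  assumes g: "g \<in> Linf"
  shows "variation_measure mu (m_L1_scalar g) = density mu (\<lambda>x. ennreal (cmod (finite_hilbert g x)))"
  using variation_measure_eq[OF mu.finite_measure_axioms integrable_minus[OF finite_hilbert_Linf_integrable[OF g]] m_L1_scalar_eq[OF g]]
  by simp

lemma nn_integral_variation_m_L1:
  assumes f: "f \<in> L0" and g: "g \<in> Linf"
  shows "(\<integral>\<^sup>+x. ennreal (cmod (f x)) \<partial>variation_measure mu (m_L1_scalar g))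
    = (\<integral>\<^sup>+x. ennreal (cmod (f x) * cmod (finite_hilbert g x)) \<partial>mu)"
proof -
  have [measurable]: "f \<in> borel_measurable mu" "finite_hilbert g \<in> borel_measurable mu"
    using f finite_hilbert_Linf_measurable[OF g] by (simp_all add: L0_def)
  show ?thesis unfolding variation_measure_m_L1[OF g]
    by (subst nn_integral_density) (auto intro!: nn_integral_cong simp: ennreal_mult mult.commute)
qed

lemma complex_measure_integrable_m_L1:
  assumes f: "f \<in> L0" and g: "g \<in> Linf"
  shows "complex_measure_integrable mu (m_L1_scalar g) f \<longleftrightarrow> integrable mu (\<lambda>x. f x * finite_hilbert g x)"
proof -
  have [measurable]: "f \<in> borel_measurable mu" "finite_hilbert g \<in> borel_measurable mu"
    using f finite_hilbert_Linf_measurable[OF g] by (simp_all add: L0_def)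
  have "complex_measure_integrable mu (m_L1_scalar g) f \<longleftrightarrow> integrable mu (\<lambda>x. cmod (finite_hilbert g x) *\<^sub>R f x)"
    unfolding complex_measure_integrable_def variation_measure_m_L1[OF g] by (rule integrable_density) auto
  also have "\<dots> \<longleftrightarrow> integrable mu (\<lambda>x. f x * finite_hilbert g x)"
    unfolding integrable_iff_bounded by (simp add: norm_mult mult.commute)
  finally show ?thesis .
qed

lemma complex_measure_integral_m_L1:
  assumes f: "f \<in> L0" and g: "g \<in> Linf" and i: "integrable mu (\<lambda>x. f x * finite_hilbert g x)" and A: "A \<in> sets mu"
  shows "complex_measure_integral mu (m_L1_scalar g) A f = - (\<integral>x. indicator A x *\<^sub>R (f x * finite_hilbert g x) \<partial>mu)"
proof -
  have "complex_measure_integral mu (m_L1_scalar g) A f = (\<integral>x. indicator A x *\<^sub>R (f x * (- finite_hilbert g x)) \<partial>mu)"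
    by (rule complex_measure_integral_eq[OF integrable_minus[OF finite_hilbert_Linf_integrable[OF g]] m_L1_scalar_eq[OF g] _ _ A])
       (use f i in \<open>auto simp: L0_def\<close>)
  then show ?thesis by simp
qed

lemma LlogL_indicator:
  assumes "f \<in> LlogL" "A \<in> sets mu"
  shows "(\<lambda>x. indicator A x *\<^sub>R f x) \<in> LlogL"
  by (rule LlogL_ideal[OF assms(1)]) (use assms in \<open>auto simp: LlogL_def L0_def indicator_def\<close>)

lemma is_m_L1_integral_LlogL:
  assumes f: "f \<in> LlogL" and A: "A \<in> sets mu"
  shows "is_m_L1_integral f A (finite_hilbert (\<lambda>x. indicator A x *\<^sub>R f x))"
  unfolding is_m_L1_integral_def
proof (intro conjI ballI)
  have f0: "f \<in> L0" using f by (simp add: LlogL_def)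
  note fA = LlogL_indicator[OF f A]
  show "finite_hilbert (\<lambda>x. indicator A x *\<^sub>R f x) \<in> L1" by (rule finite_hilbert_L1[OF fA])
  fix g assume g: "g \<in> Linf"
  show "dual_pairing (finite_hilbert (\<lambda>x. indicator A x *\<^sub>R f x)) g = complex_measure_integral mu (m_L1_scalar g) A f"
    unfolding dual_pairing_finite_hilbert[OF fA g] complex_measure_integral_m_L1[OF f0 g finite_hilbert_dual_integrable[OF f g] A]
    by simp
qed

text \<open>The integral over the whole interval in terms of \<open>f\<close> itself; the version
  for a general set involves \<open>f\<close> cut off by an indicator, which may be a different
  function off the interval.\<close>

lemma is_m_L1_integral_space:
  assumes f: "f \<in> LlogL"
  shows "is_m_L1_integral f (space mu) (finite_hilbert f)"
  unfolding is_m_L1_integral_def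
proof (intro conjI ballI)
  have f0: "f \<in> L0" using f by (simp add: LlogL_def)
  show "finite_hilbert f \<in> L1" by (rule finite_hilbert_L1[OF f])
  fix g assume g: "g \<in> Linf"
  show "dual_pairing (finite_hilbert f) g = complex_measure_integral mu (m_L1_scalar g) (space mu) f"
    unfolding dual_pairing_finite_hilbert[OF f g] complex_measure_integral_m_L1[OF f0 g finite_hilbert_dual_integrable[OF f g] sets.top]
    by (simp cong: Bochner_Integration.integral_cong)
qed

lemma LlogL_subset_L1_m: "LlogL \<subseteq> L1_m"
proof
  fix f assume f: "f \<in> LlogL"
  then have f0: "f \<in> L0" by (simp add: LlogL_def)
  show "f \<in> L1_m"
    unfolding L1_m_def using f0 is_m_L1_integral_LlogL[OF f] finite_hilbert_dual_integrable[OF f]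
    by (auto simp: complex_measure_integrable_m_L1[OF f0])
qed

lemma norm_L1_m_eq:
  assumes f: "f \<in> L0"
  shows "norm_L1_m f = (SUP g \<in> {g \<in> Linf. norm_Linf g \<le> 1}. \<integral>\<^sup>+x. ennreal (cmod (f x) * cmod (finite_hilbert g x)) \<partial>mu)"
  unfolding norm_L1_m_def by (rule SUP_cong[OF refl]) (simp add: nn_integral_variation_m_L1[OF f])

lemma pairing_le_norm_L1_m:
  assumes "f \<in> L0" "g \<in> Linf" "norm_Linf g \<le> 1"
  shows "(\<integral>\<^sup>+x. ennreal (cmod (f x) * cmod (finite_hilbert g x)) \<partial>mu) \<le> norm_L1_m f"
  unfolding norm_L1_m_eq[OF assms(1)] by (rule SUP_upper) (use assms in auto)

lemma norm_L1_m_le: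
  assumes f: "f \<in> L0"
  shows "norm_L1_m f \<le> ennreal (4 * pi * Kexp) * norm_LlogL f"
  unfolding norm_L1_m_eq[OF f]
proof (rule SUP_least)
  fix g assume "g \<in> {g \<in> Linf. norm_Linf g \<le> 1}"
  then have "g \<in> L0" "norm_Linf g \<le> ennreal 1" by (auto simp: Linf_L0)
  from finite_hilbert_pairing_bound[OF f this] show "(\<integral>\<^sup>+x. ennreal (cmod (f x) * cmod (finite_hilbert g x)) \<partial>mu) \<le> ennreal (4 * pi * Kexp) * norm_LlogL f"
    by simp
qed

section \<open>Control of the L^1 norm by two transforms\<close>

lemma bdry_zero: "bdry (\<lambda>x. 0) (\<lambda>x. 0)"
  by (simp add: bdry_def QI_def)

lemma finite_hilbert_real:
  assumes m: "g \<in> borel_measurable borel" and b: "\<And>x. \<bar>g x\<bar> \<le> M" and z: "\<And>x. x \<notin> {-1<..<1} \<Longrightarrow> g x = 0" and h: "bdry g k"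
  shows "(\<lambda>x. complex_of_real (g x)) \<in> Linf" and "norm_Linf (\<lambda>x. complex_of_real (g x)) \<le> ennreal M"
    and "AE x in mu. finite_hilbert (\<lambda>x. complex_of_real (g x)) x = complex_of_real (k x)"
proof -
  let ?g = "\<lambda>x. complex_of_real (g x)"
  have g0: "?g \<in> L0" using borel_measurable_muI[OF m] by (simp add: L0_def)
  show n: "norm_Linf ?g \<le> ennreal M" by (rule norm_Linf_le[OF g0]) (simp add: b)
  show L: "?g \<in> Linf" using g0 le_less_trans[OF n, of top] by (simp add: Linf_def)
  have "rp ?g = g" "ip ?g = (\<lambda>x. 0)" using z by (auto simp: rp_def ip_def fun_eq_iff)
  then have "AE x in mu. finite_hilbert ?g x = Complex (k x) 0"
    using finite_hilbert_AE[OF Linf_integrable[OF L], of k "\<lambda>x. 0"] h bdry_zero by simp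
  then show "AE x in mu. finite_hilbert ?g x = complex_of_real (k x)" by eventually_elim (simp add: complex_eq_iff)
qed

lemma finite_hilbert_indicator:
  fixes a b :: real
  assumes ab: "-1 \<le> a" "a \<le> b" "b \<le> 1"
  shows "indicator {a<..<b} \<in> Linf" and "norm_Linf (indicator {a<..<b}) \<le> 1"
    and "AE x in mu. finite_hilbert (indicator {a<..<b}) x = complex_of_real ((ln \<bar>b - x\<bar> - ln \<bar>a - x\<bar>) / pi)"
proof -
  have c: "(\<lambda>x. complex_of_real (indicator {a<..<b} x)) = indicator {a<..<b}" by (auto simp: indicator_def)
  have e: "AE x in lborel. indicator {a<..<b} x = (indicator {a..b} x :: real)"
    using AE_lborel_singleton[of a] AE_lborel_singleton[of b] by eventually_elim (auto simp: indicator_def)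
  have "dom (2 * pi) (indicator {a..b})"
    unfolding dom_def
  proof (intro conjI allI)
    show "\<bar>indicator {a..b} x\<bar> \<le> 2 * pi * pois 1 x" for x :: real
    proof (cases "x \<in> {a..b}")
      case True
      then have "x\<^sup>2 \<le> 1" using ab by (auto simp: abs_square_le_1 abs_le_iff)
      then have "x\<^sup>2 + 1 \<le> 2" by simp
      then show ?thesis using True by (simp add: pois_def add_nonneg_pos le_divide_eq)
    next
      case False
      then show ?thesis using pois_nonneg[of 1 x] by simp
    qed
  qed simp
  then obtain k where k: "hil (indicator {a..b}) k" using hil_exists by blast
  have "bdry (indicator {a<..<b}) k"
    by (rule bdry_cong[OF hil_bdry[OF k]]) (use e in \<open>auto elim: eventually_mono\<close>)
  note R = finite_hilbert_real[OF _ _ _ this, of 1, unfolded c]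
  show "indicator {a<..<b} \<in> Linf" "norm_Linf (indicator {a<..<b}) \<le> 1"
    by (rule R(1), use ab in \<open>auto simp: indicator_def\<close>) (rule R(2)[simplified], use ab in \<open>auto simp: indicator_def\<close>)
  have "AE x in mu. finite_hilbert (indicator {a<..<b}) x = complex_of_real (k x)"
    by (rule R(3)) (use ab in \<open>auto simp: indicator_def\<close>)
  moreover have "AE x in mu. k x = (ln \<bar>b - x\<bar> - ln \<bar>a - x\<bar>) / pi"
    unfolding AE_mu_iff using hil_indicator[OF ab(2) k] by eventually_elim simp
  ultimately show "AE x in mu. finite_hilbert (indicator {a<..<b}) x = complex_of_real ((ln \<bar>b - x\<bar> - ln \<bar>a - x\<bar>) / pi)"
    by eventually_elim simp
qed

lemma ln_ge_one_minus_inverse: "y > 0 \<Longrightarrow> 1 - 1 / y \<le> ln y" for y :: real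
  using ln_le_minus_one[of "1 / y"] by (simp add: ln_div)

text \<open>The first difference of logarithms vanishes at 0 only, where the second is singular. For
  \<bar>x\<bar> < 1/4 one has (1 - x) / \<bar>x\<bar> \<ge> 3; otherwise the larger of (1 + x) / (1
  - x) and its inverse is at least 5/3. By \<open>ln_ge_one_minus_inverse\<close> the logarithms are
  then at least 2/3 and 2/5.\<close>

lemma log_sum_lower_bound:
  fixes x :: real
  assumes x: "-1 < x" "x < 1" "x \<noteq> 0"
  shows "2 / 5 \<le> \<bar>ln \<bar>1 - x\<bar> - ln \<bar>- 1 - x\<bar>\<bar> + \<bar>ln \<bar>1 - x\<bar> - ln \<bar>0 - x\<bar>\<bar>"
proof (cases "\<bar>x\<bar> < 1 / 4")
  case True
  have y: "(1 - x) / \<bar>x\<bar> \<ge> 3" using True x by (auto simp: le_divide_eq)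
  have "2 / 3 \<le> ln Y" if "Y \<ge> 3" for Y :: real
  proof -
    have "1 / Y \<le> 1 / 3" using that by (intro divide_left_mono) auto
    then show ?thesis using ln_ge_one_minus_inverse[of Y] that by linarith
  qed
  from this[OF y] have "2 / 3 \<le> ln ((1 - x) / \<bar>x\<bar>)" .
  also have "\<dots> = ln \<bar>1 - x\<bar> - ln \<bar>0 - x\<bar>" using x by (simp add: ln_div)
  finally show ?thesis by linarith
next
  case False
  have aux: "2 / 5 \<le> ln ((1 + y) / (1 - y))" if "y \<ge> 1 / 4" "y < 1" for y :: real
  proof -
    have "2 / 5 \<le> 1 - 1 / ((1 + y) / (1 - y))" using that by (simp add: field_simps)
    also have "\<dots> \<le> ln ((1 + y) / (1 - y))" using that by (intro ln_ge_one_minus_inverse) auto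
    finally show ?thesis .
  qed
  have e: "ln ((1 + y) / (1 - y)) = ln (1 + y) - ln (1 - y)" if "\<bar>y\<bar> < 1" for y :: real
    using that by (intro ln_divide_pos) auto
  have "2 / 5 \<le> \<bar>ln (1 - x) - ln (1 + x)\<bar>"
  proof (cases "x > 0")
    case True
    then show ?thesis using aux[of x] e[of x] False x by simp
  next
    case False': False
    then show ?thesis using aux[of "- x"] e[of "- x"] False x by simp
  qed
  moreover have "\<bar>1 - x\<bar> = 1 - x" "\<bar>- 1 - x\<bar> = 1 + x" using x by auto
  ultimately show ?thesis by (simp only:)
qed

lemma L1_norm_le_pairings:
  assumes f: "f \<in> L0"
  shows "(\<integral>\<^sup>+x. ennreal (cmod (f x)) \<partial>mu) \<le> ennreal (5 * pi / 2) *
    ((\<integral>\<^sup>+x. ennreal (cmod (f x) * cmod (finite_hilbert (indicator {-1<..<1}) x)) \<partial>mu) +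
     (\<integral>\<^sup>+x. ennreal (cmod (f x) * cmod (finite_hilbert (indicator {0<..<1}) x)) \<partial>mu))"
proof -
  note g0 = finite_hilbert_indicator[of "-1" 1] and g1 = finite_hilbert_indicator[of 0 1]
  have [measurable]: "f \<in> borel_measurable mu" "finite_hilbert (indicator {-1<..<1}) \<in> borel_measurable mu"
    "finite_hilbert (indicator {0<..<1}) \<in> borel_measurable mu"
    using f finite_hilbert_Linf_measurable[OF g0(1)] finite_hilbert_Linf_measurable[OF g1(1)] by (simp_all add: L0_def)
  have "AE x in mu. x \<noteq> 0" unfolding AE_mu_iff using AE_lborel_singleton[of 0] by eventually_elim auto
  moreover have "AE x in mu. finite_hilbert (indicator {-1<..<1}) x = complex_of_real ((ln \<bar>1 - x\<bar> - ln \<bar>- 1 - x\<bar>) / pi)"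
    by (rule g0(3)) auto
  moreover have "AE x in mu. finite_hilbert (indicator {0<..<1}) x = complex_of_real ((ln \<bar>1 - x\<bar> - ln \<bar>0 - x\<bar>) / pi)"
    by (rule g1(3)) auto
  ultimately have "AE x in mu. ennreal (cmod (f x)) \<le> ennreal (5 * pi / 2) * (ennreal (cmod (f x) * cmod (finite_hilbert (indicator {-1<..<1}) x)) +
     ennreal (cmod (f x) * cmod (finite_hilbert (indicator {0<..<1}) x)))"
    using AE_space
  proof eventually_elim
    case (elim x)
    let ?a = "cmod (finite_hilbert (indicator {-1<..<1}) x)" and ?b = "cmod (finite_hilbert (indicator {0<..<1}) x)"
    have "?a = \<bar>ln \<bar>1 - x\<bar> - ln \<bar>- 1 - x\<bar>\<bar> / pi" "?b = \<bar>ln \<bar>1 - x\<bar> - ln \<bar>0 - x\<bar>\<bar> / pi"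
      unfolding elim(2,3) norm_of_real by simp_all
    then have "?a + ?b = (\<bar>ln \<bar>1 - x\<bar> - ln \<bar>- 1 - x\<bar>\<bar> + \<bar>ln \<bar>1 - x\<bar> - ln \<bar>0 - x\<bar>\<bar>) / pi" by (simp only: add_divide_distrib)
    moreover have "(2 / 5) / pi \<le> (\<bar>ln \<bar>1 - x\<bar> - ln \<bar>- 1 - x\<bar>\<bar> + \<bar>ln \<bar>1 - x\<bar> - ln \<bar>0 - x\<bar>\<bar>) / pi"
      by (rule divide_right_mono[OF log_sum_lower_bound]) (use elim(1,4) in \<open>auto simp: space_mu\<close>)
    ultimately have s: "(2 / 5) / pi \<le> ?a + ?b" by (simp only:)
    have "cmod (f x) = 5 * pi / 2 * (cmod (f x) * ((2 / 5) / pi))" by simp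
    also have "\<dots> \<le> 5 * pi / 2 * (cmod (f x) * (?a + ?b))" using s by (intro mult_left_mono) auto
    finally have "ennreal (cmod (f x)) \<le> ennreal (5 * pi / 2 * (cmod (f x) * ?a + cmod (f x) * ?b))"
      by (intro ennreal_leI) (simp only: distrib_left)
    also have "\<dots> = ennreal (5 * pi / 2) * (ennreal (cmod (f x) * ?a) + ennreal (cmod (f x) * ?b))"
      by (subst ennreal_mult, simp, simp, subst ennreal_plus) simp_all
    finally show ?case .
  qed
  then have "(\<integral>\<^sup>+x. ennreal (cmod (f x)) \<partial>mu) \<le> (\<integral>\<^sup>+x. ennreal (5 * pi / 2) * (ennreal (cmod (f x) * cmod (finite_hilbert (indicator {-1<..<1}) x)) +
     ennreal (cmod (f x) * cmod (finite_hilbert (indicator {0<..<1}) x))) \<partial>mu)"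
    by (rule nn_integral_mono_AE)
  also have "\<dots> = ennreal (5 * pi / 2) *
    ((\<integral>\<^sup>+x. ennreal (cmod (f x) * cmod (finite_hilbert (indicator {-1<..<1}) x)) \<partial>mu) +
     (\<integral>\<^sup>+x. ennreal (cmod (f x) * cmod (finite_hilbert (indicator {0<..<1}) x)) \<partial>mu))"
    by (subst nn_integral_cmult, measurable, subst nn_integral_add) measurable
  finally show ?thesis .
qed

section \<open>The inclusion of \<open>L1_m\<close> in \<open>LlogL\<close>\<close>

lemma nn_integral_mu_outside:
  assumes "\<And>x. x \<notin> {-1<..<1} \<Longrightarrow> f x = 0"
  shows "(\<integral>\<^sup>+x. f x \<partial>mu) = (\<integral>\<^sup>+x. f x \<partial>lborel)"
  unfolding nn_integral_mu by (rule nn_integral_cong) (use assms in \<open>auto simp: indicator_def\<close>)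

lemma integral_mu_outside:
  fixes f :: "real \<Rightarrow> real"
  assumes "\<And>x. x \<notin> {-1<..<1} \<Longrightarrow> f x = 0"
  shows "integrable mu f \<longleftrightarrow> integrable lborel f" and "integral\<^sup>L mu f = integral\<^sup>L lborel f"
proof -
  have "indicator {-1<..<1} x *\<^sub>R f x = f x" for x using assms by (auto simp: indicator_def)
  then show "integrable mu f \<longleftrightarrow> integrable lborel f" "integral\<^sup>L mu f = integral\<^sup>L lborel f"
    by (simp_all only: integrable_mu_iff integral_mu)
qed

lemma ennreal_less_top_bound: "x < top \<Longrightarrow> \<exists>r\<ge>0. x \<le> ennreal r"
  using less_top_ennreal by auto

lemma entropy_constant:
  assumes "0 \<le> A" "0 \<le> G" "0 \<le> B"
  shows "2 * (ennreal (2 * pi) * (ennreal A + ennreal pi * (2 * (ennreal G + ennreal B)))) + 1 = ennreal (2 * (2 * pi * (A + pi * (2 * (G + B)))) + 1)"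
proof -
  have 1: "ennreal pi * (2 * (ennreal G + ennreal B)) = ennreal (pi * (2 * (G + B)))"
    using assms by (simp add: ennreal_mult)
  have p: "0 \<le> pi * (2 * (G + B))" using assms by simp
  have 2: "ennreal A + ennreal (pi * (2 * (G + B))) = ennreal (A + pi * (2 * (G + B)))"
    by (rule ennreal_plus[symmetric, OF assms(1) p])
  have q: "0 \<le> A + pi * (2 * (G + B))" using assms(1) p by (rule add_nonneg_nonneg)
  have 3: "ennreal (2 * pi) * ennreal (A + pi * (2 * (G + B))) = ennreal (2 * pi * (A + pi * (2 * (G + B))))"
    by (rule ennreal_mult[symmetric]) (use q in auto)
  have r: "0 \<le> 2 * pi * (A + pi * (2 * (G + B)))" using q by (intro mult_nonneg_nonneg) auto
  have 4: "2 * ennreal (2 * pi * (A + pi * (2 * (G + B)))) = ennreal (2 * (2 * pi * (A + pi * (2 * (G + B)))))"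
    using ennreal_mult[of 2, OF _ r] by (simp only: ennreal_numeral)
  show ?thesis unfolding 1 2 3 4 by (subst ennreal_plus) (use r in \<open>auto intro!: mult_nonneg_nonneg\<close>)
qed

text \<open>The entropy bound with the data of \<open>u\<close> and \<open>h\<close> replaced by
  upper bounds. It serves twice: with bounds depending on the function, for the inclusion of
  \<open>L1_m\<close> in \<open>LlogL\<close>, and with absolute bounds, for the equivalence of the
  norms.\<close>

lemma norm_LlogL_le_of_duality:
  fixes u h :: "real \<Rightarrow> real"
  assumes um: "u \<in> borel_measurable borel" and u0: "\<And>x. u x \<ge> 0" and uz: "\<And>x. x \<notin> {-1<..<1} \<Longrightarrow> u x = 0"
    and hi: "integrable lborel h"
    and dual: "\<And>g k M. g \<in> borel_measurable borel \<Longrightarrow> (\<And>x. \<bar>g x\<bar> \<le> M) \<Longrightarrow> (\<And>x. x \<notin> {-1<..<1} \<Longrightarrow> g x = 0) \<Longrightarrow> hil g k \<Longrightarrow>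
       integrable lborel (\<lambda>x. u x * k x) \<and> (\<integral>x. u x * k x \<partial>lborel) = - (\<integral>x. h x * g x \<partial>lborel)"
    and a: "(\<integral>\<^sup>+x. ennreal (u x) \<partial>mu) \<le> ennreal \<alpha>" "\<alpha> \<ge> 0"
    and b: "(\<integral>\<^sup>+x. ennreal (u x) * ennreal (4 + \<bar>L1fun x\<bar>) \<partial>mu) \<le> ennreal \<beta>" "\<beta> \<ge> 0"
    and c: "(\<integral>\<^sup>+x. ennreal \<bar>h x\<bar> \<partial>lborel) \<le> ennreal \<gamma>" "\<gamma> \<ge> 0"
  shows "norm_LlogL (\<lambda>x. complex_of_real (u x)) \<le> ennreal (2 * (2 * pi * ((1 + \<alpha>) * (5 + \<alpha>) + pi * (2 * (\<gamma> + \<beta>)))) + 1)"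
proof -
  have uL: "(\<integral>\<^sup>+x. ennreal (u x) \<partial>lborel) \<le> ennreal \<alpha>"
    using a(1) uz by (subst nn_integral_mu_outside[symmetric]) auto
  have ui: "integrable lborel u"
    by (rule integrableI_bounded) (use um u0 le_less_trans[OF uL] in auto)
  have ueq: "(\<integral>\<^sup>+x. ennreal (u x) \<partial>lborel) = ennreal (\<integral>x. \<bar>u x\<bar> \<partial>lborel)"
    using u0 by (subst nn_integral_eq_integral[OF ui]) auto
  have N: "(\<integral>x. \<bar>u x\<bar> \<partial>lborel) \<le> \<alpha>" using uL[unfolded ueq] a(2) by (simp only: ennreal_le_iff)
  have "(\<integral>\<^sup>+x. ennreal ((1 + u x) * ln (1 + u x)) \<partial>mu) \<le> ennreal (2 * pi) * (ennreal ((1 + (\<integral>x. \<bar>u x\<bar> \<partial>lborel)) * (5 + (\<integral>x. \<bar>u x\<bar> \<partial>lborel))) +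
    ennreal pi * (2 * ((\<integral>\<^sup>+s. ennreal \<bar>h s\<bar> \<partial>lborel) + (\<integral>\<^sup>+x. ennreal (u x) * ennreal (4 + \<bar>L1fun x\<bar>) \<partial>lborel))))"
    using borel_measurable_integrable[OF hi] by (intro entropy_bound um u0 uz ui hi dual) auto
  also have "\<dots> \<le> ennreal (2 * pi) * (ennreal ((1 + \<alpha>) * (5 + \<alpha>)) + ennreal pi * (2 * (ennreal \<gamma> + ennreal \<beta>)))"
  proof (intro mult_left_mono add_mono ennreal_leI mult_mono c)
    show "(\<integral>\<^sup>+x. ennreal (u x) * ennreal (4 + \<bar>L1fun x\<bar>) \<partial>lborel) \<le> ennreal \<beta>"
      using b(1) uz by (subst nn_integral_mu_outside[symmetric]) auto
  qed (use N a(2) in auto)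
  finally have E: "(\<integral>\<^sup>+x. ennreal ((1 + u x) * ln (1 + u x)) \<partial>mu) \<le> ennreal (2 * pi) * (ennreal ((1 + \<alpha>) * (5 + \<alpha>)) + ennreal pi * (2 * (ennreal \<gamma> + ennreal \<beta>)))" .
  have u_L0: "(\<lambda>x. complex_of_real (u x)) \<in> L0" using borel_measurable_muI[OF um] by (simp add: L0_def)
  have "norm_LlogL (\<lambda>x. complex_of_real (u x)) \<le> 2 * (\<integral>\<^sup>+x. ennreal ((1 + u x) * ln (1 + u x)) \<partial>mu) + 1"
    using norm_LlogL_le_entropy[OF u_L0] u0 by simp
  also have "\<dots> \<le> 2 * (ennreal (2 * pi) * (ennreal ((1 + \<alpha>) * (5 + \<alpha>)) + ennreal pi * (2 * (ennreal \<gamma> + ennreal \<beta>)))) + 1"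
    by (intro add_right_mono mult_left_mono E) simp
  also have "\<dots> = ennreal (2 * (2 * pi * ((1 + \<alpha>) * (5 + \<alpha>) + pi * (2 * (\<gamma> + \<beta>)))) + 1)"
    using a(2) b(2) c(2) by (intro entropy_constant) auto
  finally show ?thesis .
qed

text \<open>On the interval \<open>L1fun\<close> is \<pi> times the transform of the constant 1. The
  endpoint weight of the entropy bound is therefore one of the pairings that integrability with
  respect to the vector measure controls.\<close>

lemma L1fun_pairing:
  assumes f: "f \<in> L0"
  shows "(\<integral>\<^sup>+x. ennreal (cmod (f x)) * ennreal (4 + \<bar>L1fun x\<bar>) \<partial>mu) = 4 * (\<integral>\<^sup>+x. ennreal (cmod (f x)) \<partial>mu) +
    ennreal pi * (\<integral>\<^sup>+x. ennreal (cmod (f x) * cmod (finite_hilbert (indicator {-1<..<1}) x)) \<partial>mu)"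
proof -
  have [measurable]: "f \<in> borel_measurable mu" "finite_hilbert (indicator {-1<..<1}) \<in> borel_measurable mu"
    using f finite_hilbert_Linf_measurable[OF finite_hilbert_indicator(1)[of "-1" 1]] by (simp_all add: L0_def)
  have "AE x in mu. finite_hilbert (indicator {-1<..<1}) x = complex_of_real ((ln \<bar>1 - x\<bar> - ln \<bar>- 1 - x\<bar>) / pi)"
    by (rule finite_hilbert_indicator(3)) auto
  then have "AE x in mu. ennreal (cmod (f x)) * ennreal (4 + \<bar>L1fun x\<bar>) =
      4 * ennreal (cmod (f x)) + ennreal pi * ennreal (cmod (f x) * cmod (finite_hilbert (indicator {-1<..<1}) x))"
    using AE_space
  proof eventually_elim
    case (elim x)
    then have x: "-1 < x" "x < 1" by (auto simp: space_mu)
    then have "ln \<bar>1 - x\<bar> - ln \<bar>- 1 - x\<bar> = L1fun x" unfolding L1fun_def by (subst ln_divide_pos) auto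
    then have "cmod (finite_hilbert (indicator {-1<..<1}) x) = \<bar>L1fun x\<bar> / pi" unfolding elim(1) norm_of_real by simp
    then have "cmod (f x) * (4 + \<bar>L1fun x\<bar>) = 4 * cmod (f x) + pi * (cmod (f x) * cmod (finite_hilbert (indicator {-1<..<1}) x))"
      by (simp add: algebra_simps)
    then have "ennreal (cmod (f x)) * ennreal (4 + \<bar>L1fun x\<bar>) = ennreal (4 * cmod (f x) + pi * (cmod (f x) * cmod (finite_hilbert (indicator {-1<..<1}) x)))"
      by (subst ennreal_mult[symmetric], simp, simp, simp only:)
    also have "\<dots> = ennreal (4 * cmod (f x)) + ennreal (pi * (cmod (f x) * cmod (finite_hilbert (indicator {-1<..<1}) x)))"
      by (rule ennreal_plus) auto
    also have "\<dots> = 4 * ennreal (cmod (f x)) + ennreal pi * ennreal (cmod (f x) * cmod (finite_hilbert (indicator {-1<..<1}) x))"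
      by (subst (1 2) ennreal_mult) auto
    finally show ?case .
  qed
  then have "(\<integral>\<^sup>+x. ennreal (cmod (f x)) * ennreal (4 + \<bar>L1fun x\<bar>) \<partial>mu) =
    (\<integral>\<^sup>+x. 4 * ennreal (cmod (f x)) + ennreal pi * ennreal (cmod (f x) * cmod (finite_hilbert (indicator {-1<..<1}) x)) \<partial>mu)"
    by (rule nn_integral_cong_AE)
  then show ?thesis by (simp add: nn_integral_add nn_integral_cmult)
qed

lemma L1_mD:
  assumes "f \<in> L1_m"
  shows "f \<in> L0" and "g \<in> Linf \<Longrightarrow> integrable mu (\<lambda>x. f x * finite_hilbert g x)"
    and "A \<in> sets mu \<Longrightarrow> \<exists>h. is_m_L1_integral f A h"
  using assms by (auto simp: L1_m_def complex_measure_integrable_m_L1)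

lemma L1_m_pairing_finite:
  assumes "f \<in> L1_m" "g \<in> Linf"
  shows "(\<integral>\<^sup>+x. ennreal (cmod (f x) * cmod (finite_hilbert g x)) \<partial>mu) < \<infinity>"
  using L1_mD(2)[OF assms] by (simp add: integrable_iff_bounded norm_mult)

lemma L1_m_finite:
  assumes "f \<in> L1_m"
  shows "(\<integral>\<^sup>+x. ennreal (cmod (f x)) \<partial>mu) < \<infinity>"
  by (rule le_less_trans[OF L1_norm_le_pairings[OF L1_mD(1)[OF assms]]])
     (use L1_m_pairing_finite[OF assms] finite_hilbert_indicator(1) in \<open>auto simp: ennreal_mult_less_top\<close>)

lemma L1_m_cmult_positive_part:
  assumes f: "f \<in> L1_m" and c: "cmod c = 1"
  shows "(\<lambda>x. complex_of_real (max 0 (rp (\<lambda>x. c * f x) x))) \<in> LlogL"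
proof -
  have f0: "f \<in> L0" by (rule L1_mD(1)[OF f])
  have fm[measurable]: "f \<in> borel_measurable mu" using f0 by (simp add: L0_def)
  have cf0: "(\<lambda>x. c * f x) \<in> L0" using fm by (simp add: L0_def)
  define u where "u x = max 0 (rp (\<lambda>x. c * f x) x)" for x
  have um[measurable]: "u \<in> borel_measurable borel" unfolding u_def using rp_measurable[OF cf0] by measurable
  have u_le: "\<bar>u x\<bar> \<le> cmod (f x)" for x
    using abs_Re_le_cmod[of "c * f x"] c by (auto simp: u_def rp_def norm_mult)
  have uz: "u x = 0" if "x \<notin> {-1<..<1}" for x using that by (simp add: u_def rp_outside)
  define A where "A = {x \<in> space mu. 0 < Re (c * f x)}"
  have A: "A \<in> sets mu" unfolding A_def by measurable
  obtain H where H: "is_m_L1_integral f A H" using L1_mD(3)[OF f A] by blast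
  have Hi: "integrable mu H" using H by (simp add: is_m_L1_integral_def L1_def)
  define h where "h = rp (\<lambda>x. c * H x)"
  have hi: "integrable lborel h" unfolding h_def by (rule rp_integrable) (use Hi in simp)
  have dual: "integrable lborel (\<lambda>x. u x * k x) \<and> (\<integral>x. u x * k x \<partial>lborel) = - (\<integral>x. h x * g x \<partial>lborel)"
    if g: "g \<in> borel_measurable borel" "\<And>x. \<bar>g x\<bar> \<le> M" "\<And>x. x \<notin> {-1<..<1} \<Longrightarrow> g x = 0" and k: "hil g k" for g k M
  proof -
    let ?G = "\<lambda>x. complex_of_real (g x)"
    have G: "?G \<in> Linf" "norm_Linf ?G \<le> ennreal M" "AE x in mu. finite_hilbert ?G x = complex_of_real (k x)"
      by (rule finite_hilbert_real[OF g(1,2) _ hil_bdry[OF k]]; use g(3) in blast)+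
    have km[measurable]: "k \<in> borel_measurable mu" using bdry_measurable[OF hil_bdry[OF k]] by (rule borel_measurable_muI)
    have Gm[measurable]: "?G \<in> borel_measurable mu" using Linf_L0[OF G(1)] by (simp add: L0_def)
    have umm[measurable]: "u \<in> borel_measurable mu" using um by (rule borel_measurable_muI)
    \<comment> \<open>As \<open>g\<close> and \<open>k\<close> are real, the real part of
      \<open>?F\<close> is Re (c f) k on \<open>A\<close> and 0 elsewhere, that is, u k. Taking real
      parts of the complex duality thus leaves the duality for \<open>u\<close>.\<close>
    let ?F = "\<lambda>x. c * (indicator A x *\<^sub>R (f x * finite_hilbert ?G x))"
    have Fi: "integrable mu ?F"
      using integrable_mult_indicator[OF A L1_mD(2)[OF f G(1)]] by (rule integrable_mult_right)
    have "AE x in mu. Re (?F x) = u x * k x"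
      using G(3) AE_space
    proof eventually_elim
      case (elim x)
      have "Re (?F x) = indicator A x * (Re (c * f x) * k x)" unfolding elim(1) by (simp add: algebra_simps)
      also have "\<dots> = u x * k x" using elim(2) by (auto simp: A_def u_def rp_def space_mu indicator_def)
      finally show ?case .
    qed
    note e = this
    have uki: "integrable mu (\<lambda>x. u x * k x)"
      by (rule integrable_cong_AE_imp[OF integrable_Re[OF Fi] _ e]) measurable
    have HG: "integrable mu (\<lambda>x. c * (H x * ?G x))"
    proof (rule integrable_mult_right, rule Bochner_Integration.integrable_bound[OF integrable_mult_right[OF Hi, of "complex_of_real M"]])
      show "AE x in mu. norm (H x * ?G x) \<le> norm (complex_of_real M * H x)"
      proof (rule AE_I2)
        fix x
        have "\<bar>g x\<bar> \<le> \<bar>M\<bar>" using g(2)[of x] by simp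
        from mult_right_mono[OF this norm_ge_zero[of "H x"]] show "norm (H x * ?G x) \<le> norm (complex_of_real M * H x)"
          by (simp add: norm_mult mult.commute)
      qed
    qed (use Hi Gm in measurable)
    have z1: "u x * k x = 0" "h x * g x = 0" if "x \<notin> {-1<..<1}" for x using uz g(3) that by simp_all
    have "(\<integral>x. h x * g x \<partial>lborel) = (\<integral>x. h x * g x \<partial>mu)" by (rule integral_mu_outside(2)[OF z1(2), symmetric])
    also have "\<dots> = (\<integral>x. Re (c * (H x * ?G x)) \<partial>mu)"
      by (rule Bochner_Integration.integral_cong[OF refl]) (simp add: h_def rp_def space_mu algebra_simps)
    also have "\<dots> = Re (c * dual_pairing H ?G)"
      by (subst integral_Re[OF HG]) (simp add: dual_pairing_def)
    also have "dual_pairing H ?G = - (\<integral>x. indicator A x *\<^sub>R (f x * finite_hilbert ?G x) \<partial>mu)"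
      using H G(1) complex_measure_integral_m_L1[OF f0 G(1) L1_mD(2)[OF f G(1)] A] by (simp add: is_m_L1_integral_def)
    also have "Re (c * - (\<integral>x. indicator A x *\<^sub>R (f x * finite_hilbert ?G x) \<partial>mu)) = - Re (\<integral>x. ?F x \<partial>mu)"
      by (simp only: integral_mult_right_zero mult_minus_right uminus_complex.sel)
    also have "Re (\<integral>x. ?F x \<partial>mu) = (\<integral>x. Re (?F x) \<partial>mu)" by (rule integral_Re[OF Fi, symmetric])
    also have "\<dots> = (\<integral>x. u x * k x \<partial>mu)" by (rule integral_cong_AE[OF _ _ e]) (use borel_measurable_integrable[OF integrable_Re[OF Fi]] in auto)
    also have "\<dots> = (\<integral>x. u x * k x \<partial>lborel)" by (rule integral_mu_outside(2)[OF z1(1)])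
    finally show ?thesis using uki integral_mu_outside(1)[OF z1(1)] by simp
  qed
  have fin: "(\<integral>\<^sup>+x. ennreal (cmod (f x)) \<partial>mu) < \<infinity>" by (rule L1_m_finite[OF f])
  have "(\<integral>\<^sup>+x. ennreal (u x) \<partial>mu) \<le> (\<integral>\<^sup>+x. ennreal (cmod (f x)) \<partial>mu)"
    using u_le by (intro nn_integral_mono ennreal_leI) (simp add: abs_le_iff)
  then have "(\<integral>\<^sup>+x. ennreal (u x) \<partial>mu) < top" using fin by (simp add: le_less_trans)
  then obtain \<alpha> where a: "(\<integral>\<^sup>+x. ennreal (u x) \<partial>mu) \<le> ennreal \<alpha>" "\<alpha> \<ge> 0"
    using ennreal_less_top_bound by blast
  have "(\<integral>\<^sup>+x. ennreal (u x) * ennreal (4 + \<bar>L1fun x\<bar>) \<partial>mu) \<le> (\<integral>\<^sup>+x. ennreal (cmod (f x)) * ennreal (4 + \<bar>L1fun x\<bar>) \<partial>mu)"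
    using u_le by (intro nn_integral_mono mult_right_mono ennreal_leI) (auto simp: abs_le_iff)
  also have "\<dots> < top"
    unfolding L1fun_pairing[OF f0] using fin L1_m_pairing_finite[OF f finite_hilbert_indicator(1)[of "-1" 1]]
    by (auto simp: ennreal_mult_less_top)
  finally obtain \<beta> where b: "(\<integral>\<^sup>+x. ennreal (u x) * ennreal (4 + \<bar>L1fun x\<bar>) \<partial>mu) \<le> ennreal \<beta>" "\<beta> \<ge> 0"
    using ennreal_less_top_bound by blast
  have "(\<integral>\<^sup>+x. ennreal \<bar>h x\<bar> \<partial>lborel) < top" using hi by (simp add: integrable_iff_bounded)
  then obtain \<gamma> where g: "(\<integral>\<^sup>+x. ennreal \<bar>h x\<bar> \<partial>lborel) \<le> ennreal \<gamma>" "\<gamma> \<ge> 0"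
    using ennreal_less_top_bound by blast
  have up: "u x \<ge> 0" for x by (simp add: u_def)
  have "norm_LlogL (\<lambda>x. complex_of_real (u x)) \<le> ennreal (2 * (2 * pi * ((1 + \<alpha>) * (5 + \<alpha>) + pi * (2 * (\<gamma> + \<beta>)))) + 1)"
    by (rule norm_LlogL_le_of_duality[OF um _ _ hi _ a b g]; (fact uz | fact up | fact dual))
  then have "norm_LlogL (\<lambda>x. complex_of_real (u x)) < top" by (rule le_less_trans) simp
  moreover have "(\<lambda>x. complex_of_real (u x)) \<in> L0" using borel_measurable_muI[OF um] by (simp add: L0_def)
  ultimately show ?thesis by (simp add: LlogL_def u_def)
qed

lemma L1_m_subset_LlogL: "L1_m \<subseteq> LlogL"
proof
  fix f assume f: "f \<in> L1_m"
  let ?P = "\<lambda>c x. complex_of_real (max 0 (rp (\<lambda>x. c * f x) x))"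
  have "(\<lambda>x. (?P 1 x + ?P (-1) x) + (?P \<i> x + ?P (-\<i>) x)) \<in> LlogL"
    by (intro LlogL_add L1_m_cmult_positive_part[OF f]) auto
  moreover have "cmod (f x) \<le> cmod ((?P 1 x + ?P (-1) x) + (?P \<i> x + ?P (-\<i>) x))" if "x \<in> space mu" for x
  proof -
    have "(?P 1 x + ?P (-1) x) + (?P \<i> x + ?P (-\<i>) x) = complex_of_real (\<bar>Re (f x)\<bar> + \<bar>Im (f x)\<bar>)"
      using that by (auto simp: rp_def space_mu max_def abs_if)
    then show ?thesis using cmod_le[of "f x"] by (simp only: norm_of_real abs_of_nonneg abs_ge_zero add_nonneg_nonneg)
  qed
  ultimately show "f \<in> LlogL"
    using L1_mD(1)[OF f] by (intro LlogL_ideal[where g=f]) (auto intro!: AE_I2)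
qed

lemma L1_m_eq_LlogL: "L1_m = LlogL"
  by (rule equalityI[OF L1_m_subset_LlogL LlogL_subset_L1_m])

section \<open>Equivalence of the norms\<close>

lemma norm_L1_m_cmult:
  assumes f: "f \<in> L0"
  shows "norm_L1_m (\<lambda>x. c * f x) = ennreal (cmod c) * norm_L1_m f"
proof -
  have cf: "(\<lambda>x. c * f x) \<in> L0" using f by (simp add: L0_def)
  have [measurable]: "f \<in> borel_measurable mu" using f by (simp add: L0_def)
  show ?thesis
    unfolding norm_L1_m_eq[OF f] norm_L1_m_eq[OF cf] SUP_mult_left_ennreal
  proof (rule SUP_cong[OF refl])
    fix g assume "g \<in> {g \<in> Linf. norm_Linf g \<le> 1}"
    then have [measurable]: "finite_hilbert g \<in> borel_measurable mu" using finite_hilbert_Linf_measurable by auto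
    show "(\<integral>\<^sup>+x. ennreal (cmod (c * f x) * cmod (finite_hilbert g x)) \<partial>mu) = ennreal (cmod c) * (\<integral>\<^sup>+x. ennreal (cmod (f x) * cmod (finite_hilbert g x)) \<partial>mu)"
      by (subst nn_integral_cmult[symmetric]) (auto simp: norm_mult mult.assoc ennreal_mult intro!: nn_integral_cong)
  qed
qed

lemma norm_L1_m_mono:
  assumes f: "f \<in> L0" and g: "g \<in> L0" and le: "AE x in mu. cmod (f x) \<le> cmod (g x)"
  shows "norm_L1_m f \<le> norm_L1_m g"
  unfolding norm_L1_m_eq[OF f] norm_L1_m_eq[OF g]
proof (rule SUP_mono'[OF nn_integral_mono_AE])
  show "AE x in mu. ennreal (cmod (f x) * cmod (finite_hilbert h x)) \<le> ennreal (cmod (g x) * cmod (finite_hilbert h x))" for h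
    using le by eventually_elim (intro ennreal_leI mult_right_mono norm_ge_zero)
qed

lemma norm_L1_m_triangle:
  assumes f: "f \<in> L0" and g: "g \<in> L0"
  shows "norm_L1_m (\<lambda>x. f x + g x) \<le> norm_L1_m f + norm_L1_m g"
  unfolding norm_L1_m_eq[OF L0_add[OF f g]]
proof (rule SUP_least)
  fix h assume "h \<in> {g \<in> Linf. norm_Linf g \<le> 1}"
  then have h: "h \<in> Linf" "norm_Linf h \<le> 1" by auto
  have [measurable]: "f \<in> borel_measurable mu" "g \<in> borel_measurable mu" "finite_hilbert h \<in> borel_measurable mu"
    using f g finite_hilbert_Linf_measurable[OF h(1)] by (simp_all add: L0_def)
  have "(\<integral>\<^sup>+x. ennreal (cmod (f x + g x) * cmod (finite_hilbert h x)) \<partial>mu)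
    \<le> (\<integral>\<^sup>+x. ennreal (cmod (f x) * cmod (finite_hilbert h x)) + ennreal (cmod (g x) * cmod (finite_hilbert h x)) \<partial>mu)"
  proof (rule nn_integral_mono)
    fix x
    have "cmod (f x + g x) * cmod (finite_hilbert h x) \<le> cmod (f x) * cmod (finite_hilbert h x) + cmod (g x) * cmod (finite_hilbert h x)"
      using mult_right_mono[OF norm_triangle_ineq norm_ge_zero] by (simp add: distrib_right)
    from ennreal_leI[OF this] show "ennreal (cmod (f x + g x) * cmod (finite_hilbert h x)) \<le> ennreal (cmod (f x) * cmod (finite_hilbert h x)) + ennreal (cmod (g x) * cmod (finite_hilbert h x))"
      by (simp add: ennreal_plus)
  qed
  also have "\<dots> = (\<integral>\<^sup>+x. ennreal (cmod (f x) * cmod (finite_hilbert h x)) \<partial>mu) + (\<integral>\<^sup>+x. ennreal (cmod (g x) * cmod (finite_hilbert h x)) \<partial>mu)"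
    by (rule nn_integral_add) measurable
  also have "\<dots> \<le> norm_L1_m f + norm_L1_m g"
    by (rule add_mono[OF pairing_le_norm_L1_m[OF f h] pairing_le_norm_L1_m[OF g h]])
  finally show "(\<integral>\<^sup>+x. ennreal (cmod (f x + g x) * cmod (finite_hilbert h x)) \<partial>mu) \<le> norm_L1_m f + norm_L1_m g" .
qed

lemma L1_norm_le_norm_L1_m:
  assumes f: "f \<in> L0"
  shows "(\<integral>\<^sup>+x. ennreal (cmod (f x)) \<partial>mu) \<le> ennreal (5 * pi) * norm_L1_m f"
proof -
  note g0 = finite_hilbert_indicator[of "-1" 1] and g1 = finite_hilbert_indicator[of 0 1]
  have "(\<integral>\<^sup>+x. ennreal (cmod (f x)) \<partial>mu) \<le> ennreal (5 * pi / 2) * (norm_L1_m f + norm_L1_m f)"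
    by (rule order_trans[OF L1_norm_le_pairings[OF f]], intro mult_left_mono add_mono pairing_le_norm_L1_m f g0 g1) auto
  also have "\<dots> = (ennreal (5 * pi / 2) + ennreal (5 * pi / 2)) * norm_L1_m f" by (simp add: distrib_left distrib_right)
  also have "ennreal (5 * pi / 2) + ennreal (5 * pi / 2) = ennreal (5 * pi)" by (subst ennreal_plus[symmetric]) auto
  finally show ?thesis .
qed

text \<open>The constant of \<open>norm_LlogL_le_of_duality\<close> for \<open>\<alpha> = 5 \<pi>\<close>, \<open>\<beta> = 21 \<pi>\<close>, \<open>\<gamma> = 1\<close>.\<close>
definition Clow :: real where
  "Clow = 2 * (2 * pi * ((1 + 5 * pi) * (5 + 5 * pi) + pi * (2 * (1 + 21 * pi)))) + 1"

lemma Clow_pos: "Clow > 0"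
  unfolding Clow_def by (intro add_nonneg_pos mult_nonneg_nonneg add_nonneg_nonneg) auto

text \<open>The vector integral gives no uniform bound for the L^1 norm of \<open>h\<close>. Now
  that \<open>f\<close> lies in \<open>LlogL\<close>, the boundary function of \<bar>f\<bar> exists,
  and duality against its own sign bounds its L^1 norm on the interval by
  \<open>norm_L1_m\<close>.\<close>

lemma norm_LlogL_le_Clow:
  assumes f: "f \<in> LlogL" and n: "norm_L1_m f \<le> 1"
  shows "norm_LlogL f \<le> ennreal Clow"
proof -
  have f0: "f \<in> L0" using f by (simp add: LlogL_def)
  \<comment> \<open>Both norms depend only on \<bar>f\<bar>, and the entropy bound is stated for
    nonnegative functions.\<close>
  let ?U = "\<lambda>x. complex_of_real (cmod (f x))"
  have U0: "?U \<in> L0" using f0 by (simp add: L0_def)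
  have U: "?U \<in> LlogL" by (rule LlogL_ideal[OF f U0]) simp
  have nU: "norm_L1_m ?U \<le> 1" using norm_L1_m_mono[OF U0 f0] n by (auto intro: order_trans)
  define u where "u = rp ?U"
  have um[measurable]: "u \<in> borel_measurable borel" unfolding u_def by (rule rp_measurable[OF U0])
  have uz: "u x = 0" if "x \<notin> {-1<..<1}" for x using that by (simp add: u_def rp_outside)
  have u0: "u x \<ge> 0" for x by (simp add: u_def rp_def)
  have ue: "u x = cmod (f x)" if "x \<in> space mu" for x using that by (simp add: u_def rp_def space_mu)
  have uL: "(\<lambda>x. complex_of_real (u x)) \<in> LlogL" unfolding u_def by (rule LlogL_rp[OF U])
  obtain h where h: "bdry u h" and hd: "\<And>C g k. dom C g \<Longrightarrow> hil g k \<Longrightarrow> (\<integral>x. h x * g x \<partial>lborel) = - (\<integral>x. u x * k x \<partial>lborel)"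
    using bdry_exists_LlogL(2)[OF um uz uL] by blast
  have hm[measurable]: "h \<in> borel_measurable borel" by (rule bdry_measurable[OF h])
  \<comment> \<open>On the whole line \<open>h\<close> is integrable only for \<open>nu\<close>. Its
    restriction to the interval is integrable for Lebesgue measure and has the same pairings with
    test functions on the interval.\<close>
  define h0 where "h0 x = (if x \<in> {-1<..<1} then h x else 0)" for x
  have h0m[measurable]: "h0 \<in> borel_measurable borel" unfolding h0_def by measurable
  have h0i: "integrable lborel h0"
  proof -
    have "(\<lambda>x. indicator {-1<..<1} x *\<^sub>R h x) = h0" by (auto simp: h0_def fun_eq_iff)
    with integrable_nu_imp_mu[OF bdry_integrable[OF h]] show ?thesis by (simp only: integrable_mu_iff)
  qed
  have dual: "integrable lborel (\<lambda>x. u x * k x) \<and> (\<integral>x. u x * k x \<partial>lborel) = - (\<integral>x. h0 x * g x \<partial>lborel)"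
    if g: "g \<in> borel_measurable borel" "\<And>x. \<bar>g x\<bar> \<le> M" "\<And>x. x \<notin> {-1<..<1} \<Longrightarrow> g x = 0" and k: "hil g k" for g k M
  proof -
    have d: "dom (2 * pi * M) g" by (rule domI_interval[OF g(1,2)]) (use g(3) in blast)
    have "h0 x * g x = h x * g x" for x using g(3)[of x] by (cases "x \<in> {-1<..<1}") (simp_all add: h0_def)
    then have "(\<integral>x. h0 x * g x \<partial>lborel) = (\<integral>x. h x * g x \<partial>lborel)" by (simp only:)
    then show ?thesis using hd[OF d k] integral_mult_LlogL(1)[OF um uz uL d k] by simp
  qed
  have a: "(\<integral>\<^sup>+x. ennreal (u x) \<partial>mu) \<le> ennreal (5 * pi)"
  proof -
    have "(\<integral>\<^sup>+x. ennreal (u x) \<partial>mu) = (\<integral>\<^sup>+x. ennreal (cmod (f x)) \<partial>mu)" by (rule nn_integral_cong) (simp add: ue)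
    also have "\<dots> \<le> ennreal (5 * pi) * norm_L1_m f" by (rule L1_norm_le_norm_L1_m[OF f0])
    also have "\<dots> \<le> ennreal (5 * pi) * 1" by (rule mult_left_mono[OF n]) simp
    finally show ?thesis by simp
  qed
  have b: "(\<integral>\<^sup>+x. ennreal (u x) * ennreal (4 + \<bar>L1fun x\<bar>) \<partial>mu) \<le> ennreal (21 * pi)"
  proof -
    have "(\<integral>\<^sup>+x. ennreal (u x) * ennreal (4 + \<bar>L1fun x\<bar>) \<partial>mu) = (\<integral>\<^sup>+x. ennreal (cmod (f x)) * ennreal (4 + \<bar>L1fun x\<bar>) \<partial>mu)"
      by (rule nn_integral_cong) (simp add: ue)
    also have "\<dots> = 4 * (\<integral>\<^sup>+x. ennreal (u x) \<partial>mu) +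
      ennreal pi * (\<integral>\<^sup>+x. ennreal (cmod (f x) * cmod (finite_hilbert (indicator {-1<..<1}) x)) \<partial>mu)"
      unfolding L1fun_pairing[OF f0] by (simp add: ue cong: nn_integral_cong)
    also have "\<dots> \<le> 4 * ennreal (5 * pi) + ennreal pi * 1"
      using finite_hilbert_indicator[of "-1" 1]
      by (intro add_mono mult_left_mono a order_trans[OF pairing_le_norm_L1_m[OF f0] n]) auto
    also have "\<dots> = ennreal (21 * pi)"
    proof -
      have "4 * ennreal (5 * pi) = ennreal (20 * pi)" using ennreal_mult[of 4 "5 * pi"] by simp
      then have "4 * ennreal (5 * pi) + ennreal pi * 1 = ennreal (20 * pi) + ennreal pi" by simp
      also have "\<dots> = ennreal (20 * pi + pi)" by (rule ennreal_plus[symmetric]) auto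
      finally show ?thesis by simp
    qed
    finally show ?thesis .
  qed
  have c: "(\<integral>\<^sup>+x. ennreal \<bar>h0 x\<bar> \<partial>lborel) \<le> ennreal 1"
  proof -
    define g where "g x = sgn (h0 x)" for x
    have gm: "g \<in> borel_measurable borel" unfolding g_def by measurable
    have gb: "\<bar>g x\<bar> \<le> 1" for x by (simp add: g_def abs_sgn_eq)
    have gz: "g x = 0" if "x \<notin> {-1<..<1}" for x
    proof -
      have "h0 x = 0" using that unfolding h0_def by (rule if_not_P)
      then show ?thesis by (simp add: g_def)
    qed
    have "dom (2 * pi * 1) g" by (rule domI_interval[OF gm gb gz])
    then obtain k where k: "hil g k" using hil_exists by blast
    have G: "(\<lambda>x. complex_of_real (g x)) \<in> Linf" "norm_Linf (\<lambda>x. complex_of_real (g x)) \<le> 1"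
      "AE x in mu. finite_hilbert (\<lambda>x. complex_of_real (g x)) x = complex_of_real (k x)"
      using finite_hilbert_real[OF gm gb gz hil_bdry[OF k]] by simp_all
    have gh: "h0 x * g x = \<bar>h0 x\<bar>" for x by (simp add: g_def abs_sgn)
    note d = dual[OF gm gb gz k]
    have "(\<integral>\<^sup>+x. ennreal \<bar>h0 x\<bar> \<partial>lborel) = ennreal (\<integral>x. \<bar>h0 x\<bar> \<partial>lborel)"
      by (rule nn_integral_eq_integral) (use h0i in auto)
    also have "(\<integral>x. \<bar>h0 x\<bar> \<partial>lborel) = - (\<integral>x. u x * k x \<partial>lborel)" using d by (simp add: gh)
    also have "ennreal (- (\<integral>x. u x * k x \<partial>lborel)) \<le> ennreal \<bar>\<integral>x. u x * k x \<partial>lborel\<bar>" by (rule ennreal_leI) simp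
    also have "\<dots> \<le> (\<integral>\<^sup>+x. ennreal \<bar>u x * k x\<bar> \<partial>lborel)"
      using integral_norm_bound_ennreal[of lborel "\<lambda>x. u x * k x"] d by simp
    also have "\<dots> = (\<integral>\<^sup>+x. ennreal \<bar>u x * k x\<bar> \<partial>mu)"
      by (rule nn_integral_mu_outside[symmetric]) (simp add: uz)
    also have "\<dots> = (\<integral>\<^sup>+x. ennreal (cmod (f x) * cmod (finite_hilbert (\<lambda>x. complex_of_real (g x)) x)) \<partial>mu)"
    proof (rule nn_integral_cong_AE)
      show "AE x in mu. ennreal \<bar>u x * k x\<bar> = ennreal (cmod (f x) * cmod (finite_hilbert (\<lambda>x. complex_of_real (g x)) x))"
        using G(3) AE_space by eventually_elim (simp add: ue abs_mult)
    qed
    also have "\<dots> \<le> norm_L1_m f" by (rule pairing_le_norm_L1_m[OF f0 G(1,2)])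
    finally show ?thesis using n by simp
  qed
  have "norm_LlogL (\<lambda>x. complex_of_real (u x)) \<le> ennreal (2 * (2 * pi * ((1 + 5 * pi) * (5 + 5 * pi) + pi * (2 * (1 + 21 * pi)))) + 1)"
    by (rule norm_LlogL_le_of_duality[OF um u0 _ h0i _ a _ b _ c]; (fact uz | fact dual | simp))
  moreover have "norm_LlogL f \<le> norm_LlogL (\<lambda>x. complex_of_real (u x))"
  proof (rule norm_LlogL_mono[OF f0])
    show "(\<lambda>x. complex_of_real (u x)) \<in> L0" using uL by (simp add: LlogL_def)
    show "AE x in mu. cmod (f x) \<le> cmod (complex_of_real (u x))" by (rule AE_I2) (simp add: ue)
  qed
  ultimately show ?thesis unfolding Clow_def by (rule order_trans[rotated])
qed

lemma norm_LlogL_le_norm_L1_m: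
  assumes f: "f \<in> LlogL"
  shows "norm_LlogL f \<le> ennreal Clow * norm_L1_m f"
proof -
  have f0: "f \<in> L0" and fin: "norm_LlogL f < top" using f by (auto simp: LlogL_def)
  have "norm_L1_m f < top" by (rule le_less_trans[OF norm_L1_m_le[OF f0]]) (use fin in \<open>simp add: ennreal_mult_less_top\<close>)
  then obtain m where m: "norm_L1_m f = ennreal m" "m \<ge> 0" by (auto simp: less_top_ennreal)
  show ?thesis
  proof (cases "m = 0")
    \<comment> \<open>Scaling to norm 1 is impossible here; the L^1 bound shows that
      \<open>f\<close> vanishes a.e.\<close>
    case True
    with L1_norm_le_norm_L1_m[OF f0] m have "(\<integral>\<^sup>+x. ennreal (cmod (f x)) \<partial>mu) = 0" by simp
    then have "AE x in mu. f x = 0" using f0 by (subst (asm) nn_integral_0_iff_AE) (auto simp: L0_def)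
    then have "norm_LlogL f = 0" using lattice_norm_LlogL f by (simp add: lattice_norm_on_def)
    then show ?thesis by simp
  next
    case False
    let ?F = "\<lambda>x. complex_of_real (1 / m) * f x"
    have "norm_L1_m ?F = ennreal (1 / m) * ennreal m"
      using False m norm_L1_m_cmult[OF f0, of "complex_of_real (1 / m)"] by (simp add: norm_divide)
    also have "\<dots> = 1" using False m(2) by (subst ennreal_mult[symmetric]) auto
    finally have "norm_LlogL ?F \<le> ennreal Clow" by (intro norm_LlogL_le_Clow LlogL_cmult[OF f]) simp
    then have "ennreal m * norm_LlogL ?F \<le> ennreal m * ennreal Clow" by (rule mult_left_mono) simp
    moreover have "ennreal m * norm_LlogL ?F = norm_LlogL f"
    proof -
      have "ennreal m * norm_LlogL ?F = ennreal m * (ennreal (1 / m) * norm_LlogL f)"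
        using m(2) norm_LlogL_cmult[OF f0, of "complex_of_real (1 / m)"] by (simp add: norm_divide)
      also have "\<dots> = ennreal (m * (1 / m)) * norm_LlogL f" using m(2) by (simp only: mult.assoc[symmetric] ennreal_mult[symmetric] divide_nonneg_nonneg zero_le_one)
      finally show ?thesis using False by simp
    qed
    ultimately show ?thesis using m by (simp add: mult.commute)
  qed
qed

lemma norm_complete_on_equivalent:
  assumes N: "norm_complete_on X N" and d: "\<And>f g. f \<in> X \<Longrightarrow> g \<in> X \<Longrightarrow> (\<lambda>x. f x - g x) \<in> X"
    and up: "\<And>f. f \<in> X \<Longrightarrow> N f \<le> ennreal C * N' f" "C > 0"
    and lo: "\<And>f. f \<in> X \<Longrightarrow> N' f \<le> ennreal c * N f"
  shows "norm_complete_on X N'"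
  unfolding norm_complete_on_def
proof (intro allI impI, elim conjE)
  fix u :: "nat \<Rightarrow> real \<Rightarrow> complex"
  assume u: "\<forall>n. u n \<in> X" and cau: "\<forall>e>0. \<exists>K. \<forall>m\<ge>K. \<forall>n\<ge>K. N' (\<lambda>x. u m x - u n x) < e"
  have "\<exists>K. \<forall>m\<ge>K. \<forall>n\<ge>K. N (\<lambda>x. u m x - u n x) < e" if e: "e > 0" for e
  proof -
    \<comment> \<open>\<open>e\<close> may be infinite, so a finite positive \<open>q\<close> below
      it is chosen before dividing by \<open>C\<close>.\<close>
    obtain q where q: "0 < q" "q < e" using dense[OF e] by blast
    then obtain r where r: "q = ennreal r" "r \<ge> 0" using less_top_ennreal[of q] by (metis less_top_ennreal order_less_le_trans top_greatest)
    have r0: "r > 0" using q(1) r by simp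
    have "ennreal (r / C) > 0" using r0 up(2) by simp
    with cau obtain K where K: "\<And>m n. m \<ge> K \<Longrightarrow> n \<ge> K \<Longrightarrow> N' (\<lambda>x. u m x - u n x) < ennreal (r / C)" by blast
    have "N (\<lambda>x. u m x - u n x) < e" if "m \<ge> K" "n \<ge> K" for m n
    proof -
      have "N (\<lambda>x. u m x - u n x) \<le> ennreal C * N' (\<lambda>x. u m x - u n x)" using u by (intro up(1) d) auto
      also have "\<dots> \<le> ennreal C * ennreal (r / C)" by (rule mult_left_mono[OF less_imp_le[OF K[OF that]]]) simp
      also have "\<dots> = q" using up(2) r by (subst ennreal_mult[symmetric]) auto
      finally show ?thesis using q(2) by simp
    qed
    then show ?thesis by blast
  qed
  with N u obtain f where f: "f \<in> X" "(\<lambda>n. N (\<lambda>x. u n x - f x)) \<longlonglongrightarrow> 0" unfolding norm_complete_on_def by blast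
  have l: "(\<lambda>n. ennreal c * N (\<lambda>x. u n x - f x)) \<longlonglongrightarrow> ennreal c * 0" by (rule ennreal_tendsto_cmult[OF _ f(2)]) simp
  have "(\<lambda>n. N' (\<lambda>x. u n x - f x)) \<longlonglongrightarrow> 0"
  proof (rule tendsto_sandwich[OF _ _ tendsto_const])
    show "\<forall>\<^sub>F n in sequentially. N' (\<lambda>x. u n x - f x) \<le> ennreal c * N (\<lambda>x. u n x - f x)"
      using u f(1) by (intro always_eventually allI lo d) auto
    show "(\<lambda>n. ennreal c * N (\<lambda>x. u n x - f x)) \<longlonglongrightarrow> 0" using l by simp
  qed simp
  with f(1) show "\<exists>f\<in>X. (\<lambda>n. N' (\<lambda>x. u n x - f x)) \<longlonglongrightarrow> 0" by blast
qed

lemma LlogL_diff: "f \<in> LlogL \<Longrightarrow> g \<in> LlogL \<Longrightarrow> (\<lambda>x. f x - g x) \<in> LlogL"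
  using LlogL_add[of f "\<lambda>x. - 1 * g x"] LlogL_cmult[of g "- 1"] by simp

lemma complete_norm_L1_m: "norm_complete_on LlogL norm_L1_m"
  by (rule norm_complete_on_equivalent[OF complete_LlogL LlogL_diff norm_LlogL_le_norm_L1_m Clow_pos norm_L1_m_le])
     (auto simp: LlogL_def)

lemma lattice_norm_L1_m: "lattice_norm_on LlogL norm_L1_m"
  unfolding lattice_norm_on_def
proof (intro conjI ballI allI impI)
  fix f assume f: "f \<in> LlogL"
  have f0: "f \<in> L0" and fin: "norm_LlogL f < top" using f by (auto simp: LlogL_def)
  show "norm_L1_m f < \<infinity>"
    using le_less_trans[OF norm_L1_m_le[OF f0], of top] fin by (simp add: ennreal_mult_less_top)
  have "norm_L1_m f = 0 \<longleftrightarrow> norm_LlogL f = 0"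
    using norm_L1_m_le[OF f0] norm_LlogL_le_norm_L1_m[OF f] by (metis le_zero_eq mult_zero_right)
  then show "norm_L1_m f = 0 \<longleftrightarrow> (AE x in mu. f x = 0)"
    using lattice_norm_LlogL f by (simp add: lattice_norm_on_def)
  fix g assume "g \<in> LlogL"
  then have g0: "g \<in> L0" by (simp add: LlogL_def)
  show "norm_L1_m (\<lambda>x. f x + g x) \<le> norm_L1_m f + norm_L1_m g" by (rule norm_L1_m_triangle[OF f0 g0])
  show "norm_L1_m f \<le> norm_L1_m g" if "AE x in mu. cmod (f x) \<le> cmod (g x)" by (rule norm_L1_m_mono[OF f0 g0 that])
next
  fix c f assume "f \<in> LlogL"
  then show "norm_L1_m (\<lambda>x. c * f x) = ennreal (cmod c) * norm_L1_m f"
    by (intro norm_L1_m_cmult) (simp add: LlogL_def)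
qed

lemma equivalent_norms: "equivalent_norms_on LlogL norm_L1_m norm_LlogL"
  unfolding equivalent_norms_on_def
proof (rule exI[of _ "1 / (4 * pi * Kexp)"], rule exI[of _ Clow], intro conjI ballI)
  have K: "4 * pi * Kexp > 0" using Kexp_pos by simp
  then show "0 < 1 / (4 * pi * Kexp)" by simp
  show "0 < Clow" by (rule Clow_pos)
  fix f assume f: "f \<in> LlogL"
  then have f0: "f \<in> L0" by (simp add: LlogL_def)
  show "norm_LlogL f \<le> ennreal Clow * norm_L1_m f" by (rule norm_LlogL_le_norm_L1_m[OF f])
  have "ennreal (1 / (4 * pi * Kexp)) * norm_L1_m f \<le> ennreal (1 / (4 * pi * Kexp)) * (ennreal (4 * pi * Kexp) * norm_LlogL f)"
    by (rule mult_left_mono[OF norm_L1_m_le[OF f0]]) simp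
  also have "\<dots> = ennreal (1 / (4 * pi * Kexp) * (4 * pi * Kexp)) * norm_LlogL f"
    using K by (subst ennreal_mult) (auto simp: mult.assoc)
  also have "1 / (4 * pi * Kexp) * (4 * pi * Kexp) = 1" using Kexp_pos by simp
  finally show "ennreal (1 / (4 * pi * Kexp)) * norm_L1_m f \<le> norm_LlogL f" by simp
qed

text \<open>Pairing \<open>h - h'\<close> with the conjugate of its own sign gives the L^1 norm of
  the difference. This is the uniqueness of the integral, which identifies the representative
  selected by \<open>SOME\<close> with the transform.\<close>

lemma AE_eq_of_dual_pairing_eq:
  assumes h: "h \<in> L1" and h': "h' \<in> L1" and eq: "\<And>g. g \<in> Linf \<Longrightarrow> dual_pairing h g = dual_pairing h' g"
  shows "AE x in mu. h x = h' x"
proof -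
  have hi: "integrable mu h" "integrable mu h'" using h h' by (auto simp: L1_def)
  define g where "g x = cnj (sgn (h x - h' x))" for x
  have [measurable]: "cnj \<in> borel_measurable borel"
    by (intro borel_measurable_continuous_onI continuous_intros)
  have gm: "g \<in> borel_measurable mu"
    unfolding g_def sgn_div_norm
    using borel_measurable_integrable[OF hi(1)] borel_measurable_integrable[OF hi(2)] by measurable
  have gb: "cmod (g x) \<le> 1" for x by (simp add: g_def norm_sgn)
  have gL: "g \<in> Linf"
    using gm norm_Linf_le[of g 1] gb by (auto simp: Linf_def L0_def intro: le_less_trans)
  have ig: "integrable mu (\<lambda>x. k x * g x)" if "integrable mu k" for k
  proof (rule Bochner_Integration.integrable_bound[OF that])
    show "(\<lambda>x. k x * g x) \<in> borel_measurable mu" using that gm by measurable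
    show "AE x in mu. norm (k x * g x) \<le> norm (k x)"
      using mult_left_mono[OF gb norm_ge_zero] by (intro AE_I2) (simp add: norm_mult)
  qed
  have di: "integrable mu (\<lambda>x. cmod (h x - h' x))" using hi by auto
  have s: "z * cnj (sgn z) = complex_of_real (cmod z)" for z
  proof (cases "z = 0")
    case False
    have "z * cnj (sgn z) = complex_of_real (inverse (cmod z)) * (z * cnj z)"
      by (simp add: sgn_div_norm scaleR_conv_of_real)
    also have "\<dots> = complex_of_real (inverse (cmod z) * (cmod z)\<^sup>2)" by (simp only: complex_norm_square of_real_mult)
    also have "inverse (cmod z) * (cmod z)\<^sup>2 = cmod z" using False by (simp add: power2_eq_square)
    finally show ?thesis .
  qed simp
  have e: "(h x - h' x) * g x = complex_of_real (cmod (h x - h' x))" for x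
    unfolding g_def by (rule s)
  have "complex_of_real (\<integral>x. cmod (h x - h' x) \<partial>mu) = (\<integral>x. (h x - h' x) * g x \<partial>mu)"
    unfolding e by (rule integral_complex_of_real[symmetric])
  also have "\<dots> = dual_pairing h g - dual_pairing h' g"
    unfolding dual_pairing_def using ig[OF hi(1)] ig[OF hi(2)] by (simp add: left_diff_distrib)
  finally have "(\<integral>x. cmod (h x - h' x) \<partial>mu) = 0" using eq[OF gL] by simp
  then have "AE x in mu. cmod (h x - h' x) = 0" by (subst (asm) integral_nonneg_eq_0_iff_AE[OF di]) auto
  then show ?thesis by eventually_elim simp
qed

lemma I_m_L1_LlogL:
  assumes f: "f \<in> LlogL"
  shows "I_m_L1 f \<in> L1" and "AE t in mu. I_m_L1 f t = finite_hilbert f t"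
proof -
  note T = is_m_L1_integral_space[OF f]
  have S: "is_m_L1_integral f (space mu) (I_m_L1 f)"
    unfolding I_m_L1_def m_L1_integral_def by (rule someI[where P="is_m_L1_integral f (space mu)", OF T])
  then show "I_m_L1 f \<in> L1" by (simp add: is_m_L1_integral_def)
  show "AE t in mu. I_m_L1 f t = finite_hilbert f t"
    by (rule AE_eq_of_dual_pairing_eq) (use S T in \<open>auto simp: is_m_L1_integral_def\<close>)
qed

theorem theorem4p1:
  shows
    "(vector_sublattice L1_m \<and> vector_sublattice LlogL \<and> L1_m = LlogL \<and>
      lattice_norm_on L1_m norm_L1_m \<and> lattice_norm_on LlogL norm_LlogL \<and>
      equivalent_norms_on LlogL norm_L1_m norm_LlogL) \<and>
     (banach_function_space L1_m norm_L1_m \<and> banach_function_space LlogL norm_LlogL \<and>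
      isomorphic_bfs L1_m norm_L1_m LlogL norm_LlogL) \<and>
     (\<forall>f\<in>L1_m. I_m_L1 f \<in> L1 \<and> T_log f \<in> L1 \<and> (AE t in mu. I_m_L1 f t = T_log f t))"
  unfolding L1_m_eq_LlogL
proof (intro conjI ballI)
  show "vector_sublattice LlogL" by (rule order_ideal_imp_vector_sublattice[OF order_ideal_LlogL])
  then show "vector_sublattice LlogL" .
  show "lattice_norm_on LlogL norm_L1_m" by (rule lattice_norm_L1_m)
  show "lattice_norm_on LlogL norm_LlogL" by (rule lattice_norm_LlogL)
  show "equivalent_norms_on LlogL norm_L1_m norm_LlogL" by (rule equivalent_norms)
  show "banach_function_space LlogL norm_LlogL" by (rule bfs_LlogL)
  show "banach_function_space LlogL norm_L1_m"
    unfolding banach_function_space_def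
    by (intro conjI order_ideal_LlogL simple_subset_LlogL lattice_norm_L1_m complete_norm_L1_m)
  show "isomorphic_bfs LlogL norm_L1_m LlogL norm_LlogL"
    unfolding isomorphic_bfs_def
    by (rule exI[of _ "\<lambda>f. f"]) (use equivalent_norms in \<open>auto simp: equivalent_norms_on_def\<close>)
  fix f assume f: "f \<in> LlogL"
  then have T: "T_log f = finite_hilbert f" by (simp add: T_log_def)
  show "I_m_L1 f \<in> L1" by (rule I_m_L1_LlogL[OF f])
  show "T_log f \<in> L1" unfolding T by (rule finite_hilbert_L1[OF f])
  show "AE t in mu. I_m_L1 f t = T_log f t" unfolding T by (rule I_m_L1_LlogL[OF f])
qed simp

end
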